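(* For any Schwartz-class reference wavefunction $\chi\in\mathcal{S}(\mathbb{R}^n)$ (normalized, $\int|\chi(y)|^2\,dy=1$) and for any quantum state $\rho$ (i.e., positive semidefinite trace-class operator on $L^2(\mathbb{R}^n)$), with spectral decomposition $\{\psi_i\}$, quasicharacteristic function $\Phi_\rho$, Wigner function $W_\rho$, kernel $K_\rho$, Husimi function $Q_\rho$, and matrix element $M_\rho$, the following conditions are equivalent: (1) $W_\rho\in\mathcal{S}(\mathbb{R}^{2n})$; (2) $W_\rho\in\mathcal{D}(\mathbb{R}^{2n})$; (3) $Q_\rho\in\mathcal{S}(\mathbb{R}^{2n})$; (4) $Q_\rho\in\mathcal{D}(\mathbb{R}^{2n})$; (5) $M_\rho\in\mathcal{S}(\mathbb{R}^{4n})$; (6) $M_\rho\in\mathcal{D}(\mathbb{R}^{4n})$; (7) $\Phi_\rho\in\mathcal{S}(\mathbb{R}^{2n})$; (8) $K_\rho\in\mathcal{S}(\mathbb{R}^{2n})$; (9) $\{\psi_i\}$ is jointly Schwartz; (10) $\rho$ is a Schwartz operator. Furthermore, if the set $\{\psi_i\}$ is finite (e.g., if the state is pure, $\rho=|\psi\rangle\langle\psi|$), then the condition $\{\psi_i\}\subset\mathcal{S}(\mathbb{R}^n)$ (each $\psi_i$ individually a Schwartz function) is also equivalent to conditions (1)–(10).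
   Context: Setting: $n$ continuous degrees of freedom. $\mathcal{S}(\mathbb{R}^m)$ denotes Schwartz functions and $\mathcal{D}(\mathbb{R}^m)$ rapidly decaying functions, i.e. functions $F$ with $\sup|\alpha^a F(\alpha)|<\infty$ for all multi-indices $a$. Phase-space points $\alpha=(\alpha_x,\alpha_p)\in\mathbb{R}^{2n}$, symplectic form $\alpha\wedge\beta=\alpha_x\cdot\beta_p-\alpha_p\cdot\beta_x$, position/momentum operators $X,P$, $R=(X,P)$. Displacement operator $D_\xi=e^{i\xi\wedge R}=e^{i(\xi_x\cdot P-\xi_p\cdot X)}$, acting as $D_\xi\phi(y)=e^{i(y-\xi_x/2)\cdot\xi_p}\phi(y-\xi_x)$; $\chi_\alpha:=D_\alpha\chi$. Spectral decomposition: $(\rho\phi)(x)=\sum_i\psi_i(x)\langle\psi_i|\phi\rangle$ with unnormalized orthogonal eigenvectors $\psi_i\in L^2(\mathbb{R}^n)$; kernel $K_\rho(x,y)=\sum_i\psi_i(x)\bar\psi_i(y)$. Quasicharacteristic function $\Phi_\rho(\xi)=\mathrm{Tr}[\rho D_\xi]$. Wigner function $W_\rho(\alpha)=(2\pi)^{-n}\int e^{i\alpha_p\cdot y}K_\rho(\alpha_x-y/2,\alpha_x+y/2)\,dy$. Matrix element $M_\rho(\alpha,\beta)=\langle\chi_\alpha|\rho|\chi_\beta\rangle$; Husimi function $Q_\rho(\alpha)=\langle\chi_\alpha|\rho|\chi_\alpha\rangle$. A set $\{\psi_i\}\subset L^2(\mathbb{R}^n)$ is jointly Schwartz if $\sup_x\sum_i|x^a\partial_x^b\psi_i(x)|^2<\infty$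 for all multi-indices $a,b\in(\mathbb{N}\cup\{0\})^{n}$. An operator $E$ is a Schwartz operator (Keyl et al.) if $\sup_{\|\psi\|=\|\phi\|=1}|\langle\psi|X^aP^bEP^cX^d|\phi\rangle|<\infty$ for all multi-indices $a,b,c,d\in(\mathbb{N}\cup\{0\})^{n}$. *)

theory Defs
  imports "HOL-Analysis.Analysis"
begin

definition monom :: "('a::euclidean_space \<Rightarrow> nat) \<Rightarrow> 'a \<Rightarrow> real" where
  "monom a x = (\<Prod>b\<in>Basis. (x \<bullet> b) ^ a b)"

text \<open>Iterated partial derivative along a list of coordinate directions
  (a multi-index derivative corresponds to any list with the right multiplicities).\<close>
fun dpart :: "'a::euclidean_space list \<Rightarrow> ('a \<Rightarrow> complex) \<Rightarrow> 'a \<Rightarrow> complex" where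
  "dpart [] f = f"
| "dpart (b # bs) f = (\<lambda>x. frechet_derivative (dpart bs f) (at x) b)"

definition smooth_fun :: "('a::euclidean_space \<Rightarrow> complex) \<Rightarrow> bool" where
  "smooth_fun f \<longleftrightarrow> (\<forall>bs x. set bs \<subseteq> Basis \<longrightarrow> dpart bs f differentiable (at x))"

definition schwartz :: "('a::euclidean_space \<Rightarrow> complex) \<Rightarrow> bool" where
  "schwartz f \<longleftrightarrow> smooth_fun f \<and>
     (\<forall>a bs. set bs \<subseteq> Basis \<longrightarrow> bounded (range (\<lambda>x. of_real (monom a x) * dpart bs f x)))"

definition rapid_decay :: "('a::euclidean_space \<Rightarrow> complex) \<Rightarrow> bool" where
  "rapid_decay F \<longleftrightarrow> (\<forall>a. bounded (range (\<lambda>x. of_real (monom a x) * F x)))"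

definition jointly_schwartz :: "'i set \<Rightarrow> ('i \<Rightarrow> 'a::euclidean_space \<Rightarrow> complex) \<Rightarrow> bool" where
  "jointly_schwartz I \<phi> \<longleftrightarrow> (\<forall>i\<in>I. smooth_fun (\<phi> i)) \<and>
     (\<forall>a bs. set bs \<subseteq> Basis \<longrightarrow> (\<exists>C. \<forall>x.
        (\<lambda>i. (cmod (of_real (monom a x) * dpart bs (\<phi> i) x))\<^sup>2) summable_on I \<and>
        (\<Sum>\<^sub>\<infinity>i\<in>I. (cmod (of_real (monom a x) * dpart bs (\<phi> i) x))\<^sup>2) \<le> C))"

type_synonym 'n phase = "(real^'n) \<times> (real^'n)"

definition l2ip :: "(real^'n \<Rightarrow> complex) \<Rightarrow> (real^'n \<Rightarrow> complex) \<Rightarrow> complex" where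
  "l2ip f g = (LINT x|lborel. cnj (f x) * g x)"

definition sq_integrable :: "(real^'n \<Rightarrow> complex) \<Rightarrow> bool" where
  "sq_integrable f \<longleftrightarrow> f \<in> borel_measurable lborel \<and> integrable lborel (\<lambda>x. (cmod (f x))\<^sup>2)"

definition l2norm_sq :: "(real^'n \<Rightarrow> complex) \<Rightarrow> real" where
  "l2norm_sq f = (LINT x|lborel. (cmod (f x))\<^sup>2)"

text \<open>Displacement operator D_xi = exp(i xi wedge R), xi = (xi_x, xi_p).\<close>
definition disp :: "'n phase \<Rightarrow> (real^'n \<Rightarrow> complex) \<Rightarrow> real^'n \<Rightarrow> complex" where
  "disp \<xi> \<phi> y = exp (\<i> * of_real ((y - (1/2) *\<^sub>R fst \<xi>) \<bullet> snd \<xi>)) * \<phi> (y - fst \<xi>)"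

text \<open>The state rho = sum_i |psi_i><psi_i| is given by its spectral decomposition
  (orthogonal, unnormalised eigenvectors psi_i, i in I).\<close>
definition is_state :: "'i set \<Rightarrow> ('i \<Rightarrow> real^'n \<Rightarrow> complex) \<Rightarrow> bool" where
  "is_state I \<psi> \<longleftrightarrow> countable I \<and>
     (\<forall>i\<in>I. sq_integrable (\<psi> i) \<and> l2norm_sq (\<psi> i) > 0) \<and>
     (\<forall>i\<in>I. \<forall>j\<in>I. i \<noteq> j \<longrightarrow> l2ip (\<psi> i) (\<psi> j) = 0) \<and>
     (\<lambda>i. l2norm_sq (\<psi> i)) summable_on I"

text \<open>Quasicharacteristic function Phi(xi) = Tr[rho D_xi].\<close>
definition qchar :: "'i set \<Rightarrow> ('i \<Rightarrow> real^'n \<Rightarrow> complex) \<Rightarrow> 'n phase \<Rightarrow> complex" where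
  "qchar I \<psi> \<xi> = (\<Sum>\<^sub>\<infinity>i\<in>I. l2ip (\<psi> i) (disp \<xi> (\<psi> i)))"

definition kernel :: "'i set \<Rightarrow> ('i \<Rightarrow> real^'n \<Rightarrow> complex) \<Rightarrow> ((real^'n) \<times> (real^'n)) \<Rightarrow> complex" where
  "kernel I \<psi> z = (\<Sum>\<^sub>\<infinity>i\<in>I. \<psi> i (fst z) * cnj (\<psi> i (snd z)))"

definition wigner :: "'i set \<Rightarrow> ('i \<Rightarrow> real^'n \<Rightarrow> complex) \<Rightarrow> 'n phase \<Rightarrow> complex" where
  "wigner I \<psi> \<alpha> = of_real ((1 / (2 * pi)) ^ CARD('n)) *
     (LINT y|lborel. exp (\<i> * of_real (snd \<alpha> \<bullet> y)) *
        kernel I \<psi> (fst \<alpha> - (1/2) *\<^sub>R y, fst \<alpha> + (1/2) *\<^sub>R y))"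

text \<open>Matrix element M(alpha,beta) = <chi_alpha|rho|chi_beta>, chi_alpha = D_alpha chi.\<close>
definition matel :: "(real^'n \<Rightarrow> complex) \<Rightarrow> 'i set \<Rightarrow> ('i \<Rightarrow> real^'n \<Rightarrow> complex)
    \<Rightarrow> 'n phase \<times> 'n phase \<Rightarrow> complex" where
  "matel chi I \<psi> z = (\<Sum>\<^sub>\<infinity>i\<in>I. l2ip (disp (fst z) chi) (\<psi> i) * l2ip (\<psi> i) (disp (snd z) chi))"

definition husimi :: "(real^'n \<Rightarrow> complex) \<Rightarrow> 'i set \<Rightarrow> ('i \<Rightarrow> real^'n \<Rightarrow> complex)
    \<Rightarrow> 'n phase \<Rightarrow> complex" where
  "husimi chi I \<psi> \<alpha> = matel chi I \<psi> (\<alpha>, \<alpha>)"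

definition Xop :: "(real^'n \<Rightarrow> nat) \<Rightarrow> (real^'n \<Rightarrow> complex) \<Rightarrow> real^'n \<Rightarrow> complex" where
  "Xop a f x = of_real (monom a x) * f x"

definition Pop :: "(real^'n) list \<Rightarrow> (real^'n \<Rightarrow> complex) \<Rightarrow> real^'n \<Rightarrow> complex" where
  "Pop bs f x = (- \<i>) ^ length bs * dpart bs f x"

text \<open>Schwartz operator (Keyl et al.): the forms <psi|X^a P^b rho P^c X^d|phi>, for unit
  Schwartz psi, phi, are uniformly bounded. Here <psi|X^a P^b rho P^c X^d|phi>
  = <P^b X^a psi| rho (P^c X^d phi)> with rho eta = sum_i psi_i <psi_i|eta>.\<close>
definition schwartz_operator :: "'i set \<Rightarrow> ('i \<Rightarrow> real^'n \<Rightarrow> complex) \<Rightarrow> bool" where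
  "schwartz_operator I \<psi> \<longleftrightarrow>
     (\<forall>a bs cs d. set bs \<subseteq> Basis \<longrightarrow> set cs \<subseteq> Basis \<longrightarrow>
        bounded {(\<Sum>\<^sub>\<infinity>i\<in>I. l2ip (Pop bs (Xop a f)) (\<psi> i) * l2ip (\<psi> i) (Pop cs (Xop d g))) | f g.
                   schwartz f \<and> schwartz g \<and> l2norm_sq f = 1 \<and> l2norm_sq g = 1})"

end

theory Submission
  imports "HOL-Probability.Characteristic_Functions" "HOL-Probability.Sinc_Integral" Defs
begin

text \<open>All conditions are compared with rapid decay of the Husimi function \<open>Q\<close>.
  Since \<open>Q(\<alpha>) = \<Sum>\<^sub>i |\<langle>\<chi>\<^sub>\<alpha>|\<psi>\<^sub>i\<rangle>|\<^sup>2\<close>, decay of \<open>Q\<close> controls the amplitudes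
  \<open>\<langle>\<chi>\<^sub>\<alpha>|\<psi>\<^sub>i\<rangle>\<close> jointly in \<open>i\<close>. The resolution of the identity
  \<open>\<psi>\<^sub>i = (2\<pi>)\<^sup>-\<^sup>n \<integral> \<langle>\<chi>\<^sub>\<alpha>|\<psi>\<^sub>i\<rangle> \<chi>\<^sub>\<alpha> d\<alpha>\<close> then shows that the \<open>\<psi>\<^sub>i\<close> and all their
  derivatives are rapidly decreasing with constants whose squares are summable over \<open>i\<close>.
  For such families the kernel is a Schwartz function, and the matrix element, the Wigner function and
  the characteristic function are obtained from it by Fourier transforms and linear substitutions.
  Conversely, \<open>Q\<close> is a convolution of the Wigner function with the Wigner function of \<open>\<chi>\<close>, and
  a Fourier transform of the characteristic function times a Schwartz function. Finally, the commutators
  of \<open>X\<close> and \<open>P\<close> with \<open>D\<^sub>\<alpha>\<close> turn the bounds of a Schwartz operator into decay of \<open>Q\<close>,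
  while integration by parts turns joint bounds on the \<open>\<psi>\<^sub>i\<close> into operator bounds.\<close>

section \<open>Polynomial weights and rapid decay\<close>

text \<open>Joint Schwartz bounds control a supremum over x of sums over i, whereas differentiating
  the kernel term by term calls for a sum over i of suprema. The exchange is not attempted directly;
  it is gained on the detour through Q. Decay of Q yields, by Cauchy-Schwarz over phase space,
  weighted L^1 norms of the amplitudes whose squares are summable over i, and such a norm bounds a
  superposition of displaced functions uniformly in x. For W and M decay suffices, because Q is an
  average of W and the diagonal of M. For the characteristic function smoothness is used too: it is
  its smoothness that corresponds to decay of Q. Eigenvectors are determined up to null sets only.
  The reconstruction formula is therefore first established weakly, by pairing with Schwartz
  functions, and then lifted to almost every x by a density argument. Gaussians serve twice: as
  summation kernel in the Fourier inversion theorem and as test functions in the density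
  argument.\<close>

definition wt :: "'a::euclidean_space \<Rightarrow> real" where
  "wt x = (\<Prod>b\<in>Basis. 1 + (x \<bullet> b)\<^sup>2)"

lemma wt_ge1: "1 \<le> wt x"
  unfolding wt_def by (rule prod_ge_1) auto

lemma wt_pos [simp]: "0 < wt x"
  using wt_ge1[of x] by linarith

lemma wt_nonneg [simp]: "0 \<le> wt x" and wt_neq0 [simp]: "wt x \<noteq> 0"
  using wt_pos[of x] by linarith+

lemma continuous_on_wt [continuous_intros]:
  "continuous_on S f \<Longrightarrow> continuous_on S (\<lambda>x. wt (f x))"
  unfolding wt_def by (intro continuous_intros) auto

lemma borel_measurable_wt [measurable]: "wt \<in> borel_measurable borel"
  by (intro borel_measurable_continuous_onI continuous_intros)

lemma abs_le_one_add_square: "\<bar>t\<bar> \<le> 1 + (t::real)\<^sup>2"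
  using zero_le_power2[of "\<bar>t\<bar> - 1"] by (simp add: power2_diff)

lemma one_add_square_le_wt:
  assumes "b \<in> Basis" shows "1 + (x \<bullet> b)\<^sup>2 \<le> wt x"
proof -
  have "wt x = (1 + (x \<bullet> b)\<^sup>2) * (\<Prod>b\<in>Basis - {b}. 1 + (x \<bullet> b)\<^sup>2)"
    unfolding wt_def using assms by (simp add: prod.remove)
  moreover have "1 \<le> (\<Prod>b\<in>Basis - {b}. 1 + (x \<bullet> b)\<^sup>2)" by (rule prod_ge_1) auto
  moreover have "0 \<le> 1 + (x \<bullet> b)\<^sup>2" by simp
  ultimately show ?thesis by (metis mult.right_neutral mult_left_mono)
qed

lemma abs_inner_le_wt:
  assumes "b \<in> Basis" shows "\<bar>x \<bullet> b\<bar> \<le> wt x"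
  using one_add_square_le_wt[OF assms, of x] abs_le_one_add_square[of "x \<bullet> b"] by linarith

lemma norm_le_wt: "norm (x::'a::euclidean_space) \<le> DIM('a) * wt x"
proof -
  have "norm x \<le> (\<Sum>b\<in>Basis. \<bar>x \<bullet> b\<bar>)" by (rule norm_le_l1)
  also have "\<dots> \<le> (\<Sum>b\<in>(Basis::'a set). wt x)" by (intro sum_mono abs_inner_le_wt)
  finally show ?thesis by simp
qed

lemma wt_minus [simp]: "wt (- x) = wt x"
  unfolding wt_def by simp

text \<open>Peetre's inequality for this weight, proved coordinate by coordinate. It moves decay
  from one point to a translate of it at the price of a factor \<open>wt\<close> of the
  translation.\<close>

lemma wt_add: "wt (x + y) \<le> 2 ^ DIM('a) * wt x * wt (y::'a::euclidean_space)"
proof -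
  have "1 + (s + t)\<^sup>2 \<le> 2 * ((1 + s\<^sup>2) * (1 + t\<^sup>2))" for s t :: real
  proof -
    have "2 * ((1 + s\<^sup>2) * (1 + t\<^sup>2)) - (1 + (s + t)\<^sup>2) = 1 + (s - t)\<^sup>2 + 2 * (s * t)\<^sup>2"
      by (simp add: power2_eq_square algebra_simps)
    also have "\<dots> \<ge> 0" by simp
    finally show ?thesis by simp
  qed
  then have "wt (x + y) \<le> (\<Prod>b\<in>(Basis::'a set). 2 * ((1 + (x \<bullet> b)\<^sup>2) * (1 + (y \<bullet> b)\<^sup>2)))"
    unfolding wt_def by (intro prod_mono) (auto simp: inner_add_left)
  also have "\<dots> = 2 ^ DIM('a) * wt x * wt y"
    by (simp add: prod.distrib wt_def)
  finally show ?thesis .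
qed

text \<open>The weight is a product over coordinates for this reason: one power of it on a product
  space supplies one integrable power in each factor.\<close>

lemma wt_Pair: "wt (x, y) = wt x * wt y"
  unfolding wt_def Basis_prod_def
  by (subst prod.union_disjoint) (auto simp: prod.reindex inj_on_def comp_def)

text \<open>The integral factorises into copies of the integral of \<open>1 / (1 + t^2)\<close>, so
  a single power of the weight is integrable whatever the dimension.\<close>

lemma integrable_inverse_wt: "integrable lborel (\<lambda>x::'a::euclidean_space. 1 / wt x)"
proof (rule integrableI_bounded)
  show "(\<lambda>x::'a. 1 / wt x) \<in> borel_measurable lborel" by measurable
  have "integrable lborel (\<lambda>t::real. inverse (1 + t\<^sup>2))"
    using integrable_inverse_1_plus_square by (simp add: set_integrable_def)
  then have fin: "(\<integral>\<^sup>+ t. ennreal (inverse (1 + t\<^sup>2)) \<partial>lborel) < \<infinity>"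
    by (simp add: integrable_iff_bounded)
  have "(\<integral>\<^sup>+ x. ennreal (norm (1 / wt x)) \<partial>(lborel::'a measure)) =
      (\<integral>\<^sup>+ x. (\<Prod>b\<in>Basis. ennreal (inverse (1 + (x \<bullet> b)\<^sup>2))) \<partial>(lborel::'a measure))"
    by (rule nn_integral_cong, subst prod_ennreal)
      (auto simp: wt_def prod_inversef[symmetric] comp_def divide_inverse abs_prod intro!: prod_nonneg)
  also have "\<dots> = (\<Prod>b\<in>(Basis::'a set). \<integral>\<^sup>+ t. ennreal (inverse (1 + t\<^sup>2)) \<partial>lborel)"
    by (rule nn_integral_lborel_prod) auto
  also have "\<dots> < \<infinity>"
    using fin by (simp add: power_less_top_ennreal)
  finally show "(\<integral>\<^sup>+ x. ennreal (norm (1 / wt x)) \<partial>(lborel::'a measure)) < \<infinity>" .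
qed

section \<open>Monomials against powers of the weight\<close>

lemma monom_add: "monom (\<lambda>b. a b + a' b) x = monom a x * monom a' x"
  by (simp add: monom_def power_add prod.distrib)

lemma monom_zero [simp]: "monom (\<lambda>_. 0) x = 1"
  by (simp add: monom_def)

lemma monom_upd:
  assumes "b \<in> Basis"
  shows "monom (a(b := k)) x = (x \<bullet> b) ^ k * monom (a(b := 0)) x"
proof -
  have "monom (a(b := k)) x = (x \<bullet> b) ^ k * (\<Prod>c\<in>Basis - {b}. (x \<bullet> c) ^ a c)" for k
    unfolding monom_def using assms by (subst prod.remove[of _ b]) (auto intro!: prod.cong)
  from this[of k] this[of 0] show ?thesis by simp
qed

lemma monom_split:
  assumes "b \<in> Basis"
  shows "monom a x = (x \<bullet> b) ^ a b * monom (a(b := 0)) x"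
  using monom_upd[OF assms, of a "a b" x] by simp

lemma mult_monom:
  assumes "b \<in> Basis"
  shows "(x \<bullet> b) * monom a x = monom (a(b := Suc (a b))) x"
  using monom_split[OF assms, of a x] monom_upd[OF assms, of a "Suc (a b)" x] by simp

text \<open>Values of \<open>a\<close> off \<open>Basis\<close> do not enter \<open>monom\<close>,
  so the base case consists of all exponents vanishing on \<open>Basis\<close>, not of the zero
  function alone.\<close>

lemma monom_induct:
  fixes a :: "'a::euclidean_space \<Rightarrow> nat"
  assumes z: "\<And>a. (\<forall>b\<in>Basis. a b = 0) \<Longrightarrow> P a"
    and s: "\<And>a b. b \<in> Basis \<Longrightarrow> P a \<Longrightarrow> P (a(b := Suc (a b)))"
  shows "P a"
proof (induction "\<Sum>b\<in>Basis. a b" arbitrary: a)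
  case 0
  then show ?case by (intro z) auto
next
  case (Suc n)
  then obtain b where b: "b \<in> Basis" "a b \<noteq> 0"
    by (metis Zero_not_Suc sum.neutral)
  define a' where "a' = a(b := a b - 1)"
  have "(\<Sum>c\<in>Basis. a c) = Suc (\<Sum>c\<in>Basis. a' c)"
    unfolding a'_def using b by (subst (1 2) sum.remove[of _ b]) auto
  with Suc have "P a'" by auto
  then have "P (a'(b := Suc (a' b)))" using b s by blast
  moreover have "a'(b := Suc (a' b)) = a" using b by (auto simp: a'_def)
  ultimately show ?case by simp
qed

lemma abs_monom_le_wt: "\<bar>monom a x\<bar> \<le> wt x ^ (\<Sum>b\<in>Basis. a b)"
proof -
  have "\<bar>monom a x\<bar> = (\<Prod>b\<in>Basis. \<bar>x \<bullet> b\<bar> ^ a b)"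
    by (simp add: monom_def abs_prod power_abs)
  also have "\<dots> \<le> (\<Prod>b\<in>Basis. wt x ^ a b)"
    by (intro prod_mono) (auto intro!: power_mono abs_inner_le_wt)
  also have "\<dots> = wt x ^ (\<Sum>b\<in>Basis. a b)" by (simp add: power_sum)
  finally show ?thesis .
qed

text \<open>Expanding the product over coordinates. Through this identity hypotheses about monomials
  give bounds with the weight.\<close>

lemma wt_eq_sum_monom:
  "wt x = (\<Sum>A\<in>Pow Basis. monom (\<lambda>b. if b \<in> A then 2 else 0) x)"
proof -
  have "wt x = (\<Sum>A\<in>Pow Basis. \<Prod>b\<in>A. (x \<bullet> b)\<^sup>2)"
    unfolding wt_def by (subst add.commute, subst prod_add) auto
  also have "\<dots> = (\<Sum>A\<in>Pow Basis. monom (\<lambda>b. if b \<in> A then 2 else 0) x)"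
  proof (intro sum.cong refl)
    fix A :: "'a set" assume "A \<in> Pow Basis"
    then have "(\<Prod>b\<in>Basis. if b \<in> A then (x \<bullet> b)\<^sup>2 else 1) = (\<Prod>b\<in>A. (x \<bullet> b)\<^sup>2)"
      by (subst prod.inter_restrict[symmetric]) (auto simp: Int_absorb1)
    moreover have "(\<Prod>b\<in>Basis. if b \<in> A then (x \<bullet> b)\<^sup>2 else 1) = monom (\<lambda>b. if b \<in> A then 2 else 0) x"
      unfolding monom_def by (intro prod.cong) auto
    ultimately show "(\<Prod>b\<in>A. (x \<bullet> b)\<^sup>2) = monom (\<lambda>b. if b \<in> A then 2 else 0) x"
      by simp
  qed
  finally show ?thesis .
qed

lemma rapid_decay_wt_mult:
  assumes "rapid_decay F" shows "rapid_decay (\<lambda>x. of_real (wt x) * F x)"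
  unfolding rapid_decay_def
proof
  fix a :: "'a \<Rightarrow> nat"
  have eq: "of_real (monom a x) * (of_real (wt x) * F x) =
     (\<Sum>A\<in>Pow Basis. of_real (monom (\<lambda>b. a b + (if b \<in> A then 2 else 0)) x) * F x)" for x
    unfolding wt_eq_sum_monom
    by (simp add: monom_add sum_distrib_left sum_distrib_right mult_ac)
  have "bounded (range (\<lambda>x. \<Sum>A\<in>\<A>. of_real (monom (\<lambda>b. a b + (if b \<in> A then 2 else 0)) x) * F x))"
    if "finite \<A>" for \<A> :: "'a set set"
    using that
  proof (induction \<A>)
    case (insert A \<A>)
    have "bounded (range (\<lambda>x. of_real (monom (\<lambda>b. a b + (if b \<in> A then 2 else 0)) x) * F x))"
      using assms unfolding rapid_decay_def by blast
    from bounded_plus_comp[OF this insert.IH] show ?case using insert by simp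
  qed simp
  from this[of "Pow Basis"] show "bounded (range (\<lambda>x. of_real (monom a x) * (of_real (wt x) * F x)))"
    unfolding eq by simp
qed

text \<open>Together with the converse \<open>rapid_decayI_wt\<close> this replaces the family of
  all monomials by the powers of a single positive function.\<close>

lemma rapid_decay_wt_bound:
  assumes "rapid_decay F" shows "\<exists>C. \<forall>x. wt x ^ N * cmod (F x) \<le> C"
proof -
  have *: "rapid_decay (\<lambda>x. of_real (wt x ^ N) * F x)"
  proof (induction N)
    case (Suc N)
    from rapid_decay_wt_mult[OF this] show ?case by (simp add: mult_ac)
  qed (use assms in simp)
  then have "bounded (range (\<lambda>x. of_real (monom (\<lambda>_. 0) x) * (of_real (wt x ^ N) * F x)))"
    unfolding rapid_decay_def by blast
  then show ?thesis
    by (auto simp: bounded_iff norm_mult norm_power)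
qed

lemma rapid_decayI_wt:
  assumes "\<And>N. \<exists>C. \<forall>x. wt x ^ N * cmod (F x) \<le> C" shows "rapid_decay F"
  unfolding rapid_decay_def
proof
  fix a :: "'a \<Rightarrow> nat"
  obtain C where C: "\<And>x. wt x ^ (\<Sum>b\<in>Basis. a b) * cmod (F x) \<le> C" using assms by meson
  have "cmod (of_real (monom a x) * F x) \<le> C" for x
    using mult_right_mono[OF abs_monom_le_wt[of a x], of "cmod (F x)"] C[of x]
    by (simp add: norm_mult)
  then show "bounded (range (\<lambda>x. of_real (monom a x) * F x))"
    by (auto simp: bounded_iff)
qed

text \<open>A monomial of degree N is at most the N-th power of the largest coordinate, and that
  power is at most a sum over coordinates. Commutators with X and P deliver bounds for one
  coordinate at a time, in exactly this form.\<close>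

lemma rapid_decayI_coord:
  fixes F :: "'a::euclidean_space \<Rightarrow> complex"
  assumes "\<And>N b. b \<in> Basis \<Longrightarrow> \<exists>C. \<forall>x. \<bar>x \<bullet> b\<bar> ^ N * cmod (F x) \<le> C"
    and F0: "\<exists>C. \<forall>x. cmod (F x) \<le> C"
  shows "rapid_decay F"
  unfolding rapid_decay_def
proof
  fix a :: "'a \<Rightarrow> nat"
  define N where "N = (\<Sum>b\<in>Basis. a b)"
  obtain C where C: "\<And>b x. b \<in> Basis \<Longrightarrow> \<bar>x \<bullet> b\<bar> ^ N * cmod (F x) \<le> C b"
    using assms(1)[where N = N] by metis
  obtain C0 where C0: "\<And>x. cmod (F x) \<le> C0" using F0 by blast
  have "cmod (of_real (monom a x) * F x) \<le> C0 + (\<Sum>b\<in>Basis. C b)" for x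
  proof -
    define m where "m = Max (insert 1 ((\<lambda>b. \<bar>x \<bullet> b\<bar>) ` Basis))"
    have m: "m \<in> insert 1 ((\<lambda>b. \<bar>x \<bullet> b\<bar>) ` Basis)"
      unfolding m_def by (rule Max_in) auto
    have "\<bar>x \<bullet> b\<bar> \<le> m" if "b \<in> Basis" for b unfolding m_def using that by (intro Max_ge) auto
    then have "\<bar>monom a x\<bar> \<le> (\<Prod>b\<in>(Basis::'a set). m ^ a b)"
      unfolding monom_def abs_prod power_abs by (intro prod_mono) (auto intro!: power_mono)
    also have "\<dots> = m ^ N" by (simp add: power_sum N_def)
    also have "\<dots> \<le> 1 + (\<Sum>b\<in>Basis. \<bar>x \<bullet> b\<bar> ^ N)"
      using m
    proof
      assume "m \<in> (\<lambda>b. \<bar>x \<bullet> b\<bar>) ` Basis"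
      then obtain b where b: "b \<in> Basis" "m = \<bar>x \<bullet> b\<bar>" by auto
      have "\<bar>x \<bullet> b\<bar> ^ N \<le> (\<Sum>b\<in>Basis. \<bar>x \<bullet> b\<bar> ^ N)"
        using b by (intro member_le_sum) auto
      then show ?thesis using b by simp
    qed (auto intro!: sum_nonneg)
    finally have "\<bar>monom a x\<bar> * cmod (F x) \<le> (1 + (\<Sum>b\<in>Basis. \<bar>x \<bullet> b\<bar> ^ N)) * cmod (F x)"
      by (rule mult_right_mono) simp
    also have "\<dots> = cmod (F x) + (\<Sum>b\<in>Basis. \<bar>x \<bullet> b\<bar> ^ N * cmod (F x))"
      by (simp add: distrib_right sum_distrib_right)
    also have "\<dots> \<le> C0 + (\<Sum>b\<in>Basis. C b)"
      by (intro add_mono sum_mono C C0)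
    finally show ?thesis by (simp add: norm_mult)
  qed
  then show "bounded (range (\<lambda>x. of_real (monom a x) * F x))"
    by (auto simp: bounded_iff)
qed

section \<open>Families of Schwartz functions\<close>

text \<open>Compared with joint boundedness, the supremum over \<open>x\<close> is taken before the sum over \<open>i\<close>;
  \<open>sjs\<close> is the corresponding strengthening of \<open>jointly_schwartz\<close>.\<close>

definition ssb :: "'i set \<Rightarrow> ('i \<Rightarrow> 'a \<Rightarrow> complex) \<Rightarrow> bool" where
  "ssb I \<Phi> \<longleftrightarrow> (\<exists>B. B summable_on I \<and> (\<forall>i\<in>I. \<forall>x. (cmod (\<Phi> i x))\<^sup>2 \<le> B i))"

definition sjs :: "'i set \<Rightarrow> ('i \<Rightarrow> 'a::euclidean_space \<Rightarrow> complex) \<Rightarrow> bool" where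
  "sjs I \<Phi> \<longleftrightarrow> (\<forall>i\<in>I. smooth_fun (\<Phi> i)) \<and>
     (\<forall>a bs. set bs \<subseteq> Basis \<longrightarrow> ssb I (\<lambda>i x. of_real (monom a x) * dpart bs (\<Phi> i) x))"

lemma ssbI:
  assumes "B summable_on I" "\<And>i x. i \<in> I \<Longrightarrow> (cmod (\<Phi> i x))\<^sup>2 \<le> B i"
  shows "ssb I \<Phi>"
  using assms unfolding ssb_def by blast

lemma ssb_add:
  assumes "ssb I \<Phi>" "ssb I \<Psi>"
  shows "ssb I (\<lambda>i x. \<Phi> i x + \<Psi> i x)"
proof -
  obtain B where B: "B summable_on I" "\<And>i x. i \<in> I \<Longrightarrow> (cmod (\<Phi> i x))\<^sup>2 \<le> B i"
    using assms(1) unfolding ssb_def by blast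
  obtain C where C: "C summable_on I" "\<And>i x. i \<in> I \<Longrightarrow> (cmod (\<Psi> i x))\<^sup>2 \<le> C i"
    using assms(2) unfolding ssb_def by blast
  have "(cmod (u + v))\<^sup>2 \<le> 2 * (cmod u)\<^sup>2 + 2 * (cmod v)\<^sup>2" for u v
  proof -
    have "(cmod (u + v))\<^sup>2 \<le> (cmod u + cmod v)\<^sup>2"
      by (intro power_mono norm_triangle_ineq) auto
    also have "\<dots> \<le> 2 * (cmod u)\<^sup>2 + 2 * (cmod v)\<^sup>2"
      using zero_le_power2[of "cmod u - cmod v"] by (simp add: power2_sum power2_diff)
    finally show ?thesis .
  qed
  then have "(cmod (\<Phi> i x + \<Psi> i x))\<^sup>2 \<le> 2 * B i + 2 * C i" if "i \<in> I" for i x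
    using B(2)[OF that, of x] C(2)[OF that, of x] by (smt (verit))
  moreover have "(\<lambda>i. 2 * B i + 2 * C i) summable_on I"
    using B(1) C(1) by (intro summable_on_add summable_on_cmult_right)
  ultimately show ?thesis by (intro ssbI)
qed

lemma ssb_cmult:
  assumes "ssb I \<Phi>"
  shows "ssb I (\<lambda>i x. c * \<Phi> i x)"
proof -
  obtain B where B: "B summable_on I" "\<And>i x. i \<in> I \<Longrightarrow> (cmod (\<Phi> i x))\<^sup>2 \<le> B i"
    using assms unfolding ssb_def by blast
  have "(cmod (c * \<Phi> i x))\<^sup>2 \<le> (cmod c)\<^sup>2 * B i" if "i \<in> I" for i x
    using B(2)[OF that, of x] by (simp add: norm_mult power_mult_distrib mult_left_mono)
  moreover have "(\<lambda>i. (cmod c)\<^sup>2 * B i) summable_on I"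
    using B(1) by (intro summable_on_cmult_right)
  ultimately show ?thesis by (intro ssbI)
qed

lemma ssb_cong:
  "(\<And>i x. i \<in> I \<Longrightarrow> \<Phi> i x = \<Psi> i x) \<Longrightarrow> ssb I \<Phi> \<longleftrightarrow> ssb I \<Psi>"
  unfolding ssb_def by auto

lemma ssb_comp:
  assumes "ssb I \<Phi>" "\<And>i x. i \<in> I \<Longrightarrow> \<exists>y. cmod (\<Psi> i x) = cmod (\<Phi> i y)"
  shows "ssb I \<Psi>"
proof -
  obtain B where B: "B summable_on I" "\<And>i x. i \<in> I \<Longrightarrow> (cmod (\<Phi> i x))\<^sup>2 \<le> B i"
    using assms(1) unfolding ssb_def by blast
  show ?thesis
  proof (rule ssbI[OF B(1)])
    fix i x assume "i \<in> I"
    with assms(2) obtain y where "cmod (\<Psi> i x) = cmod (\<Phi> i y)" by blast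
    with B(2)[OF \<open>i \<in> I\<close>, of y] show "(cmod (\<Psi> i x))\<^sup>2 \<le> B i" by simp
  qed
qed

text \<open>The largest class of bounded families closed under partial derivatives and
  multiplication by coordinates is \<open>sjs\<close>: derivatives are iterated first, coordinates
  multiplied afterwards. Proofs for products, integrals and series then only have to name an
  invariant class, and iterated derivatives are never expanded.\<close>

lemma sjs_coinduct:
  fixes \<Phi> :: "'i \<Rightarrow> 'a::euclidean_space \<Rightarrow> complex"
  assumes P: "P \<Phi>"
    and bd: "\<And>\<Phi>. P \<Phi> \<Longrightarrow> ssb I \<Phi>"
    and der: "\<And>\<Phi>. P \<Phi> \<Longrightarrow>
      \<exists>D. (\<forall>i\<in>I. \<forall>x. (\<Phi> i has_derivative D i x) (at x)) \<and> (\<forall>b\<in>Basis. P (\<lambda>i x. D i x b))"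
    and mult: "\<And>\<Phi> b. P \<Phi> \<Longrightarrow> b \<in> Basis \<Longrightarrow> P (\<lambda>i x. of_real (x \<bullet> b) * \<Phi> i x)"
  shows "sjs I \<Phi>"
proof -
  \<comment> \<open>Nothing is known about members with index outside \<open>I\<close>, so a
    derivative agrees with a family satisfying \<open>P\<close> on \<open>I\<close> only.\<close>
  have dp: "\<exists>\<Psi>. P \<Psi> \<and> (\<forall>i\<in>I. dpart bs (\<Phi> i) = \<Psi> i)" if "set bs \<subseteq> Basis" for bs
    using that
  proof (induction bs)
    case Nil
    then show ?case using P by auto
  next
    case (Cons b bs)
    then obtain \<Psi> where \<Psi>: "P \<Psi>" "\<And>i. i \<in> I \<Longrightarrow> dpart bs (\<Phi> i) = \<Psi> i" by auto
    from der[OF \<Psi>(1)] obtain D where D: "\<And>i x. i \<in> I \<Longrightarrow> (\<Psi> i has_derivative D i x) (at x)"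
      "\<And>b. b \<in> Basis \<Longrightarrow> P (\<lambda>i x. D i x b)" by blast
    have "frechet_derivative (\<Psi> i) (at x) = D i x" if "i \<in> I" for i x
      using D(1)[OF that, of x] by (rule frechet_derivative_at[symmetric])
    then have "\<forall>i\<in>I. dpart (b # bs) (\<Phi> i) = (\<lambda>x. D i x b)" using \<Psi>(2) by auto
    then show ?case using D(2)[of b] Cons.prems by auto
  qed
  have mn: "P (\<lambda>i x. of_real (monom a x) * \<Psi> i x)" if "P \<Psi>" for a \<Psi>
    using that
  proof (induction a rule: monom_induct)
    case (1 a)
    have "monom a x = 1" for x using 1(1) by (simp add: monom_def)
    then show ?case using 1 by simp
  next
    case (2 a b)
    then show ?case
      using mult[of "\<lambda>i x. of_real (monom a x) * \<Psi> i x" b]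
      by (simp add: mult_monom[symmetric] mult.assoc del: fun_upd_apply)
  qed
  show ?thesis unfolding sjs_def smooth_fun_def
  proof (intro conjI ballI allI impI)
    fix i bs and x :: 'a assume "i \<in> I" "set bs \<subseteq> (Basis::'a set)"
    with dp obtain \<Psi> where \<Psi>: "P \<Psi>" "dpart bs (\<Phi> i) = \<Psi> i" by meson
    with der[OF \<Psi>(1)] \<open>i \<in> I\<close> show "dpart bs (\<Phi> i) differentiable at x"
      unfolding differentiable_def by metis
  next
    fix a :: "'a \<Rightarrow> nat" and bs assume "set bs \<subseteq> (Basis::'a set)"
    with dp obtain \<Psi> where \<Psi>: "P \<Psi>" "\<And>i. i \<in> I \<Longrightarrow> dpart bs (\<Phi> i) = \<Psi> i" by meson
    have "ssb I (\<lambda>i x. of_real (monom a x) * \<Psi> i x)" using bd mn \<Psi>(1) by blast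
    then show "ssb I (\<lambda>i x. of_real (monom a x) * dpart bs (\<Phi> i) x)"
      by (rule ssb_cong[THEN iffD1, rotated]) (simp add: \<Psi>(2))
  qed
qed

lemma sjs_ssb_monom: "sjs I \<Phi> \<Longrightarrow> ssb I (\<lambda>i x. of_real (monom a x) * \<Phi> i x)"
  unfolding sjs_def by (drule conjunct2, drule spec[of _ a], drule spec[of _ "[]"]) simp

lemma sjs_ssb: "sjs I \<Phi> \<Longrightarrow> ssb I \<Phi>"
  using sjs_ssb_monom[of I \<Phi> "\<lambda>_. 0"] by simp

lemma sjs_has_derivative:
  assumes "sjs I \<Phi>" "i \<in> I"
  shows "(\<Phi> i has_derivative frechet_derivative (\<Phi> i) (at x)) (at x)"
proof -
  have "dpart [] (\<Phi> i) differentiable at x"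
    using assms unfolding sjs_def smooth_fun_def by (auto dest!: bspec spec[of _ "[]"])
  then show ?thesis by (simp add: frechet_derivative_works)
qed

lemma dpart_append: "dpart (bs @ cs) f = dpart bs (dpart cs f)"
  by (induction bs) auto

text \<open>The derivative applied first is the last entry of the list, so a new innermost
  derivative is appended at the end and no interchange of partial derivatives arises.\<close>

lemma sjs_deriv:
  assumes "sjs I \<Phi>" "b \<in> Basis"
  shows "sjs I (\<lambda>i x. frechet_derivative (\<Phi> i) (at x) b)"
proof -
  have "dpart bs (\<lambda>x. frechet_derivative f (at x) b) = dpart (bs @ [b]) f" for bs f
    by (simp add: dpart_append)
  note eq = this
  have sub: "set (bs @ [b]) \<subseteq> Basis" if "set bs \<subseteq> Basis" for bs using assms that by auto
  have 1: "\<And>i bs x. i \<in> I \<Longrightarrow> set bs \<subseteq> Basis \<Longrightarrow> dpart bs (\<Phi> i) differentiable at x"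
    and 2: "\<And>a bs. set bs \<subseteq> Basis \<Longrightarrow> ssb I (\<lambda>i x. of_real (monom a x) * dpart bs (\<Phi> i) x)"
    using assms(1) unfolding sjs_def smooth_fun_def by blast+
  show ?thesis unfolding sjs_def smooth_fun_def eq
    by (intro conjI ballI allI impI 1 2 sub)
qed

text \<open>The Leibniz rule for iterated derivatives is avoided: the module generated by all sjs families
  is closed under both operations, so coinduction shows that it consists of sjs families.\<close>

inductive sjs_span :: "'i set \<Rightarrow> ('i \<Rightarrow> 'a::euclidean_space \<Rightarrow> complex) \<Rightarrow> bool" for I where
  base: "sjs I \<Phi> \<Longrightarrow> sjs_span I \<Phi>"
| coord: "sjs_span I \<Phi> \<Longrightarrow> b \<in> Basis \<Longrightarrow> sjs_span I (\<lambda>i x. of_real (x \<bullet> b) * \<Phi> i x)"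
| add: "sjs_span I \<Phi> \<Longrightarrow> sjs_span I \<Psi> \<Longrightarrow> sjs_span I (\<lambda>i x. \<Phi> i x + \<Psi> i x)"
| scale: "sjs_span I \<Phi> \<Longrightarrow> sjs_span I (\<lambda>i x. c * \<Phi> i x)"

lemma sjs_span_ssb:
  "sjs_span I \<Phi> \<Longrightarrow> ssb I (\<lambda>i x. of_real (monom a x) * \<Phi> i x)"
proof (induction arbitrary: a rule: sjs_span.induct)
  case (base \<Phi>)
  then show ?case by (rule sjs_ssb_monom)
next
  case (coord \<Phi> b)
  have eq: "of_real (monom (a(b := Suc (a b))) x) * \<Phi> i x = of_real (monom a x) * (of_real (x \<bullet> b) * \<Phi> i x)" for i x
    using coord.hyps(2) by (simp add: mult_monom[symmetric])
  from coord.IH[of "a(b := Suc (a b))"] show ?case unfolding eq .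
next
  case (add \<Phi> \<Psi>)
  from ssb_add[OF add.IH(1)[of a] add.IH(2)[of a]] show ?case by (simp add: distrib_left)
next
  case (scale \<Phi> c)
  from ssb_cmult[OF scale.IH[of a], of c] show ?case by (simp add: mult_ac)
qed

lemma sjs_span_deriv:
  "sjs_span I \<Phi> \<Longrightarrow>
   \<exists>D. (\<forall>i\<in>I. \<forall>x. (\<Phi> i has_derivative D i x) (at x)) \<and> (\<forall>b\<in>Basis. sjs_span I (\<lambda>i x. D i x b))"
proof (induction rule: sjs_span.induct)
  case (base \<Phi>)
  then show ?case using sjs_has_derivative[OF base] sjs_span.base[OF sjs_deriv[OF base]]
    by (intro exI[of _ "\<lambda>i x. frechet_derivative (\<Phi> i) (at x)"]) auto
next
  case (coord \<Phi> b)
  then obtain D where D: "\<And>i x. i \<in> I \<Longrightarrow> (\<Phi> i has_derivative D i x) (at x)"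
    "\<And>b. b \<in> Basis \<Longrightarrow> sjs_span I (\<lambda>i x. D i x b)" by blast
  have "((\<lambda>x. of_real (x \<bullet> b) * \<Phi> i x) has_derivative
     (\<lambda>h. of_real (x \<bullet> b) * D i x h + of_real (h \<bullet> b) * \<Phi> i x)) (at x)" if "i \<in> I" for i x
    using D(1)[OF that] by (auto intro!: derivative_eq_intros)
  moreover have "sjs_span I (\<lambda>i x. of_real (x \<bullet> b) * D i x c + of_real (c \<bullet> b) * \<Phi> i x)" if "c \<in> Basis" for c
    by (intro sjs_span.add sjs_span.coord D(2) that coord.hyps sjs_span.scale)
  ultimately show ?case
    by (intro exI[of _ "\<lambda>i x h. of_real (x \<bullet> b) * D i x h + of_real (h \<bullet> b) * \<Phi> i x"]) auto
next
  case (add \<Phi> \<Psi>)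
  from add.IH obtain D E where D: "\<And>i x. i \<in> I \<Longrightarrow> (\<Phi> i has_derivative D i x) (at x)"
    "\<And>b. b \<in> Basis \<Longrightarrow> sjs_span I (\<lambda>i x. D i x b)" 
    and E: "\<And>i x. i \<in> I \<Longrightarrow> (\<Psi> i has_derivative E i x) (at x)"
    "\<And>b. b \<in> Basis \<Longrightarrow> sjs_span I (\<lambda>i x. E i x b)" by blast
  then show ?case
    by (intro exI[of _ "\<lambda>i x h. D i x h + E i x h"]) (auto intro!: derivative_eq_intros sjs_span.add)
next
  case (scale \<Phi> c)
  from scale.IH obtain D where D: "\<And>i x. i \<in> I \<Longrightarrow> (\<Phi> i has_derivative D i x) (at x)"
    "\<And>b. b \<in> Basis \<Longrightarrow> sjs_span I (\<lambda>i x. D i x b)" by blast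
  then show ?case
    by (intro exI[of _ "\<lambda>i x h. c * D i x h"]) (auto intro!: derivative_eq_intros sjs_span.scale)
qed

lemma sjs_span_sjs: "sjs_span I \<Phi> \<Longrightarrow> sjs I \<Phi>"
proof (rule sjs_coinduct[where P = "sjs_span I"])
  show "ssb I \<Phi>" if "sjs_span I \<Phi>" for \<Phi> :: "'a \<Rightarrow> 'b \<Rightarrow> complex"
    using sjs_span_ssb[OF that, of "\<lambda>_. 0"] by simp
qed (auto intro: sjs_span_deriv sjs_span.coord)

lemma sjs_add: "sjs I \<Phi> \<Longrightarrow> sjs I \<Psi> \<Longrightarrow> sjs I (\<lambda>i x. \<Phi> i x + \<Psi> i x)"
  and sjs_cmult: "sjs I \<Phi> \<Longrightarrow> sjs I (\<lambda>i x. c * \<Phi> i x)"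
  and sjs_coord: "sjs I \<Phi> \<Longrightarrow> b \<in> Basis \<Longrightarrow> sjs I (\<lambda>i x. of_real (x \<bullet> b) * \<Phi> i x)"
  by (rule sjs_span_sjs, rule sjs_span.add, (rule sjs_span.base, assumption)+,
      rule sjs_span_sjs, rule sjs_span.scale, rule sjs_span.base, assumption,
      rule sjs_span_sjs, rule sjs_span.coord, rule sjs_span.base, assumption+)

lemma sjs_zero: "sjs (I::'i set) (\<lambda>i (x::'a::euclidean_space). 0)"
proof (rule sjs_coinduct[where P = "\<lambda>\<Phi>. \<Phi> = (\<lambda>i x. 0)"])
  show "ssb I \<Phi>" if "\<Phi> = (\<lambda>i x. 0)" for \<Phi> :: "'i \<Rightarrow> 'a \<Rightarrow> complex"
    using that unfolding ssb_def by (intro exI[of _ "\<lambda>_. 0"]) auto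
qed (auto intro!: exI[of _ "\<lambda>i x h. 0"])

lemma sjs_sum:
  "finite A \<Longrightarrow> (\<And>c. c \<in> A \<Longrightarrow> sjs I (\<Phi> c)) \<Longrightarrow> sjs I (\<lambda>i x. \<Sum>c\<in>A. \<Phi> c i x)"
  by (induction A rule: finite_induct) (auto intro: sjs_add sjs_zero)

text \<open>The left inverse \<open>S\<close> expresses x affinely through \<open>t + L x\<close>,
  so a coordinate of x becomes a polynomial factor in the argument of \<Phi>. As L is injective but
  not necessarily onto, slices and diagonals are covered together with changes of variables.\<close>

lemma sjs_affine:
  fixes \<Phi> :: "'i \<Rightarrow> 'b::euclidean_space \<Rightarrow> complex" and L :: "'a::euclidean_space \<Rightarrow> 'b"
  assumes \<Phi>: "sjs I \<Phi>" and L: "linear L" and S: "linear S" and SL: "\<And>x. S (L x) = x"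
  shows "sjs I (\<lambda>i x. \<Phi> i (t + L x))"
proof (rule sjs_coinduct[where P = "\<lambda>\<Xi>. \<exists>\<Phi>. sjs I \<Phi> \<and> \<Xi> = (\<lambda>i x. \<Phi> i (t + L x))"])
  show "\<exists>\<Phi>'. sjs I \<Phi>' \<and> (\<lambda>i x. \<Phi> i (t + L x)) = (\<lambda>i x. \<Phi>' i (t + L x))" using \<Phi> by blast
next
  fix \<Xi> :: "'i \<Rightarrow> 'a \<Rightarrow> complex" assume "\<exists>\<Phi>. sjs I \<Phi> \<and> \<Xi> = (\<lambda>i x. \<Phi> i (t + L x))"
  then obtain \<Phi> where \<Phi>: "sjs I \<Phi>" and \<Xi>: "\<Xi> = (\<lambda>i x. \<Phi> i (t + L x))" by blast
  show "ssb I \<Xi>" by (rule ssb_comp[OF sjs_ssb[OF \<Phi>]]) (auto simp: \<Xi>)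
next
  fix \<Xi> :: "'i \<Rightarrow> 'a \<Rightarrow> complex" assume "\<exists>\<Phi>. sjs I \<Phi> \<and> \<Xi> = (\<lambda>i x. \<Phi> i (t + L x))"
  then obtain \<Phi> where \<Phi>: "sjs I \<Phi>" and \<Xi>: "\<Xi> = (\<lambda>i x. \<Phi> i (t + L x))" by blast
  define D where "D i x h = frechet_derivative (\<Phi> i) (at (t + L x)) (L h)" for i x h
  have D: "(\<Xi> i has_derivative D i x) (at x)" if "i \<in> I" for i x
  proof -
    have "((\<lambda>x. t + L x) has_derivative L) (at x)"
      using linear_imp_has_derivative[OF L] by (auto intro!: derivative_eq_intros)
    from has_derivative_compose[OF this sjs_has_derivative[OF \<Phi> that]] show ?thesis
      unfolding \<Xi> D_def[abs_def] .
  qed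
  have Dexp: "D i x b = (\<Sum>c\<in>Basis. of_real (L b \<bullet> c) * frechet_derivative (\<Phi> i) (at (t + L x)) c)"
    if "i \<in> I" for i x b
  proof -
    have lin: "linear (frechet_derivative (\<Phi> i) (at (t + L x)))"
      using sjs_has_derivative[OF \<Phi> that] has_derivative_linear by blast
    have "frechet_derivative (\<Phi> i) (at (t + L x)) (\<Sum>c\<in>Basis. (L b \<bullet> c) *\<^sub>R c) =
       (\<Sum>c\<in>Basis. (L b \<bullet> c) *\<^sub>R frechet_derivative (\<Phi> i) (at (t + L x)) c)"
      by (simp add: linear_sum[OF lin] linear_cmul[OF lin])
    then show ?thesis by (simp add: D_def euclidean_representation scaleR_conv_of_real)
  qed
  \<comment> \<open>Off \<open>I\<close> the derivative need not be linear, so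
    \<open>D i x b\<close> may differ from its basis expansion. There \<open>D'\<close> is the
    expansion by definition, which makes the identity with a transported family hold for every
    index.\<close>
  define D' where "D' i x h = (if i \<in> I then D i x h else
    (\<Sum>c\<in>Basis. of_real (L h \<bullet> c) * frechet_derivative (\<Phi> i) (at (t + L x)) c))" for i x h
  have 1: "\<forall>i\<in>I. \<forall>x. (\<Xi> i has_derivative D' i x) (at x)"
  proof -
    have "D' i = D i" if "i \<in> I" for i using that by (simp add: fun_eq_iff D'_def)
    then show ?thesis using D by simp
  qed
  have 2: "\<exists>\<Phi>'. sjs I \<Phi>' \<and> (\<lambda>i x. D' i x b) = (\<lambda>i x. \<Phi>' i (t + L x))" if "b \<in> Basis" for b
  proof (intro exI conjI)
    show "sjs I (\<lambda>i y. \<Sum>c\<in>Basis. of_real (L b \<bullet> c) * frechet_derivative (\<Phi> i) (at y) c)"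
      by (intro sjs_sum sjs_cmult sjs_deriv \<Phi>) auto
    show "(\<lambda>i x. D' i x b) = (\<lambda>i x. \<Sum>c\<in>Basis. of_real (L b \<bullet> c) * frechet_derivative (\<Phi> i) (at (t + L x)) c)"
      by (auto simp: fun_eq_iff D'_def Dexp)
  qed
  show "\<exists>D. (\<forall>i\<in>I. \<forall>x. (\<Xi> i has_derivative D i x) (at x)) \<and>
      (\<forall>b\<in>Basis. \<exists>\<Phi>. sjs I \<Phi> \<and> (\<lambda>i x. D i x b) = (\<lambda>i x. \<Phi> i (t + L x)))"
    by (intro exI[of _ D'] conjI ballI 1 2)
next
  fix \<Xi> :: "'i \<Rightarrow> 'a \<Rightarrow> complex" and b :: 'a
  assume "\<exists>\<Phi>. sjs I \<Phi> \<and> \<Xi> = (\<lambda>i x. \<Phi> i (t + L x))"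
  then obtain \<Phi> where \<Phi>: "sjs I \<Phi>" and \<Xi>: "\<Xi> = (\<lambda>i x. \<Phi> i (t + L x))" by blast
  have S': "S y \<bullet> b = (\<Sum>c\<in>Basis. (S c \<bullet> b) * (y \<bullet> c))" for y
  proof -
    have "S (\<Sum>c\<in>Basis. (y \<bullet> c) *\<^sub>R c) = (\<Sum>c\<in>Basis. (y \<bullet> c) *\<^sub>R S c)"
      by (simp add: linear_sum[OF S] linear_cmul[OF S])
    then show ?thesis by (simp add: euclidean_representation inner_sum_left mult.commute)
  qed
  have xb: "x \<bullet> b = (\<Sum>c\<in>Basis. (S c \<bullet> b) * ((t + L x) \<bullet> c)) + (- (S t \<bullet> b))" for x
    unfolding S'[symmetric] by (simp add: linear_add[OF S] SL inner_add_left)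
  show "\<exists>\<Phi>'. sjs I \<Phi>' \<and> (\<lambda>i x. of_real (x \<bullet> b) * \<Xi> i x) = (\<lambda>i x. \<Phi>' i (t + L x))"
  proof (intro exI conjI)
    show "sjs I (\<lambda>i y. (\<Sum>c\<in>Basis. of_real (S c \<bullet> b) * (of_real (y \<bullet> c) * \<Phi> i y)) + of_real (- (S t \<bullet> b)) * \<Phi> i y)"
      by (intro sjs_add sjs_sum sjs_cmult sjs_coord \<Phi>) auto
    show "(\<lambda>i x. of_real (x \<bullet> b) * \<Xi> i x) = (\<lambda>i x. (\<Sum>c\<in>Basis. of_real (S c \<bullet> b) * (of_real ((t + L x) \<bullet> c) * \<Phi> i (t + L x)))
        + of_real (- (S t \<bullet> b)) * \<Phi> i (t + L x))"
    proof (intro ext)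
      fix i x
      show "of_real (x \<bullet> b) * \<Xi> i x = (\<Sum>c\<in>Basis. of_real (S c \<bullet> b) * (of_real ((t + L x) \<bullet> c) * \<Phi> i (t + L x)))
        + of_real (- (S t \<bullet> b)) * \<Phi> i (t + L x)"
        unfolding \<Xi> by (subst xb) (simp add: distrib_right left_diff_distrib sum_distrib_right mult.assoc)
    qed
  qed
qed

lemma sjs_cnj:
  assumes "sjs I \<Phi>" shows "sjs I (\<lambda>i x. cnj (\<Phi> i x))"
proof (rule sjs_coinduct[where P = "\<lambda>\<Xi>. \<exists>\<Phi>. sjs I \<Phi> \<and> \<Xi> = (\<lambda>i x. cnj (\<Phi> i x))"])
  show "\<exists>\<Phi>'. sjs I \<Phi>' \<and> (\<lambda>i x. cnj (\<Phi> i x)) = (\<lambda>i x. cnj (\<Phi>' i x))" using assms by blast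
next
  fix \<Xi> :: "'a \<Rightarrow> 'b \<Rightarrow> complex" assume "\<exists>\<Phi>. sjs I \<Phi> \<and> \<Xi> = (\<lambda>i x. cnj (\<Phi> i x))"
  then obtain \<Phi> where \<Phi>: "sjs I \<Phi>" and \<Xi>: "\<Xi> = (\<lambda>i x. cnj (\<Phi> i x))" by blast
  show "ssb I \<Xi>" by (rule ssb_comp[OF sjs_ssb[OF \<Phi>]]) (auto simp: \<Xi>)
next
  fix \<Xi> :: "'a \<Rightarrow> 'b \<Rightarrow> complex" assume "\<exists>\<Phi>. sjs I \<Phi> \<and> \<Xi> = (\<lambda>i x. cnj (\<Phi> i x))"
  then obtain \<Phi> where \<Phi>: "sjs I \<Phi>" and \<Xi>: "\<Xi> = (\<lambda>i x. cnj (\<Phi> i x))" by blast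
  show "\<exists>D. (\<forall>i\<in>I. \<forall>x. (\<Xi> i has_derivative D i x) (at x)) \<and>
      (\<forall>b\<in>Basis. \<exists>\<Phi>. sjs I \<Phi> \<and> (\<lambda>i x. D i x b) = (\<lambda>i x. cnj (\<Phi> i x)))"
    unfolding \<Xi>
    by (intro exI[of _ "\<lambda>i x h. cnj (frechet_derivative (\<Phi> i) (at x) h)"] conjI ballI allI
        has_derivative_cnj sjs_has_derivative[OF \<Phi>])
      (assumption, rule exI[of _ "\<lambda>i x. frechet_derivative (\<Phi> i) (at x) _"], rule conjI[OF sjs_deriv[OF \<Phi>] refl])
next
  fix \<Xi> :: "'a \<Rightarrow> 'b \<Rightarrow> complex" and b :: 'b
  assume "b \<in> Basis" "\<exists>\<Phi>. sjs I \<Phi> \<and> \<Xi> = (\<lambda>i x. cnj (\<Phi> i x))"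
  then obtain \<Phi> where "sjs I \<Phi>" "\<Xi> = (\<lambda>i x. cnj (\<Phi> i x))" by blast
  then show "\<exists>\<Phi>. sjs I \<Phi> \<and> (\<lambda>i x. of_real (x \<bullet> b) * \<Xi> i x) = (\<lambda>i x. cnj (\<Phi> i x))"
    using sjs_coord[of I \<Phi> b] \<open>b \<in> Basis\<close>
    by (intro exI[of _ "\<lambda>i x. of_real (x \<bullet> b) * \<Phi> i x"]) simp
qed

section \<open>Single Schwartz functions as one-element families\<close>

lemma bounded_range_norm_iff: "bounded (range f) \<longleftrightarrow> (\<exists>C. \<forall>x. norm (f x) \<le> C)"
  by (auto simp: bounded_iff)

lemma ssb_unit: "ssb {()} (\<lambda>_. f) \<longleftrightarrow> bounded (range f)"
proof
  assume "ssb {()} (\<lambda>_. f)"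
  then obtain B where "\<And>x. (cmod (f x))\<^sup>2 \<le> B ()" unfolding ssb_def by auto
  then have "cmod (f x) \<le> sqrt (B ())" for x by (simp add: real_le_rsqrt)
  then show "bounded (range f)" unfolding bounded_range_norm_iff by blast
next
  assume "bounded (range f)"
  then obtain C where "\<And>x. cmod (f x) \<le> C" unfolding bounded_range_norm_iff by blast
  then have "(cmod (f x))\<^sup>2 \<le> C\<^sup>2" for x by (simp add: power_mono)
  then show "ssb {()} (\<lambda>_. f)" unfolding ssb_def by (intro exI[of _ "\<lambda>_. C\<^sup>2"]) auto
qed

lemma schwartz_iff_sjs: "schwartz f \<longleftrightarrow> sjs {()} (\<lambda>_. f)"
  unfolding schwartz_def sjs_def by (auto simp: ssb_unit)

lemma schwartz_coinduct:
  assumes "P f"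
    and bd: "\<And>f. P f \<Longrightarrow> \<exists>C. \<forall>x. cmod (f x) \<le> C"
    and der: "\<And>f. P f \<Longrightarrow> \<exists>D. (\<forall>x. (f has_derivative D x) (at x)) \<and> (\<forall>b\<in>Basis. P (\<lambda>x. D x b))"
    and mult: "\<And>f b. P f \<Longrightarrow> b \<in> Basis \<Longrightarrow> P (\<lambda>x. of_real (x \<bullet> b) * f x)"
  shows "schwartz f"
  unfolding schwartz_iff_sjs
proof (rule sjs_coinduct[where P = "\<lambda>\<Phi>. P (\<Phi> ())"])
  fix \<Phi> :: "unit \<Rightarrow> 'a \<Rightarrow> complex" assume P: "P (\<Phi> ())"
  have "ssb {()} (\<lambda>_. \<Phi> ())" using bd[OF P] unfolding ssb_unit bounded_range_norm_iff .
  then show "ssb {()} \<Phi>" unfolding ssb_def by simp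
  obtain D where "\<forall>x. (\<Phi> () has_derivative D x) (at x)" "\<forall>b\<in>Basis. P (\<lambda>x. D x b)"
    using der[OF P] by blast
  then show "\<exists>D. (\<forall>i\<in>{()}. \<forall>x. (\<Phi> i has_derivative D i x) (at x)) \<and> (\<forall>b\<in>Basis. P (\<lambda>x. D () x b))"
    by (intro exI[of _ "\<lambda>_. D"]) auto
qed (use assms in auto)

lemma sjs_imp_schwartz:
  assumes "sjs I \<Phi>" "i \<in> I" shows "schwartz (\<Phi> i)"
proof -
  have bd: "bounded (range (F i))" if "ssb I F" for F :: "'a \<Rightarrow> 'b \<Rightarrow> complex"
  proof -
    from that obtain B where "\<And>x. (cmod (F i x))\<^sup>2 \<le> B i" using assms(2) unfolding ssb_def by blast
    then have "cmod (F i x) \<le> sqrt (B i)" for x by (simp add: real_le_rsqrt)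
    then show ?thesis unfolding bounded_range_norm_iff by blast
  qed
  have "smooth_fun (\<Phi> i)"
    using assms unfolding sjs_def by blast
  moreover have "bounded (range (\<lambda>x. of_real (monom a x) * dpart bs (\<Phi> i) x))" if "set bs \<subseteq> Basis" for a bs
  proof -
    have "ssb I (\<lambda>i x. of_real (monom a x) * dpart bs (\<Phi> i) x)"
      using assms that unfolding sjs_def by blast
    from bd[OF this] show ?thesis .
  qed
  ultimately show ?thesis unfolding schwartz_def by simp
qed

text \<open>For finitely many indices any bounds, one for each member, are summable; this is the
  source of the addendum on finite spectral decompositions.\<close>

lemma finite_sjs_iff:
  assumes "finite I" shows "sjs I \<Phi> \<longleftrightarrow> (\<forall>i\<in>I. schwartz (\<Phi> i))"
proof
  assume S: "\<forall>i\<in>I. schwartz (\<Phi> i)"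
  have "ssb I F" if bd: "\<And>i. i \<in> I \<Longrightarrow> bounded (range (F i))" for F :: "'a \<Rightarrow> 'b \<Rightarrow> complex"
  proof -
    have "\<exists>C. \<forall>x. cmod (F i x) \<le> C" if "i \<in> I" for i
      using bd[OF that] unfolding bounded_range_norm_iff .
    then obtain C where "\<And>i x. i \<in> I \<Longrightarrow> cmod (F i x) \<le> C i" by (metis bd[unfolded bounded_range_norm_iff])
    then have "(cmod (F i x))\<^sup>2 \<le> (C i)\<^sup>2" if "i \<in> I" for i x using that by (simp add: power_mono)
    then show ?thesis unfolding ssb_def using assms by (intro exI[of _ "\<lambda>i. (C i)\<^sup>2"]) auto
  qed
  with S show "sjs I \<Phi>" unfolding sjs_def schwartz_def by simp
qed (auto intro: sjs_imp_schwartz)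

lemma schwartz_add: "schwartz f \<Longrightarrow> schwartz g \<Longrightarrow> schwartz (\<lambda>x. f x + g x)"
  and schwartz_cmult: "schwartz f \<Longrightarrow> schwartz (\<lambda>x. c * f x)"
  and schwartz_coord: "schwartz f \<Longrightarrow> b \<in> Basis \<Longrightarrow> schwartz (\<lambda>x. of_real (x \<bullet> b) * f x)"
  and schwartz_deriv: "schwartz f \<Longrightarrow> b \<in> Basis \<Longrightarrow> schwartz (\<lambda>x. frechet_derivative f (at x) b)"
  and schwartz_cnj: "schwartz f \<Longrightarrow> schwartz (\<lambda>x. cnj (f x))"
  and schwartz_has_derivative: "schwartz f \<Longrightarrow> (f has_derivative frechet_derivative f (at x)) (at x)"
  unfolding schwartz_iff_sjs
  using sjs_add[of _ "\<lambda>_. f" "\<lambda>_. g"] sjs_cmult[of _ "\<lambda>_. f"] sjs_coord[of _ "\<lambda>_. f"] sjs_deriv[of _ "\<lambda>_. f"]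
    sjs_cnj[of _ "\<lambda>_. f"] sjs_has_derivative[of "{()}" "\<lambda>_. f"]
  by auto

lemma schwartz_affine:
  assumes "schwartz f" "linear L" "linear S" "\<And>x. S (L x) = x"
  shows "schwartz (\<lambda>x. f (t + L x))"
  using sjs_affine[of _ "\<lambda>_. f", OF _ assms(2-4)] assms(1) unfolding schwartz_iff_sjs by auto

lemma schwartz_linear:
  assumes "schwartz f" "linear L" "linear S" "\<And>x. S (L x) = x"
  shows "schwartz (\<lambda>x. f (L x))"
  using schwartz_affine[OF assms, of 0] by simp

lemma schwartz_imp_rapid_decay: "schwartz f \<Longrightarrow> rapid_decay f"
  unfolding schwartz_def rapid_decay_def by (auto dest!: spec[of _ "[]"])

section \<open>Kernels of families of Schwartz functions\<close>

lemma has_derivative_directional_sequence: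
  fixes f :: "'a::real_normed_vector \<Rightarrow> 'b::real_normed_vector"
  assumes f: "(f has_derivative f') (at x)" and r: "r > 0"
  shows "(\<lambda>n. (f (x + (r / Suc n) *\<^sub>R h) - f x) /\<^sub>R (r / Suc n)) \<longlonglongrightarrow> f' h"
proof -
  have "((\<lambda>s. x + s *\<^sub>R h) has_derivative (\<lambda>s. s *\<^sub>R h)) (at (0::real))"
    by (auto intro!: derivative_eq_intros)
  moreover have "(f has_derivative f') (at (x + 0 *\<^sub>R h))" using f by simp
  ultimately have "((\<lambda>s. f (x + s *\<^sub>R h)) has_derivative (\<lambda>s. f' (s *\<^sub>R h))) (at (0::real))"
    by (rule has_derivative_compose)
  moreover have "f' (s *\<^sub>R h) = s *\<^sub>R f' h" for s
    using f has_derivative_linear linear_cmul by blast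
  ultimately have "((\<lambda>s. f (x + s *\<^sub>R h)) has_vector_derivative f' h) (at (0::real))"
    unfolding has_vector_derivative_def by simp
  then have lim: "((\<lambda>s. (f (x + s *\<^sub>R h) - f x) /\<^sub>R s) \<longlongrightarrow> f' h) (at (0::real))"
  proof -
    let ?g = "\<lambda>s. f (x + s *\<^sub>R h)"
    have "((\<lambda>s. ((?g s - ?g 0) - (s - 0) *\<^sub>R f' h) /\<^sub>R norm (s - 0)) \<longlongrightarrow> 0) (at 0)"
      using \<open>(?g has_vector_derivative f' h) (at 0)\<close>
      unfolding has_vector_derivative_def has_derivative_def by simp
    from tendsto_norm_zero[OF this]
    have "((\<lambda>s. norm ((?g s - ?g 0) /\<^sub>R s - f' h)) \<longlongrightarrow> 0) (at 0)"
    proof (rule Lim_transform_eventually)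
      have "norm (((?g s - ?g 0) - (s - 0) *\<^sub>R f' h) /\<^sub>R norm (s - 0)) = norm ((?g s - ?g 0) /\<^sub>R s - f' h)"
        if "s \<noteq> 0" for s
      proof -
        have "(?g s - ?g 0) /\<^sub>R s - f' h = ((?g s - ?g 0) - s *\<^sub>R f' h) /\<^sub>R s"
          using that by (simp add: scaleR_diff_right)
        then show ?thesis by simp
      qed
      then show "eventually (\<lambda>s. norm (((?g s - ?g 0) - (s - 0) *\<^sub>R f' h) /\<^sub>R norm (s - 0)) =
          norm ((?g s - ?g 0) /\<^sub>R s - f' h)) (at 0)"
        unfolding eventually_at by (intro exI[of _ 1]) auto
    qed
    then have "((\<lambda>s. (?g s - ?g 0) /\<^sub>R s - f' h) \<longlongrightarrow> 0) (at 0)" by (rule tendsto_norm_zero_cancel)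
    then show ?thesis by (simp add: LIM_zero_iff)
  qed
  have "(\<lambda>n. r / Suc n) \<longlonglongrightarrow> 0"
    by (rule LIMSEQ_Suc[OF lim_const_over_n])
  then have "filterlim (\<lambda>n. r / Suc n) (at 0) sequentially"
    using r by (auto simp: filterlim_at)
  from filterlim_compose[OF lim this] show ?thesis .
qed

text \<open>If f is not integrable its integral is 0 by convention and the estimate persists, as the
  majorant is nonnegative almost everywhere. Many estimates below therefore run without a
  measurability check.\<close>

lemma norm_integral_le_AE:
  fixes f :: "'t \<Rightarrow> complex"
  assumes g: "integrable M g" and le: "AE x in M. cmod (f x) \<le> g x"
  shows "cmod (\<integral>x. f x \<partial>M) \<le> (\<integral>x. g x \<partial>M)"
proof (cases "integrable M f")
  case True
  have "cmod (\<integral>x. f x \<partial>M) \<le> (\<integral>x. cmod (f x) \<partial>M)" by (rule integral_norm_bound)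
  also have "\<dots> \<le> (\<integral>x. g x \<partial>M)"
    using True by (intro integral_mono_AE g le) auto
  finally show ?thesis .
next
  case False
  have "AE x in M. 0 \<le> g x"
    using le by eventually_elim (rule order_trans[OF norm_ge_zero])
  with False show ?thesis by (simp add: not_integrable_integral_eq integral_nonneg_AE)
qed

lemma norm_integral_le:
  fixes f :: "'t \<Rightarrow> complex"
  assumes "integrable M g" "\<And>x. x \<in> space M \<Longrightarrow> cmod (f x) \<le> g x"
  shows "cmod (\<integral>x. f x \<partial>M) \<le> (\<integral>x. g x \<partial>M)"
  using assms by (intro norm_integral_le_AE AE_I2)

text \<open>Dominated convergence along sequences: on the convex set S the mean value inequality
  makes \<open>E t\<close> Lipschitz with constant \<open>B t\<close>, so the normalised remainder
  is at most \<open>2 * B t\<close>. The measure is arbitrary; with the counting measure this is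
  termwise differentiation of series.\<close>

lemma has_derivative_integral:
  fixes E :: "'t \<Rightarrow> 'a::euclidean_space \<Rightarrow> complex"
  assumes S: "open S" "convex S" "x0 \<in> S"
    and int: "\<And>x. x \<in> S \<Longrightarrow> integrable M (\<lambda>t. E t x)"
    and der: "\<And>t x. t \<in> space M \<Longrightarrow> x \<in> S \<Longrightarrow> (E t has_derivative E' t x) (at x)"
    and bd: "\<And>t x h. t \<in> space M \<Longrightarrow> x \<in> S \<Longrightarrow> norm (E' t x h) \<le> B t * norm h"
    and B: "integrable M B"
  shows "((\<lambda>x. \<integral>t. E t x \<partial>M) has_derivative (\<lambda>h. \<integral>t. E' t x0 h \<partial>M)) (at x0)"
    and "integrable M (\<lambda>t. E' t x0 h)"
proof -
  obtain e where e: "e > 0" "ball x0 e \<subseteq> S" using S(1,3) open_contains_ball by blast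
  \<comment> \<open>The derivative is a pointwise limit of difference quotients and hence measurable
    in t. The first step length \<open>r\<close> is short enough to keep all base points inside
    \<open>S\<close>.\<close>
  have meas: "(\<lambda>t. E' t x0 h) \<in> borel_measurable M" for h
  proof -
    define r where "r = e / (norm h + 1)"
    have r: "r > 0" using e(1) by (simp add: r_def add_nonneg_pos)
    have in_S: "x0 + (r / Suc n) *\<^sub>R h \<in> S" for n
    proof -
      have "norm ((r / Suc n) *\<^sub>R h) \<le> r * norm h"
      proof -
        have "r / Suc n \<le> r" using r by (simp add: divide_le_eq mult_le_cancel_left1)
        from mult_right_mono[OF this, of "norm h"] show ?thesis using r by simp
      qed
      also have "\<dots> < e"
      proof -
        have "0 < norm h + 1" by (simp add: add_nonneg_pos)
        moreover have "e * norm h < e * (norm h + 1)" using e(1) by (intro mult_strict_left_mono) auto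
        ultimately show ?thesis by (simp add: r_def pos_divide_less_eq)
      qed
      finally show ?thesis using e(2) by (auto simp: dist_norm)
    qed
    show ?thesis
    proof (rule borel_measurable_LIMSEQ_metric)
      show "(\<lambda>t. (E t (x0 + (r / Suc n) *\<^sub>R h) - E t x0) /\<^sub>R (r / Suc n)) \<in> borel_measurable M" for n
        using int[OF in_S] int[OF S(3)] by (intro borel_measurable_scaleR borel_measurable_diff) auto
      show "(\<lambda>n. (E t (x0 + (r / Suc n) *\<^sub>R h) - E t x0) /\<^sub>R (r / Suc n)) \<longlonglongrightarrow> E' t x0 h"
        if "t \<in> space M" for t
        by (rule has_derivative_directional_sequence[OF der[OF that S(3)] r])
    qed
  qed
  show int': "integrable M (\<lambda>t. E' t x0 h)" for h
  proof (rule Bochner_Integration.integrable_bound)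
    show "integrable M (\<lambda>t. B t * norm h)" using B by simp
    show "AE t in M. norm (E' t x0 h) \<le> norm (B t * norm h)"
    proof (rule AE_I2)
      fix t assume "t \<in> space M"
      then have "norm (E' t x0 h) \<le> B t * norm h" by (rule bd[OF _ S(3)])
      also have "\<dots> \<le> norm (B t * norm h)" unfolding real_norm_def by (rule abs_ge_self)
      finally show "norm (E' t x0 h) \<le> norm (B t * norm h)" .
    qed
  qed (rule meas)
  have lin: "linear (E' t x0)" if "t \<in> space M" for t
    using der[OF that S(3)] has_derivative_linear by blast
  have Lip: "norm (E t x - E t x0) \<le> B t * norm (x - x0)" if "t \<in> space M" "x \<in> S" for t x
    by (rule differentiable_bound[OF S(2) has_derivative_at_withinI[OF der[OF that(1)]] _ that(2) S(3)])
      (assumption, rule onorm_le, rule bd[OF that(1)])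
  show "((\<lambda>x. \<integral>t. E t x \<partial>M) has_derivative (\<lambda>h. \<integral>t. E' t x0 h \<partial>M)) (at x0)"
    unfolding has_derivative_at_within
  proof
    show "bounded_linear (\<lambda>h. \<integral>t. E' t x0 h \<partial>M)"
    proof (rule bounded_linear_intro)
      show "(\<integral>t. E' t x0 (h + k) \<partial>M) = (\<integral>t. E' t x0 h \<partial>M) + (\<integral>t. E' t x0 k \<partial>M)" for h k
        by (subst Bochner_Integration.integral_add[symmetric, OF int' int'])
          (auto intro!: Bochner_Integration.integral_cong simp: linear_add lin)
      show "(\<integral>t. E' t x0 (r *\<^sub>R h) \<partial>M) = r *\<^sub>R (\<integral>t. E' t x0 h \<partial>M)" for r h
        by (rule trans[OF Bochner_Integration.integral_cong[OF refl linear_cmul[OF lin]] integral_scaleR_right])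
      show "norm (\<integral>t. E' t x0 h \<partial>M) \<le> norm h * (\<integral>t. B t \<partial>M)" for h
      proof -
        have "norm (\<integral>t. E' t x0 h \<partial>M) \<le> (\<integral>t. B t * norm h \<partial>M)"
          by (rule norm_integral_le) (use B bd[OF _ S(3)] in auto)
        then show ?thesis by (simp add: mult.commute)
      qed
    qed
    show "((\<lambda>y. ((\<integral>t. E t y \<partial>M) - (\<integral>t. E t x0 \<partial>M) - (\<integral>t. E' t x0 (y - x0) \<partial>M)) /\<^sub>R norm (y - x0)) \<longlongrightarrow> 0) (at x0)"
      unfolding tendsto_at_iff_sequentially
    proof (intro allI impI)
      fix X :: "nat \<Rightarrow> 'a" assume X: "\<forall>i. X i \<in> UNIV - {x0}" "X \<longlonglongrightarrow> x0"
      obtain N where N: "\<And>n. n \<ge> N \<Longrightarrow> X n \<in> S"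
        using topological_tendstoD[OF X(2) S(1,3)] unfolding eventually_sequentially by blast
      let ?q = "\<lambda>n t. (E t (X n) - E t x0 - E' t x0 (X n - x0)) /\<^sub>R norm (X n - x0)"
      have "(\<lambda>n. \<integral>t. ?q (n + N) t \<partial>M) \<longlonglongrightarrow> (\<integral>t. 0 \<partial>M)"
      proof (rule integral_dominated_convergence[where w = "\<lambda>t. 2 * B t"])
        show "integrable M (\<lambda>t. 2 * B t)" using B by simp
        show "?q (n + N) \<in> borel_measurable M" for n
          using int[OF N, of "n + N"] int[OF S(3)] meas by auto
        show "AE t in M. norm (?q (n + N) t) \<le> 2 * B t" for n
        proof (rule AE_I2)
          fix t assume t: "t \<in> space M"
          have pos: "norm (X (n + N) - x0) > 0" using X(1) by simp
          have "norm (E t (X (n + N)) - E t x0 - E' t x0 (X (n + N) - x0)) \<le>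
            B t * norm (X (n + N) - x0) + B t * norm (X (n + N) - x0)"
            by (rule order_trans[OF norm_triangle_ineq4]) (intro add_mono Lip bd t N S(3), simp)
          then have "norm (E t (X (n + N)) - E t x0 - E' t x0 (X (n + N) - x0)) / norm (X (n + N) - x0) \<le> 2 * B t"
            by (subst pos_divide_le_eq[OF pos]) simp
          then show "norm (?q (n + N) t) \<le> 2 * B t"
            by (simp only: norm_scaleR abs_inverse abs_norm_cancel divide_inverse mult.commute)
        qed
        show "AE t in M. (\<lambda>n. ?q (n + N) t) \<longlonglongrightarrow> 0"
        proof (rule AE_I2)
          fix t assume t: "t \<in> space M"
          have "((\<lambda>y. (E t y - E t x0 - E' t x0 (y - x0)) /\<^sub>R norm (y - x0)) \<longlongrightarrow> 0) (at x0)"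
            using der[OF t S(3)] unfolding has_derivative_def by simp
          then have "(\<lambda>n. ?q n t) \<longlonglongrightarrow> 0"
            using X unfolding tendsto_at_iff_sequentially comp_def by blast
          then show "(\<lambda>n. ?q (n + N) t) \<longlonglongrightarrow> 0" by (rule LIMSEQ_ignore_initial_segment)
        qed
      qed simp
      moreover have "(\<integral>t. ?q (n + N) t \<partial>M) =
        ((\<integral>t. E t (X (n + N)) \<partial>M) - (\<integral>t. E t x0 \<partial>M) - (\<integral>t. E' t x0 (X (n + N) - x0) \<partial>M)) /\<^sub>R norm (X (n + N) - x0)" for n
        using int[OF N, of "n + N"] int[OF S(3)] int' by simp
      ultimately have "(\<lambda>n. ((\<integral>t. E t (X (n + N)) \<partial>M) - (\<integral>t. E t x0 \<partial>M) - (\<integral>t. E' t x0 (X (n + N) - x0) \<partial>M)) /\<^sub>R norm (X (n + N) - x0)) \<longlonglongrightarrow> 0"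
        by (simp only: Bochner_Integration.integral_zero)
      then show "((\<lambda>y. ((\<integral>t. E t y \<partial>M) - (\<integral>t. E t x0 \<partial>M) - (\<integral>t. E' t x0 (y - x0) \<partial>M)) /\<^sub>R norm (y - x0)) \<circ> X) \<longlonglongrightarrow> 0"
        unfolding comp_def by (rule LIMSEQ_offset)
    qed
  qed
qed

lemma linear_eq_sum_Basis:
  fixes f :: "'a::euclidean_space \<Rightarrow> complex"
  assumes "linear f" shows "f h = (\<Sum>b\<in>Basis. of_real (h \<bullet> b) * f b)"
proof -
  have "f (\<Sum>b\<in>Basis. (h \<bullet> b) *\<^sub>R b) = (\<Sum>b\<in>Basis. (h \<bullet> b) *\<^sub>R f b)"
    by (simp add: linear_sum[OF assms] linear_cmul[OF assms])
  then show ?thesis by (simp add: euclidean_representation scaleR_conv_of_real)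
qed

lemma norm_linear_le_sum_Basis:
  fixes f :: "'a::euclidean_space \<Rightarrow> complex"
  assumes "linear f" shows "cmod (f h) \<le> norm h * (\<Sum>b\<in>Basis. cmod (f b))"
proof -
  have "cmod (f h) \<le> (\<Sum>b\<in>Basis. \<bar>h \<bullet> b\<bar> * cmod (f b))"
    unfolding linear_eq_sum_Basis[OF assms, of h] by (rule sum_norm_le) (simp add: norm_mult)
  also have "\<dots> \<le> (\<Sum>b\<in>Basis. norm h * cmod (f b))"
    by (intro sum_mono mult_right_mono Basis_le_norm) auto
  finally show ?thesis by (simp add: sum_distrib_left)
qed

lemma sjs_frechet_linear:
  "sjs I \<Phi> \<Longrightarrow> i \<in> I \<Longrightarrow> linear (frechet_derivative (\<Phi> i) (at x))"
  by (rule has_derivative_linear[OF sjs_has_derivative])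

lemma schwartz_frechet_linear: "schwartz f \<Longrightarrow> linear (frechet_derivative f (at x))"
  by (rule has_derivative_linear[OF schwartz_has_derivative])

section \<open>Summation over the index set\<close>

lemma ssb_root:
  assumes "ssb I \<Phi>"
  shows "\<exists>\<beta>. (\<lambda>i. (\<beta> i)\<^sup>2) summable_on I \<and> (\<forall>i\<in>I. \<forall>x. cmod (\<Phi> i x) \<le> \<beta> i)"
proof -
  obtain B where B: "B summable_on I" "\<And>i x. i \<in> I \<Longrightarrow> (cmod (\<Phi> i x))\<^sup>2 \<le> B i"
    using assms unfolding ssb_def by blast
  have nn: "0 \<le> B i" if "i \<in> I" for i using B(2)[OF that] by (rule order_trans[OF zero_le_power2])
  have "(\<lambda>i. (sqrt (B i))\<^sup>2) summable_on I"
    using B(1) by (rule summable_on_cong[THEN iffD1, rotated]) (simp add: nn)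
  moreover have "cmod (\<Phi> i x) \<le> sqrt (B i)" if "i \<in> I" for i x
    using B(2)[OF that] by (intro real_le_rsqrt)
  ultimately show ?thesis by (intro exI[of _ "\<lambda>i. sqrt (B i)"]) auto
qed

lemma summable_on_mult_squares:
  fixes \<beta> \<gamma> :: "'i \<Rightarrow> real"
  assumes "(\<lambda>i. (\<beta> i)\<^sup>2) summable_on I" "(\<lambda>i. (\<gamma> i)\<^sup>2) summable_on I"
  shows "(\<lambda>i. \<bar>\<beta> i\<bar> * \<bar>\<gamma> i\<bar>) summable_on I"
proof (rule summable_on_comparison_test)
  show "(\<lambda>i. (\<beta> i)\<^sup>2 + (\<gamma> i)\<^sup>2) summable_on I" using assms by (rule summable_on_add)
  show "\<bar>\<beta> i\<bar> * \<bar>\<gamma> i\<bar> \<le> (\<beta> i)\<^sup>2 + (\<gamma> i)\<^sup>2" for i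
  proof -
    have "2 * (\<bar>\<beta> i\<bar> * \<bar>\<gamma> i\<bar>) \<le> (\<beta> i)\<^sup>2 + (\<gamma> i)\<^sup>2"
      using sum_squares_bound[of "\<bar>\<beta> i\<bar>" "\<bar>\<gamma> i\<bar>"] by (simp add: mult.assoc)
    moreover have "0 \<le> \<bar>\<beta> i\<bar> * \<bar>\<gamma> i\<bar>" by simp
    ultimately show ?thesis by linarith
  qed
qed auto

lemma summable_on_finite_sum:
  fixes f :: "'a \<Rightarrow> 'i \<Rightarrow> real"
  assumes "finite A" "\<And>a. a \<in> A \<Longrightarrow> f a summable_on I"
  shows "(\<lambda>i. \<Sum>a\<in>A. f a i) summable_on I"
  using assms by (induction A rule: finite_induct) (auto intro: summable_on_add)

text \<open>Through this identification the theorems on parameter integrals apply to unordered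
  sums.\<close>

lemma infsum_eq_integral:
  fixes f :: "'i \<Rightarrow> complex"
  assumes "B summable_on I" "\<And>i. i \<in> I \<Longrightarrow> cmod (f i) \<le> B i"
  shows "integrable (count_space I) f" "(\<Sum>\<^sub>\<infinity>i\<in>I. f i) = (\<integral>i. f i \<partial>count_space I)"
    "(\<lambda>i. cmod (f i)) summable_on I"
proof -
  show s: "(\<lambda>i. cmod (f i)) summable_on I"
    by (rule summable_on_comparison_test[OF assms(1)]) (use assms(2) in auto)
  then have a: "Infinite_Set_Sum.abs_summable_on f I" unfolding abs_summable_equivalent .
  then show "integrable (count_space I) f" unfolding abs_summable_on_def .
  show "(\<Sum>\<^sub>\<infinity>i\<in>I. f i) = (\<integral>i. f i \<partial>count_space I)"
    using infsetsum_infsum[OF a] unfolding infsetsum_def by simp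
qed

lemma integrable_count_space_iff:
  fixes f :: "'i \<Rightarrow> real"
  shows "integrable (count_space I) f \<longleftrightarrow> f summable_on I"
  using abs_summable_equivalent[of f I, unfolded abs_summable_on_def]
    summable_on_iff_abs_summable_on_real[of f I] by blast

text \<open>The two factors are evaluated at independent points, so a majorant summable over i has
  to bound each of them by its supremum. This is why \<open>ssb\<close> takes the supremum before
  the sum.\<close>

lemma ssb_kernel_bounds:
  assumes "ssb I \<Phi>" "ssb I \<Psi>"
  shows "\<exists>B. B summable_on I \<and> (\<forall>i\<in>I. \<forall>x y. cmod (\<Phi> i x) * cmod (\<Psi> i y) \<le> B i)"
proof -
  obtain \<beta> where \<beta>: "(\<lambda>i. (\<beta> i)\<^sup>2) summable_on I" "\<forall>i\<in>I. \<forall>x. cmod (\<Phi> i x) \<le> \<beta> i"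
    using ssb_root[OF assms(1)] by (elim exE conjE) (rule that)
  obtain \<gamma> where \<gamma>: "(\<lambda>i. (\<gamma> i)\<^sup>2) summable_on I" "\<forall>i\<in>I. \<forall>x. cmod (\<Psi> i x) \<le> \<gamma> i"
    using ssb_root[OF assms(2)] by (elim exE conjE) (rule that)
  have "cmod (\<Phi> i x) * cmod (\<Psi> i y) \<le> \<bar>\<beta> i\<bar> * \<bar>\<gamma> i\<bar>" if "i \<in> I" for i x y
    using \<beta>(2)[rule_format, OF that, of x] \<gamma>(2)[rule_format, OF that, of y] by (intro mult_mono) auto
  with summable_on_mult_squares[OF \<beta>(1) \<gamma>(1)] show ?thesis
    by (intro exI[of _ "\<lambda>i. \<bar>\<beta> i\<bar> * \<bar>\<gamma> i\<bar>"]) auto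
qed

text \<open>The invariant class consists of all such kernels. A basis vector of the product space
  lies in one of the factors, so a partial derivative or a coordinate acts on only one of the two
  families and stays in the class.\<close>

lemma schwartz_sum_kernel:
  fixes \<Phi> :: "'i \<Rightarrow> 'a::euclidean_space \<Rightarrow> complex" and \<Psi> :: "'i \<Rightarrow> 'b::euclidean_space \<Rightarrow> complex"
  assumes "sjs I \<Phi>" "sjs I \<Psi>"
  shows "schwartz (\<lambda>z. \<Sum>\<^sub>\<infinity>i\<in>I. \<Phi> i (fst z) * \<Psi> i (snd z))"
proof (rule schwartz_coinduct[where P = "\<lambda>u. \<exists>\<Phi> \<Psi>. sjs I \<Phi> \<and> sjs I \<Psi> \<and>
    u = (\<lambda>z. \<Sum>\<^sub>\<infinity>i\<in>I. \<Phi> i (fst z) * \<Psi> i (snd z))"], goal_cases)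
  case 1
  show ?case by (intro exI[of _ \<Phi>] exI[of _ \<Psi>] conjI assms refl)
next
  case (2 u)
  then obtain \<Phi> \<Psi> where \<Phi>: "sjs I \<Phi>" and \<Psi>: "sjs I \<Psi>"
    and u: "u = (\<lambda>z. \<Sum>\<^sub>\<infinity>i\<in>I. \<Phi> i (fst z) * \<Psi> i (snd z))" by blast
  obtain B where B: "B summable_on I" "\<And>i x y. i \<in> I \<Longrightarrow> cmod (\<Phi> i x) * cmod (\<Psi> i y) \<le> B i"
    using ssb_kernel_bounds[OF sjs_ssb[OF \<Phi>] sjs_ssb[OF \<Psi>]] by blast
  have "cmod (u z) \<le> (\<integral>i. B i \<partial>count_space I)" for z
  proof -
    have *: "cmod (\<Phi> i (fst z) * \<Psi> i (snd z)) \<le> B i" if "i \<in> I" for i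
      using B(2)[OF that] by (simp add: norm_mult)
    have "u z = (\<integral>i. \<Phi> i (fst z) * \<Psi> i (snd z) \<partial>count_space I)"
      unfolding u by (rule infsum_eq_integral(2)[OF B(1)]) (rule *)
    then show ?thesis
      by (simp only:) (rule norm_integral_le, use B(1) * in \<open>auto simp: integrable_count_space_iff\<close>)
  qed
  then show ?case by blast
next
  case (3 u)
  then obtain \<Phi> \<Psi> where \<Phi>: "sjs I \<Phi>" and \<Psi>: "sjs I \<Psi>"
    and u: "u = (\<lambda>z. \<Sum>\<^sub>\<infinity>i\<in>I. \<Phi> i (fst z) * \<Psi> i (snd z))" by blast
  define D\<Phi> where "D\<Phi> i x = frechet_derivative (\<Phi> i) (at x)" for i x
  define D\<Psi> where "D\<Psi> i x = frechet_derivative (\<Psi> i) (at x)" for i x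
  have sD\<Phi>: "sjs I (\<lambda>i x. D\<Phi> i x b)" if "b \<in> Basis" for b
    unfolding D\<Phi>_def by (rule sjs_deriv[OF \<Phi> that])
  have sD\<Psi>: "sjs I (\<lambda>i x. D\<Psi> i x b)" if "b \<in> Basis" for b
    unfolding D\<Psi>_def by (rule sjs_deriv[OF \<Psi> that])
  define E where "E i z = \<Phi> i (fst z) * \<Psi> i (snd z)" for i z
  define E' where "E' i z h = D\<Phi> i (fst z) (fst h) * \<Psi> i (snd z) + \<Phi> i (fst z) * D\<Psi> i (snd z) (snd h)" for i z h
  have "\<forall>b\<in>Basis. \<exists>B. B summable_on I \<and> (\<forall>i\<in>I. \<forall>x y. cmod (D\<Phi> i x b) * cmod (\<Psi> i y) \<le> B i)"
    using ssb_kernel_bounds[OF sjs_ssb[OF sD\<Phi>] sjs_ssb[OF \<Psi>]] by blast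
  then obtain B1 where B1: "\<And>b. b \<in> Basis \<Longrightarrow> B1 b summable_on I"
    "\<And>b i x y. b \<in> Basis \<Longrightarrow> i \<in> I \<Longrightarrow> cmod (D\<Phi> i x b) * cmod (\<Psi> i y) \<le> B1 b i" by metis
  have "\<forall>b\<in>Basis. \<exists>B. B summable_on I \<and> (\<forall>i\<in>I. \<forall>x y. cmod (\<Phi> i x) * cmod (D\<Psi> i y b) \<le> B i)"
    using ssb_kernel_bounds[OF sjs_ssb[OF \<Phi>] sjs_ssb[OF sD\<Psi>]] by blast
  then obtain B2 where B2: "\<And>b. b \<in> Basis \<Longrightarrow> B2 b summable_on I"
    "\<And>b i x y. b \<in> Basis \<Longrightarrow> i \<in> I \<Longrightarrow> cmod (\<Phi> i x) * cmod (D\<Psi> i y b) \<le> B2 b i" by metis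
  define B where "B i = (\<Sum>b\<in>Basis. B1 b i) + (\<Sum>b\<in>Basis. B2 b i)" for i
  obtain B0 where B0: "B0 summable_on I" "\<And>i x y. i \<in> I \<Longrightarrow> cmod (\<Phi> i x) * cmod (\<Psi> i y) \<le> B0 i"
    using ssb_kernel_bounds[OF sjs_ssb[OF \<Phi>] sjs_ssb[OF \<Psi>]] by blast
  have E0: "cmod (E i z) \<le> B0 i" if "i \<in> I" for i z
    using B0(2)[OF that] by (simp add: E_def norm_mult)
  have ueq: "u = (\<lambda>z. \<integral>i. E i z \<partial>count_space I)"
    unfolding u E_def[symmetric] using infsum_eq_integral(2)[OF B0(1) E0] by simp
  have bd: "cmod (E' i z h) \<le> B i * norm h" if "i \<in> I" for i z h
  proof -
    have "cmod (D\<Phi> i (fst z) (fst h)) * cmod (\<Psi> i (snd z)) \<le>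
       (norm (fst h) * (\<Sum>b\<in>Basis. cmod (D\<Phi> i (fst z) b))) * cmod (\<Psi> i (snd z))"
      unfolding D\<Phi>_def by (intro mult_right_mono norm_linear_le_sum_Basis sjs_frechet_linear[OF \<Phi> that]) auto
    also have "\<dots> = norm (fst h) * (\<Sum>b\<in>Basis. cmod (D\<Phi> i (fst z) b) * cmod (\<Psi> i (snd z)))"
      by (simp add: sum_distrib_right mult.assoc)
    also have "\<dots> \<le> norm h * (\<Sum>b\<in>Basis. B1 b i)"
      by (intro mult_mono sum_mono B1 that sum_nonneg) (auto intro: norm_fst_le[of "fst h" "snd h", simplified])
    finally have 1: "cmod (D\<Phi> i (fst z) (fst h)) * cmod (\<Psi> i (snd z)) \<le> norm h * (\<Sum>b\<in>Basis. B1 b i)" .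
    have "cmod (\<Phi> i (fst z)) * cmod (D\<Psi> i (snd z) (snd h)) \<le>
       cmod (\<Phi> i (fst z)) * (norm (snd h) * (\<Sum>b\<in>Basis. cmod (D\<Psi> i (snd z) b)))"
      unfolding D\<Psi>_def by (intro mult_left_mono norm_linear_le_sum_Basis sjs_frechet_linear[OF \<Psi> that]) auto
    also have "\<dots> = norm (snd h) * (\<Sum>b\<in>Basis. cmod (\<Phi> i (fst z)) * cmod (D\<Psi> i (snd z) b))"
      by (simp add: sum_distrib_left mult.left_commute)
    also have "\<dots> \<le> norm h * (\<Sum>b\<in>Basis. B2 b i)"
      by (intro mult_mono sum_mono B2 that sum_nonneg) (auto intro: norm_snd_le[of "snd h" "fst h", simplified])
    finally have 2: "cmod (\<Phi> i (fst z)) * cmod (D\<Psi> i (snd z) (snd h)) \<le> norm h * (\<Sum>b\<in>Basis. B2 b i)" .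
    have "cmod (E' i z h) \<le> cmod (D\<Phi> i (fst z) (fst h)) * cmod (\<Psi> i (snd z)) + cmod (\<Phi> i (fst z)) * cmod (D\<Psi> i (snd z) (snd h))"
      unfolding E'_def norm_mult[symmetric] by (rule norm_triangle_ineq)
    also have "\<dots> \<le> norm h * (\<Sum>b\<in>Basis. B1 b i) + norm h * (\<Sum>b\<in>Basis. B2 b i)"
      using 1 2 by (rule add_mono)
    finally show ?thesis by (simp add: B_def distrib_left mult.commute)
  qed
  have Bsum: "B summable_on I"
    unfolding B_def using B1(1) B2(1) by (intro summable_on_add summable_on_finite_sum) auto
  have derE: "(E i has_derivative E' i z) (at z)" if "i \<in> I" for i z
  proof -
    have "((\<lambda>z. \<Phi> i (fst z)) has_derivative (\<lambda>h. D\<Phi> i (fst z) (fst h))) (at z)"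
      unfolding D\<Phi>_def by (rule has_derivative_compose[OF has_derivative_fst[OF has_derivative_ident] sjs_has_derivative[OF \<Phi> that]])
    moreover have "((\<lambda>z. \<Psi> i (snd z)) has_derivative (\<lambda>h. D\<Psi> i (snd z) (snd h))) (at z)"
      unfolding D\<Psi>_def by (rule has_derivative_compose[OF has_derivative_snd[OF has_derivative_ident] sjs_has_derivative[OF \<Psi> that]])
    ultimately show ?thesis unfolding E_def[abs_def] E'_def[abs_def]
      by (auto intro!: derivative_eq_intros)
  qed
  have D: "(u has_derivative (\<lambda>h. \<integral>i. E' i z h \<partial>count_space I)) (at z)" for z
    unfolding ueq
  proof (rule has_derivative_integral(1)[where S = UNIV])
    show "integrable (count_space I) B" using Bsum by (simp add: integrable_count_space_iff)
    show "integrable (count_space I) (\<lambda>i. E i x)" for x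
      by (rule infsum_eq_integral(1)[OF B0(1) E0])
  qed (use bd derE in auto)
  \<comment> \<open>In the direction \<open>(b, 0)\<close> the summand with the derivative of \<Psi>
    vanishes by linearity, and the other one is again a kernel of two sjs families.\<close>
  have comp1: "(\<integral>i. E' i z (b, 0) \<partial>count_space I) = (\<Sum>\<^sub>\<infinity>i\<in>I. D\<Phi> i (fst z) b * \<Psi> i (snd z))"
    if b: "b \<in> Basis" for b z
  proof -
    have z: "D\<Psi> i (snd z) 0 = 0" if "i \<in> I" for i
      unfolding D\<Psi>_def by (rule linear_0[OF sjs_frechet_linear[OF \<Psi> that]])
    have *: "cmod (D\<Phi> i (fst z) b * \<Psi> i (snd z)) \<le> B1 b i" if "i \<in> I" for i
      using B1(2)[OF b that] by (simp add: norm_mult)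
    have "(\<Sum>\<^sub>\<infinity>i\<in>I. D\<Phi> i (fst z) b * \<Psi> i (snd z)) = (\<integral>i. D\<Phi> i (fst z) b * \<Psi> i (snd z) \<partial>count_space I)"
      by (rule infsum_eq_integral(2)[OF B1(1)[OF b]]) (rule *)
    then show ?thesis unfolding \<open>_ = (\<integral>i. D\<Phi> i (fst z) b * \<Psi> i (snd z) \<partial>count_space I)\<close>
      by (intro Bochner_Integration.integral_cong) (auto simp: E'_def z)
  qed
  have comp2: "(\<integral>i. E' i z (0, b) \<partial>count_space I) = (\<Sum>\<^sub>\<infinity>i\<in>I. \<Phi> i (fst z) * D\<Psi> i (snd z) b)"
    if b: "b \<in> Basis" for b z
  proof -
    have z: "D\<Phi> i (fst z) 0 = 0" if "i \<in> I" for i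
      unfolding D\<Phi>_def by (rule linear_0[OF sjs_frechet_linear[OF \<Phi> that]])
    have *: "cmod (\<Phi> i (fst z) * D\<Psi> i (snd z) b) \<le> B2 b i" if "i \<in> I" for i
      using B2(2)[OF b that] by (simp add: norm_mult)
    have "(\<Sum>\<^sub>\<infinity>i\<in>I. \<Phi> i (fst z) * D\<Psi> i (snd z) b) = (\<integral>i. \<Phi> i (fst z) * D\<Psi> i (snd z) b \<partial>count_space I)"
      by (rule infsum_eq_integral(2)[OF B2(1)[OF b]]) (rule *)
    then show ?thesis unfolding \<open>_ = (\<integral>i. \<Phi> i (fst z) * D\<Psi> i (snd z) b \<partial>count_space I)\<close>
      by (intro Bochner_Integration.integral_cong) (auto simp: E'_def z)
  qed
  show ?case
  proof (intro exI[of _ "\<lambda>z h. \<integral>i. E' i z h \<partial>count_space I"] conjI allI D ballI)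
    fix b :: "'a \<times> 'b" assume "b \<in> Basis"
    then consider b1 where "b1 \<in> Basis" "b = (b1, 0)" | b2 where "b2 \<in> Basis" "b = (0, b2)"
      unfolding Basis_prod_def by blast
    then show "\<exists>\<Phi>' \<Psi>'. sjs I \<Phi>' \<and> sjs I \<Psi>' \<and> (\<lambda>z. \<integral>i. E' i z b \<partial>count_space I) = (\<lambda>z. \<Sum>\<^sub>\<infinity>i\<in>I. \<Phi>' i (fst z) * \<Psi>' i (snd z))"
    proof cases
      case 1
      show ?thesis unfolding 1(2) comp1[OF 1(1)]
        by (intro exI[of _ "\<lambda>i x. D\<Phi> i x b1"] exI[of _ \<Psi>] conjI sD\<Phi> 1(1) \<Psi> refl)
    next
      case 2
      show ?thesis unfolding 2(2) comp2[OF 2(1)]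
        by (intro exI[of _ "\<lambda>i x. D\<Psi> i x b2"] exI[of _ \<Phi>] conjI sD\<Psi> 2(1) \<Phi> refl)
    qed
  qed
next
  case (4 u b)
  then obtain \<Phi> \<Psi> where \<Phi>: "sjs I \<Phi>" and \<Psi>: "sjs I \<Psi>"
    and u: "u = (\<lambda>z. \<Sum>\<^sub>\<infinity>i\<in>I. \<Phi> i (fst z) * \<Psi> i (snd z))" by blast
  from 4 consider b1 where "b1 \<in> Basis" "b = (b1, 0)" | b2 where "b2 \<in> Basis" "b = (0, b2)"
    unfolding Basis_prod_def by blast
  then show ?case
  proof cases
    case 1
    show ?thesis
      by (intro exI[of _ "\<lambda>i x. of_real (x \<bullet> b1) * \<Phi> i x"] exI[of _ \<Psi>] conjI sjs_coord 1(1) \<Phi> \<Psi>)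
        (simp add: fun_eq_iff u 1(2) infsum_cmult_right' inner_Pair_0 inner_prod_def mult.assoc)
  next
    case 2
    show ?thesis
      by (intro exI[of _ "\<lambda>i x. of_real (x \<bullet> b2) * \<Psi> i x"] exI[of _ \<Phi>] conjI sjs_coord 2(1) \<Phi> \<Psi>)
        (simp add: fun_eq_iff u 2(2) infsum_cmult_right'[symmetric] inner_prod_def mult.left_commute)
  qed
qed

lemma schwartz_tensor:
  assumes "schwartz f" "schwartz g"
  shows "schwartz (\<lambda>z. f (fst z) * g (snd z))"
  using schwartz_sum_kernel[of "{()}" "\<lambda>_. f" "\<lambda>_. g"] assms unfolding schwartz_iff_sjs by simp

text \<open>The pointwise product is the tensor product restricted to the diagonal, an injective
  linear substitution.\<close>

lemma schwartz_mult:
  assumes "schwartz f" "schwartz g" shows "schwartz (\<lambda>x. f x * g x)"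
  using schwartz_linear[OF schwartz_tensor[OF assms], of "\<lambda>x. (x, x)" fst]
  by (simp add: linear_iff)

lemma schwartz_slice:
  assumes "schwartz G" shows "schwartz (\<lambda>y. G (x, y))"
  using schwartz_affine[OF assms, of "\<lambda>y. (0, y)" snd "(x, 0)"] by (simp add: linear_iff)

lemma schwartz_translate:
  assumes "schwartz f" shows "schwartz (\<lambda>x. f (x - a))"
  using schwartz_affine[OF assms, of id id "- a"] by (simp add: linear_iff)

section \<open>Integration and Fourier transform of Schwartz functions\<close>

lemma schwartz_bound:
  assumes "schwartz f" shows "\<exists>C\<ge>0. \<forall>x. cmod (f x) \<le> C / wt x ^ N"
proof -
  obtain C where C: "\<And>x. wt x ^ N * cmod (f x) \<le> C"
    using rapid_decay_wt_bound[OF schwartz_imp_rapid_decay[OF assms]] by meson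
  have "cmod (f x) \<le> C / wt x ^ N" for x
    using C[of x] by (simp add: pos_le_divide_eq mult.commute)
  moreover have "0 \<le> C" using C[of 0] by (rule order_trans[rotated]) simp
  ultimately show ?thesis by blast
qed

lemma wt_le_mult: "wt y \<le> wt x * wt y"
  using mult_right_mono[OF wt_ge1[of x], of "wt y"] by simp

lemma schwartz_frechet_bound:
  assumes "schwartz (f::'a::euclidean_space \<Rightarrow> complex)"
  shows "\<exists>C\<ge>0. \<forall>x h. cmod (frechet_derivative f (at x) h) \<le> C / wt x ^ N * norm h"
proof -
  have "\<forall>b\<in>(Basis::'a set). \<exists>C\<ge>0. \<forall>x. cmod (frechet_derivative f (at x) b) \<le> C / wt x ^ N"
    using schwartz_bound[OF schwartz_deriv[OF assms]] by blast
  then obtain C where C: "\<And>b. b \<in> (Basis::'a set) \<Longrightarrow> C b \<ge> 0"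
    "\<And>b x. b \<in> (Basis::'a set) \<Longrightarrow> cmod (frechet_derivative f (at x) b) \<le> C b / wt x ^ N"
    by (metis (no_types, lifting))
  have "cmod (frechet_derivative f (at x) h) \<le> (\<Sum>b\<in>Basis. C b) / wt x ^ N * norm h" for x h
  proof -
    have "cmod (frechet_derivative f (at x) h) \<le> norm h * (\<Sum>b\<in>Basis. cmod (frechet_derivative f (at x) b))"
      by (rule norm_linear_le_sum_Basis[OF schwartz_frechet_linear[OF assms]])
    also have "\<dots> \<le> norm h * (\<Sum>b\<in>Basis. C b / wt x ^ N)"
      by (intro mult_left_mono sum_mono C) auto
    finally show ?thesis by (simp add: sum_divide_distrib mult.commute)
  qed
  moreover have "0 \<le> (\<Sum>b\<in>Basis. C b)" by (intro sum_nonneg C)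
  ultimately show ?thesis by blast
qed

lemma schwartz_continuous: "schwartz f \<Longrightarrow> continuous_on S f"
  by (intro continuous_at_imp_continuous_on ballI) (rule has_derivative_continuous[OF schwartz_has_derivative])

lemma schwartz_measurable: "schwartz f \<Longrightarrow> f \<in> borel_measurable borel"
  by (intro borel_measurable_continuous_onI schwartz_continuous)

lemma integrable_wt_bound:
  fixes f :: "'a::euclidean_space \<Rightarrow> complex"
  assumes "f \<in> borel_measurable borel" "\<And>x. cmod (f x) \<le> C / wt x"
  shows "integrable lborel f"
proof (rule Bochner_Integration.integrable_bound)
  show "integrable lborel (\<lambda>x::'a. C * (1 / wt x))"
    using integrable_inverse_wt by (rule integrable_mult_right)
  show "AE x in lborel. cmod (f x) \<le> norm (C * (1 / wt x))"
  proof (rule AE_I2)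
    fix x
    have "cmod (f x) \<le> C * (1 / wt x)" using assms(2)[of x] by simp
    also have "\<dots> \<le> norm (C * (1 / wt x))" unfolding real_norm_def by (rule abs_ge_self)
    finally show "cmod (f x) \<le> norm (C * (1 / wt x))" .
  qed
qed (use assms(1) in simp)

lemma schwartz_integrable: "schwartz f \<Longrightarrow> integrable lborel f"
  using schwartz_bound[of f 1] integrable_wt_bound[OF schwartz_measurable] by auto

lemma wt_ball_bound:
  assumes "norm (x::'a::euclidean_space) \<le> 1" shows "wt x \<le> 2 ^ DIM('a)"
proof -
  have "(x \<bullet> b)\<^sup>2 \<le> 1" if "b \<in> Basis" for b
    using Basis_le_norm[OF that, of x] assms by (simp add: abs_square_le_1)
  then have "wt x \<le> (\<Prod>b\<in>(Basis::'a set). 2)"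
    unfolding wt_def by (intro prod_mono) auto
  then show ?thesis by simp
qed

text \<open>Peetre's inequality for \<open>x = (x + z) + (- z)\<close>.\<close>

lemma inverse_wt_shift:
  "1 / wt (x + z) \<le> 2 ^ DIM('a) * wt z / wt (x::'a::euclidean_space)"
proof -
  have "wt x \<le> 2 ^ DIM('a) * wt (x + z) * wt z"
    using wt_add[of "x + z" "- z"] by simp
  then show ?thesis by (simp add: field_simps)
qed

lemma integral_translate:
  fixes f :: "'a::euclidean_space \<Rightarrow> complex"
  assumes "f \<in> borel_measurable borel"
  shows "(\<integral>x. f (x + z) \<partial>lborel) = (\<integral>x. f x \<partial>lborel)"
proof -
  have "(\<integral>x. f x \<partial>lborel) = (\<integral>x. f x \<partial>distr lborel borel ((+) z))"
    by (simp add: lborel_distr_plus)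
  also have "\<dots> = (\<integral>x. f (z + x) \<partial>lborel)"
    by (rule integral_distr) (use assms in auto)
  finally show ?thesis by (simp add: add.commute)
qed

lemma integrable_translate:
  fixes f :: "'a::euclidean_space \<Rightarrow> complex"
  assumes "integrable lborel f"
  shows "integrable lborel (\<lambda>x. f (x + z))"
proof -
  have "integrable (distr lborel borel ((+) z)) f"
    using assms by (simp add: lborel_distr_plus)
  then have "integrable lborel (\<lambda>x. f (z + x))"
    by (subst (asm) integrable_distr_eq) (use assms in auto)
  then show ?thesis by (simp add: add.commute)
qed

text \<open>Differentiate \<open>\<integral> f(x + z) dx\<close>, which does not depend on \<open>z\<close>.\<close>

lemma integral_frechet_derivative_eq_0:
  assumes f: "schwartz (f::'a::euclidean_space \<Rightarrow> complex)"
  shows "(\<integral>x. frechet_derivative f (at x) b \<partial>lborel) = 0"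
proof -
  obtain C where C: "C \<ge> 0" "\<And>x h. cmod (frechet_derivative f (at x) h) \<le> C / wt x ^ 1 * norm h"
    using schwartz_frechet_bound[OF f] by meson
  have "((\<lambda>z. \<integral>x. f (x + z) \<partial>lborel) has_derivative (\<lambda>h. \<integral>x. frechet_derivative f (at (x + 0)) h \<partial>lborel)) (at 0)"
  proof (rule has_derivative_integral(1)[where S = "ball 0 1" and B = "\<lambda>x. C * 2 ^ DIM('a) * 2 ^ DIM('a) * (1 / wt x)"])
    show "integrable lborel (\<lambda>x. f (x + z))" for z
      by (rule integrable_translate[OF schwartz_integrable[OF f]])
    show "((\<lambda>z. f (x + z)) has_derivative frechet_derivative f (at (x + z))) (at z)" for x z
    proof -
      have "((\<lambda>z. x + z) has_derivative (\<lambda>h. h)) (at z)" by (auto intro!: derivative_eq_intros)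
      from has_derivative_compose[OF this schwartz_has_derivative[OF f]] show ?thesis .
    qed
    \<comment> \<open>For z in the unit ball the translation costs a constant: one factor
      \<open>2 ^ DIM('a)\<close> is Peetre's, the other bounds \<open>wt z\<close>.\<close>
    show "cmod (frechet_derivative f (at (x + z)) h) \<le> C * 2 ^ DIM('a) * 2 ^ DIM('a) * (1 / wt x) * norm h"
      if "z \<in> ball 0 1" for x z h :: 'a
    proof -
      have "1 / wt (x + z) \<le> 2 ^ DIM('a) * wt z / wt x" by (rule inverse_wt_shift)
      also have "\<dots> \<le> 2 ^ DIM('a) * 2 ^ DIM('a) / wt x"
        using that by (intro divide_right_mono mult_left_mono wt_ball_bound) auto
      finally have "C * (1 / wt (x + z)) * norm h \<le> C * (2 ^ DIM('a) * 2 ^ DIM('a) / wt x) * norm h"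
        using C(1) by (intro mult_right_mono mult_left_mono) auto
      with C(2)[of "x + z" h] show ?thesis by simp
    qed
    show "integrable lborel (\<lambda>x::'a. C * 2 ^ DIM('a) * 2 ^ DIM('a) * (1 / wt x))"
      using integrable_inverse_wt by (rule integrable_mult_right)
  qed auto
  moreover have "(\<lambda>z. \<integral>x. f (x + z) \<partial>lborel) = (\<lambda>z. \<integral>x. f x \<partial>lborel)"
    by (simp add: integral_translate schwartz_measurable[OF f])
  ultimately have "((\<lambda>z::'a. \<integral>x. f x \<partial>lborel) has_derivative (\<lambda>h. \<integral>x. frechet_derivative f (at x) h \<partial>lborel)) (at 0)"
    by simp
  moreover have "((\<lambda>z::'a. \<integral>x. f x \<partial>lborel) has_derivative (\<lambda>h. 0)) (at 0)" by simp
  ultimately have "(\<lambda>h. \<integral>x. frechet_derivative f (at x) h \<partial>lborel) = (\<lambda>h. 0)"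
    by (rule has_derivative_unique)
  then show ?thesis by meson
qed

lemma frechet_derivative_mult:
  assumes "schwartz f" "schwartz g"
  shows "frechet_derivative (\<lambda>x. f x * g x) (at x) b =
    f x * frechet_derivative g (at x) b + frechet_derivative f (at x) b * g x"
proof -
  have "((\<lambda>x. f x * g x) has_derivative
    (\<lambda>h. f x * frechet_derivative g (at x) h + frechet_derivative f (at x) h * g x)) (at x)"
    by (rule has_derivative_mult[OF assms[THEN schwartz_has_derivative]])
  from frechet_derivative_at[OF this] show ?thesis by metis
qed

lemma integral_by_parts:
  assumes "schwartz f" "schwartz g" "b \<in> Basis"
  shows "(\<integral>x. frechet_derivative f (at x) b * g x \<partial>lborel) = - (\<integral>x. f x * frechet_derivative g (at x) b \<partial>lborel)"
proof -
  have "0 = (\<integral>x. frechet_derivative (\<lambda>x. f x * g x) (at x) b \<partial>lborel)"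
    using integral_frechet_derivative_eq_0[OF schwartz_mult[OF assms(1,2)]] by simp
  also have "\<dots> = (\<integral>x. f x * frechet_derivative g (at x) b \<partial>lborel) + (\<integral>x. frechet_derivative f (at x) b * g x \<partial>lborel)"
    unfolding frechet_derivative_mult[OF assms(1,2)]
    by (intro Bochner_Integration.integral_add schwartz_integrable schwartz_mult schwartz_deriv assms)
  finally show ?thesis by (simp add: eq_neg_iff_add_eq_0 add.commute)
qed

lemma has_derivative_iexp [derivative_intros]:
  assumes "(f has_derivative f') (at x within S)"
  shows "((\<lambda>x. iexp (f x)) has_derivative (\<lambda>h. iexp (f x) * (\<i> * of_real (f' h)))) (at x within S)"
proof -
  have "((\<lambda>x. \<i> * of_real (f x)) has_derivative (\<lambda>h. \<i> * of_real (f' h))) (at x within S)"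
    by (intro has_derivative_mult_right has_derivative_of_real assms)
  from has_derivative_compose[OF this DERIV_exp[unfolded has_field_derivative_def]] show ?thesis .
qed

lemma schwartz_modulate_has_derivative:
  assumes "schwartz f"
  shows "((\<lambda>x. iexp (p \<bullet> x) * f x) has_derivative
    (\<lambda>h. iexp (p \<bullet> x) * (frechet_derivative f (at x) h + \<i> * of_real (p \<bullet> h) * f x))) (at x)"
proof -
  have "((\<lambda>x. p \<bullet> x) has_derivative (\<lambda>h. p \<bullet> h)) (at x)"
    by (auto intro!: derivative_eq_intros)
  from has_derivative_mult[OF has_derivative_iexp[OF this] schwartz_has_derivative[OF assms]]
  show ?thesis by (simp add: algebra_simps)
qed

text \<open>The invariant class is that of Schwartz functions times one fixed exponential: the term
  created by differentiating the exponential is absorbed into the Schwartz factor, and the modulus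
  of the exponential is 1.\<close>

lemma schwartz_modulate:
  assumes "schwartz f" shows "schwartz (\<lambda>x. iexp (p \<bullet> x) * f x)"
proof (rule schwartz_coinduct[where P = "\<lambda>u. \<exists>f. schwartz f \<and> u = (\<lambda>x. iexp (p \<bullet> x) * f x)"], goal_cases)
  case 1
  show ?case using assms by blast
next
  case (2 u)
  then obtain f where f: "schwartz f" "u = (\<lambda>x. iexp (p \<bullet> x) * f x)" by blast
  from schwartz_bound[OF f(1), of 0] show ?case by (auto simp: f(2) norm_mult)
next
  case (3 u)
  then obtain f where f: "schwartz f" "u = (\<lambda>x. iexp (p \<bullet> x) * f x)" by blast
  show ?case
  proof (intro exI conjI allI ballI)
    show "(u has_derivative (\<lambda>h. iexp (p \<bullet> x) * (frechet_derivative f (at x) h + \<i> * of_real (p \<bullet> h) * f x))) (at x)" for x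
      unfolding f(2) by (rule schwartz_modulate_has_derivative[OF f(1)])
    fix b :: 'a assume "b \<in> Basis"
    then show "schwartz (\<lambda>x. frechet_derivative f (at x) b + \<i> * of_real (p \<bullet> b) * f x)"
      by (intro schwartz_add schwartz_deriv schwartz_cmult f(1))
    show "(\<lambda>x. iexp (p \<bullet> x) * (frechet_derivative f (at x) b + \<i> * of_real (p \<bullet> b) * f x)) =
      (\<lambda>x. iexp (p \<bullet> x) * (frechet_derivative f (at x) b + \<i> * of_real (p \<bullet> b) * f x))" ..
  qed
next
  case (4 u b)
  then obtain f where f: "schwartz f" "u = (\<lambda>x. iexp (p \<bullet> x) * f x)" by blast
  show ?case
    by (intro exI[of _ "\<lambda>x. of_real (x \<bullet> b) * f x"] conjI schwartz_coord f(1) 4(2)) (simp add: f(2) mult_ac)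
qed

section \<open>Partial Fourier transform in the second variable\<close>

lemma frechet_derivative_slice:
  assumes "schwartz G"
  shows "frechet_derivative (\<lambda>y. G (x, y)) (at y) h = frechet_derivative G (at (x, y)) (0, h)"
proof -
  have "((\<lambda>y. (x, y)) has_derivative (\<lambda>h. (0, h))) (at y)"
    by (auto intro!: derivative_eq_intros)
  from has_derivative_compose[OF this schwartz_has_derivative[OF assms]]
  show ?thesis by (metis frechet_derivative_at)
qed

text \<open>The common form of the matrix element, the Wigner function, the characteristic function
  and the amplitudes, each up to a linear substitution and a constant. The first variable is kept as
  a parameter because each of them transforms only half of the variables.\<close>

definition pft :: "('a::euclidean_space \<times> 'b::euclidean_space \<Rightarrow> complex) \<Rightarrow> 'a \<times> 'b \<Rightarrow> complex" where
  "pft G z = (\<integral>y. iexp (snd z \<bullet> y) * G (fst z, y) \<partial>lborel)"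

text \<open>The derivative of the whole integrand, exponential included, integrates to 0; its two
  summands are the two sides up to a factor.\<close>

lemma pft_coord2:
  assumes G: "schwartz G" and b: "b \<in> Basis"
  shows "of_real (snd z \<bullet> b) * pft G z = pft (\<lambda>z. \<i> * frechet_derivative G (at z) (0, b)) z"
proof -
  have G1: "schwartz (\<lambda>y. G (fst z, y))" by (rule schwartz_slice[OF G])
  have G2: "schwartz (\<lambda>y. frechet_derivative G (at (fst z, y)) (0, b))"
    using b by (intro schwartz_slice[OF schwartz_deriv[OF G]]) (simp add: Basis_prod_def)
  let ?h = "\<lambda>y. iexp (snd z \<bullet> y) * G (fst z, y)"
  have D: "frechet_derivative ?h (at y) b = iexp (snd z \<bullet> y) * frechet_derivative G (at (fst z, y)) (0, b)
      + \<i> * of_real (snd z \<bullet> b) * ?h y" for y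
    using frechet_derivative_at[OF schwartz_modulate_has_derivative[OF G1, of "snd z" y], symmetric]
    by (simp add: frechet_derivative_slice[OF G] algebra_simps)
  have "0 = (\<integral>y. frechet_derivative ?h (at y) b \<partial>lborel)"
    using integral_frechet_derivative_eq_0[OF schwartz_modulate[OF G1]] by simp
  also have "\<dots> = (\<integral>y. iexp (snd z \<bullet> y) * frechet_derivative G (at (fst z, y)) (0, b) \<partial>lborel)
     + (\<integral>y. \<i> * of_real (snd z \<bullet> b) * ?h y \<partial>lborel)"
    unfolding D by (intro Bochner_Integration.integral_add schwartz_integrable schwartz_modulate schwartz_cmult G1 G2)
  also have "(\<integral>y. \<i> * of_real (snd z \<bullet> b) * ?h y \<partial>lborel) = \<i> * of_real (snd z \<bullet> b) * pft G z"
    unfolding pft_def by (rule integral_mult_right_zero)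
  finally have *: "(\<integral>y. iexp (snd z \<bullet> y) * frechet_derivative G (at (fst z, y)) (0, b) \<partial>lborel) =
     - (\<i> * of_real (snd z \<bullet> b) * pft G z)"
    by (simp add: eq_neg_iff_add_eq_0)
  have "pft (\<lambda>z. \<i> * frechet_derivative G (at z) (0, b)) z =
    \<i> * (\<integral>y. iexp (snd z \<bullet> y) * frechet_derivative G (at (fst z, y)) (0, b) \<partial>lborel)"
    unfolding pft_def by (subst integral_mult_right_zero[symmetric]) (simp add: mult.left_commute)
  then show ?thesis unfolding * by (simp add: algebra_simps)
qed

text \<open>Operations on the first variable pass through the integral to G. Operations on the
  second one are exchanged: a derivative becomes multiplication by the integration variable, and
  multiplication by a coordinate becomes a derivative, each with a factor \<i>.\<close>

lemma schwartz_pft: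
  fixes G :: "'a::euclidean_space \<times> 'b::euclidean_space \<Rightarrow> complex"
  assumes "schwartz G" shows "schwartz (pft G)"
proof (rule schwartz_coinduct[where P = "\<lambda>u. \<exists>G. schwartz G \<and> u = pft G"], goal_cases)
  case 1
  show ?case using assms by blast
next
  case (2 u)
  then obtain G where G: "schwartz G" "u = pft G" by blast
  obtain C where C: "C \<ge> 0" "\<And>z. cmod (G z) \<le> C / wt z ^ 1" using schwartz_bound[OF G(1)] by meson
  have "cmod (u z) \<le> (\<integral>y. C * (1 / wt y) \<partial>(lborel::'b measure))" for z
    unfolding G(2) pft_def
  proof (rule norm_integral_le)
    show "integrable lborel (\<lambda>y::'b. C * (1 / wt y))" using integrable_inverse_wt by (rule integrable_mult_right)
    fix y :: 'b
    have "C / (wt (fst z) * wt y) \<le> C / wt y"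
      using C(1) wt_ge1[of "fst z"] by (intro divide_left_mono) (auto simp: wt_le_mult)
    then show "cmod (iexp (snd z \<bullet> y) * G (fst z, y)) \<le> C * (1 / wt y)"
      using C(2)[of "(fst z, y)"] by (simp add: norm_mult wt_Pair)
  qed
  then show ?case by blast
next
  case (3 u)
  then obtain G where G: "schwartz G" "u = pft G" by blast
  \<comment> \<open>Two powers: one absorbs the factor linear in y that differentiating the
    exponential creates, the other keeps the majorant integrable.\<close>
  obtain C where C: "C \<ge> 0" "\<And>z. cmod (G z) \<le> C / wt z ^ 2" using schwartz_bound[OF G(1)] by meson
  obtain C' where C': "C' \<ge> 0" "\<And>z h. cmod (frechet_derivative G (at z) h) \<le> C' / wt z ^ 1 * norm h"
    using schwartz_frechet_bound[OF G(1)] by meson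
  define E where "E y z = iexp (snd z \<bullet> y) * G (fst z, y)" for y z
  define E' where "E' y z h = iexp (snd z \<bullet> y) *
     (frechet_derivative G (at (fst z, y)) (fst h, 0) + \<i> * of_real (snd h \<bullet> y) * G (fst z, y))" for y z h
  have dE: "(E y has_derivative E' y z) (at z)" for y z
  proof -
    have "((\<lambda>z. (fst z, y)) has_derivative (\<lambda>h. (fst h, 0))) (at z)"
      by (auto intro!: derivative_eq_intros)
    from has_derivative_compose[OF this schwartz_has_derivative[OF G(1)]]
    have "((\<lambda>z. G (fst z, y)) has_derivative (\<lambda>h. frechet_derivative G (at (fst z, y)) (fst h, 0))) (at z)" .
    then show ?thesis unfolding E_def[abs_def] E'_def[abs_def]
      by (auto intro!: derivative_eq_intros simp: algebra_simps)
  qed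
  have bE: "cmod (E' y z h) \<le> (C' + DIM('b) * C) * (1 / wt y) * norm h" for y z h
  proof -
    have w: "1 / (wt (fst z) * wt y) \<le> 1 / wt y"
      using wt_ge1[of "fst z"] by (intro divide_left_mono) (auto simp: wt_le_mult)
    have "norm (fst h, 0::'b) \<le> norm h" using norm_fst_le[of "fst h" "snd h"] by (simp add: norm_Pair)
    then have "cmod (frechet_derivative G (at (fst z, y)) (fst h, 0)) \<le> C' * (1 / (wt (fst z) * wt y)) * norm h"
      using C'(2)[of "(fst z, y)" "(fst h, 0)"] C'(1) 
      by (elim order_trans) (auto simp: wt_Pair intro!: mult_left_mono divide_right_mono)
    also have "\<dots> \<le> C' * (1 / wt y) * norm h"
      using w C'(1) by (intro mult_right_mono mult_left_mono) auto
    finally have 1: "cmod (frechet_derivative G (at (fst z, y)) (fst h, 0)) \<le> C' * (1 / wt y) * norm h" .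
    have "\<bar>snd h \<bullet> y\<bar> \<le> norm h * (DIM('b) * wt y)"
      using Cauchy_Schwarz_ineq2[of "snd h" y] norm_snd_le[of "snd h" "fst h"] norm_le_wt[of y]
      by (elim order_trans) (intro mult_mono, auto)
    moreover have "cmod (G (fst z, y)) \<le> C / (wt y)\<^sup>2"
    proof -
      have "C / (wt (fst z) * wt y)\<^sup>2 \<le> C / (wt y)\<^sup>2"
        using C(1) wt_ge1[of "fst z"]
        by (intro divide_left_mono power_mono) (auto simp: wt_le_mult)
      with C(2)[of "(fst z, y)"] show ?thesis by (simp add: wt_Pair)
    qed
    ultimately have "\<bar>snd h \<bullet> y\<bar> * cmod (G (fst z, y)) \<le> (norm h * (DIM('b) * wt y)) * (C / (wt y)\<^sup>2)"
      by (intro mult_mono) auto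
    also have "\<dots> = DIM('b) * C * (1 / wt y) * norm h" by (simp add: power2_eq_square field_simps)
    finally have 2: "\<bar>snd h \<bullet> y\<bar> * cmod (G (fst z, y)) \<le> DIM('b) * C * (1 / wt y) * norm h" .
    have "cmod (E' y z h) \<le> cmod (frechet_derivative G (at (fst z, y)) (fst h, 0)) + \<bar>snd h \<bullet> y\<bar> * cmod (G (fst z, y))"
      unfolding E'_def norm_mult norm_exp_i_times by (simp, rule order_trans[OF norm_triangle_ineq]) (simp add: norm_mult)
    with 1 2 show ?thesis by (simp add: algebra_simps)
  qed
  have D: "(u has_derivative (\<lambda>h. \<integral>y. E' y z h \<partial>lborel)) (at z)" for z
  proof -
    have "u = (\<lambda>z. \<integral>y. E y z \<partial>lborel)" unfolding G(2) pft_def E_def by simp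
    moreover have "((\<lambda>z. \<integral>y. E y z \<partial>lborel) has_derivative (\<lambda>h. \<integral>y. E' y z h \<partial>lborel)) (at z)"
    proof (rule has_derivative_integral(1)[where S = UNIV and B = "\<lambda>y. (C' + DIM('b) * C) * (1 / wt y)"])
      show "integrable lborel (\<lambda>y. E y x)" for x
        unfolding E_def by (intro schwartz_integrable schwartz_modulate schwartz_slice G(1))
      show "integrable lborel (\<lambda>y::'b. (C' + DIM('b) * C) * (1 / wt y))"
        using integrable_inverse_wt by (rule integrable_mult_right)
    qed (use dE bE in auto)
    ultimately show ?thesis by simp
  qed
  show ?case
  proof (intro exI[of _ "\<lambda>z h. \<integral>y. E' y z h \<partial>lborel"] conjI allI D ballI)
    fix b :: "'a \<times> 'b" assume b: "b \<in> Basis"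
    then consider b1 where "b1 \<in> Basis" "b = (b1, 0)" | b2 where "b2 \<in> Basis" "b = (0, b2)"
      unfolding Basis_prod_def by blast
    then show "\<exists>G. schwartz G \<and> (\<lambda>z. \<integral>y. E' y z b \<partial>lborel) = pft G"
    proof cases
      case 1
      show ?thesis
        by (intro exI[of _ "\<lambda>z. frechet_derivative G (at z) b"] conjI schwartz_deriv G(1) b)
          (simp add: fun_eq_iff E'_def pft_def 1)
    next
      case 2
      have "frechet_derivative G (at z) 0 = 0" for z
        by (rule linear_0[OF schwartz_frechet_linear[OF G(1)]])
      then show ?thesis
        by (intro exI[of _ "\<lambda>z. \<i> * (of_real (z \<bullet> b) * G z)"] conjI schwartz_coord schwartz_cmult G(1) b)
          (simp add: fun_eq_iff E'_def pft_def 2 zero_prod_def[symmetric] inner_commute mult_ac)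
    qed
  qed
next
  case (4 u b)
  then obtain G where G: "schwartz G" "u = pft G" by blast
  from 4 consider b1 where "b1 \<in> Basis" "b = (b1, 0)" | b2 where "b2 \<in> Basis" "b = (0, b2)"
    unfolding Basis_prod_def by blast
  then show ?case
  proof cases
    case 1
    have "of_real (z \<bullet> b) * pft G z = pft (\<lambda>z. of_real (z \<bullet> b) * G z) z" for z
      unfolding pft_def 1 by (subst integral_mult_right_zero[symmetric]) (simp add: inner_prod_def mult_ac)
    then show ?thesis
      by (intro exI[of _ "\<lambda>z. of_real (z \<bullet> b) * G z"] conjI schwartz_coord G(1) 4(2)) (simp add: G(2))
  next
    case 2
    have "of_real (z \<bullet> b) * pft G z = pft (\<lambda>z. \<i> * frechet_derivative G (at z) b) z" for z
      using pft_coord2[OF G(1) 2(1), of z] by (simp add: 2 inner_prod_def)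
    then show ?thesis
      by (intro exI[of _ "\<lambda>z. \<i> * frechet_derivative G (at z) b"] conjI schwartz_cmult schwartz_deriv G(1) 4(2)) (simp add: G(2))
  qed
qed

section \<open>Fourier inversion\<close>

lemma borel_measurable_cnj [measurable]: "cnj \<in> borel_measurable borel"
  by (intro borel_measurable_continuous_onI continuous_intros)

lemma integrable_tensor:
  fixes f :: "'a::euclidean_space \<Rightarrow> 'c::{real_normed_field,banach,second_countable_topology}"
    and g :: "'b::euclidean_space \<Rightarrow> 'c"
  assumes f: "integrable lborel f" and g: "integrable lborel g"
  shows "integrable lborel (\<lambda>z. f (fst z) * g (snd z))"
proof -
  have [measurable]: "f \<in> borel_measurable borel" "g \<in> borel_measurable borel" using f g by auto
  have "integrable (lborel \<Otimes>\<^sub>M lborel) (\<lambda>z. f (fst z) * g (snd z))"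
  proof (rule lborel_pair.Fubini_integrable)
    show "integrable lborel (\<lambda>x. \<integral>y. norm (f (fst (x, y)) * g (snd (x, y))) \<partial>lborel)"
      using f by (simp add: norm_mult)
    show "AE x in lborel. integrable lborel (\<lambda>y. f (fst (x, y)) * g (snd (x, y)))"
      using g by simp
  qed measurable
  then show ?thesis by (simp add: lborel_prod)
qed

lemma integrable_tensor_bound:
  fixes F :: "'a::euclidean_space \<times> 'b::euclidean_space \<Rightarrow> complex"
  assumes F: "F \<in> borel_measurable borel" and f: "integrable lborel f" and g: "integrable lborel g"
    and bd: "\<And>x y. cmod (F (x, y)) \<le> f x * g y"
  shows "integrable lborel F"
proof (rule Bochner_Integration.integrable_bound[OF integrable_tensor[OF f g]])
  show "AE z in lborel. cmod (F z) \<le> norm (f (fst z) * g (snd z))"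
  proof (rule AE_I2)
    fix z :: "'a \<times> 'b"
    have "cmod (F z) \<le> f (fst z) * g (snd z)" using bd[of "fst z" "snd z"] by simp
    also have "\<dots> \<le> norm (f (fst z) * g (snd z))" unfolding real_norm_def by (rule abs_ge_self)
    finally show "cmod (F z) \<le> norm (f (fst z) * g (snd z))" .
  qed
qed (use F in simp)

lemma lborel_integral_fst:
  fixes F :: "'a::euclidean_space \<times> 'b::euclidean_space \<Rightarrow> complex"
  assumes "integrable lborel F"
  shows "(\<integral>x. (\<integral>y. F (x, y) \<partial>lborel) \<partial>lborel) = (\<integral>z. F z \<partial>lborel)"
  using lborel_pair.integral_fst'[of F] assms by (simp add: lborel_prod)

lemma lborel_integral_snd:
  fixes F :: "'a::euclidean_space \<times> 'b::euclidean_space \<Rightarrow> complex"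
  assumes "integrable lborel F"
  shows "(\<integral>y. (\<integral>x. F (x, y) \<partial>lborel) \<partial>lborel) = (\<integral>z. F z \<partial>lborel)"
  using lborel_pair.integral_snd[of "\<lambda>x y. F (x, y)"] assms by (simp add: lborel_prod)

lemma lborel_integral_swap:
  fixes F :: "'a::euclidean_space \<times> 'b::euclidean_space \<Rightarrow> complex"
  assumes "integrable lborel F"
  shows "(\<integral>x. (\<integral>y. F (x, y) \<partial>lborel) \<partial>lborel) = (\<integral>y. (\<integral>x. F (x, y) \<partial>lborel) \<partial>lborel)"
  by (simp only: lborel_integral_fst[OF assms] lborel_integral_snd[OF assms])

lemma integral_affine:
  fixes f :: "'a::euclidean_space \<Rightarrow> complex"
  assumes f: "f \<in> borel_measurable borel" and c: "c \<noteq> 0"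
  shows "(\<integral>x. f x \<partial>lborel) = of_real (\<bar>c\<bar> ^ DIM('a)) * (\<integral>x. f (t + c *\<^sub>R x) \<partial>lborel)"
proof -
  have "(\<integral>x. f x \<partial>lborel) = (\<integral>x. f x \<partial>density (distr lborel borel (\<lambda>x. t + c *\<^sub>R x)) (\<lambda>_. \<bar>c\<bar>^DIM('a)))"
    using lborel_affine[OF c, of t] by simp
  also have "\<dots> = (\<integral>x. \<bar>c\<bar>^DIM('a) *\<^sub>R f x \<partial>distr lborel borel (\<lambda>x. t + c *\<^sub>R x))"
    by (subst integral_density) (use f in auto)
  also have "\<dots> = (\<integral>x. \<bar>c\<bar>^DIM('a) *\<^sub>R f (t + c *\<^sub>R x) \<partial>lborel)"
    by (rule integral_distr) (use f in auto)
  finally show ?thesis by (simp add: scaleR_conv_of_real)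
qed

lemma integrable_affine:
  fixes f :: "'a::euclidean_space \<Rightarrow> 'c::{banach,second_countable_topology}"
  assumes f: "integrable lborel f" and c: "c \<noteq> 0"
  shows "integrable lborel (\<lambda>x. f (t + c *\<^sub>R x))"
proof -
  have [measurable]: "f \<in> borel_measurable borel" using f by auto
  have "integrable (density (distr lborel borel (\<lambda>x. t + c *\<^sub>R x)) (\<lambda>_. \<bar>c\<bar>^DIM('a))) f"
    using lborel_affine[OF c, of t] f by simp
  then have "integrable (distr lborel borel (\<lambda>x. t + c *\<^sub>R x)) (\<lambda>x. \<bar>c\<bar>^DIM('a) *\<^sub>R f x)"
    by (subst (asm) integrable_density) auto
  then have "integrable lborel (\<lambda>x. \<bar>c\<bar>^DIM('a) *\<^sub>R f (t + c *\<^sub>R x))"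
    by (subst (asm) integrable_distr_eq) auto
  then have "integrable lborel (\<lambda>x. inverse (\<bar>c\<bar>^DIM('a)) *\<^sub>R (\<bar>c\<bar>^DIM('a) *\<^sub>R f (t + c *\<^sub>R x)))"
    by (rule integrable_scaleR_right)
  then show ?thesis using c by simp
qed

lemma
  fixes f :: "'a::euclidean_space \<Rightarrow> real \<Rightarrow> complex"
  assumes f: "\<And>b. b \<in> Basis \<Longrightarrow> integrable lborel (f b)"
  shows integral_lborel_prod: "(\<integral>x. (\<Prod>b\<in>Basis. f b (x \<bullet> b)) \<partial>lborel) = (\<Prod>b\<in>Basis. \<integral>t. f b t \<partial>lborel)"
    and integrable_lborel_prod: "integrable lborel (\<lambda>x. \<Prod>b\<in>Basis. f b (x \<bullet> b))"
proof -
  interpret product_sigma_finite "\<lambda>_::'a. lborel::real measure" ..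
  have [measurable]: "f b \<in> borel_measurable borel" if "b \<in> Basis" for b using f[OF that] by auto
  have m: "(\<lambda>x. \<Prod>b\<in>Basis. f b (x \<bullet> b)) \<in> borel_measurable borel"
    by (intro borel_measurable_prod) measurable
  have T: "(\<lambda>f. \<Sum>b\<in>Basis. f b *\<^sub>R b) \<in> (\<Pi>\<^sub>M b\<in>(Basis::'a set). lborel) \<rightarrow>\<^sub>M borel"
    by measurable
  have eq: "(\<Prod>b\<in>Basis. f b ((\<Sum>c\<in>Basis. g c *\<^sub>R c) \<bullet> b)) = (\<Prod>b\<in>Basis. f b (g b))" for g :: "'a \<Rightarrow> real"
    by (intro prod.cong refl) simp
  show "(\<integral>x. (\<Prod>b\<in>Basis. f b (x \<bullet> b)) \<partial>lborel) = (\<Prod>b\<in>Basis. \<integral>t. f b t \<partial>lborel)"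
    unfolding lborel_eq[where 'a='a] integral_distr[OF T m] eq
    by (rule product_integral_prod) (use f in auto)
  show "integrable lborel (\<lambda>x. \<Prod>b\<in>Basis. f b (x \<bullet> b))"
    unfolding lborel_eq[where 'a='a] integrable_distr_eq[OF T m] eq
    by (rule product_integrable_prod) (use f in auto)
qed

section \<open>The Gaussian and its Fourier transform\<close>

definition gauss :: "'a::euclidean_space \<Rightarrow> real" where
  "gauss x = exp (- (x \<bullet> x) / 2)"

lemma gauss_pos [simp]: "0 < gauss x" and gauss_nonneg [simp]: "0 \<le> gauss x"
  and gauss_le_1: "gauss x \<le> 1" and gauss_0 [simp]: "gauss 0 = 1"
  by (simp_all add: gauss_def)

lemma gauss_minus [simp]: "gauss (- x) = gauss x"
  by (simp add: gauss_def)

lemma continuous_on_gauss [continuous_intros]: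
  "continuous_on S f \<Longrightarrow> continuous_on S (\<lambda>x. gauss (f x))"
  unfolding gauss_def by (intro continuous_intros) auto

lemma borel_measurable_gauss [measurable]: "gauss \<in> borel_measurable borel"
  by (intro borel_measurable_continuous_onI continuous_intros)

lemma gauss_eq_prod: "gauss x = (\<Prod>b\<in>Basis. exp (- (x \<bullet> b)\<^sup>2 / 2))"
proof -
  have "- (x \<bullet> x) / 2 = (\<Sum>b\<in>Basis. - (x \<bullet> b)\<^sup>2 / 2)"
    by (subst euclidean_inner) (simp add: power2_eq_square sum_negf sum_divide_distrib)
  then show ?thesis by (simp add: gauss_def exp_sum)
qed

text \<open>The transform is read off from the characteristic function of the standard normal
  distribution; \<open>sqrt (2 * pi)\<close> undoes the normalisation of its density.\<close>

lemma
  shows integrable_gauss_real: "integrable lborel (\<lambda>t::real. iexp (s * t) * of_real (exp (- t\<^sup>2 / 2)))"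
    and fourier_gauss_real: "(\<integral>t. iexp (s * t) * of_real (exp (- t\<^sup>2 / 2)) \<partial>lborel) =
      of_real (sqrt (2 * pi) * exp (- s\<^sup>2 / 2))"
proof -
  have d: "exp (- t\<^sup>2 / 2) = sqrt (2 * pi) * std_normal_density t" for t
    by (simp add: std_normal_density_def)
  have i: "integrable lborel (\<lambda>t. std_normal_density t *\<^sub>R iexp (s * t))"
    by (rule Bochner_Integration.integrable_bound[OF integrable_normal_density[where \<mu> = 0 and \<sigma> = 1]]) auto
  have eq: "iexp (s * t) * of_real (exp (- t\<^sup>2 / 2)) = of_real (sqrt (2 * pi)) * (std_normal_density t *\<^sub>R iexp (s * t))" for t
    unfolding d by (simp add: scaleR_conv_of_real)
  show "integrable lborel (\<lambda>t. iexp (s * t) * of_real (exp (- t\<^sup>2 / 2)))"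
    unfolding eq using i by (rule integrable_mult_right)
  have "(\<integral>t. std_normal_density t *\<^sub>R iexp (s * t) \<partial>lborel) = char std_normal_distribution s"
    unfolding char_def by (subst integral_density) (auto simp: normal_density_nonneg)
  also have "\<dots> = of_real (exp (- s\<^sup>2 / 2))"
    by (simp add: char_std_normal_distribution)
  finally show "(\<integral>t. iexp (s * t) * of_real (exp (- t\<^sup>2 / 2)) \<partial>lborel) =
      of_real (sqrt (2 * pi) * exp (- s\<^sup>2 / 2))"
    unfolding eq integral_mult_right_zero by simp
qed

lemma
  fixes p :: "'a::euclidean_space"
  shows integrable_iexp_gauss: "integrable lborel (\<lambda>x. iexp (p \<bullet> x) * of_real (gauss x))"
    and fourier_gauss: "(\<integral>x. iexp (p \<bullet> x) * of_real (gauss x) \<partial>lborel) =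
      of_real (sqrt (2 * pi) ^ DIM('a) * gauss p)"
proof -
  have eq: "iexp (p \<bullet> x) * of_real (gauss x) =
     (\<Prod>b\<in>Basis. iexp ((p \<bullet> b) * (x \<bullet> b)) * of_real (exp (- (x \<bullet> b)\<^sup>2 / 2)))" for x
    unfolding gauss_eq_prod
    by (subst euclidean_inner) (simp add: prod.distrib exp_sum sum_distrib_left)
  show "integrable lborel (\<lambda>x. iexp (p \<bullet> x) * of_real (gauss x))"
    unfolding eq by (intro integrable_lborel_prod integrable_gauss_real)
  show "(\<integral>x. iexp (p \<bullet> x) * of_real (gauss x) \<partial>lborel) = of_real (sqrt (2 * pi) ^ DIM('a) * gauss p)"
    unfolding eq integral_lborel_prod[OF integrable_gauss_real] fourier_gauss_real
    by (simp add: prod.distrib gauss_eq_prod)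
qed

lemma integrable_gauss_complex: "integrable lborel (\<lambda>x. complex_of_real (gauss x))"
  and integral_gauss_complex: "(\<integral>x. complex_of_real (gauss x) \<partial>(lborel::'a::euclidean_space measure)) =
    of_real (sqrt (2 * pi) ^ DIM('a))"
  using integrable_iexp_gauss[of 0] fourier_gauss[of "0::'a"] by simp_all

lemma integrable_gauss: "integrable lborel gauss"
  using integrable_norm[OF integrable_gauss_complex] by simp

text \<open>The Gaussian factor makes the double integral absolutely convergent. After the
  interchange the p-integral is a Gaussian of width e in \<open>s - y\<close>, and the substitution
  \<open>s = y + e *\<^sub>R w\<close> moves the parameter e into the argument of h.\<close>

lemma pft_inversion_regularized:
  fixes h :: "'a::euclidean_space \<Rightarrow> complex"
  assumes h: "integrable lborel h" and e: "e > 0"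
  shows "(\<integral>p. iexp (- (p \<bullet> y)) * (\<integral>s. iexp (p \<bullet> s) * h s \<partial>lborel) * of_real (gauss (e *\<^sub>R p)) \<partial>lborel) =
     of_real (sqrt (2 * pi) ^ DIM('a)) * (\<integral>w. h (y + e *\<^sub>R w) * of_real (gauss w) \<partial>lborel)"
proof -
  have [measurable]: "h \<in> borel_measurable borel" using h by auto
  let ?c = "sqrt (2 * pi) ^ DIM('a)"
  define F where "F z = iexp (fst z \<bullet> (snd z - y)) * h (snd z) * of_real (gauss (e *\<^sub>R fst z))" for z
  have ge: "integrable lborel (\<lambda>p::'a. gauss (e *\<^sub>R p))"
    using integrable_affine[OF integrable_gauss, of e 0] e by simp
  have F: "integrable lborel F"
  proof (rule integrable_tensor_bound[OF _ ge integrable_norm[OF h]])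
    show "cmod (F (p, s)) \<le> gauss (e *\<^sub>R p) * cmod (h s)" for p s
      by (simp add: F_def norm_mult)
    have [measurable]: "(\<lambda>z::'a\<times>'a. iexp (fst z \<bullet> (snd z - y))) \<in> borel_measurable borel"
      "(\<lambda>z::'a\<times>'a. gauss (e *\<^sub>R fst z)) \<in> borel_measurable borel"
      by (intro borel_measurable_continuous_onI continuous_intros)+
    show "F \<in> borel_measurable borel"
      unfolding F_def[abs_def] borel_prod[symmetric] by measurable
  qed
  have "(\<integral>p. iexp (- (p \<bullet> y)) * (\<integral>s. iexp (p \<bullet> s) * h s \<partial>lborel) * of_real (gauss (e *\<^sub>R p)) \<partial>lborel) =
    (\<integral>p. (\<integral>s. F (p, s) \<partial>lborel) \<partial>lborel)"
  proof (rule Bochner_Integration.integral_cong[OF refl])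
    fix p
    have eq: "F (p, s) = iexp (- (p \<bullet> y)) * of_real (gauss (e *\<^sub>R p)) * (iexp (p \<bullet> s) * h s)" for s
      by (simp add: F_def inner_diff_right right_diff_distrib exp_diff exp_minus field_simps)
    show "iexp (- (p \<bullet> y)) * (\<integral>s. iexp (p \<bullet> s) * h s \<partial>lborel) * of_real (gauss (e *\<^sub>R p)) = (\<integral>s. F (p, s) \<partial>lborel)"
      unfolding eq integral_mult_right_zero by (simp add: mult_ac)
  qed
  also have "\<dots> = (\<integral>s. (\<integral>p. F (p, s) \<partial>lborel) \<partial>lborel)" by (rule lborel_integral_swap[OF F])
  also have "\<dots> = (\<integral>s. h s * (of_real ((1 / e) ^ DIM('a) * ?c * gauss ((1 / e) *\<^sub>R (s - y)))) \<partial>lborel)"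
  proof (rule Bochner_Integration.integral_cong[OF refl])
    fix s
    have "(\<integral>p. F (p, s) \<partial>lborel) = h s * (\<integral>p. iexp (p \<bullet> (s - y)) * of_real (gauss (e *\<^sub>R p)) \<partial>lborel)"
      by (subst integral_mult_right_zero[symmetric]) (simp add: F_def mult_ac)
    also have "(\<integral>p. iexp (p \<bullet> (s - y)) * of_real (gauss (e *\<^sub>R p)) \<partial>lborel) =
       of_real (\<bar>1 / e\<bar> ^ DIM('a)) * (\<integral>w. iexp ((0 + (1 / e) *\<^sub>R w) \<bullet> (s - y)) * of_real (gauss (e *\<^sub>R (0 + (1 / e) *\<^sub>R w))) \<partial>lborel)"
      by (rule integral_affine) (use e in \<open>auto intro!: borel_measurable_continuous_onI continuous_intros\<close>)
    also have "(\<integral>w. iexp ((0 + (1 / e) *\<^sub>R w) \<bullet> (s - y)) * of_real (gauss (e *\<^sub>R (0 + (1 / e) *\<^sub>R w))) \<partial>lborel) =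
       (\<integral>w. iexp (((1 / e) *\<^sub>R (s - y)) \<bullet> w) * of_real (gauss w) \<partial>lborel)"
      using e by (intro Bochner_Integration.integral_cong refl) (simp add: inner_commute)
    also have "\<dots> = of_real (?c * gauss ((1 / e) *\<^sub>R (s - y)))" by (rule fourier_gauss)
    finally show "(\<integral>p. F (p, s) \<partial>lborel) = h s * (of_real ((1 / e) ^ DIM('a) * ?c * gauss ((1 / e) *\<^sub>R (s - y))))"
      using e by (simp add: mult_ac)
  qed
  also have "\<dots> = of_real (\<bar>e\<bar> ^ DIM('a)) * (\<integral>w. h (y + e *\<^sub>R w) * (of_real ((1 / e) ^ DIM('a) * ?c * gauss ((1 / e) *\<^sub>R (y + e *\<^sub>R w - y)))) \<partial>lborel)"
    by (rule integral_affine) (use e in auto)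
  also have "\<dots> = of_real ?c * (\<integral>w. h (y + e *\<^sub>R w) * of_real (gauss w) \<partial>lborel)"
  proof -
    have eq: "h (y + e *\<^sub>R w) * (of_real ((1 / e) ^ DIM('a) * ?c * gauss ((1 / e) *\<^sub>R (y + e *\<^sub>R w - y)))) =
      of_real ((1 / e) ^ DIM('a)) * of_real ?c * (h (y + e *\<^sub>R w) * of_real (gauss w))" for w
      using e by (simp add: mult_ac)
    have "of_real (\<bar>e\<bar> ^ DIM('a)) * (\<integral>w. h (y + e *\<^sub>R w) * (of_real ((1 / e) ^ DIM('a) * ?c * gauss ((1 / e) *\<^sub>R (y + e *\<^sub>R w - y)))) \<partial>lborel)
      = of_real (\<bar>e\<bar> ^ DIM('a) * (1 / e) ^ DIM('a)) * (of_real ?c * (\<integral>w. h (y + e *\<^sub>R w) * of_real (gauss w) \<partial>lborel))"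
      unfolding eq integral_mult_right_zero by (simp only: of_real_mult mult_ac)
    also have "\<bar>e\<bar> ^ DIM('a) * (1 / e) ^ DIM('a) = 1"
      using e by (simp add: power_mult_distrib[symmetric])
    finally show ?thesis by simp
  qed
  finally show ?thesis .
qed

lemma LIMSEQ_inverse_Suc_scaleR: "(\<lambda>n. (1 / real (Suc n)) *\<^sub>R (w::'a::real_normed_vector)) \<longlonglongrightarrow> 0"
  using tendsto_scaleR[OF LIMSEQ_Suc[OF lim_const_over_n[of 1]] tendsto_const[of w]] by simp

lemma tendsto_continuous_UNIV:
  "continuous_on UNIV f \<Longrightarrow> X \<longlonglongrightarrow> a \<Longrightarrow> (\<lambda>n. f (X n)) \<longlonglongrightarrow> f a"
  using continuous_on_tendsto_compose[of UNIV f X a sequentially] by auto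

text \<open>Let the regularisation tend to 0 on both sides. On the left the transform of h is the
  majorant; on the right h is bounded and continuous. The constant is a product of two factors
  \<open>sqrt (2 * pi) ^ DIM('a)\<close>, one from the regularised formula and one from the mass of
  the Gaussian.\<close>

theorem fourier_inversion:
  fixes h :: "'a::euclidean_space \<Rightarrow> complex"
  assumes h: "schwartz h" and H: "integrable lborel (\<lambda>p. \<integral>s. iexp (p \<bullet> s) * h s \<partial>lborel)"
  shows "(\<integral>p. iexp (- (p \<bullet> y)) * (\<integral>s. iexp (p \<bullet> s) * h s \<partial>lborel) \<partial>lborel) = of_real ((2 * pi) ^ DIM('a)) * h y"
proof -
  let ?c = "sqrt (2 * pi) ^ DIM('a)"
  define H' where "H' p = (\<integral>s. iexp (p \<bullet> s) * h s \<partial>lborel)" for p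
  define e where "e n = 1 / real (Suc n)" for n
  have e: "e n > 0" for n by (simp add: e_def)
  have H'i: "integrable lborel H'" using H unfolding H'_def .
  then have [measurable]: "H' \<in> borel_measurable borel" by auto
  have [measurable]: "h \<in> borel_measurable borel" by (rule schwartz_measurable[OF h])
  have [measurable]: "(\<lambda>p. iexp (- (p \<bullet> y))) \<in> borel_measurable borel"
    by (intro borel_measurable_continuous_onI continuous_intros)
  have e0: "(\<lambda>n. e n *\<^sub>R w) \<longlonglongrightarrow> 0" for w :: 'a unfolding e_def by (rule LIMSEQ_inverse_Suc_scaleR)
  have L1: "(\<lambda>n. \<integral>p. iexp (- (p \<bullet> y)) * H' p * of_real (gauss (e n *\<^sub>R p)) \<partial>lborel) \<longlonglongrightarrow>
      (\<integral>p. iexp (- (p \<bullet> y)) * H' p \<partial>lborel)"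
  proof (rule integral_dominated_convergence[where w = "\<lambda>p. cmod (H' p)"])
    show "AE p in lborel. (\<lambda>n. iexp (- (p \<bullet> y)) * H' p * of_real (gauss (e n *\<^sub>R p))) \<longlonglongrightarrow> iexp (- (p \<bullet> y)) * H' p"
    proof (rule AE_I2)
      fix p :: 'a
      have "(\<lambda>n. gauss (e n *\<^sub>R p)) \<longlonglongrightarrow> gauss (0::'a)"
        using tendsto_continuous_UNIV[OF continuous_on_gauss[OF continuous_on_id] e0[of p]] .
      from tendsto_mult[OF tendsto_const tendsto_of_real[OF this]]
      show "(\<lambda>n. iexp (- (p \<bullet> y)) * H' p * of_real (gauss (e n *\<^sub>R p))) \<longlonglongrightarrow> iexp (- (p \<bullet> y)) * H' p"
        by simp
    qed
    show "AE p in lborel. cmod (iexp (- (p \<bullet> y)) * H' p * of_real (gauss (e n *\<^sub>R p))) \<le> cmod (H' p)" for n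
      using mult_left_mono[OF gauss_le_1] by (intro AE_I2) (simp add: norm_mult mult_left_le gauss_le_1)
  qed (use integrable_norm[OF H'i] in auto)
  obtain C where C: "C \<ge> 0" "\<And>x. cmod (h x) \<le> C" using schwartz_bound[OF h, of 0] by auto
  have L2: "(\<lambda>n. \<integral>w. h (y + e n *\<^sub>R w) * of_real (gauss w) \<partial>lborel) \<longlonglongrightarrow> (\<integral>w. h y * of_real (gauss (w::'a)) \<partial>lborel)"
  proof (rule integral_dominated_convergence[where w = "\<lambda>w. C * gauss w"])
    show "integrable lborel (\<lambda>w::'a. C * gauss w)" by (rule integrable_mult_right[OF integrable_gauss])
    show "AE w in lborel. (\<lambda>n. h (y + e n *\<^sub>R w) * of_real (gauss w)) \<longlonglongrightarrow> h y * of_real (gauss w)"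
    proof (intro AE_I2 tendsto_mult tendsto_const)
      fix w
      have "(\<lambda>n. y + e n *\<^sub>R w) \<longlonglongrightarrow> y + 0" by (intro tendsto_add tendsto_const e0)
      from tendsto_continuous_UNIV[OF schwartz_continuous[OF h] this]
      show "(\<lambda>n. h (y + e n *\<^sub>R w)) \<longlonglongrightarrow> h y" by simp
    qed
    show "AE w in lborel. cmod (h (y + e n *\<^sub>R w) * of_real (gauss w)) \<le> C * gauss w" for n
      using C(2) by (intro AE_I2) (simp add: norm_mult mult_right_mono)
  qed auto
  have "(\<integral>p. iexp (- (p \<bullet> y)) * H' p * of_real (gauss (e n *\<^sub>R p)) \<partial>lborel) =
     of_real ?c * (\<integral>w. h (y + e n *\<^sub>R w) * of_real (gauss w) \<partial>lborel)" for n
    unfolding H'_def by (rule pft_inversion_regularized[OF schwartz_integrable[OF h] e])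
  with L1 have "(\<lambda>n. of_real ?c * (\<integral>w. h (y + e n *\<^sub>R w) * of_real (gauss w) \<partial>lborel)) \<longlonglongrightarrow> (\<integral>p. iexp (- (p \<bullet> y)) * H' p \<partial>lborel)"
    by simp
  moreover have "(\<lambda>n. of_real ?c * (\<integral>w. h (y + e n *\<^sub>R w) * of_real (gauss w) \<partial>lborel)) \<longlonglongrightarrow> of_real ?c * (\<integral>w. h y * of_real (gauss (w::'a)) \<partial>lborel)"
    by (intro tendsto_mult tendsto_const L2)
  ultimately have "(\<integral>p. iexp (- (p \<bullet> y)) * H' p \<partial>lborel) = of_real ?c * (\<integral>w. h y * of_real (gauss (w::'a)) \<partial>lborel)"
    by (rule LIMSEQ_unique)
  also have "\<dots> = of_real (?c * ?c) * h y"
    unfolding integral_mult_right_zero integral_gauss_complex of_real_mult by simp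
  also have "?c * ?c = (2 * pi) ^ DIM('a)"
    by (subst power_mult_distrib[symmetric]) simp
  finally show ?thesis unfolding H'_def .
qed

corollary pft_inversion:
  fixes G :: "'a::euclidean_space \<times> 'b::euclidean_space \<Rightarrow> complex"
  assumes "schwartz G"
  shows "(\<integral>p. iexp (- (p \<bullet> y)) * pft G (x, p) \<partial>lborel) = of_real ((2 * pi) ^ DIM('b)) * G (x, y)"
proof -
  have "integrable lborel (\<lambda>p. pft G (x, p))"
    by (rule schwartz_integrable[OF schwartz_slice[OF schwartz_pft[OF assms]]])
  then show ?thesis
    using fourier_inversion[OF schwartz_slice[OF assms, of x], of y] by (simp add: pft_def)
qed

text \<open>The asymmetry is deliberate: inversion is applied to the Schwartz function G, while k is
  merely integrable. In the applications k is a slice of the kernel of the state, about which no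
  more is known.\<close>

lemma parseval_slice:
  fixes G :: "'a::euclidean_space \<times> 'b::euclidean_space \<Rightarrow> complex"
  assumes G: "schwartz G" and k: "integrable lborel k"
  shows "(\<integral>s. k s * cnj (G (u, s)) \<partial>lborel) =
    of_real ((1 / (2 * pi)) ^ DIM('b)) * (\<integral>p. (\<integral>s. iexp (p \<bullet> s) * k s \<partial>lborel) * cnj (pft G (u, p)) \<partial>lborel)"
proof -
  have [measurable]: "k \<in> borel_measurable borel" using k by auto
  define g where "g p = pft G (u, p)" for p
  have S: "schwartz g" unfolding g_def by (rule schwartz_slice[OF schwartz_pft[OF G]])
  have [measurable]: "g \<in> borel_measurable borel" by (rule schwartz_measurable[OF S])
  define F where "F z = iexp (fst z \<bullet> snd z) * k (snd z) * cnj (g (fst z))" for z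
  have F: "integrable lborel F"
  proof (rule integrable_tensor_bound[OF _ integrable_norm[OF schwartz_integrable[OF S]] integrable_norm[OF k]])
    show "cmod (F (p, s)) \<le> cmod (g p) * cmod (k s)" for p s
      by (simp add: F_def norm_mult)
    have [measurable]: "(\<lambda>z::'b\<times>'b. iexp (fst z \<bullet> snd z)) \<in> borel_measurable borel"
      by (intro borel_measurable_continuous_onI continuous_intros)
    show "F \<in> borel_measurable borel"
      unfolding F_def[abs_def] borel_prod[symmetric] by measurable
  qed
  have "(\<integral>p. (\<integral>s. iexp (p \<bullet> s) * k s \<partial>lborel) * cnj (g p) \<partial>lborel) = (\<integral>p. (\<integral>s. F (p, s) \<partial>lborel) \<partial>lborel)"
    by (intro Bochner_Integration.integral_cong refl, subst integral_mult_left_zero[symmetric]) (simp add: F_def)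
  also have "\<dots> = (\<integral>s. (\<integral>p. F (p, s) \<partial>lborel) \<partial>lborel)" by (rule lborel_integral_swap[OF F])
  also have "\<dots> = (\<integral>s. of_real ((2 * pi) ^ DIM('b)) * (k s * cnj (G (u, s))) \<partial>lborel)"
  proof (rule Bochner_Integration.integral_cong[OF refl])
    fix s
    have "(\<integral>p. F (p, s) \<partial>lborel) = k s * (\<integral>p. cnj (iexp (- (p \<bullet> s)) * g p) \<partial>lborel)"
      by (subst integral_mult_right_zero[symmetric]) (simp add: F_def exp_cnj mult_ac)
    also have "(\<integral>p. cnj (iexp (- (p \<bullet> s)) * g p) \<partial>lborel) = cnj (of_real ((2 * pi) ^ DIM('b)) * G (u, s))"
      unfolding Bochner_Integration.integral_cnj g_def pft_inversion[OF G] ..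
    finally show "(\<integral>p. F (p, s) \<partial>lborel) = of_real ((2 * pi) ^ DIM('b)) * (k s * cnj (G (u, s)))"
      by (simp add: mult_ac)
  qed
  finally show ?thesis unfolding g_def by (simp add: power_divide)
qed

section \<open>Cauchy-Schwarz inequality, exchange of sums and integrals\<close>

lemma integrable_mult_of_squares:
  fixes f g :: "'t \<Rightarrow> complex"
  assumes "f \<in> borel_measurable M" "g \<in> borel_measurable M"
    and "integrable M (\<lambda>x. (cmod (f x))\<^sup>2)" "integrable M (\<lambda>x. (cmod (g x))\<^sup>2)"
  shows "integrable M (\<lambda>x. f x * g x)"
proof (rule Bochner_Integration.integrable_bound)
  show "integrable M (\<lambda>x. (cmod (f x))\<^sup>2 + (cmod (g x))\<^sup>2)"
    using assms by simp
  show "(\<lambda>x. f x * g x) \<in> borel_measurable M" using assms by measurable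
  show "AE x in M. cmod (f x * g x) \<le> norm ((cmod (f x))\<^sup>2 + (cmod (g x))\<^sup>2)"
  proof (rule AE_I2)
    fix x
    have "2 * (cmod (f x) * cmod (g x)) \<le> (cmod (f x))\<^sup>2 + (cmod (g x))\<^sup>2"
      using sum_squares_bound[of "cmod (f x)" "cmod (g x)"] by (simp add: mult.assoc)
    moreover have "0 \<le> cmod (f x) * cmod (g x)" by simp
    ultimately have "cmod (f x) * cmod (g x) \<le> (cmod (f x))\<^sup>2 + (cmod (g x))\<^sup>2" by linarith
    then show "cmod (f x * g x) \<le> norm ((cmod (f x))\<^sup>2 + (cmod (g x))\<^sup>2)"
      by (simp add: norm_mult)
  qed
qed

lemma integral_Cauchy_Schwarz:
  fixes f g :: "'t \<Rightarrow> complex"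
  assumes f: "f \<in> borel_measurable M" and g: "g \<in> borel_measurable M"
    and f2: "integrable M (\<lambda>x. (cmod (f x))\<^sup>2)" and g2: "integrable M (\<lambda>x. (cmod (g x))\<^sup>2)"
  shows "(\<integral>x. cmod (f x) * cmod (g x) \<partial>M)\<^sup>2 \<le> (\<integral>x. (cmod (f x))\<^sup>2 \<partial>M) * (\<integral>x. (cmod (g x))\<^sup>2 \<partial>M)"
proof -
  define A where "A = (\<integral>x. (cmod (f x))\<^sup>2 \<partial>M)"
  define B where "B = (\<integral>x. (cmod (g x))\<^sup>2 \<partial>M)"
  define c where "c = (\<integral>x. cmod (f x) * cmod (g x) \<partial>M)"
  have fg: "integrable M (\<lambda>x. cmod (f x) * cmod (g x))"
    using integrable_norm[OF integrable_mult_of_squares[OF f g f2 g2]] by (simp add: norm_mult)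
  have "0 \<le> A" unfolding A_def by (rule integral_nonneg_AE) auto
  have q: "0 \<le> s\<^sup>2 * A - 2 * s * c + B" for s
  proof -
    have "0 \<le> (\<integral>x. (s * cmod (f x) - cmod (g x))\<^sup>2 \<partial>M)" by (rule integral_nonneg_AE) auto
    also have "\<dots> = (\<integral>x. s\<^sup>2 * (cmod (f x))\<^sup>2 - 2 * s * (cmod (f x) * cmod (g x)) + (cmod (g x))\<^sup>2 \<partial>M)"
      by (intro Bochner_Integration.integral_cong refl) (simp add: power2_diff power_mult_distrib algebra_simps)
    also have "\<dots> = s\<^sup>2 * A - 2 * s * c + B"
      unfolding A_def B_def c_def using f2 g2 fg by simp
    finally show ?thesis .
  qed
  have "c\<^sup>2 \<le> A * B"
  proof (cases "A = 0")
    case True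
    then have "AE x in M. (cmod (f x))\<^sup>2 = 0"
      unfolding A_def by (subst (asm) integral_nonneg_eq_0_iff_AE[OF f2]) auto
    then have "c = (\<integral>x. 0 \<partial>M)"
      unfolding c_def using fg f by (intro integral_cong_AE) auto
    then show ?thesis using True by simp
  next
    case False
    with \<open>0 \<le> A\<close> have "A > 0" by simp
    \<comment> \<open>The quadratic in s attains its minimum at \<open>c / A\<close>.\<close>
    from q[of "c / A"] have "0 \<le> B - c\<^sup>2 / A"
      using \<open>A > 0\<close> by (simp add: power2_eq_square field_simps)
    with \<open>A > 0\<close> show ?thesis by (simp add: pos_divide_le_eq mult.commute)
  qed
  then show ?thesis unfolding A_def B_def c_def .
qed

lemma cmod_integral_mult_le:
  fixes f g :: "'t \<Rightarrow> complex"
  assumes f: "f \<in> borel_measurable M" and g: "g \<in> borel_measurable M"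
    and f2: "integrable M (\<lambda>x. (cmod (f x))\<^sup>2)" and g2: "integrable M (\<lambda>x. (cmod (g x))\<^sup>2)"
  shows "(cmod (\<integral>x. f x * g x \<partial>M))\<^sup>2 \<le> (\<integral>x. (cmod (f x))\<^sup>2 \<partial>M) * (\<integral>x. (cmod (g x))\<^sup>2 \<partial>M)"
proof -
  have "cmod (\<integral>x. f x * g x \<partial>M) \<le> (\<integral>x. cmod (f x) * cmod (g x) \<partial>M)"
    using integrable_norm[OF integrable_mult_of_squares[OF f g f2 g2]]
    by (intro norm_integral_le) (auto simp: norm_mult)
  then have "(cmod (\<integral>x. f x * g x \<partial>M))\<^sup>2 \<le> (\<integral>x. cmod (f x) * cmod (g x) \<partial>M)\<^sup>2"
    by (rule power_mono) simp
  also note integral_Cauchy_Schwarz[OF assms]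
  finally show ?thesis .
qed

text \<open>Fubini's theorem with the counting measure as one factor; countability of
  \<open>I\<close> makes that measure sigma-finite.\<close>

lemma
  fixes f :: "'i \<Rightarrow> 'x \<Rightarrow> complex"
  assumes M: "sigma_finite_measure M" and I: "countable I"
    and f: "\<And>i. i \<in> I \<Longrightarrow> integrable M (f i)"
    and sum: "(\<lambda>i. \<integral>x. cmod (f i x) \<partial>M) summable_on I"
  shows integrable_infsum: "integrable M (\<lambda>x. \<Sum>\<^sub>\<infinity>i\<in>I. f i x)"
    and integral_infsum: "(\<integral>x. (\<Sum>\<^sub>\<infinity>i\<in>I. f i x) \<partial>M) = (\<Sum>\<^sub>\<infinity>i\<in>I. \<integral>x. f i x \<partial>M)"
proof -
  interpret M: sigma_finite_measure M by fact
  interpret C: sigma_finite_measure "count_space I" using I by (rule sigma_finite_measure_count_space_countable)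
  interpret P: pair_sigma_finite "count_space I" M ..
  let ?F = "\<lambda>(i, x). f i x"
  have F: "integrable (count_space I \<Otimes>\<^sub>M M) ?F"
  proof (rule P.Fubini_integrable)
    show "?F \<in> borel_measurable (count_space I \<Otimes>\<^sub>M M)"
      using I f by (intro measurable_pair_measure_countable1) auto
    show "integrable (count_space I) (\<lambda>i. \<integral>x. norm (?F (i, x)) \<partial>M)"
      using sum by (simp add: integrable_count_space_iff)
    show "AE i in count_space I. integrable M (\<lambda>x. ?F (i, x))"
      using f by (intro AE_I2) auto
  qed
  \<comment> \<open>This holds for every g: without absolute summability both sides are 0 by
    convention.\<close>
  have eq: "(\<Sum>\<^sub>\<infinity>i\<in>I. g i) = (\<integral>i. g i \<partial>count_space I)" for g :: "'i \<Rightarrow> complex"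
  proof (cases "(\<lambda>i. cmod (g i)) summable_on I")
    case True
    then show ?thesis by (intro infsum_eq_integral(2)) auto
  next
    case False
    then have "\<not> g summable_on I" using summable_on_iff_abs_summable_on_complex by blast
    moreover have "\<not> integrable (count_space I) g"
      using False abs_summable_equivalent[of g I] unfolding abs_summable_on_def by simp
    ultimately show ?thesis by (simp add: infsum_not_exists not_integrable_integral_eq)
  qed
  show "integrable M (\<lambda>x. \<Sum>\<^sub>\<infinity>i\<in>I. f i x)"
    unfolding eq using P.integrable_snd[of f] F by simp
  show "(\<integral>x. (\<Sum>\<^sub>\<infinity>i\<in>I. f i x) \<partial>M) = (\<Sum>\<^sub>\<infinity>i\<in>I. \<integral>x. f i x \<partial>M)"
    unfolding eq using P.integral_snd[of f] P.integral_fst[of f] F by simp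
qed

section \<open>Midpoint and difference coordinates\<close>

lemma nn_integral_translate:
  fixes f :: "'a::euclidean_space \<Rightarrow> ennreal"
  assumes [measurable]: "f \<in> borel_measurable borel"
  shows "(\<integral>\<^sup>+x. f (z + x) \<partial>lborel) = (\<integral>\<^sup>+x. f x \<partial>lborel)"
proof -
  have "(\<integral>\<^sup>+x. f x \<partial>lborel) = (\<integral>\<^sup>+x. f x \<partial>distr lborel borel ((+) z))"
    by (simp add: lborel_distr_plus)
  also have "\<dots> = (\<integral>\<^sup>+x. f (z + x) \<partial>lborel)"
    by (rule nn_integral_distr) auto
  finally show ?thesis by simp
qed

text \<open>The substitution is a composition of two shears, each of which is a translation in one
  variable while the other is held fixed. Translation invariance and Tonelli suffice, and no
  determinant appears.\<close>

lemma distr_midpoint: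
  "distr lborel borel (\<lambda>z::'a::euclidean_space \<times> 'a. (fst z - (1/2) *\<^sub>R snd z, fst z + (1/2) *\<^sub>R snd z)) = lborel"
  (is "distr _ _ ?T = _")
proof (rule measure_eqI)
  fix A assume "A \<in> sets (distr lborel borel ?T)"
  then have A[measurable]: "A \<in> sets borel" by simp
  have T[measurable]: "?T \<in> borel \<rightarrow>\<^sub>M borel"
    by (intro borel_measurable_continuous_onI continuous_intros)
  have nn_fst: "(\<integral>\<^sup>+z. g z \<partial>lborel) = (\<integral>\<^sup>+x. (\<integral>\<^sup>+y. g (x, y) \<partial>lborel) \<partial>lborel)"
    and nn_snd: "(\<integral>\<^sup>+z. g z \<partial>lborel) = (\<integral>\<^sup>+y. (\<integral>\<^sup>+x. g (x, y) \<partial>lborel) \<partial>lborel)"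
    if "g \<in> borel_measurable borel" for g :: "'a \<times> 'a \<Rightarrow> ennreal"
    using that lborel.nn_integral_fst[of g lborel] lborel_pair.nn_integral_snd[of g]
    by (simp_all add: lborel_prod)
  define g :: "'a \<times> 'a \<Rightarrow> ennreal" where "g = indicator A"
  have [measurable]: "g \<in> borel_measurable borel" unfolding g_def by simp
  have gT: "(\<lambda>z. g (?T z)) \<in> borel_measurable borel"
    using measurable_compose[OF T, of g] by simp
  have S: "(\<lambda>z::'a\<times>'a. (fst z, fst z + snd z)) \<in> borel \<rightarrow>\<^sub>M borel"
    by (intro borel_measurable_continuous_onI continuous_intros)
  have [measurable]: "(\<lambda>z::'a\<times>'a. g (fst z, fst z + snd z)) \<in> borel_measurable borel"
    using measurable_compose[OF S, of g] by simp
  have slice: "(\<lambda>y. f (x, y)) \<in> borel_measurable borel" "(\<lambda>x. f (x, y)) \<in> borel_measurable borel"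
    if "f \<in> borel_measurable borel" for f :: "'a \<times> 'a \<Rightarrow> ennreal" and x y
    using that by (auto simp: borel_prod[symmetric])
  have "emeasure (distr lborel borel ?T) A = (\<integral>\<^sup>+z. g z \<partial>distr lborel borel ?T)"
    unfolding g_def by simp
  also have "\<dots> = (\<integral>\<^sup>+z. g (?T z) \<partial>lborel)"
    by (rule nn_integral_distr) (use T in \<open>simp_all add: g_def\<close>)
  also have "\<dots> = (\<integral>\<^sup>+s. (\<integral>\<^sup>+u. g (u - (1/2) *\<^sub>R s, u + (1/2) *\<^sub>R s) \<partial>lborel) \<partial>lborel)"
    by (subst nn_snd[OF gT]) simp
  also have "\<dots> = (\<integral>\<^sup>+s. (\<integral>\<^sup>+u. g (u, u + s) \<partial>lborel) \<partial>lborel)"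
  proof (rule nn_integral_cong)
    fix s :: 'a
    have [measurable]: "(\<lambda>u. g (u, u + s)) \<in> borel_measurable borel"
      using slice(2)[of "\<lambda>z. g (fst z, fst z + snd z)" s] by simp
    have "s = (1/2) *\<^sub>R s + (1/2) *\<^sub>R s" by (simp flip: scaleR_add_left)
    then have e1: "u + (1/2) *\<^sub>R s = (- (1/2) *\<^sub>R s + u) + s" for u by (simp add: algebra_simps)
    have e2: "u - (1/2) *\<^sub>R s = - (1/2) *\<^sub>R s + u" for u by simp
    have "(\<integral>\<^sup>+u. g (u - (1/2) *\<^sub>R s, u + (1/2) *\<^sub>R s) \<partial>lborel) =
      (\<integral>\<^sup>+u. g (- (1/2) *\<^sub>R s + u, (- (1/2) *\<^sub>R s + u) + s) \<partial>lborel)"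
      unfolding e1 e2 ..
    also have "\<dots> = (\<integral>\<^sup>+u. g (u, u + s) \<partial>lborel)"
      by (rule nn_integral_translate[of "\<lambda>u. g (u, u + s)"]) simp
    finally show "(\<integral>\<^sup>+u. g (u - (1/2) *\<^sub>R s, u + (1/2) *\<^sub>R s) \<partial>lborel) = (\<integral>\<^sup>+u. g (u, u + s) \<partial>lborel)" .
  qed
  also have "\<dots> = (\<integral>\<^sup>+u. (\<integral>\<^sup>+s. g (u, u + s) \<partial>lborel) \<partial>lborel)"
    using nn_fst[of "\<lambda>z. g (fst z, fst z + snd z)"] nn_snd[of "\<lambda>z. g (fst z, fst z + snd z)"] by simp
  also have "\<dots> = (\<integral>\<^sup>+u. (\<integral>\<^sup>+s. g (u, s) \<partial>lborel) \<partial>lborel)"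
  proof (rule nn_integral_cong)
    fix u :: 'a
    show "(\<integral>\<^sup>+s. g (u, u + s) \<partial>lborel) = (\<integral>\<^sup>+s. g (u, s) \<partial>lborel)"
      by (rule nn_integral_translate[of "\<lambda>s. g (u, s)"]) (rule slice(1), simp)
  qed
  also have "\<dots> = (\<integral>\<^sup>+z. g z \<partial>lborel)"
    by (rule nn_fst[symmetric]) simp
  also have "\<dots> = emeasure lborel A" unfolding g_def by simp
  finally show "emeasure (distr lborel borel ?T) A = emeasure lborel A" .
qed simp

lemma
  fixes F :: "'a::euclidean_space \<times> 'a \<Rightarrow> complex"
  assumes F: "integrable lborel F"
  shows integrable_midpoint: "integrable lborel (\<lambda>z. F (fst z - (1/2) *\<^sub>R snd z, fst z + (1/2) *\<^sub>R snd z))"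
    and integral_midpoint: "(\<integral>z. F (fst z - (1/2) *\<^sub>R snd z, fst z + (1/2) *\<^sub>R snd z) \<partial>lborel) = (\<integral>z. F z \<partial>lborel)"
proof -
  let ?T = "\<lambda>z::'a \<times> 'a. (fst z - (1/2) *\<^sub>R snd z, fst z + (1/2) *\<^sub>R snd z)"
  have T: "?T \<in> lborel \<rightarrow>\<^sub>M borel"
    using borel_measurable_continuous_onI[of ?T] by (simp add: continuous_intros)
  have [measurable]: "F \<in> borel_measurable borel" using F by auto
  have "integrable (distr lborel borel ?T) F" unfolding distr_midpoint by (rule F)
  then show "integrable lborel (\<lambda>z. F (?T z))"
    by (subst (asm) integrable_distr_eq[OF T]) auto
  have "(\<integral>z. F (?T z) \<partial>lborel) = (\<integral>z. F z \<partial>distr lborel borel ?T)"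
    by (rule integral_distr[OF T, symmetric]) auto
  then show "(\<integral>z. F (?T z) \<partial>lborel) = (\<integral>z. F z \<partial>lborel)" unfolding distr_midpoint .
qed

section \<open>Gaussians as Schwartz functions\<close>

lemma wt_power_gauss_bounded: "\<exists>C. \<forall>x::'a::euclidean_space. wt x ^ N * gauss x \<le> C"
proof (intro exI allI)
  fix x :: 'a
  \<comment> \<open>Large enough for \<open>1 + t^2 \<le> M * exp (t^2 / M)\<close>, and such that
    the N-th power of the exponential is still at most \<open>exp (t^2 / 2)\<close>.\<close>
  define M where "M = real (2 * (N + 1))"
  have M: "M \<ge> 2" by (simp add: M_def)
  have one: "(1 + t\<^sup>2) ^ N * exp (- t\<^sup>2 / 2) \<le> M ^ N" for t :: real
  proof -
    have "1 + t\<^sup>2 \<le> M * (1 + t\<^sup>2 / M)" using M by (simp add: field_simps)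
    also have "\<dots> \<le> M * exp (t\<^sup>2 / M)" using M exp_ge_add_one_self[of "t\<^sup>2 / M"] by (intro mult_left_mono) auto
    finally have "(1 + t\<^sup>2) ^ N \<le> (M * exp (t\<^sup>2 / M)) ^ N" by (intro power_mono) auto
    also have "\<dots> = M ^ N * exp (N * (t\<^sup>2 / M))" by (simp only: power_mult_distrib exp_of_nat_mult)
    also have "N * (t\<^sup>2 / M) \<le> t\<^sup>2 / 2"
    proof -
      have "real N * t\<^sup>2 * 2 \<le> t\<^sup>2 * M" by (simp add: M_def algebra_simps)
      then show ?thesis using M by (simp add: field_simps)
    qed
    finally have "(1 + t\<^sup>2) ^ N \<le> M ^ N * exp (t\<^sup>2 / 2)" using M by (simp add: mult_left_mono)
    then have "(1 + t\<^sup>2) ^ N * exp (- t\<^sup>2 / 2) \<le> M ^ N * exp (t\<^sup>2 / 2) * exp (- t\<^sup>2 / 2)"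
      by (intro mult_right_mono) auto
    then show ?thesis by (simp add: mult.assoc flip: exp_add)
  qed
  have "wt x ^ N * gauss x = (\<Prod>b\<in>Basis. (1 + (x \<bullet> b)\<^sup>2) ^ N * exp (- (x \<bullet> b)\<^sup>2 / 2))"
    by (simp add: wt_def gauss_eq_prod prod.distrib prod_power_distrib)
  also have "\<dots> \<le> (\<Prod>b\<in>(Basis::'a set). M ^ N)"
    by (intro prod_mono conjI one) auto
  finally show "wt x ^ N * gauss x \<le> (\<Prod>b\<in>(Basis::'a set). real (2 * (N + 1)) ^ N)" by (simp add: M_def)
qed

text \<open>Polynomials times the Gaussian, generated in the way that suits
  \<open>schwartz_coinduct\<close>.\<close>

inductive gauss_span :: "('a::euclidean_space \<Rightarrow> complex) \<Rightarrow> bool" where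
  base: "gauss_span (\<lambda>x. of_real (gauss x))"
| coord: "gauss_span f \<Longrightarrow> b \<in> Basis \<Longrightarrow> gauss_span (\<lambda>x. of_real (x \<bullet> b) * f x)"
| add: "gauss_span f \<Longrightarrow> gauss_span g \<Longrightarrow> gauss_span (\<lambda>x. f x + g x)"
| scale: "gauss_span f \<Longrightarrow> gauss_span (\<lambda>x. c * f x)"

lemma has_derivative_gauss:
  "((\<lambda>x. complex_of_real (gauss x)) has_derivative (\<lambda>h. - (of_real (x \<bullet> h) * of_real (gauss x)))) (at x)"
proof -
  have "((\<lambda>x. - (x \<bullet> x) / 2) has_derivative (\<lambda>h. - (x \<bullet> h))) (at x)"
    by (auto intro!: derivative_eq_intros simp: inner_commute)
  from has_derivative_of_real[OF has_derivative_compose[OF this DERIV_exp[unfolded has_field_derivative_def]]]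
  show ?thesis by (simp add: gauss_def mult_ac)
qed

lemma schwartz_gauss: "schwartz (\<lambda>x. complex_of_real (gauss x))"
proof (rule schwartz_coinduct[where P = gauss_span], goal_cases)
  case 1
  show ?case by (rule gauss_span.base)
next
  case (2 f)
  then have "\<exists>C\<ge>0. \<exists>N. \<forall>x. cmod (f x) \<le> C * (wt x ^ N * gauss x)"
  proof induction
    case base
    show ?case by (intro exI[of _ 1] conjI exI[of _ 0]) (auto simp: wt_ge1)
  next
    case (coord f b)
    then obtain C N where C: "C \<ge> 0" "\<And>x. cmod (f x) \<le> C * (wt x ^ N * gauss x)" by blast
    have "cmod (of_real (x \<bullet> b) * f x) \<le> C * (wt x ^ Suc N * gauss x)" for x
      using mult_mono[OF abs_inner_le_wt[OF coord.hyps(2)] C(2), of x x] by (simp add: norm_mult mult_ac)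
    with C(1) show ?case by blast
  next
    case (add f g)
    then obtain C N C' N' where C: "C \<ge> 0" "\<And>x. cmod (f x) \<le> C * (wt x ^ N * gauss x)"
      and C': "C' \<ge> 0" "\<And>x. cmod (g x) \<le> C' * (wt x ^ N' * gauss x)" by blast
    have "cmod (f x + g x) \<le> (C + C') * (wt x ^ (N + N') * gauss x)" for x
    proof -
      have "cmod (f x + g x) \<le> C * (wt x ^ N * gauss x) + C' * (wt x ^ N' * gauss x)"
        by (rule order_trans[OF norm_triangle_ineq add_mono[OF C(2) C'(2)]])
      also have "\<dots> \<le> C * (wt x ^ (N + N') * gauss x) + C' * (wt x ^ (N + N') * gauss x)"
        using C(1) C'(1) by (intro add_mono mult_left_mono mult_right_mono power_increasing wt_ge1) auto
      finally show ?thesis by (simp add: distrib_right)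
    qed
    with C(1) C'(1) show ?case by (intro exI[of _ "C + C'"] conjI exI[of _ "N + N'"]) auto
  next
    case (scale f c)
    then obtain C N where C: "C \<ge> 0" "\<And>x. cmod (f x) \<le> C * (wt x ^ N * gauss x)" by blast
    have "cmod (c * f x) \<le> (cmod c * C) * (wt x ^ N * gauss x)" for x
      using mult_left_mono[OF C(2), of "cmod c" x] by (simp add: norm_mult mult.assoc)
    with C(1) show ?case by (intro exI[of _ "cmod c * C"] conjI exI[of _ N]) auto
  qed
  then obtain C N where C: "C \<ge> 0" "\<And>x. cmod (f x) \<le> C * (wt x ^ N * gauss x)" by blast
  obtain B where B: "\<And>x::'a. wt x ^ N * gauss x \<le> B" using wt_power_gauss_bounded by blast
  have "cmod (f x) \<le> C * B" for x
    by (rule order_trans[OF C(2) mult_left_mono[OF B C(1)]])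
  then show ?case by blast
next
  case (3 f)
  then show ?case
  proof induction
    case base
    have "gauss_span (\<lambda>x. - 1 * (of_real (x \<bullet> b) * of_real (gauss x)))" if "b \<in> Basis" for b :: 'a
      by (intro gauss_span.scale gauss_span.coord gauss_span.base that)
    then show ?case
      by (intro exI[of _ "\<lambda>x h. - (of_real (x \<bullet> h) * of_real (gauss x))"] conjI allI has_derivative_gauss) simp
  next
    case (coord f b)
    then obtain D where D: "\<forall>x. (f has_derivative D x) (at x)" "\<forall>b\<in>Basis. gauss_span (\<lambda>x. D x b)"
      by (elim exE conjE) (rule that)
    have "((\<lambda>x. of_real (x \<bullet> b) * f x) has_derivative
       (\<lambda>h. of_real (x \<bullet> b) * D x h + of_real (h \<bullet> b) * f x)) (at x)" for x
      using D(1)[rule_format, of x] by (auto intro!: derivative_eq_intros)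
    moreover have "gauss_span (\<lambda>x. of_real (x \<bullet> b) * D x c + of_real (c \<bullet> b) * f x)" if "c \<in> Basis" for c
      by (intro gauss_span.add gauss_span.coord D(2)[rule_format] that coord.hyps gauss_span.scale)
    ultimately show ?case
      by (intro exI[of _ "\<lambda>x h. of_real (x \<bullet> b) * D x h + of_real (h \<bullet> b) * f x"]) auto
  next
    case (add f g)
    from add.IH(1) obtain D where D: "\<forall>x. (f has_derivative D x) (at x)" "\<forall>b\<in>Basis. gauss_span (\<lambda>x. D x b)"
      by (elim exE conjE) (rule that)
    from add.IH(2) obtain E where E: "\<forall>x. (g has_derivative E x) (at x)" "\<forall>b\<in>Basis. gauss_span (\<lambda>x. E x b)"
      by (elim exE conjE) (rule that)
    show ?case
      by (intro exI[of _ "\<lambda>x h. D x h + E x h"] conjI allI ballI has_derivative_add gauss_span.add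
          D[rule_format] E[rule_format])
  next
    case (scale f c)
    then obtain D where D: "\<forall>x. (f has_derivative D x) (at x)" "\<forall>b\<in>Basis. gauss_span (\<lambda>x. D x b)"
      by (elim exE conjE) (rule that)
    show ?case
      by (intro exI[of _ "\<lambda>x h. c * D x h"] conjI allI ballI has_derivative_mult_right gauss_span.scale D[rule_format])
  qed
next
  case (4 f b)
  then show ?case by (intro gauss_span.coord)
qed

lemma schwartz_gauss_affine:
  assumes "c \<noteq> 0" shows "schwartz (\<lambda>x. complex_of_real (gauss (c *\<^sub>R (x - a))))"
  using schwartz_affine[OF schwartz_gauss, of "\<lambda>x. c *\<^sub>R x" "\<lambda>x. (1 / c) *\<^sub>R x" "- (c *\<^sub>R a)"] assms
  by (simp add: linear_iff scaleR_right_distrib scaleR_right_diff_distrib)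

section \<open>Functions orthogonal to the Schwartz space\<close>

text \<open>The positive and the negative part of h are densities of two measures that agree on open
  boxes. Boxes are stable under intersection and generate the Borel sets, so the measures and then
  their densities coincide, which forces both parts to vanish.\<close>

lemma AE_zero_if_box_integrals_zero:
  fixes h :: "'a::euclidean_space \<Rightarrow> real"
  assumes [measurable]: "h \<in> borel_measurable borel"
    and int: "\<And>l u. integrable lborel (\<lambda>x. indicator (box l u) x * h x)"
    and zero: "\<And>l u. (\<integral>x. indicator (box l u) x * h x \<partial>lborel) = 0"
  shows "AE x in lborel. h x = 0"
proof -
  define N where "N f = density (lborel::'a measure) (\<lambda>x. ennreal (f x))" for f :: "'a \<Rightarrow> real"
  have em: "emeasure (N f) (box l u) = (\<integral>\<^sup>+x. ennreal (indicator (box l u) x * f x) \<partial>lborel)"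
    if [measurable]: "f \<in> borel_measurable borel" for f l u
    unfolding N_def by (subst emeasure_density) (auto intro!: nn_integral_cong split: split_indicator)
  have fin: "(\<integral>\<^sup>+x. ennreal (indicator (box l u) x * h x) \<partial>lborel) < \<infinity>"
    "(\<integral>\<^sup>+x. ennreal (indicator (box l u) x * - h x) \<partial>lborel) < \<infinity>" for l u
    using int[of l u] integrable_minus[OF int[of l u]]
    unfolding real_integrable_def by (auto simp: less_top)
  have eq: "emeasure (N h) (box l u) = emeasure (N (\<lambda>x. - h x)) (box l u)" for l u
  proof -
    define A where "A = (\<integral>\<^sup>+x. ennreal (indicator (box l u) x * h x) \<partial>lborel)"
    define B where "B = (\<integral>\<^sup>+x. ennreal (indicator (box l u) x * - h x) \<partial>lborel)"
    have "enn2real A = enn2real B"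
      using zero[of l u] real_lebesgue_integral_def[OF int[of l u]] by (simp add: A_def B_def)
    moreover have "A < top" "B < top" using fin[of l u] by (simp_all add: A_def B_def)
    ultimately have "A = B" by (metis ennreal_enn2real)
    then have "(\<integral>\<^sup>+x. ennreal (indicator (box l u) x * h x) \<partial>lborel) = (\<integral>\<^sup>+x. ennreal (indicator (box l u) x * - h x) \<partial>lborel)"
      unfolding A_def B_def .
    then show ?thesis by (simp add: em)
  qed
  have "N h = N (\<lambda>x. - h x)"
  proof (rule measure_eqI_generator_eq)
    let ?E = "range (\<lambda>(a, b). box a b::'a set)"
    show "Int_stable ?E" by (auto simp: Int_stable_def box_Int_box)
    show "?E \<subseteq> Pow UNIV" "sets (N h) = sigma_sets UNIV ?E" "sets (N (\<lambda>x. - h x)) = sigma_sets UNIV ?E"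
      by (simp_all add: borel_eq_box N_def)
    let ?A = "\<lambda>n::nat. box (- (real n *\<^sub>R One)) (real n *\<^sub>R One) :: 'a set"
    show "range ?A \<subseteq> ?E" "(\<Union>i. ?A i) = UNIV" unfolding UN_box_eq_UNIV by auto
    show "emeasure (N h) (?A i) \<noteq> \<infinity>" for i using fin(1) by (simp add: em less_top)
    show "emeasure (N h) X = emeasure (N (\<lambda>x. - h x)) X" if "X \<in> ?E" for X
      using that eq by auto
  qed
  then have "AE x in lborel. ennreal (h x) = ennreal (- h x)"
    unfolding N_def by (intro sigma_finite_measure.density_unique[OF sigma_finite_lborel]) auto
  then show ?thesis
  proof eventually_elim
    case (elim x)
    then show ?case
      by (cases "h x" "0::real" rule: linorder_cases) (auto simp: ennreal_neg dest!: sym[of 0])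
  qed
qed

lemma AE_lborel_snd:
  assumes "AE y in lborel. P (y::'b::euclidean_space)"
  shows "AE z in lborel. P (snd (z::'a::euclidean_space \<times> 'b))"
proof -
  obtain N where N: "N \<in> null_sets lborel" "{y \<in> space lborel. \<not> P y} \<subseteq> N"
    using assms unfolding eventually_ae_filter by blast
  have "UNIV \<times> N \<in> null_sets (lborel \<Otimes>\<^sub>M lborel :: ('a \<times> 'b) measure)"
    using N(1) by (intro lborel.times_in_null_sets2) auto
  then have "UNIV \<times> N \<in> null_sets (lborel :: ('a \<times> 'b) measure)" by (simp add: lborel_prod)
  then show ?thesis by (rule AE_I') (use N(2) in auto)
qed

lemma AE_lborel_fst:
  assumes "AE x in lborel. P (x::'a::euclidean_space)"
  shows "AE z in lborel. P (fst (z::'a \<times> 'b::euclidean_space))"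
proof -
  obtain N where N: "N \<in> null_sets lborel" "{y \<in> space lborel. \<not> P y} \<subseteq> N"
    using assms unfolding eventually_ae_filter by blast
  have "N \<times> UNIV \<in> null_sets (lborel \<Otimes>\<^sub>M lborel :: ('a \<times> 'b) measure)"
    using N(1) by (intro lborel.times_in_null_sets1) auto
  then have "N \<times> UNIV \<in> null_sets (lborel :: ('a \<times> 'b) measure)" by (simp add: lborel_prod)
  then show ?thesis by (rule AE_I') (use N(2) in auto)
qed

lemma AE_not_in_box_boundary: "AE y in lborel. y \<notin> cbox l u - box l (u::'a::euclidean_space)"
proof -
  have "emeasure lborel (cbox l u - box l u) = emeasure lborel (cbox l u) - emeasure lborel (box l u)"
    by (rule emeasure_Diff) (auto simp: emeasure_lborel_box_eq box_subset_cbox)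
  also have "\<dots> = 0" by (simp add: emeasure_lborel_box_eq emeasure_lborel_cbox_eq)
  finally have "cbox l u - box l u \<in> null_sets lborel" by (intro null_setsI) auto
  then show ?thesis by (rule AE_not_in)
qed

lemma integrable_gauss_wt: "integrable lborel (\<lambda>w::'a::euclidean_space. gauss w * wt w)"
proof -
  obtain B where B: "\<And>x::'a. wt x ^ 2 * gauss x \<le> B" using wt_power_gauss_bounded by blast
  have "integrable lborel (\<lambda>w::'a. complex_of_real (gauss w * wt w))"
  proof (rule integrable_wt_bound)
    show "cmod (complex_of_real (gauss w * wt w)) \<le> B / wt w" for w :: 'a
      using B[of w] by (simp add: norm_mult pos_le_divide_eq power2_eq_square mult_ac)
  qed measurable
  from integrable_norm[OF this] show ?thesis by (simp add: norm_mult)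
qed

text \<open>A square-integrable function need not be integrable, but \<open>1 / wt\<close> is
  square-integrable as well, so the quotient is. It replaces h in the product majorants for
  Fubini.\<close>

lemma integrable_cmod_div_wt:
  fixes h :: "'a::euclidean_space \<Rightarrow> complex"
  assumes [measurable]: "h \<in> borel_measurable borel" and h2: "integrable lborel (\<lambda>x. (cmod (h x))\<^sup>2)"
  shows "integrable lborel (\<lambda>x. cmod (h x) / wt x)"
proof (rule Bochner_Integration.integrable_bound)
  show "integrable lborel (\<lambda>x. (cmod (h x))\<^sup>2 + 1 / wt x)" 
    using h2 integrable_inverse_wt by (rule Bochner_Integration.integrable_add)
  show "AE x in lborel. norm (cmod (h x) / wt x) \<le> norm ((cmod (h x))\<^sup>2 + 1 / wt x)"
  proof (rule AE_I2)
    fix x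
    have "2 * (cmod (h x) * (1 / wt x)) \<le> (cmod (h x))\<^sup>2 + (1 / wt x)\<^sup>2"
      using sum_squares_bound[of "cmod (h x)" "1 / wt x"] by (simp only: mult.assoc)
    moreover have "(1 / wt x)\<^sup>2 \<le> 1 / wt x"
      using wt_ge1[of x] by (simp add: power2_eq_square divide_simps)
    moreover have "0 \<le> cmod (h x) * (1 / wt x)" by simp
    ultimately have "cmod (h x) * (1 / wt x) \<le> (cmod (h x))\<^sup>2 + 1 / wt x" by linarith
    then show "norm (cmod (h x) / wt x) \<le> norm ((cmod (h x))\<^sup>2 + 1 / wt x)"
      by simp
  qed
qed measurable

text \<open>Testing against Gaussians of width tending to 0 recovers the integrals of h over boxes.\<close>

lemma AE_zero_if_orthogonal_schwartz:
  fixes h :: "'a::euclidean_space \<Rightarrow> complex"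
  assumes h[measurable]: "h \<in> borel_measurable borel" and h2: "integrable lborel (\<lambda>x. (cmod (h x))\<^sup>2)"
    and orth: "\<And>f. schwartz f \<Longrightarrow> (\<integral>x. f x * h x \<partial>lborel) = 0"
  shows "AE x in lborel. h x = 0"
proof -
  have hw: "integrable lborel (\<lambda>x. cmod (h x) / wt x)" by (rule integrable_cmod_div_wt[OF h h2])
  have box: "integrable lborel (\<lambda>x. indicator (box l u) x * h x) \<and> (\<integral>x. indicator (box l u) x * h x \<partial>lborel) = 0" for l u
  proof -
    define U :: "'a \<Rightarrow> complex" where "U = indicator (box l u)"
    have U[measurable]: "U \<in> borel_measurable borel" by (simp add: U_def)
    \<comment> \<open>Of the two powers, one is spent on turning the decay of the Gaussian in
      \<open>a - y\<close> into decay in y, the other keeps the integral over the box variable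
      finite.\<close>
    obtain C where C: "C \<ge> 0" "\<And>x. cmod (U x) \<le> C / wt x ^ 2"
    proof -
      have "bounded (wt ` cbox l u)"
        by (intro compact_imp_bounded compact_continuous_image continuous_intros compact_cbox)
      then obtain B where B: "\<And>x. x \<in> cbox l u \<Longrightarrow> wt x \<le> B" by (auto simp: bounded_iff)
      show ?thesis
      proof
        show "0 \<le> B\<^sup>2" by simp
        show "cmod (U x) \<le> B\<^sup>2 / wt x ^ 2" for x
        proof (cases "x \<in> box l u")
          case True
          then have "wt x ^ 2 \<le> B\<^sup>2" using B box_subset_cbox by (intro power_mono) auto
          then show ?thesis using True by (simp add: U_def pos_le_divide_eq)
        qed (simp add: U_def)
      qed
    qed
    have C1: "cmod (U x) \<le> C / wt x" for x
    proof -
      have "C / wt x ^ 2 \<le> C / wt x"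
        using C(1) wt_ge1[of x] by (intro divide_left_mono) (auto simp: power2_eq_square mult_le_cancel_right1)
      with C(2)[of x] show ?thesis by linarith
    qed
    define e where "e n = 1 / real (Suc n)" for n
    have e: "e n > 0" "e n \<le> 1" for n by (auto simp: e_def divide_le_eq)
    \<comment> \<open>Integrating out the first variable smears the box indicator with a Gaussian of
      width \<open>e n\<close>; in the limit the smearing disappears.\<close>
    define F where "F n z = of_real (gauss (fst z)) * U (snd z + e n *\<^sub>R fst z) * h (snd z)" for n and z :: "'a \<times> 'a"
    have wte: "wt (e n *\<^sub>R w) \<le> wt w" for n and w :: 'a
    proof -
      have "(e n)\<^sup>2 * t\<^sup>2 \<le> t\<^sup>2" for t
        using e[of n] mult_right_mono[of "(e n)\<^sup>2" 1 "t\<^sup>2"] by (simp add: power_le_one)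
      then show ?thesis unfolding wt_def by (intro prod_mono) (simp add: power_mult_distrib)
    qed
    have F_le: "cmod (F n (w, y)) \<le> (C * 2 ^ DIM('a) * (gauss w * wt w)) * (cmod (h y) / wt y)" for n w y
    proof -
      have "cmod (U (y + e n *\<^sub>R w)) \<le> C * (1 / wt (y + e n *\<^sub>R w))" using C1[of "y + e n *\<^sub>R w"] by simp
      also have "\<dots> \<le> C * (2 ^ DIM('a) * wt (e n *\<^sub>R w) / wt y)"
        by (intro mult_left_mono inverse_wt_shift C(1))
      also have "\<dots> \<le> C * (2 ^ DIM('a) * wt w / wt y)"
        by (intro mult_left_mono divide_right_mono wte C(1)) auto
      finally have "gauss w * cmod (U (y + e n *\<^sub>R w)) * cmod (h y) \<le> gauss w * (C * (2 ^ DIM('a) * wt w / wt y)) * cmod (h y)"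
        by (intro mult_right_mono mult_left_mono) auto
      then show ?thesis by (simp add: F_def norm_mult mult_ac)
    qed
    have gw: "integrable lborel (\<lambda>w::'a. C * 2 ^ DIM('a) * (gauss w * wt w))"
      by (rule integrable_mult_right[OF integrable_gauss_wt])
    have [measurable]: "F n \<in> borel_measurable borel" for n
    proof -
      have [measurable]: "(\<lambda>z::'a\<times>'a. snd z + e n *\<^sub>R fst z) \<in> borel_measurable borel"
        by (intro borel_measurable_continuous_onI continuous_intros)
      have [measurable]: "(\<lambda>z::'a\<times>'a. U (snd z + e n *\<^sub>R fst z)) \<in> borel_measurable borel"
        using measurable_compose[OF \<open>(\<lambda>z::'a\<times>'a. snd z + e n *\<^sub>R fst z) \<in> borel_measurable borel\<close> U] by simp
      show ?thesis unfolding F_def[abs_def] borel_prod[symmetric] by measurable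
    qed
    have Fi: "integrable lborel (F n)" for n
      by (rule integrable_tensor_bound[OF _ gw hw F_le]) simp
    have Uh: "integrable lborel (\<lambda>y. U y * h y)"
    proof (rule Bochner_Integration.integrable_bound)
      show "integrable lborel (\<lambda>y. C * (cmod (h y) / wt y))" using hw by (rule integrable_mult_right)
      show "AE y in lborel. cmod (U y * h y) \<le> norm (C * (cmod (h y) / wt y))"
        using mult_right_mono[OF C1, of "cmod (h y)" y for y] C(1) by (intro AE_I2) (simp add: norm_mult)
    qed measurable
    \<comment> \<open>With the substitution \<open>a = y + e n *\<^sub>R w\<close> the integral over
      y pairs h with a Gaussian centred at a. That Gaussian is a Schwartz function, so the pairing
      is 0 by orthogonality.\<close>
    have F0: "(\<integral>z. F n z \<partial>lborel) = 0" for n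
    proof -
      define G where "G z = U (fst z) * of_real (gauss ((1 / e n) *\<^sub>R (fst z - snd z))) * h (snd z)" for z :: "'a \<times> 'a"
      have sg: "schwartz (\<lambda>x::'a. complex_of_real (gauss ((1 / e n) *\<^sub>R (x - a))))" for a
        using e(1)[of n] by (intro schwartz_gauss_affine) simp
      obtain B where B: "B \<ge> 0" "\<And>x::'a. gauss ((1 / e n) *\<^sub>R x) \<le> B / wt x"
        using schwartz_bound[OF sg[of 0], of 1] by auto
      have "integrable lborel G"
      proof (rule integrable_tensor_bound[OF _ _ hw])
        show "integrable lborel (\<lambda>a::'a. C * B * 2 ^ DIM('a) * (1 / wt a))"
          by (rule integrable_mult_right[OF integrable_inverse_wt])
        show "cmod (G (a, y)) \<le> C * B * 2 ^ DIM('a) * (1 / wt a) * (cmod (h y) / wt y)" for a y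
        proof -
          have "gauss ((1 / e n) *\<^sub>R (a - y)) \<le> B * (1 / wt (- y + a))"
            using B(2)[of "a - y"] by (simp add: add.commute)
          also have "\<dots> \<le> B * (2 ^ DIM('a) * wt a / wt (- y))"
            by (intro mult_left_mono inverse_wt_shift B(1))
          finally have g: "gauss ((1 / e n) *\<^sub>R (a - y)) \<le> B * (2 ^ DIM('a) * wt a / wt y)" by simp
          have "cmod (U a) * gauss ((1 / e n) *\<^sub>R (a - y)) \<le> (C / wt a ^ 2) * (B * (2 ^ DIM('a) * wt a / wt y))"
            using C(1) by (intro mult_mono C(2) g) auto
          also have "\<dots> = C * B * 2 ^ DIM('a) * (1 / wt a) / wt y" by (simp add: power2_eq_square)
          finally have "cmod (U a) * gauss ((1 / e n) *\<^sub>R (a - y)) * cmod (h y) \<le> C * B * 2 ^ DIM('a) * (1 / wt a) / wt y * cmod (h y)"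
            by (intro mult_right_mono) auto
          then show ?thesis by (simp add: G_def norm_mult)
        qed
        have [measurable]: "(\<lambda>z::'a\<times>'a. gauss ((1 / e n) *\<^sub>R (fst z - snd z))) \<in> borel_measurable borel"
          by (intro borel_measurable_continuous_onI continuous_intros)
        show "G \<in> borel_measurable borel"
          unfolding G_def[abs_def] borel_prod[symmetric] by measurable
      qed
      from lborel_integral_swap[OF this]
      have "(\<integral>y. (\<integral>a. G (a, y) \<partial>lborel) \<partial>lborel) = (\<integral>a. (\<integral>y. G (a, y) \<partial>lborel) \<partial>lborel)" ..
      also have "\<dots> = (\<integral>a. U a * (\<integral>y. of_real (gauss ((1 / e n) *\<^sub>R (y - a))) * h y \<partial>lborel) \<partial>lborel)"
      proof (rule Bochner_Integration.integral_cong[OF refl])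
        fix a :: 'a
        have g: "gauss ((1 / e n) *\<^sub>R (a - y)) = gauss ((1 / e n) *\<^sub>R (y - a))" for y
          using gauss_minus[of "(1 / e n) *\<^sub>R (y - a)"] by (simp flip: scaleR_minus_right)
        show "(\<integral>y. G (a, y) \<partial>lborel) = U a * (\<integral>y. of_real (gauss ((1 / e n) *\<^sub>R (y - a))) * h y \<partial>lborel)"
          by (subst integral_mult_right_zero[symmetric]) (simp add: G_def g mult.assoc)
      qed
      also have "\<dots> = 0" using orth[OF sg] by simp
      finally have G0: "(\<integral>y. (\<integral>a. G (a, y) \<partial>lborel) \<partial>lborel) = 0" .
      have "(\<integral>a. G (a, y) \<partial>lborel) = of_real (\<bar>e n\<bar> ^ DIM('a)) * (\<integral>w. F n (w, y) \<partial>lborel)" for y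
      proof -
        have "(\<integral>a. G (a, y) \<partial>lborel) = of_real (\<bar>e n\<bar> ^ DIM('a)) * (\<integral>w. G (y + e n *\<^sub>R w, y) \<partial>lborel)"
        proof (rule integral_affine)
          have [measurable]: "(\<lambda>a. gauss ((1 / e n) *\<^sub>R (a - y))) \<in> borel_measurable borel"
            by (intro borel_measurable_continuous_onI continuous_intros)
          show "(\<lambda>a. G (a, y)) \<in> borel_measurable borel" unfolding G_def fst_conv snd_conv by measurable
        qed (use e(1)[of n] in auto)
        also have "(\<integral>w. G (y + e n *\<^sub>R w, y) \<partial>lborel) = (\<integral>w. F n (w, y) \<partial>lborel)"
          using e(1)[of n] by (intro Bochner_Integration.integral_cong refl) (simp add: G_def F_def)
        finally show ?thesis .
      qed
      then have "of_real (\<bar>e n\<bar> ^ DIM('a)) * (\<integral>y. (\<integral>w. F n (w, y) \<partial>lborel) \<partial>lborel) = 0"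
        using G0 by simp
      then have "(\<integral>y. (\<integral>w. F n (w, y) \<partial>lborel) \<partial>lborel) = 0" using e(1)[of n] by simp
      then show ?thesis using lborel_integral_snd[OF Fi] by simp
    qed
    have "(\<lambda>n. \<integral>z. F n z \<partial>lborel) \<longlonglongrightarrow> (\<integral>z. of_real (gauss (fst z)) * (U (snd z) * h (snd z)) \<partial>(lborel::('a\<times>'a) measure))"
    proof (rule integral_dominated_convergence[where w = "\<lambda>z::'a\<times>'a. (C * 2 ^ DIM('a) * (gauss (fst z) * wt (fst z))) * (cmod (h (snd z)) / wt (snd z))"])
      show "integrable lborel (\<lambda>z::'a\<times>'a. (C * 2 ^ DIM('a) * (gauss (fst z) * wt (fst z))) * (cmod (h (snd z)) / wt (snd z)))"
        by (rule integrable_tensor[OF gw hw])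
      show "AE z in lborel. cmod (F n z) \<le> (C * 2 ^ DIM('a) * (gauss (fst z) * wt (fst z))) * (cmod (h (snd z)) / wt (snd z))" for n
        using F_le[of n "fst z" "snd z" for z] by (intro AE_I2) simp
      show "(\<lambda>z::'a\<times>'a. of_real (gauss (fst z)) * (U (snd z) * h (snd z))) \<in> borel_measurable lborel"
        by (rule borel_measurable_integrable[OF integrable_tensor[OF integrable_gauss_complex Uh]])
      \<comment> \<open>Off the boundary of the box its indicator is locally constant, hence the
        sequence is eventually constant there; the boundary is a null set.\<close>
      have "AE z in lborel. snd (z::'a\<times>'a) \<notin> cbox l u - box l u"
        by (rule AE_lborel_snd[OF AE_not_in_box_boundary])
      then show "AE z in lborel. (\<lambda>n. F n z) \<longlonglongrightarrow> of_real (gauss (fst z)) * (U (snd z) * h (snd z))"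
      proof eventually_elim
        case (elim z)
        have lim: "(\<lambda>n. snd z + e n *\<^sub>R fst z) \<longlonglongrightarrow> snd z"
          using tendsto_add[OF tendsto_const[of "snd z"] LIMSEQ_inverse_Suc_scaleR[of "fst z"]] by (simp add: e_def)
        have "eventually (\<lambda>n. U (snd z + e n *\<^sub>R fst z) = U (snd z)) sequentially"
        proof (cases "snd z \<in> box l u")
          case True
          from topological_tendstoD[OF lim open_box this] show ?thesis
            by eventually_elim (use True in \<open>simp add: U_def\<close>)
        next
          case False
          with elim have "snd z \<in> - cbox l u" by auto
          from topological_tendstoD[OF lim _ this] have "eventually (\<lambda>n. snd z + e n *\<^sub>R fst z \<in> - cbox l u) sequentially"
            by (simp add: closed_cbox open_Compl)
          then show ?thesis
            by eventually_elim (use False box_subset_cbox[of l u] in \<open>auto simp: U_def indicator_def\<close>)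
        qed
        then have "eventually (\<lambda>n. F n z = of_real (gauss (fst z)) * (U (snd z) * h (snd z))) sequentially"
          by eventually_elim (simp add: F_def)
        then show ?case by (rule tendsto_eventually)
      qed
    qed simp
    then have "(\<integral>z. of_real (gauss (fst z)) * (U (snd z) * h (snd z)) \<partial>(lborel::('a\<times>'a) measure)) = 0"
      by (simp add: F0 LIMSEQ_const_iff)
    moreover have "(\<integral>z. of_real (gauss (fst z)) * (U (snd z) * h (snd z)) \<partial>(lborel::('a\<times>'a) measure)) =
       of_real (sqrt (2 * pi) ^ DIM('a)) * (\<integral>y. U y * h y \<partial>lborel)"
      by (subst lborel_integral_fst[OF integrable_tensor[OF integrable_gauss_complex Uh], symmetric])
        (simp add: integral_gauss_complex[where 'a = 'a, simplified])
    ultimately have "(\<integral>y. U y * h y \<partial>lborel) = 0" by simp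
    with Uh show ?thesis by (simp add: U_def)
  qed
  have Re_eq: "indicator (box l u) x * Re (h x) = Re (indicator (box l u) x * h x)"
    and Im_eq: "indicator (box l u) x * Im (h x) = Im (indicator (box l u) x * h x)" for l u x
    by (auto split: split_indicator)
  note i = box[THEN conjunct1] and z = box[THEN conjunct2]
  have "AE x in lborel. Re (h x) = 0"
  proof (rule AE_zero_if_box_integrals_zero)
    show "integrable lborel (\<lambda>x. indicator (box l u) x * Re (h x))" for l u
      unfolding Re_eq by (rule integrable_bounded_linear[OF bounded_linear_Re i])
    show "(\<integral>x. indicator (box l u) x * Re (h x) \<partial>lborel) = 0" for l u
      unfolding Re_eq integral_bounded_linear[OF bounded_linear_Re i] z by simp
  qed measurable
  moreover have "AE x in lborel. Im (h x) = 0"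
  proof (rule AE_zero_if_box_integrals_zero)
    show "integrable lborel (\<lambda>x. indicator (box l u) x * Im (h x))" for l u
      unfolding Im_eq by (rule integrable_bounded_linear[OF bounded_linear_Im i])
    show "(\<integral>x. indicator (box l u) x * Im (h x) \<partial>lborel) = 0" for l u
      unfolding Im_eq integral_bounded_linear[OF bounded_linear_Im i] z by simp
  qed measurable
  ultimately show ?thesis by eventually_elim (simp add: complex_eq_iff)
qed

section \<open>Displacement operators and the inversion formula\<close>

text \<open>Summability of the squared norms says that the operator is trace class. This form is
  stable under changing the members on null sets, as \<open>l2_family_cong_AE\<close> shows.\<close>

definition l2_family :: "'i set \<Rightarrow> ('i \<Rightarrow> real^'n \<Rightarrow> complex) \<Rightarrow> bool" where
  "l2_family I \<psi> \<longleftrightarrow> countable I \<and> (\<forall>i\<in>I. sq_integrable (\<psi> i)) \<and> (\<lambda>i. l2norm_sq (\<psi> i)) summable_on I"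

lemma is_state_l2_family: "is_state I \<psi> \<Longrightarrow> l2_family I \<psi>"
  unfolding is_state_def l2_family_def by auto

section \<open>Inner products of square-integrable functions\<close>

lemma sq_integrable_measurable: "sq_integrable f \<Longrightarrow> f \<in> borel_measurable borel"
  unfolding sq_integrable_def by simp

lemma l2norm_sq_nonneg: "0 \<le> l2norm_sq f"
  unfolding l2norm_sq_def by (rule integral_nonneg_AE) auto

lemma l2ip_integrable:
  assumes "sq_integrable f" "sq_integrable g"
  shows "integrable lborel (\<lambda>x. cnj (f x) * g x)"
  using assms unfolding sq_integrable_def by (intro integrable_mult_of_squares) auto

lemma l2ip_cmod_integrable:
  assumes "sq_integrable f" "sq_integrable g"
  shows "integrable lborel (\<lambda>x. cmod (f x) * cmod (g x))"
  using integrable_norm[OF l2ip_integrable[OF assms]] by (simp add: norm_mult)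

lemma l2ip_bound:
  assumes "sq_integrable f" "sq_integrable g"
  shows "(cmod (l2ip f g))\<^sup>2 \<le> l2norm_sq f * l2norm_sq g"
proof -
  have "(\<lambda>x. cnj (f x)) \<in> borel_measurable lborel"
    by (rule measurable_compose[OF _ borel_measurable_cnj]) (use assms(1) in \<open>simp add: sq_integrable_def\<close>)
  then show ?thesis using assms cmod_integral_mult_le[of "\<lambda>x. cnj (f x)" lborel g]
    unfolding sq_integrable_def l2ip_def l2norm_sq_def by simp
qed

lemma integral_cmod_mult_le:
  assumes "sq_integrable f" "sq_integrable g"
  shows "(\<integral>x. cmod (f x) * cmod (g x) \<partial>lborel)\<^sup>2 \<le> l2norm_sq f * l2norm_sq g"
  using assms integral_Cauchy_Schwarz[of f lborel g]
  unfolding sq_integrable_def l2norm_sq_def by simp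

lemma l2ip_cnj: "l2ip g f = cnj (l2ip f g)"
  unfolding l2ip_def by (subst Bochner_Integration.integral_cnj[symmetric]) (simp add: mult.commute)

lemma l2ip_cong_AE:
  assumes "AE x in lborel. f x = f' x" "AE x in lborel. g x = g' x"
    and "sq_integrable f" "sq_integrable f'" "sq_integrable g" "sq_integrable g'"
  shows "l2ip f g = l2ip f' g'"
  unfolding l2ip_def
proof (rule integral_cong_AE)
  show "AE x in lborel. cnj (f x) * g x = cnj (f' x) * g' x"
    using assms(1,2) by eventually_elim simp
qed (rule borel_measurable_integrable[OF l2ip_integrable], fact, fact)+

lemma l2norm_sq_cong_AE:
  assumes "AE x in lborel. f x = f' x" "sq_integrable f" "sq_integrable f'"
  shows "l2norm_sq f = l2norm_sq f'"
  unfolding l2norm_sq_def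
proof (rule integral_cong_AE)
  show "AE x in lborel. (cmod (f x))\<^sup>2 = (cmod (f' x))\<^sup>2" using assms(1) by eventually_elim simp
qed (use assms in \<open>auto simp: sq_integrable_def\<close>)

lemma l2ip_add_left:
  assumes "sq_integrable f" "sq_integrable g" "sq_integrable h"
  shows "l2ip (\<lambda>x. f x + g x) h = l2ip f h + l2ip g h"
  unfolding l2ip_def using l2ip_integrable[OF assms(1,3)] l2ip_integrable[OF assms(2,3)]
  by (simp add: distrib_right)

lemma l2ip_cmult_left: "l2ip (\<lambda>x. c * f x) h = cnj c * l2ip f h"
  unfolding l2ip_def by (subst integral_mult_right_zero[symmetric]) (simp add: mult.assoc)

lemma schwartz_square_bound:
  assumes "schwartz f" shows "\<exists>C\<ge>0. \<forall>x. (cmod (f x))\<^sup>2 \<le> C / wt x ^ N"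
proof -
  obtain C where C: "C \<ge> 0" "\<And>x. cmod (f x) \<le> C / wt x ^ N" using schwartz_bound[OF assms] by meson
  have "(cmod (f x))\<^sup>2 \<le> C\<^sup>2 / wt x ^ N" for x
  proof -
    have "(cmod (f x))\<^sup>2 \<le> (C / wt x ^ N)\<^sup>2" using C by (intro power_mono) auto
    also have "\<dots> = C\<^sup>2 / (wt x ^ N * wt x ^ N)" by (simp add: power_divide power2_eq_square)
    also have "\<dots> \<le> C\<^sup>2 / wt x ^ N"
      using wt_ge1[of x] by (intro divide_left_mono) (auto simp: mult_le_cancel_right1 one_le_power)
    finally show ?thesis .
  qed
  then show ?thesis by (intro exI[of _ "C\<^sup>2"]) auto
qed

lemma schwartz_sq_integrable: "schwartz f \<Longrightarrow> sq_integrable f"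
  unfolding sq_integrable_def
proof
  assume f: "schwartz f"
  then show "f \<in> borel_measurable lborel" using schwartz_measurable by simp
  have [measurable]: "f \<in> borel_measurable borel" by (rule schwartz_measurable[OF f])
  obtain C where C: "\<And>x. (cmod (f x))\<^sup>2 \<le> C / wt x ^ 1" using schwartz_square_bound[OF f] by meson
  have "integrable lborel (\<lambda>x. complex_of_real ((cmod (f x))\<^sup>2))"
    by (rule integrable_wt_bound[where C = C]) (use C in \<open>auto simp: norm_power\<close>)
  from integrable_norm[OF this] show "integrable lborel (\<lambda>x. (cmod (f x))\<^sup>2)" by (simp add: norm_power)
qed

section \<open>Displaced functions and their inner products\<close>

lemma norm_disp [simp]: "cmod (disp \<xi> \<phi> y) = cmod (\<phi> (y - fst \<xi>))"
  by (simp add: disp_def norm_mult)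

text \<open>Splitting off the phase that does not depend on y exhibits a displacement as
  translation, modulation and a scalar, each of which preserves Schwartz functions.\<close>

lemma disp_eq: "disp \<xi> \<phi> y = iexp (- ((1/2) * (fst \<xi> \<bullet> snd \<xi>))) * (iexp (snd \<xi> \<bullet> y) * \<phi> (y - fst \<xi>))"
proof -
  have "(y - (1/2) *\<^sub>R fst \<xi>) \<bullet> snd \<xi> = - ((1/2) * (fst \<xi> \<bullet> snd \<xi>)) + snd \<xi> \<bullet> y"
    by (simp add: inner_diff_left inner_diff_right inner_commute)
  then have "iexp ((y - (1/2) *\<^sub>R fst \<xi>) \<bullet> snd \<xi>) = iexp (- ((1/2) * (fst \<xi> \<bullet> snd \<xi>))) * iexp (snd \<xi> \<bullet> y)"
    by (simp only: of_real_add distrib_left exp_add)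
  then show ?thesis unfolding disp_def by (simp only: mult.assoc)
qed

lemma schwartz_disp: "schwartz \<phi> \<Longrightarrow> schwartz (disp \<xi> \<phi>)"
  unfolding disp_eq[abs_def] by (intro schwartz_cmult schwartz_modulate schwartz_translate)

lemma disp_joint_measurable:
  fixes \<phi> :: "real^'n \<Rightarrow> complex"
  assumes [measurable]: "\<phi> \<in> borel_measurable borel"
  shows "(\<lambda>z. disp (fst z) \<phi> (snd z)) \<in> borel_measurable borel"
proof -
  have f1: "(\<lambda>z::((real^'n) \<times> (real^'n)) \<times> (real^'n). iexp ((snd z - (1/2) *\<^sub>R fst (fst z)) \<bullet> snd (fst z))) \<in> borel_measurable borel"
    by (intro borel_measurable_continuous_onI continuous_intros)
  have S: "(\<lambda>z::((real^'n) \<times> (real^'n)) \<times> (real^'n). snd z - fst (fst z)) \<in> borel \<rightarrow>\<^sub>M borel"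
    by (intro borel_measurable_continuous_onI continuous_intros)
  have f2: "(\<lambda>z::((real^'n) \<times> (real^'n)) \<times> (real^'n). \<phi> (snd z - fst (fst z))) \<in> borel_measurable borel"
    using measurable_compose[OF S, of \<phi>] by simp
  show ?thesis unfolding disp_def by (rule borel_measurable_times[OF f1 f2])
qed

lemma disp_measurable:
  assumes "\<phi> \<in> borel_measurable borel"
  shows "disp \<xi> \<phi> \<in> borel_measurable borel"
proof -
  have "(\<lambda>y. (\<xi>, y)) \<in> borel \<rightarrow>\<^sub>M borel" by (intro borel_measurable_continuous_onI continuous_intros)
  from measurable_compose[OF this disp_joint_measurable[OF assms]] show ?thesis by simp
qed

lemma sq_integrable_disp: "sq_integrable \<phi> \<Longrightarrow> sq_integrable (disp \<xi> \<phi>)"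
  unfolding sq_integrable_def
  using disp_measurable[of \<phi> \<xi>] integrable_affine[of "\<lambda>x. (cmod (\<phi> x))\<^sup>2" 1 "- fst \<xi>"] by simp

lemma l2norm_sq_disp:
  assumes "sq_integrable \<phi>" shows "l2norm_sq (disp \<xi> \<phi>) = l2norm_sq \<phi>"
proof -
  have [measurable]: "\<phi> \<in> borel_measurable borel" using assms by (rule sq_integrable_measurable)
  have "complex_of_real (l2norm_sq (disp \<xi> \<phi>)) = (\<integral>x. of_real ((cmod (\<phi> (x + - fst \<xi>)))\<^sup>2) \<partial>lborel)"
    unfolding l2norm_sq_def by (subst integral_complex_of_real[symmetric]) simp
  also have "\<dots> = (\<integral>x. of_real ((cmod (\<phi> x))\<^sup>2) \<partial>lborel)"
    by (rule integral_translate[of "\<lambda>x. of_real ((cmod (\<phi> x))\<^sup>2)"]) measurable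
  also have "\<dots> = complex_of_real (l2norm_sq \<phi>)"
    unfolding l2norm_sq_def by (rule integral_complex_of_real)
  finally show ?thesis by simp
qed

text \<open>The inner products \<open>\<langle>\<chi>\<^sub>\<alpha>|f\<rangle>\<close> form a partial Fourier transform.\<close>

definition stft_kernel :: "(real^'n \<Rightarrow> complex) \<Rightarrow> (real^'n \<Rightarrow> complex) \<Rightarrow> (real^'n) \<times> (real^'n) \<Rightarrow> complex" where
  "stft_kernel chi f z = cnj (chi (snd z - (1/2) *\<^sub>R fst z)) * f (snd z + (1/2) *\<^sub>R fst z)"

lemma half_plus_half: "(1/2) *\<^sub>R x + (1/2) *\<^sub>R x = (x::'a::real_vector)"
  by (simp flip: scaleR_add_left)

lemma midpoint_shift: "a + h - (h + h) = a - h" "a - h - h = a - (h + h)" for a h :: "'a::ab_group_add"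
  by simp_all

lemma schwartz_midpoint:
  assumes "schwartz G"
  shows "schwartz (\<lambda>z::'a::euclidean_space \<times> 'a. G (snd z - (1/2) *\<^sub>R fst z, snd z + (1/2) *\<^sub>R fst z))"
proof (rule schwartz_linear[OF assms, of "\<lambda>z. (snd z - (1/2) *\<^sub>R fst z, snd z + (1/2) *\<^sub>R fst z)"
      "\<lambda>w. (snd w - fst w, (1/2) *\<^sub>R fst w + (1/2) *\<^sub>R snd w)"])
  show "linear (\<lambda>z::'a \<times> 'a. (snd z - (1/2) *\<^sub>R fst z, snd z + (1/2) *\<^sub>R fst z))"
    by (rule linearI) (auto simp: algebra_simps)
  show "linear (\<lambda>w::'a \<times> 'a. (snd w - fst w, (1/2) *\<^sub>R fst w + (1/2) *\<^sub>R snd w))"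
    by (rule linearI) (auto simp: algebra_simps)
  fix z :: "'a \<times> 'a"
  have "(snd z + (1/2) *\<^sub>R fst z) - (snd z - (1/2) *\<^sub>R fst z) = (1/2) *\<^sub>R fst z + (1/2) *\<^sub>R fst z" by simp
  moreover have "(1/2) *\<^sub>R (snd z - (1/2) *\<^sub>R fst z) + (1/2) *\<^sub>R (snd z + (1/2) *\<^sub>R fst z) = (1/2) *\<^sub>R snd z + (1/2) *\<^sub>R snd z"
    by (simp add: scaleR_right_diff_distrib scaleR_right_distrib)
  ultimately show "(snd (snd z - (1/2) *\<^sub>R fst z, snd z + (1/2) *\<^sub>R fst z) - fst (snd z - (1/2) *\<^sub>R fst z, snd z + (1/2) *\<^sub>R fst z),
      (1/2) *\<^sub>R fst (snd z - (1/2) *\<^sub>R fst z, snd z + (1/2) *\<^sub>R fst z) + (1/2) *\<^sub>R snd (snd z - (1/2) *\<^sub>R fst z, snd z + (1/2) *\<^sub>R fst z)) = z"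
    by (simp only: fst_conv snd_conv half_plus_half prod.collapse)
qed

lemma schwartz_stft_kernel:
  assumes "schwartz chi" "schwartz f" shows "schwartz (stft_kernel chi f)"
  using schwartz_midpoint[OF schwartz_tensor[OF schwartz_cnj[OF assms(1)] assms(2)]]
  by (simp add: stft_kernel_def[abs_def])

text \<open>Shifting the integration variable by half the displacement cancels the offset in the
  phase of \<open>disp\<close>, so no additional phase remains. The frequency is negated because the
  displaced function is conjugated.\<close>

lemma l2ip_disp_eq_pft:
  assumes [measurable]: "chi \<in> borel_measurable borel" "f \<in> borel_measurable borel"
  shows "l2ip (disp \<alpha> chi) f = pft (stft_kernel chi f) (fst \<alpha>, - snd \<alpha>)"
proof -
  have "l2ip (disp \<alpha> chi) f = (\<integral>y. cnj (disp \<alpha> chi (y + (1/2) *\<^sub>R fst \<alpha>)) * f (y + (1/2) *\<^sub>R fst \<alpha>) \<partial>lborel)"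
  proof -
    have [measurable]: "disp \<alpha> chi \<in> borel_measurable borel" by (rule disp_measurable) simp
    show ?thesis unfolding l2ip_def
      by (rule integral_translate[symmetric, of "\<lambda>y. cnj (disp \<alpha> chi y) * f y"]) measurable
  qed
  also have "\<dots> = pft (stft_kernel chi f) (fst \<alpha>, - snd \<alpha>)"
    unfolding pft_def
  proof (rule Bochner_Integration.integral_cong[OF refl])
    fix y
    have e: "y + (1/2) *\<^sub>R fst \<alpha> - fst \<alpha> = y - (1/2) *\<^sub>R fst \<alpha>"
      using midpoint_shift(1)[of y "(1/2) *\<^sub>R fst \<alpha>"] by (simp only: half_plus_half)
    show "cnj (disp \<alpha> chi (y + (1/2) *\<^sub>R fst \<alpha>)) * f (y + (1/2) *\<^sub>R fst \<alpha>) =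
      iexp (snd (fst \<alpha>, - snd \<alpha>) \<bullet> y) * stft_kernel chi f (fst (fst \<alpha>, - snd \<alpha>), y)"
      unfolding disp_def e by (simp add: stft_kernel_def exp_cnj inner_commute mult.assoc)
  qed
  finally show ?thesis .
qed

lemma schwartz_flip_snd: "schwartz G \<Longrightarrow> schwartz (\<lambda>z. G (fst z, - snd z))"
  by (rule schwartz_linear[of G "\<lambda>z. (fst z, - snd z)" "\<lambda>z. (fst z, - snd z)"]) (auto intro!: linearI)

lemma schwartz_l2ip_disp:
  assumes "schwartz chi" "schwartz f"
  shows "schwartz (\<lambda>\<alpha>. l2ip (disp \<alpha> chi) f)"
  unfolding l2ip_disp_eq_pft[OF assms[THEN schwartz_measurable]]
  by (rule schwartz_flip_snd[OF schwartz_pft[OF schwartz_stft_kernel[OF assms]]])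

text \<open>For a fixed position q the integral over momenta is Fourier inversion and returns f y
  times \<open>|chi (y - q)|^2\<close>; the remaining integral over q is the norm of chi.\<close>

lemma stft_inversion:
  fixes chi :: "real^'n \<Rightarrow> complex"
  assumes chi: "schwartz chi" "l2norm_sq chi = 1" and f: "schwartz f"
  shows "(\<integral>\<alpha>. disp \<alpha> chi y * l2ip (disp \<alpha> chi) f \<partial>lborel) = of_real ((2 * pi) ^ CARD('n)) * f y"
    and "integrable lborel (\<lambda>\<alpha>. disp \<alpha> chi y * l2ip (disp \<alpha> chi) f)"
proof -
  have A: "schwartz (\<lambda>\<alpha>. l2ip (disp \<alpha> chi) f)" by (rule schwartz_l2ip_disp[OF chi(1) f])
  have [measurable]: "chi \<in> borel_measurable borel" by (rule schwartz_measurable[OF chi(1)])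
  have [measurable]: "(\<lambda>\<alpha>. l2ip (disp \<alpha> chi) f) \<in> borel_measurable borel" by (rule schwartz_measurable[OF A])
  have "(\<lambda>\<alpha>::'n phase. (\<alpha>, y)) \<in> borel \<rightarrow>\<^sub>M borel" by (intro borel_measurable_continuous_onI continuous_intros)
  from measurable_compose[OF this disp_joint_measurable[of chi]]
  have [measurable]: "(\<lambda>\<alpha>. disp \<alpha> chi y) \<in> borel_measurable borel" by simp
  obtain C where C: "\<And>x. cmod (chi x) \<le> C" using schwartz_bound[OF chi(1), of 0] by auto
  show int: "integrable lborel (\<lambda>\<alpha>. disp \<alpha> chi y * l2ip (disp \<alpha> chi) f)"
  proof (rule Bochner_Integration.integrable_bound)
    show "integrable lborel (\<lambda>\<alpha>. C * cmod (l2ip (disp \<alpha> chi) f))"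
      using integrable_norm[OF schwartz_integrable[OF A]] by (rule integrable_mult_right)
    show "AE \<alpha> in lborel. cmod (disp \<alpha> chi y * l2ip (disp \<alpha> chi) f) \<le> norm (C * cmod (l2ip (disp \<alpha> chi) f))"
      using C by (intro AE_I2) (auto simp: norm_mult abs_mult intro!: mult_right_mono order_trans[OF C abs_ge_self])
  qed measurable
  let ?G = "stft_kernel chi f"
  have G: "schwartz ?G" by (rule schwartz_stft_kernel[OF chi(1) f])
  have inner: "(\<integral>p. disp (q, p) chi y * l2ip (disp (q, p) chi) f \<partial>lborel) =
      of_real ((2 * pi) ^ CARD('n)) * f y * of_real ((cmod (chi (y - q)))\<^sup>2)" for q
  proof -
    have m: "(\<lambda>p. pft ?G (q, p)) \<in> borel_measurable borel"
      by (rule schwartz_measurable[OF schwartz_slice[OF schwartz_pft[OF G]]])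
    have m2: "(\<lambda>p. iexp (- (p \<bullet> (y - (1/2) *\<^sub>R q)))) \<in> borel_measurable borel"
      by (intro borel_measurable_continuous_onI continuous_intros)
    \<comment> \<open>The amplitude is a transform at frequency \<open>- p\<close>; writing the sign
      as the affine map \<open>0 + (-1) *\<^sub>R p\<close> prepares the reflection of the
      variable.\<close>
    have "(\<integral>p. disp (q, p) chi y * l2ip (disp (q, p) chi) f \<partial>lborel) =
      (\<integral>p. chi (y - q) * (iexp (- ((0 + (-1) *\<^sub>R p) \<bullet> (y - (1/2) *\<^sub>R q))) * pft ?G (q, 0 + (-1) *\<^sub>R p)) \<partial>lborel)"
      using schwartz_measurable[OF f]
      by (intro Bochner_Integration.integral_cong refl)
        (simp add: disp_def l2ip_disp_eq_pft inner_commute mult_ac)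
    also have "\<dots> = chi (y - q) * (\<integral>p. iexp (- (p \<bullet> (y - (1/2) *\<^sub>R q))) * pft ?G (q, p) \<partial>lborel)"
      unfolding integral_mult_right_zero
      using integral_affine[of "\<lambda>p. iexp (- (p \<bullet> (y - (1/2) *\<^sub>R q))) * pft ?G (q, p)" "-1" 0] m m2
      by simp
    also have "(\<integral>p. iexp (- (p \<bullet> (y - (1/2) *\<^sub>R q))) * pft ?G (q, p) \<partial>lborel) =
        of_real ((2 * pi) ^ CARD('n)) * ?G (q, y - (1/2) *\<^sub>R q)"
      using pft_inversion[OF G, of "y - (1/2) *\<^sub>R q" q] by simp
    also have "?G (q, y - (1/2) *\<^sub>R q) = cnj (chi (y - q)) * f y"
    proof -
      have "y - (1/2) *\<^sub>R q - (1/2) *\<^sub>R q = y - q" 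
        using midpoint_shift(2)[of y "(1/2) *\<^sub>R q"] by (simp only: half_plus_half)
      then show ?thesis by (simp add: stft_kernel_def)
    qed
    also have "chi (y - q) * (of_real ((2 * pi) ^ CARD('n)) * (cnj (chi (y - q)) * f y)) =
       of_real ((2 * pi) ^ CARD('n)) * f y * (chi (y - q) * cnj (chi (y - q)))"
      by (simp only: mult_ac)
    also have "chi (y - q) * cnj (chi (y - q)) = of_real ((cmod (chi (y - q)))\<^sup>2)"
      by (rule complex_norm_square[symmetric])
    finally show ?thesis .
  qed
  have "(\<integral>\<alpha>. disp \<alpha> chi y * l2ip (disp \<alpha> chi) f \<partial>lborel) =
    (\<integral>q. (\<integral>p. disp (q, p) chi y * l2ip (disp (q, p) chi) f \<partial>lborel) \<partial>lborel)"
    by (rule lborel_integral_fst[OF int, symmetric])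
  also have "\<dots> = of_real ((2 * pi) ^ CARD('n)) * f y * (\<integral>q. of_real ((cmod (chi (y - q)))\<^sup>2) \<partial>lborel)"
    unfolding inner integral_mult_right_zero ..
  also have "(\<integral>q. complex_of_real ((cmod (chi (y - q)))\<^sup>2) \<partial>lborel) = (\<integral>q. of_real ((cmod (chi q))\<^sup>2) \<partial>lborel)"
    using integral_affine[of "\<lambda>q. complex_of_real ((cmod (chi q))\<^sup>2)" "-1" y] by simp
  also have "\<dots> = 1" using chi(2) unfolding l2norm_sq_def by (subst integral_complex_of_real) simp
  finally show "(\<integral>\<alpha>. disp \<alpha> chi y * l2ip (disp \<alpha> chi) f \<partial>lborel) = of_real ((2 * pi) ^ CARD('n)) * f y" by simp
qed

lemma l2ip_disp_measurable:
  assumes [measurable]: "chi \<in> borel_measurable borel" "f \<in> borel_measurable borel"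
  shows "(\<lambda>\<alpha>. l2ip (disp \<alpha> chi) f) \<in> borel_measurable borel"
proof -
  have [measurable]: "(\<lambda>z. disp (fst z) chi (snd z)) \<in> borel_measurable (borel \<Otimes>\<^sub>M borel)"
    using disp_joint_measurable[of chi] by (simp add: borel_prod)
  have "(\<lambda>(\<alpha>, y). cnj (disp \<alpha> chi y) * f y) \<in> borel_measurable (borel \<Otimes>\<^sub>M lborel)"
    unfolding case_prod_beta by measurable
  from lborel.borel_measurable_lebesgue_integral[OF this]
  show ?thesis unfolding l2ip_def .
qed

section \<open>Reconstruction of the eigenfunctions from the Husimi function\<close>

lemma wt_fst_le: "wt (fst \<alpha>) \<le> wt \<alpha>"
  using wt_le_mult[of "fst \<alpha>" "snd \<alpha>"] wt_Pair[of "fst \<alpha>" "snd \<alpha>"]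
  by (simp add: mult.commute)

lemma integrable_wt_decay:
  fixes F :: "'a::euclidean_space \<Rightarrow> complex"
  assumes "F \<in> borel_measurable borel" and C: "\<And>x. cmod (F x) \<le> C / wt x ^ Suc N"
  shows "integrable lborel (\<lambda>x. wt x ^ N * cmod (F x))"
proof -
  have [measurable]: "F \<in> borel_measurable borel" by fact
  have "integrable lborel (\<lambda>x. of_real (wt x ^ N) * F x)"
  proof (rule integrable_wt_bound)
    show "cmod (of_real (wt x ^ N) * F x) \<le> C / wt x" for x
      using mult_left_mono[OF C, of "wt x ^ N" x] by (simp add: norm_mult norm_power)
  qed measurable
  from integrable_norm[OF this] show ?thesis by (simp add: norm_mult norm_power)
qed

lemma schwartz_integrable_wt:
  assumes "schwartz f" shows "integrable lborel (\<lambda>x. wt x ^ N * cmod (f x))"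
  using schwartz_bound[OF assms, of "Suc N"] integrable_wt_decay[OF schwartz_measurable[OF assms], of _ N] by blast

text \<open>Weighted L^1 norms rather than suprema: they are what Cauchy-Schwarz extracts from the
  decay of Q, and what bounds a superposition uniformly in x. Their squares are summed, to match
  \<open>ssb\<close>.\<close>

definition rapid_family :: "'i set \<Rightarrow> ('i \<Rightarrow> 'a::euclidean_space \<Rightarrow> complex) \<Rightarrow> bool" where
  "rapid_family I m \<longleftrightarrow> (\<forall>i\<in>I. m i \<in> borel_measurable borel) \<and>
     (\<forall>N. \<exists>B. (\<lambda>i. (B i)\<^sup>2) summable_on I \<and> (\<forall>i\<in>I. integrable lborel (\<lambda>x. wt x ^ N * cmod (m i x)) \<and>
        (\<integral>x. wt x ^ N * cmod (m i x) \<partial>lborel) \<le> B i))"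

lemma rapid_familyD:
  assumes "rapid_family I m"
  shows "i \<in> I \<Longrightarrow> m i \<in> borel_measurable borel"
    and "i \<in> I \<Longrightarrow> integrable lborel (\<lambda>x. wt x ^ N * cmod (m i x))"
    and "\<exists>B. (\<lambda>i. (B i)\<^sup>2) summable_on I \<and> (\<forall>i\<in>I. (\<integral>x. wt x ^ N * cmod (m i x) \<partial>lborel) \<le> B i)"
proof -
  show "i \<in> I \<Longrightarrow> m i \<in> borel_measurable borel" using assms unfolding rapid_family_def by blast
  from assms obtain B where B: "(\<lambda>i. (B i)\<^sup>2) summable_on I" "\<forall>i\<in>I. integrable lborel (\<lambda>x. wt x ^ N * cmod (m i x)) \<and>
        (\<integral>x. wt x ^ N * cmod (m i x) \<partial>lborel) \<le> B i"
    unfolding rapid_family_def by blast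
  from B(2) show "i \<in> I \<Longrightarrow> integrable lborel (\<lambda>x. wt x ^ N * cmod (m i x))" by blast
  from B show "\<exists>B. (\<lambda>i. (B i)\<^sup>2) summable_on I \<and> (\<forall>i\<in>I. (\<integral>x. wt x ^ N * cmod (m i x) \<partial>lborel) \<le> B i)"
    by (intro exI[of _ B]) simp
qed

lemma rapid_family_integrable: "rapid_family I m \<Longrightarrow> i \<in> I \<Longrightarrow> integrable lborel (m i)"
proof -
  assume m: "rapid_family I m" "i \<in> I"
  have "integrable lborel (\<lambda>x. cmod (m i x))" using rapid_familyD(2)[OF m, of 0] by simp
  then show ?thesis using rapid_familyD(1)[OF m] integrable_norm_iff[of "m i" lborel] by simp
qed

lemma rapid_family_mult:
  assumes m: "rapid_family I m" and [measurable]: "g \<in> borel_measurable borel"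
    and g: "\<And>x. cmod (g x) \<le> C * wt x" "C \<ge> 0"
  shows "rapid_family I (\<lambda>i x. g x * m i x)"
proof -
  have le: "wt x ^ N * cmod (g x * m i x) \<le> C * (wt x ^ Suc N * cmod (m i x))" for N i x
  proof -
    have "wt x ^ N * (cmod (g x) * cmod (m i x)) \<le> wt x ^ N * ((C * wt x) * cmod (m i x))"
      by (intro mult_left_mono mult_right_mono g) auto
    then show ?thesis by (simp add: norm_mult mult_ac)
  qed
  have "\<exists>B. (\<lambda>i. (B i)\<^sup>2) summable_on I \<and> (\<forall>i\<in>I. integrable lborel (\<lambda>x. wt x ^ N * cmod (g x * m i x)) \<and>
        (\<integral>x. wt x ^ N * cmod (g x * m i x) \<partial>lborel) \<le> B i)" for N
  proof -
    obtain B where B: "(\<lambda>i. (B i)\<^sup>2) summable_on I" "\<forall>i\<in>I. (\<integral>x. wt x ^ Suc N * cmod (m i x) \<partial>lborel) \<le> B i"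
      using rapid_familyD(3)[OF m] by blast
    have int: "integrable lborel (\<lambda>x. wt x ^ N * cmod (g x * m i x))" if "i \<in> I" for i
    proof (rule Bochner_Integration.integrable_bound)
      show "integrable lborel (\<lambda>x. C * (wt x ^ Suc N * cmod (m i x)))"
        by (rule integrable_mult_right[OF rapid_familyD(2)[OF m that]])
      have [measurable]: "m i \<in> borel_measurable borel" by (rule rapid_familyD(1)[OF m that])
      show "(\<lambda>x. wt x ^ N * cmod (g x * m i x)) \<in> borel_measurable lborel" by measurable
      show "AE x in lborel. norm (wt x ^ N * cmod (g x * m i x)) \<le> norm (C * (wt x ^ Suc N * cmod (m i x)))"
        using le g(2) by (intro AE_I2) (simp add: abs_mult)
    qed
    have "(\<integral>x. wt x ^ N * cmod (g x * m i x) \<partial>lborel) \<le> C * B i" if "i \<in> I" for i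
    proof -
      have "(\<integral>x. wt x ^ N * cmod (g x * m i x) \<partial>lborel) \<le> (\<integral>x. C * (wt x ^ Suc N * cmod (m i x)) \<partial>lborel)"
        by (intro integral_mono int that integrable_mult_right[OF rapid_familyD(2)[OF m that]] le)
      also have "\<dots> = C * (\<integral>x. wt x ^ Suc N * cmod (m i x) \<partial>lborel)" by (rule integral_mult_right_zero)
      also have "\<dots> \<le> C * B i" using B(2) that g(2) by (intro mult_left_mono) auto
      finally show ?thesis .
    qed
    moreover have "(\<lambda>i. (C * B i)\<^sup>2) summable_on I"
      unfolding power_mult_distrib by (rule summable_on_cmult_right[OF B(1)])
    ultimately show ?thesis using int by (intro exI[of _ "\<lambda>i. C * B i"]) simp
  qed
  moreover have "(\<lambda>x. g x * m i x) \<in> borel_measurable borel" if "i \<in> I" for i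
    using rapid_familyD(1)[OF m that] by measurable
  ultimately show ?thesis unfolding rapid_family_def by simp
qed

lemma rapid_family_coord:
  assumes m: "rapid_family I m" and b: "b \<in> Basis"
  shows "rapid_family I (\<lambda>i x. c * of_real (x \<bullet> b) * m i x)"
proof (rule rapid_family_mult[OF m])
  show "cmod (c * of_real (x \<bullet> b)) \<le> cmod c * wt x" for x
    using abs_inner_le_wt[OF b, of x] by (simp add: norm_mult mult_left_mono)
  show "(\<lambda>x. c * complex_of_real (x \<bullet> b)) \<in> borel_measurable borel"
    by (intro borel_measurable_continuous_onI continuous_intros)
qed simp

section \<open>Superpositions of displaced functions\<close>

lemma disp_has_derivative:
  assumes "schwartz f"
  shows "(disp \<alpha> f has_derivative
    (\<lambda>h. disp \<alpha> (\<lambda>y. frechet_derivative f (at y) h) x + \<i> * of_real (snd \<alpha> \<bullet> h) * disp \<alpha> f x)) (at x)"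
proof -
  have "((\<lambda>y. f (y - fst \<alpha>)) has_derivative frechet_derivative f (at (x - fst \<alpha>))) (at x)"
  proof -
    have "((\<lambda>y. y - fst \<alpha>) has_derivative (\<lambda>h. h)) (at x)" by (auto intro!: derivative_eq_intros)
    from has_derivative_compose[OF this schwartz_has_derivative[OF assms]] show ?thesis .
  qed
  moreover have "((\<lambda>y. (y - (1/2) *\<^sub>R fst \<alpha>) \<bullet> snd \<alpha>) has_derivative (\<lambda>h. h \<bullet> snd \<alpha>)) (at x)"
    by (auto intro!: derivative_eq_intros)
  ultimately have "((\<lambda>y. iexp ((y - (1/2) *\<^sub>R fst \<alpha>) \<bullet> snd \<alpha>) * f (y - fst \<alpha>)) has_derivative
     (\<lambda>h. iexp ((x - (1/2) *\<^sub>R fst \<alpha>) \<bullet> snd \<alpha>) * frechet_derivative f (at (x - fst \<alpha>)) h +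
        iexp ((x - (1/2) *\<^sub>R fst \<alpha>) \<bullet> snd \<alpha>) * (\<i> * of_real (h \<bullet> snd \<alpha>)) * f (x - fst \<alpha>))) (at x)"
    by (intro has_derivative_mult has_derivative_iexp)
  then show ?thesis unfolding disp_def[abs_def] by (simp add: inner_commute mult_ac)
qed

text \<open>The commutation relation of X with a displacement, obtained from
  \<open>x = (x - fst \<alpha>) + fst \<alpha>\<close>. Here it distributes a coordinate over f and
  the amplitude; for Schwartz operators it produces the powers of \<alpha>.\<close>

lemma disp_coord:
  "of_real (x \<bullet> b) * disp \<alpha> f x = disp \<alpha> (\<lambda>y. of_real (y \<bullet> b) * f y) x + of_real (fst \<alpha> \<bullet> b) * disp \<alpha> f x"
  by (simp add: disp_def inner_diff_left algebra_simps)

lemma disp_measurable_fst: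
  assumes "f \<in> borel_measurable borel"
  shows "(\<lambda>\<alpha>. disp \<alpha> f y) \<in> borel_measurable borel"
proof -
  have "(\<lambda>\<alpha>. (\<alpha>, y)) \<in> borel \<rightarrow>\<^sub>M borel" by (intro borel_measurable_continuous_onI continuous_intros)
  from measurable_compose[OF this disp_joint_measurable[OF assms]] show ?thesis by simp
qed

definition superpos :: "('i \<Rightarrow> 'n phase \<Rightarrow> complex) \<Rightarrow> (real^'n \<Rightarrow> complex) \<Rightarrow> 'i \<Rightarrow> real^'n \<Rightarrow> complex" where
  "superpos m f i x = (\<integral>\<alpha>. m i \<alpha> * disp \<alpha> f x \<partial>lborel)"

lemma superpos_integrable:
  assumes m: "rapid_family I m" "i \<in> I" and f: "schwartz f"
  shows "integrable lborel (\<lambda>\<alpha>. m i \<alpha> * disp \<alpha> f x)"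
proof -
  have [measurable]: "m i \<in> borel_measurable borel" by (rule rapid_familyD(1)[OF m])
  have [measurable]: "(\<lambda>\<alpha>. disp \<alpha> f x) \<in> borel_measurable borel"
    by (rule disp_measurable_fst[OF schwartz_measurable[OF f]])
  obtain C where C: "C \<ge> 0" "\<And>x. cmod (f x) \<le> C" using schwartz_bound[OF f, of 0] by auto
  show ?thesis
  proof (rule Bochner_Integration.integrable_bound)
    show "integrable lborel (\<lambda>\<alpha>. C * cmod (m i \<alpha>))"
      by (rule integrable_mult_right[OF integrable_norm[OF rapid_family_integrable[OF m]]])
    show "AE \<alpha> in lborel. cmod (m i \<alpha> * disp \<alpha> f x) \<le> norm (C * cmod (m i \<alpha>))"
    proof (rule AE_I2)
      fix \<alpha>
      have "cmod (disp \<alpha> f x) * cmod (m i \<alpha>) \<le> C * cmod (m i \<alpha>)"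
        unfolding norm_disp by (intro mult_right_mono C) simp
      then show "cmod (m i \<alpha> * disp \<alpha> f x) \<le> norm (C * cmod (m i \<alpha>))"
        using C(1) by (simp add: norm_mult abs_mult mult.commute)
    qed
  qed measurable
qed

text \<open>Sums are included because both operations of the coinduction split a superposition into
  two: in one the operation acts on f, in the other the amplitude gains a coordinate of
  \<alpha>.\<close>

inductive superpos_span :: "'i set \<Rightarrow> ('i \<Rightarrow> real^'n \<Rightarrow> complex) \<Rightarrow> bool" for I where
  base: "rapid_family I m \<Longrightarrow> schwartz f \<Longrightarrow> superpos_span I (superpos m f)"
| add: "superpos_span I \<Phi> \<Longrightarrow> superpos_span I \<Psi> \<Longrightarrow> superpos_span I (\<lambda>i x. \<Phi> i x + \<Psi> i x)"

lemma superpos_has_derivative: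
  fixes m :: "'i \<Rightarrow> 'n::finite phase \<Rightarrow> complex"
  assumes m: "rapid_family I m" and f: "schwartz f"
  shows "\<exists>D. (\<forall>i\<in>I. \<forall>x. (superpos m f i has_derivative D i x) (at x)) \<and> (\<forall>b\<in>Basis. superpos_span I (\<lambda>i x. D i x b))"
proof -
  obtain C where C: "C \<ge> 0" "\<And>x. cmod (f x) \<le> C" using schwartz_bound[OF f, of 0] by auto
  obtain C' where C': "C' \<ge> 0" "\<And>x h. cmod (frechet_derivative f (at x) h) \<le> C' * norm h"
    using schwartz_frechet_bound[OF f, of 0] by auto
  define E' where "E' i \<alpha> x h = m i \<alpha> * (disp \<alpha> (\<lambda>y. frechet_derivative f (at y) h) x + \<i> * of_real (snd \<alpha> \<bullet> h) * disp \<alpha> f x)" for i \<alpha> x h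
  define K where "K = C' + DIM('n phase) * C"
  have bd: "cmod (E' i \<alpha> x h) \<le> K * (wt \<alpha> ^ 1 * cmod (m i \<alpha>)) * norm h" for i \<alpha> x h
  proof -
    have "\<bar>snd \<alpha> \<bullet> h\<bar> \<le> norm (snd \<alpha>) * norm h" by (rule Cauchy_Schwarz_ineq2)
    also have "\<dots> \<le> (DIM('n phase) * wt \<alpha>) * norm h"
      using norm_snd_le[of "snd \<alpha>" "fst \<alpha>"] norm_le_wt[of \<alpha>] by (intro mult_right_mono) auto
    finally have s: "\<bar>snd \<alpha> \<bullet> h\<bar> \<le> (DIM('n phase) * wt \<alpha>) * norm h" .
    have "cmod (disp \<alpha> (\<lambda>y. frechet_derivative f (at y) h) x + \<i> * of_real (snd \<alpha> \<bullet> h) * disp \<alpha> f x) \<le>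
       cmod (disp \<alpha> (\<lambda>y. frechet_derivative f (at y) h) x) + \<bar>snd \<alpha> \<bullet> h\<bar> * cmod (disp \<alpha> f x)"
      by (rule order_trans[OF norm_triangle_ineq]) (simp add: norm_mult)
    also have "\<dots> \<le> C' * norm h + ((DIM('n phase) * wt \<alpha>) * norm h) * C"
      unfolding norm_disp by (intro add_mono mult_mono C C' s) auto
    also have "\<dots> \<le> (C' * wt \<alpha>) * norm h + ((DIM('n phase) * wt \<alpha>) * norm h) * C"
      using C(1) C'(1) wt_ge1[of \<alpha>] by (intro add_mono mult_right_mono) (auto simp: mult_le_cancel_left1)
    also have "\<dots> = K * wt \<alpha> * norm h" by (simp add: K_def algebra_simps)
    finally have "cmod (m i \<alpha>) * cmod (disp \<alpha> (\<lambda>y. frechet_derivative f (at y) h) x + \<i> * of_real (snd \<alpha> \<bullet> h) * disp \<alpha> f x)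
       \<le> cmod (m i \<alpha>) * (K * wt \<alpha> * norm h)" by (rule mult_left_mono) simp
    then show ?thesis by (simp add: E'_def norm_mult mult_ac)
  qed
  define D where "D i x h = (\<integral>\<alpha>. E' i \<alpha> x h \<partial>lborel)" for i x h
  define D' where "D' i x h = superpos m (\<lambda>y. frechet_derivative f (at y) h) i x +
      superpos (\<lambda>i \<alpha>. \<i> * of_real (\<alpha> \<bullet> (0, h)) * m i \<alpha>) f i x" for i x h
  have D: "(superpos m f i has_derivative D i x) (at x)" if "i \<in> I" for i x
    unfolding superpos_def[abs_def] D_def[abs_def]
  proof (rule has_derivative_integral(1)[where S = UNIV and B = "\<lambda>\<alpha>. K * (wt \<alpha> ^ 1 * cmod (m i \<alpha>))"])
    show "integrable lborel (\<lambda>\<alpha>. m i \<alpha> * disp \<alpha> f x)" for x by (rule superpos_integrable[OF m that f])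
    show "((\<lambda>x. m i \<alpha> * disp \<alpha> f x) has_derivative E' i \<alpha> x) (at x)" for \<alpha> x
      unfolding E'_def[abs_def] by (rule has_derivative_mult_right[OF disp_has_derivative[OF f]])
    show "integrable lborel (\<lambda>\<alpha>. K * (wt \<alpha> ^ 1 * cmod (m i \<alpha>)))"
      by (rule integrable_mult_right[OF rapid_familyD(2)[OF m that]])
  qed (use bd in auto)
  have Deq: "D i x b = D' i x b" if i: "i \<in> I" and b: "b \<in> Basis" for i x b
  proof -
    have b': "(0, b) \<in> Basis" using b by (simp add: Basis_prod_def)
    have "E' i \<alpha> x b = m i \<alpha> * disp \<alpha> (\<lambda>y. frechet_derivative f (at y) b) x + \<i> * of_real (\<alpha> \<bullet> (0, b)) * m i \<alpha> * disp \<alpha> f x" for \<alpha>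
      by (simp add: E'_def inner_prod_def algebra_simps)
    then show ?thesis unfolding D_def D'_def superpos_def
      using superpos_integrable[OF m i schwartz_deriv[OF f b], of x]
        superpos_integrable[OF rapid_family_coord[OF m b', of \<i>] i f, of x]
      by simp
  qed
  \<comment> \<open>Off \<open>I\<close> the integrals need not split. Taking the split form there
    by definition makes \<open>D2\<close> equal to a member of the span on the whole index
    type.\<close>
  define D2 where "D2 i x h = (if i \<in> I then D i x h else D' i x h)" for i x h
  have 1: "(superpos m f i has_derivative D2 i x) (at x)" if "i \<in> I" for i x
  proof -
    have "D2 i x = D i x" using that by (simp add: fun_eq_iff D2_def)
    then show ?thesis using D[OF that] by simp
  qed
  have 2: "superpos_span I (\<lambda>i x. D2 i x b)" if b: "b \<in> Basis" for b
  proof -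
    have b': "(0, b) \<in> Basis" using b by (simp add: Basis_prod_def)
    have "(\<lambda>i x. D2 i x b) = (\<lambda>i x. superpos m (\<lambda>y. frechet_derivative f (at y) b) i x +
      superpos (\<lambda>i \<alpha>. \<i> * of_real (\<alpha> \<bullet> (0, b)) * m i \<alpha>) f i x)"
      using Deq[OF _ b] by (auto simp: fun_eq_iff D2_def D'_def)
    moreover have "superpos_span I \<dots>"
      by (intro superpos_span.add superpos_span.base m f schwartz_deriv b rapid_family_coord[OF m b'])
    ultimately show ?thesis by simp
  qed
  show ?thesis by (intro exI[of _ D2] conjI ballI allI 1 2)
qed

text \<open>A superposition is at most sup |f| times the L^1 norm of its amplitude, for every x.
  This is the point where the supremum gets inside the sum over i. The invariant asks for agreement
  with the span on \<open>I\<close> only, since multiplication by a coordinate is known to stay in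
  the span only there.\<close>

lemma superpos_span_sjs: "superpos_span I \<Phi> \<Longrightarrow> sjs I \<Phi>"
proof (rule sjs_coinduct[where P = "\<lambda>\<Phi>. \<exists>\<Psi>. superpos_span I \<Psi> \<and> (\<forall>i\<in>I. \<Phi> i = \<Psi> i)"], goal_cases)
  case 1
  then show ?case by blast
next
  case (2 \<Phi>)
  then obtain \<Psi> where \<Psi>: "superpos_span I \<Psi>" "\<forall>i\<in>I. \<Phi> i = \<Psi> i" by blast
  from \<Psi>(1) have "ssb I \<Psi>"
  proof induction
    case (base m f)
    obtain C where C: "C \<ge> 0" "\<And>x. cmod (f x) \<le> C" using schwartz_bound[OF base(2), of 0] by auto
    obtain B where B: "(\<lambda>i. (B i)\<^sup>2) summable_on I" "\<forall>i\<in>I. (\<integral>x. wt x ^ 0 * cmod (m i x) \<partial>lborel) \<le> B i"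
      using rapid_familyD(3)[OF base(1)] by blast
    show ?case
    proof (rule ssbI)
      show "(\<lambda>i. (C * B i)\<^sup>2) summable_on I"
        unfolding power_mult_distrib by (rule summable_on_cmult_right[OF B(1)])
      fix i x assume i: "i \<in> I"
      have "cmod (superpos m f i x) \<le> (\<integral>\<alpha>. C * cmod (m i \<alpha>) \<partial>lborel)"
        unfolding superpos_def
      proof (rule norm_integral_le)
        show "integrable lborel (\<lambda>\<alpha>. C * cmod (m i \<alpha>))"
          by (rule integrable_mult_right[OF integrable_norm[OF rapid_family_integrable[OF base(1) i]]])
        show "cmod (m i \<alpha> * disp \<alpha> f x) \<le> C * cmod (m i \<alpha>)" for \<alpha>
        proof -
          have "cmod (disp \<alpha> f x) * cmod (m i \<alpha>) \<le> C * cmod (m i \<alpha>)"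
            unfolding norm_disp by (intro mult_right_mono C) simp
          then show ?thesis by (simp add: norm_mult mult.commute)
        qed
      qed
      also have "\<dots> = C * (\<integral>\<alpha>. cmod (m i \<alpha>) \<partial>lborel)" by (rule integral_mult_right_zero)
      also have "\<dots> \<le> C * B i" using B(2) i C(1) by (intro mult_left_mono) auto
      finally show "(cmod (superpos m f i x))\<^sup>2 \<le> (C * B i)\<^sup>2" by (rule power_mono) simp
    qed
  next
    case (add \<Phi> \<Psi>)
    from ssb_add[OF add.IH] show ?case .
  qed
  then show ?case by (rule ssb_comp) (use \<Psi>(2) in auto)
next
  case (3 \<Phi>)
  then obtain \<Psi> where \<Psi>: "superpos_span I \<Psi>" "\<forall>i\<in>I. \<Phi> i = \<Psi> i" by blast
  from \<Psi>(1) have "\<exists>D. (\<forall>i\<in>I. \<forall>x. (\<Psi> i has_derivative D i x) (at x)) \<and> (\<forall>b\<in>Basis. superpos_span I (\<lambda>i x. D i x b))"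
  proof induction
    case (base m f)
    then show ?case by (rule superpos_has_derivative)
  next
    case (add \<Phi> \<Psi>)
    from add.IH(1) obtain D where D: "\<forall>i\<in>I. \<forall>x. (\<Phi> i has_derivative D i x) (at x)" "\<forall>b\<in>Basis. superpos_span I (\<lambda>i x. D i x b)"
      by (elim exE conjE) (rule that)
    from add.IH(2) obtain E where E: "\<forall>i\<in>I. \<forall>x. (\<Psi> i has_derivative E i x) (at x)" "\<forall>b\<in>Basis. superpos_span I (\<lambda>i x. E i x b)"
      by (elim exE conjE) (rule that)
    show ?case
      by (intro exI[of _ "\<lambda>i x h. D i x h + E i x h"] conjI ballI allI has_derivative_add superpos_span.add
          D[rule_format] E[rule_format])
  qed
  then obtain D where D: "\<forall>i\<in>I. \<forall>x. (\<Psi> i has_derivative D i x) (at x)" "\<forall>b\<in>Basis. superpos_span I (\<lambda>i x. D i x b)"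
    by (elim exE conjE) (rule that)
  show ?case
    using D(1) \<Psi>(2) by (intro exI[of _ D] conjI ballI exI[of _ "\<lambda>i x. D i x _"] D(2)[rule_format]) auto
next
  case (4 \<Phi> b)
  then obtain \<Psi> where \<Psi>: "superpos_span I \<Psi>" "\<forall>i\<in>I. \<Phi> i = \<Psi> i" by blast
  from \<Psi>(1) have "\<exists>\<Xi>. superpos_span I \<Xi> \<and> (\<forall>i\<in>I. (\<lambda>x. of_real (x \<bullet> b) * \<Psi> i x) = \<Xi> i)"
  proof induction
    case (base m f)
    have b': "(b, 0) \<in> Basis" using 4(3) by (simp add: Basis_prod_def)
    note m' = rapid_family_coord[OF base(1) b', of 1]
    have f': "schwartz (\<lambda>y. of_real (y \<bullet> b) * f y)" by (rule schwartz_coord[OF base(2) 4(3)])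
    let ?\<Xi> = "\<lambda>i x. superpos m (\<lambda>y. of_real (y \<bullet> b) * f y) i x + superpos (\<lambda>i \<alpha>. 1 * of_real (\<alpha> \<bullet> (b, 0)) * m i \<alpha>) f i x"
    have "of_real (x \<bullet> b) * superpos m f i x = ?\<Xi> i x" if i: "i \<in> I" for i x
    proof -
      have "of_real (x \<bullet> b) * superpos m f i x = (\<integral>\<alpha>. of_real (x \<bullet> b) * (m i \<alpha> * disp \<alpha> f x) \<partial>lborel)"
        unfolding superpos_def by simp
      also have "\<dots> = (\<integral>\<alpha>. m i \<alpha> * disp \<alpha> (\<lambda>y. of_real (y \<bullet> b) * f y) x + 1 * of_real (\<alpha> \<bullet> (b, 0)) * m i \<alpha> * disp \<alpha> f x \<partial>lborel)"
      proof (rule Bochner_Integration.integral_cong[OF refl])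
        fix \<alpha> :: "'b phase"
        have "of_real (x \<bullet> b) * (m i \<alpha> * disp \<alpha> f x) = m i \<alpha> * (of_real (x \<bullet> b) * disp \<alpha> f x)" by (simp only: mult_ac)
        then show "of_real (x \<bullet> b) * (m i \<alpha> * disp \<alpha> f x) =
           m i \<alpha> * disp \<alpha> (\<lambda>y. of_real (y \<bullet> b) * f y) x + 1 * of_real (\<alpha> \<bullet> (b, 0)) * m i \<alpha> * disp \<alpha> f x"
          unfolding disp_coord by (simp add: inner_prod_def algebra_simps)
      qed
      also have "\<dots> = ?\<Xi> i x"
        unfolding superpos_def
        by (rule Bochner_Integration.integral_add[OF superpos_integrable[OF base(1) i f'] superpos_integrable[OF m' i base(2)]])
      finally show ?thesis .
    qed
    moreover have "superpos_span I ?\<Xi>"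
      by (intro superpos_span.add superpos_span.base base f' m')
    ultimately show ?case by (intro exI[of _ ?\<Xi>]) auto
  next
    case (add \<Phi> \<Psi>)
    from add.IH(1) obtain X where X: "superpos_span I X" "\<forall>i\<in>I. (\<lambda>x. of_real (x \<bullet> b) * \<Phi> i x) = X i"
      by (elim exE conjE) (rule that)
    from add.IH(2) obtain Y where Y: "superpos_span I Y" "\<forall>i\<in>I. (\<lambda>x. of_real (x \<bullet> b) * \<Psi> i x) = Y i"
      by (elim exE conjE) (rule that)
    show ?case
      using X(2) Y(2) by (intro exI[of _ "\<lambda>i x. X i x + Y i x"] conjI superpos_span.add X(1) Y(1) ballI)
        (auto simp: fun_eq_iff distrib_left)
  qed
  with \<Psi>(2) show ?case by auto
qed

section \<open>Amplitudes of the eigenfunctions controlled by the Husimi function\<close>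

lemma infsum_of_real_complex:
  assumes "f summable_on I"
  shows "(\<Sum>\<^sub>\<infinity>i\<in>I. complex_of_real (f i)) = of_real (\<Sum>\<^sub>\<infinity>i\<in>I. f i)"
proof -
  have "(f has_sum infsum f I) I" using assms by (rule has_sum_infsum)
  from has_sum_of_real[OF this, where 'a = complex] show ?thesis by (rule infsumI)
qed

lemma l2_familyD:
  assumes "l2_family I \<psi>"
  shows "countable I" "i \<in> I \<Longrightarrow> sq_integrable (\<psi> i)" "(\<lambda>i. l2norm_sq (\<psi> i)) summable_on I"
  using assms unfolding l2_family_def by auto

lemma summable_l2ip:
  assumes "l2_family I \<psi>" "sq_integrable f"
  shows "(\<lambda>i. (cmod (l2ip f (\<psi> i)))\<^sup>2) summable_on I"
proof (rule summable_on_comparison_test)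
  show "(\<lambda>i. l2norm_sq f * l2norm_sq (\<psi> i)) summable_on I"
    by (rule summable_on_cmult_right[OF l2_familyD(3)[OF assms(1)]])
  show "(cmod (l2ip f (\<psi> i)))\<^sup>2 \<le> l2norm_sq f * l2norm_sq (\<psi> i)" if "i \<in> I" for i
    by (rule l2ip_bound[OF assms(2) l2_familyD(2)[OF assms(1) that]])
qed auto

lemma husimi_eq:
  assumes "l2_family I \<psi>" "sq_integrable chi"
  shows "husimi chi I \<psi> \<alpha> = of_real (\<Sum>\<^sub>\<infinity>i\<in>I. (cmod (l2ip (disp \<alpha> chi) (\<psi> i)))\<^sup>2)"
proof -
  have "l2ip (disp \<alpha> chi) (\<psi> i) * l2ip (\<psi> i) (disp \<alpha> chi) = of_real ((cmod (l2ip (disp \<alpha> chi) (\<psi> i)))\<^sup>2)" for i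
    by (subst (2) l2ip_cnj) (rule complex_norm_square[symmetric])
  then show ?thesis
    unfolding husimi_def matel_def fst_conv snd_conv
    by (simp only: infsum_of_real_complex[OF summable_l2ip[OF assms(1) sq_integrable_disp[OF assms(2)]]])
qed

lemma sum_l2ip_le_husimi:
  assumes "l2_family I \<psi>" "sq_integrable chi" "finite F" "F \<subseteq> I"
  shows "(\<Sum>i\<in>F. (cmod (l2ip (disp \<alpha> chi) (\<psi> i)))\<^sup>2) \<le> cmod (husimi chi I \<psi> \<alpha>)"
proof -
  note s = summable_l2ip[OF assms(1) sq_integrable_disp[OF assms(2)], of \<alpha>]
  have "(\<Sum>i\<in>F. (cmod (l2ip (disp \<alpha> chi) (\<psi> i)))\<^sup>2) \<le> (\<Sum>\<^sub>\<infinity>i\<in>I. (cmod (l2ip (disp \<alpha> chi) (\<psi> i)))\<^sup>2)"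
    by (rule finite_sum_le_infsum[OF s assms(3,4)]) auto
  also have "\<dots> \<le> cmod (husimi chi I \<psi> \<alpha>)" unfolding husimi_eq[OF assms(1,2)] norm_of_real by (rule abs_ge_self)
  finally show ?thesis .
qed

text \<open>Write the integrand as \<open>(wt ^ Suc N * |m i|) * (1 / wt)\<close> and apply
  Cauchy-Schwarz. The square integrals of the first factors are \<open>S i\<close>, and their finite
  sums are bounded by an integral of a power of the weight times Q, so they are summable.\<close>

lemma rapid_family_stft:
  fixes chi :: "real^'n \<Rightarrow> complex"
  assumes fam: "l2_family I \<psi>" and chi: "sq_integrable chi" and Q: "rapid_decay (husimi chi I \<psi>)"
  shows "rapid_family I (\<lambda>i \<alpha>. l2ip (disp \<alpha> chi) (\<psi> i))"
proof -
  define m where "m i \<alpha> = l2ip (disp \<alpha> chi) (\<psi> i)" for i \<alpha>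
  have mm: "m i \<in> borel_measurable borel" if "i \<in> I" for i
    unfolding m_def by (intro l2ip_disp_measurable sq_integrable_measurable chi l2_familyD(2)[OF fam that])
  have le: "(\<Sum>i\<in>F. (cmod (m i \<alpha>))\<^sup>2) \<le> cmod (husimi chi I \<psi> \<alpha>)" if "finite F" "F \<subseteq> I" for F \<alpha>
    unfolding m_def by (rule sum_l2ip_le_husimi[OF fam chi that])
  have "\<exists>B. (\<lambda>i. (B i)\<^sup>2) summable_on I \<and> (\<forall>i\<in>I. integrable lborel (\<lambda>x. wt x ^ N * cmod (m i x)) \<and>
        (\<integral>x. wt x ^ N * cmod (m i x) \<partial>lborel) \<le> B i)" for N
  proof -
    \<comment> \<open>The exponent of the squared factor \<open>wt ^ Suc N\<close>. The decay of Q
      is used with one power more, so that \<open>1 / wt\<close> is left as an integrable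
      majorant.\<close>
    define k where "k = 2 * N + 2"
    obtain C where C: "\<And>x. wt x ^ (Suc k) * cmod (husimi chi I \<psi> x) \<le> C"
      using rapid_decay_wt_bound[OF Q] by meson
    have ptw: "(\<Sum>i\<in>F. wt x ^ k * (cmod (m i x))\<^sup>2) \<le> C * (1 / wt x)" if "finite F" "F \<subseteq> I" for F x
    proof -
      have "wt x * (\<Sum>i\<in>F. wt x ^ k * (cmod (m i x))\<^sup>2) = wt x ^ Suc k * (\<Sum>i\<in>F. (cmod (m i x))\<^sup>2)"
        by (simp add: sum_distrib_left mult.assoc)
      also have "\<dots> \<le> wt x ^ Suc k * cmod (husimi chi I \<psi> x)"
        by (intro mult_left_mono le that) simp
      also have "\<dots> \<le> C" by (rule C)
      finally show ?thesis by (simp add: pos_le_divide_eq mult.commute)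
    qed
    have int1: "integrable lborel (\<lambda>x. wt x ^ k * (cmod (m i x))\<^sup>2)" if i: "i \<in> I" for i
    proof (rule Bochner_Integration.integrable_bound)
      show "integrable lborel (\<lambda>x::'n phase. C * (1 / wt x))" by (rule integrable_mult_right[OF integrable_inverse_wt])
      have [measurable]: "m i \<in> borel_measurable borel" by (rule mm[OF i])
      show "(\<lambda>x. wt x ^ k * (cmod (m i x))\<^sup>2) \<in> borel_measurable lborel" by measurable
      show "AE x in lborel. norm (wt x ^ k * (cmod (m i x))\<^sup>2) \<le> norm (C * (1 / wt x))"
      proof (rule AE_I2)
        fix x
        have "wt x ^ k * (cmod (m i x))\<^sup>2 \<le> C * (1 / wt x)" using ptw[of "{i}" x] i by simp
        also have "\<dots> \<le> norm (C * (1 / wt x))" unfolding real_norm_def by (rule abs_ge_self)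
        finally show "norm (wt x ^ k * (cmod (m i x))\<^sup>2) \<le> norm (C * (1 / wt x))" by simp
      qed
    qed
    define S where "S i = (\<integral>x. wt x ^ k * (cmod (m i x))\<^sup>2 \<partial>lborel)" for i
    have S0: "0 \<le> S i" for i unfolding S_def by (rule integral_nonneg_AE) auto
    have Ssum: "S summable_on I"
    proof (rule nonneg_bdd_above_summable_on)
      show "0 \<le> S i" for i by (rule S0)
      show "bdd_above (sum S ` {F. F \<subseteq> I \<and> finite F})"
      proof (rule bdd_aboveI2)
        fix F assume F: "F \<in> {F. F \<subseteq> I \<and> finite F}"
        have "sum S F = (\<integral>x. (\<Sum>i\<in>F. wt x ^ k * (cmod (m i x))\<^sup>2) \<partial>lborel)"
          unfolding S_def using F int1 by (subst Bochner_Integration.integral_sum) auto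
        also have "\<dots> \<le> (\<integral>x. C * (1 / wt x) \<partial>(lborel::'n phase measure))"
          using F int1 by (intro integral_mono ptw integrable_mult_right[OF integrable_inverse_wt] Bochner_Integration.integrable_sum) auto
        finally show "sum S F \<le> (\<integral>x. C * (1 / wt x) \<partial>(lborel::'n phase measure))" .
      qed
    qed
    have w2: "integrable lborel (\<lambda>x::'n phase. (cmod (of_real (1 / wt x)))\<^sup>2)"
    proof (rule Bochner_Integration.integrable_bound[OF integrable_inverse_wt])
      show "AE x::'n phase in lborel. norm ((cmod (of_real (1 / wt x)))\<^sup>2) \<le> norm (1 / wt x)"
        using wt_ge1 by (intro AE_I2) (simp add: norm_divide power2_eq_square divide_simps)
    qed measurable
    define K where "K = (\<integral>x. (cmod (of_real (1 / wt x)))\<^sup>2 \<partial>(lborel::'n phase measure))"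
    have K0: "0 \<le> K" unfolding K_def by (rule integral_nonneg_AE) auto
    have main: "integrable lborel (\<lambda>x. wt x ^ N * cmod (m i x)) \<and> (\<integral>x. wt x ^ N * cmod (m i x) \<partial>lborel) \<le> sqrt (S i * K)"
      if i: "i \<in> I" for i
    proof -
      have [measurable]: "m i \<in> borel_measurable borel" by (rule mm[OF i])
      let ?f = "\<lambda>x. of_real (wt x ^ Suc N) * m i x" and ?g = "\<lambda>x. complex_of_real (1 / wt x)"
      have f2: "(cmod (?f x))\<^sup>2 = wt x ^ k * (cmod (m i x))\<^sup>2" for x
        by (simp add: norm_mult norm_power power_mult_distrib k_def power_mult[symmetric] power_add power2_eq_square mult_2)
      have fg: "cmod (?f x) * cmod (?g x) = wt x ^ N * cmod (m i x)" for x
        by (simp add: norm_mult norm_power norm_divide)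
      have f: "?f \<in> borel_measurable lborel" and g: "?g \<in> borel_measurable lborel" by measurable
      have f2i: "integrable lborel (\<lambda>x. (cmod (?f x))\<^sup>2)" unfolding f2 by (rule int1[OF i])
      have "integrable lborel (\<lambda>x. cmod (?f x * ?g x))"
        by (rule integrable_norm[OF integrable_mult_of_squares[OF f g f2i w2]])
      then have "integrable lborel (\<lambda>x. wt x ^ N * cmod (m i x))" unfolding norm_mult[of "?f _" "?g _"] fg .
      moreover have "(\<integral>x. wt x ^ N * cmod (m i x) \<partial>lborel)\<^sup>2 \<le> S i * K"
        using integral_Cauchy_Schwarz[OF f g f2i w2] unfolding fg f2 S_def K_def .
      ultimately show ?thesis by (simp add: real_le_rsqrt)
    qed
    have "(\<lambda>i. (sqrt (S i * K))\<^sup>2) summable_on I"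
      using summable_on_cmult_left[OF Ssum, of K] S0 K0 by simp
    then show ?thesis using main by (intro exI[of _ "\<lambda>i. sqrt (S i * K)"]) simp
  qed
  then show ?thesis unfolding rapid_family_def m_def[symmetric] using mm by simp
qed

text \<open>The pointwise inversion formula is available for Schwartz functions, not for psi. Both
  sides are paired with a Schwartz function f, and two interchanges of integrals move the inversion
  onto the conjugate of f; orthogonality of the difference to all Schwartz functions finishes the
  proof.\<close>

lemma stft_reconstruction:
  fixes chi :: "real^'n \<Rightarrow> complex"
  assumes chi: "schwartz chi" "l2norm_sq chi = 1" and psi: "sq_integrable psi"
    and m: "integrable lborel (\<lambda>\<alpha>. l2ip (disp \<alpha> chi) psi)"
    and phi: "sq_integrable phi"
    and phi_def: "\<And>x. phi x = of_real ((1 / (2 * pi)) ^ CARD('n)) * (\<integral>\<alpha>. l2ip (disp \<alpha> chi) psi * disp \<alpha> chi x \<partial>lborel)"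
  shows "AE x in lborel. psi x = phi x"
proof -
  define m where "m \<alpha> = l2ip (disp \<alpha> chi) psi" for \<alpha>
  define c where "c = complex_of_real ((1 / (2 * pi)) ^ CARD('n))"
  have c: "c * of_real ((2 * pi) ^ CARD('n)) = 1"
    unfolding c_def of_real_mult[symmetric] power_mult_distrib[symmetric] by simp
  have mi: "integrable lborel m" using m unfolding m_def .
  then have [measurable]: "m \<in> borel_measurable borel" by auto
  have [measurable]: "psi \<in> borel_measurable borel" "phi \<in> borel_measurable borel"
    using psi phi by (auto intro: sq_integrable_measurable)
  have [measurable]: "chi \<in> borel_measurable borel" by (rule schwartz_measurable[OF chi(1)])
  have dj[measurable]: "(\<lambda>z. disp (fst z) chi (snd z)) \<in> borel_measurable (borel \<Otimes>\<^sub>M borel)"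
    using disp_joint_measurable[of chi] by (simp add: borel_prod)
  obtain C where C: "C \<ge> 0" "\<And>x. cmod (chi x) \<le> C" using schwartz_bound[OF chi(1), of 0] by auto
  obtain C1 where C1: "C1 \<ge> 0" "\<And>x. cmod (chi x) \<le> C1 / wt x ^ 1" using schwartz_bound[OF chi(1), of 1] by auto
  have weak: "(\<integral>x. f x * phi x \<partial>lborel) = (\<integral>x. f x * psi x \<partial>lborel)" if f: "schwartz f" for f
  proof -
    have [measurable]: "f \<in> borel_measurable borel" by (rule schwartz_measurable[OF f])
    define g where "g x = cnj (f x)" for x
    have g: "schwartz g" unfolding g_def by (rule schwartz_cnj[OF f])
    define A where "A \<alpha> = l2ip (disp \<alpha> chi) g" for \<alpha>
    have A: "schwartz A" unfolding A_def by (rule schwartz_l2ip_disp[OF chi(1) g])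
    have [measurable]: "A \<in> borel_measurable borel" by (rule schwartz_measurable[OF A])
    define F1 where "F1 z = f (fst z) * (m (snd z) * disp (snd z) chi (fst z))" for z
    have d2: "(\<lambda>z. disp (snd z) chi (fst z)) \<in> borel_measurable (borel \<Otimes>\<^sub>M borel)"
    proof -
      have "(\<lambda>z::(real^'n) \<times> 'n phase. (snd z, fst z)) \<in> borel \<Otimes>\<^sub>M borel \<rightarrow>\<^sub>M borel \<Otimes>\<^sub>M borel" by measurable
      from measurable_compose[OF this dj] show ?thesis by simp
    qed
    have F1: "integrable lborel F1"
    proof (rule integrable_tensor_bound[OF _ integrable_norm[OF schwartz_integrable[OF f]] integrable_mult_right[OF integrable_norm[OF mi], of C]])
      show "F1 \<in> borel_measurable borel" unfolding F1_def[abs_def] borel_prod[symmetric, where 'a = "real^'n" and 'b = "'n phase"]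
        by (intro borel_measurable_times d2 measurable_compose[OF measurable_fst \<open>f \<in> borel_measurable borel\<close>]
            measurable_compose[OF measurable_snd \<open>m \<in> borel_measurable borel\<close>])
      show "cmod (F1 (x, \<alpha>)) \<le> cmod (f x) * (C * cmod (m \<alpha>))" for x \<alpha>
        using mult_left_mono[OF C(2)[of "x - fst \<alpha>"], of "cmod (f x) * cmod (m \<alpha>)"]
        by (simp add: F1_def norm_mult mult_ac)
    qed
    define F2 where "F2 z = cnj (A (fst z)) * (cnj (disp (fst z) chi (snd z)) * psi (snd z))" for z
    have F2: "integrable lborel F2"
    \<comment> \<open>The decay of chi in \<open>y - fst \<alpha>\<close> is traded by Peetre's
      inequality for decay in y. The factor \<open>wt \<alpha>\<close> that this costs is absorbed
      by the Schwartz function \<open>A\<close>, and psi divided by the weight is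
      integrable.\<close>
    proof (rule integrable_tensor_bound[OF _ integrable_mult_right[OF schwartz_integrable_wt[OF A, of 1], of "C1 * 2 ^ CARD('n)"] integrable_cmod_div_wt[of psi]])
      show "F2 \<in> borel_measurable borel" unfolding F2_def[abs_def] borel_prod[symmetric, where 'b = "real^'n" and 'a = "'n phase"]
        by (intro borel_measurable_times measurable_compose[OF dj borel_measurable_cnj]
            measurable_compose[OF measurable_compose[OF measurable_fst \<open>A \<in> borel_measurable borel\<close>] borel_measurable_cnj]
            measurable_compose[OF measurable_snd \<open>psi \<in> borel_measurable borel\<close>])
      show "cmod (F2 (\<alpha>, y)) \<le> C1 * 2 ^ CARD('n) * (wt \<alpha> ^ 1 * cmod (A \<alpha>)) * (cmod (psi y) / wt y)" for \<alpha> y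
      proof -
        have "cmod (chi (y - fst \<alpha>)) \<le> C1 * (1 / wt (y + - fst \<alpha>))" using C1(2)[of "y - fst \<alpha>"] by simp
        also have "\<dots> \<le> C1 * (2 ^ DIM(real^'n) * wt (- fst \<alpha>) / wt y)" by (intro mult_left_mono inverse_wt_shift C1)
        also have "\<dots> \<le> C1 * (2 ^ DIM(real^'n) * wt \<alpha> / wt y)"
          using wt_fst_le[of \<alpha>] C1(1) by (intro mult_left_mono divide_right_mono) auto
        finally have "cmod (A \<alpha>) * (cmod (chi (y - fst \<alpha>)) * cmod (psi y)) \<le> cmod (A \<alpha>) * (C1 * (2 ^ DIM(real^'n) * wt \<alpha> / wt y) * cmod (psi y))"
          by (intro mult_left_mono mult_right_mono) auto
        then show ?thesis by (simp add: F2_def norm_mult mult_ac)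
      qed
    qed (use psi in \<open>auto simp: sq_integrable_def\<close>)
    have "(\<integral>x. f x * phi x \<partial>lborel) = c * (\<integral>x. (\<integral>\<alpha>. F1 (x, \<alpha>) \<partial>lborel) \<partial>lborel)"
    proof -
      have "f x * phi x = c * (\<integral>\<alpha>. F1 (x, \<alpha>) \<partial>lborel)" for x
      proof -
        have "(\<integral>\<alpha>. F1 (x, \<alpha>) \<partial>lborel) = f x * (\<integral>\<alpha>. m \<alpha> * disp \<alpha> chi x \<partial>lborel)"
          unfolding F1_def fst_conv snd_conv by (rule integral_mult_right_zero)
        then show ?thesis unfolding phi_def m_def c_def by (simp only: mult.left_commute)
      qed
      then show ?thesis by (simp only: integral_mult_right_zero)
    qed
    also have "(\<integral>x. (\<integral>\<alpha>. F1 (x, \<alpha>) \<partial>lborel) \<partial>lborel) = (\<integral>\<alpha>. (\<integral>x. F1 (x, \<alpha>) \<partial>lborel) \<partial>lborel)"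
      by (rule lborel_integral_swap[OF F1])
    also have "\<dots> = (\<integral>\<alpha>. (\<integral>y. F2 (\<alpha>, y) \<partial>lborel) \<partial>lborel)"
    proof (rule Bochner_Integration.integral_cong[OF refl])
      fix \<alpha>
      have "(\<integral>x. F1 (x, \<alpha>) \<partial>lborel) = m \<alpha> * (\<integral>x. f x * disp \<alpha> chi x \<partial>lborel)"
        unfolding integral_mult_right_zero[symmetric] F1_def by (simp add: mult_ac)
      also have "(\<integral>x. f x * disp \<alpha> chi x \<partial>lborel) = cnj (A \<alpha>)"
        unfolding A_def l2ip_def Bochner_Integration.integral_cnj[symmetric] by (simp add: g_def mult.commute)
      also have "m \<alpha> * cnj (A \<alpha>) = (\<integral>y. F2 (\<alpha>, y) \<partial>lborel)"
        unfolding m_def l2ip_def F2_def by (simp add: mult.commute)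
      finally show "(\<integral>x. F1 (x, \<alpha>) \<partial>lborel) = (\<integral>y. F2 (\<alpha>, y) \<partial>lborel)" .
    qed
    also have "\<dots> = (\<integral>y. (\<integral>\<alpha>. F2 (\<alpha>, y) \<partial>lborel) \<partial>lborel)"
      by (rule lborel_integral_swap[OF F2])
    also have "\<dots> = (\<integral>y. of_real ((2 * pi) ^ CARD('n)) * (f y * psi y) \<partial>lborel)"
    proof (rule Bochner_Integration.integral_cong[OF refl])
      fix y
      have "(\<integral>\<alpha>. F2 (\<alpha>, y) \<partial>lborel) = psi y * cnj (\<integral>\<alpha>. disp \<alpha> chi y * A \<alpha> \<partial>lborel)"
        unfolding Bochner_Integration.integral_cnj[symmetric] integral_mult_right_zero[symmetric]
        by (simp add: F2_def mult_ac)
      also have "(\<integral>\<alpha>. disp \<alpha> chi y * A \<alpha> \<partial>lborel) = of_real ((2 * pi) ^ CARD('n)) * g y"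
        unfolding A_def by (rule stft_inversion(1)[OF chi g])
      finally show "(\<integral>\<alpha>. F2 (\<alpha>, y) \<partial>lborel) = of_real ((2 * pi) ^ CARD('n)) * (f y * psi y)"
        by (simp add: g_def mult_ac)
    qed
    also have "\<dots> = of_real ((2 * pi) ^ CARD('n)) * (\<integral>y. f y * psi y \<partial>lborel)" by (rule integral_mult_right_zero)
    also have "c * \<dots> = (\<integral>y. f y * psi y \<partial>lborel)" unfolding mult.assoc[symmetric] c by simp
    finally show ?thesis .
  qed
  have "AE x in lborel. psi x - phi x = 0"
  proof (rule AE_zero_if_orthogonal_schwartz)
    show "(\<lambda>x. psi x - phi x) \<in> borel_measurable borel" by measurable
    show "integrable lborel (\<lambda>x. (cmod (psi x - phi x))\<^sup>2)"
    proof (rule Bochner_Integration.integrable_bound)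
      show "integrable lborel (\<lambda>x. 2 * (cmod (psi x))\<^sup>2 + 2 * (cmod (phi x))\<^sup>2)"
        using psi phi unfolding sq_integrable_def by simp
      show "AE x in lborel. norm ((cmod (psi x - phi x))\<^sup>2) \<le> norm (2 * (cmod (psi x))\<^sup>2 + 2 * (cmod (phi x))\<^sup>2)"
      proof (rule AE_I2)
        fix x
        have "(cmod (psi x - phi x))\<^sup>2 \<le> (cmod (psi x) + cmod (phi x))\<^sup>2"
          by (intro power_mono norm_triangle_ineq4) auto
        also have "\<dots> \<le> 2 * (cmod (psi x))\<^sup>2 + 2 * (cmod (phi x))\<^sup>2"
          using zero_le_power2[of "cmod (psi x) - cmod (phi x)"] by (simp add: power2_sum power2_diff)
        finally show "norm ((cmod (psi x - phi x))\<^sup>2) \<le> norm (2 * (cmod (psi x))\<^sup>2 + 2 * (cmod (phi x))\<^sup>2)" by simp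
      qed
    qed measurable
    fix f :: "real^'n \<Rightarrow> complex" assume f: "schwartz f"
    note ff = schwartz_sq_integrable[OF schwartz_cnj[OF f]]
    have "integrable lborel (\<lambda>x. f x * psi x)" "integrable lborel (\<lambda>x. f x * phi x)"
      using l2ip_integrable[OF ff psi] l2ip_integrable[OF ff phi] by simp_all
    then show "(\<integral>x. f x * (psi x - phi x) \<partial>lborel) = 0"
      using weak[OF f] by (simp add: right_diff_distrib)
  qed
  then show ?thesis by eventually_elim simp
qed

theorem husimi_rapid_decay_imp_sjs:
  fixes chi :: "real^'n \<Rightarrow> complex"
  assumes chi: "schwartz chi" "l2norm_sq chi = 1" and fam: "l2_family I \<psi>"
    and Q: "rapid_decay (husimi chi I \<psi>)"
  shows "\<exists>\<phi>. sjs I \<phi> \<and> (\<forall>i\<in>I. AE x in lborel. \<psi> i x = \<phi> i x)"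
proof -
  note chi2 = schwartz_sq_integrable[OF chi(1)]
  note m = rapid_family_stft[OF fam chi2 Q]
  define \<phi> where "\<phi> i x = of_real ((1 / (2 * pi)) ^ CARD('n)) * superpos (\<lambda>i \<alpha>. l2ip (disp \<alpha> chi) (\<psi> i)) chi i x" for i x
  have s: "sjs I \<phi>" unfolding \<phi>_def[abs_def]
    by (intro sjs_cmult superpos_span_sjs superpos_span.base m chi(1))
  have "AE x in lborel. \<psi> i x = \<phi> i x" if i: "i \<in> I" for i
  proof (rule stft_reconstruction[OF chi l2_familyD(2)[OF fam i]])
    show "integrable lborel (\<lambda>\<alpha>. l2ip (disp \<alpha> chi) (\<psi> i))" by (rule rapid_family_integrable[OF m i])
    show "sq_integrable (\<phi> i)" by (rule schwartz_sq_integrable[OF sjs_imp_schwartz[OF s i]])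
    show "\<phi> i x = of_real ((1 / (2 * pi)) ^ CARD('n)) * (\<integral>\<alpha>. l2ip (disp \<alpha> chi) (\<psi> i) * disp \<alpha> chi x \<partial>lborel)" for x
      unfolding \<phi>_def superpos_def ..
  qed
  with s show ?thesis by blast
qed

section \<open>Kernel, Wigner function and characteristic function\<close>

lemma AE_lborel_affine:
  fixes P :: "'a::euclidean_space \<Rightarrow> bool"
  assumes P: "AE x in lborel. P x" and c: "c \<noteq> 0"
  shows "AE x in lborel. P (t + c *\<^sub>R x)"
proof -
  have "AE x in density (distr lborel borel (\<lambda>x. t + c *\<^sub>R x)) (\<lambda>_. \<bar>c\<bar>^DIM('a)). P x"
    by (subst lborel_affine[OF c, of t, symmetric]) (rule P)
  then have "AE x in distr lborel borel (\<lambda>x. t + c *\<^sub>R x). P x"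
    using c by (subst (asm) AE_density) auto
  then show ?thesis by (rule AE_distrD[rotated]) measurable
qed

lemma
  fixes f :: "real^'n \<Rightarrow> complex"
  assumes f: "sq_integrable f" and c: "c \<noteq> 0"
  shows sq_integrable_affine: "sq_integrable (\<lambda>x. f (t + c *\<^sub>R x))"
    and l2norm_sq_affine: "l2norm_sq (\<lambda>x. f (t + c *\<^sub>R x)) = l2norm_sq f / \<bar>c\<bar> ^ CARD('n)"
proof -
  have [measurable]: "f \<in> borel_measurable borel" by (rule sq_integrable_measurable[OF f])
  have "(\<lambda>x. f (t + c *\<^sub>R x)) \<in> borel_measurable lborel" by measurable
  moreover have "integrable lborel (\<lambda>x. (cmod (f (t + c *\<^sub>R x)))\<^sup>2)"
    using f c unfolding sq_integrable_def by (intro integrable_affine[of "\<lambda>x. (cmod (f x))\<^sup>2"]) auto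
  ultimately show "sq_integrable (\<lambda>x. f (t + c *\<^sub>R x))" unfolding sq_integrable_def by blast
  have "complex_of_real (l2norm_sq f) = (\<integral>x. of_real ((cmod (f x))\<^sup>2) \<partial>lborel)"
    unfolding l2norm_sq_def by (rule integral_complex_of_real[symmetric])
  also have "\<dots> = of_real (\<bar>c\<bar> ^ CARD('n)) * (\<integral>x. of_real ((cmod (f (t + c *\<^sub>R x)))\<^sup>2) \<partial>lborel)"
    using integral_affine[of "\<lambda>x. complex_of_real ((cmod (f x))\<^sup>2)" c t] c by simp
  also have "\<dots> = complex_of_real (\<bar>c\<bar> ^ CARD('n) * l2norm_sq (\<lambda>x. f (t + c *\<^sub>R x)))"
    unfolding l2norm_sq_def of_real_mult by (simp only: integral_complex_of_real)
  finally have "l2norm_sq f = \<bar>c\<bar> ^ CARD('n) * l2norm_sq (\<lambda>x. f (t + c *\<^sub>R x))"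
    by (simp only: of_real_eq_iff)
  then show "l2norm_sq (\<lambda>x. f (t + c *\<^sub>R x)) = l2norm_sq f / \<bar>c\<bar> ^ CARD('n)" using c by simp
qed

text \<open>On each slice the i-th term is a product of two affine copies of one square-integrable
  function, so its L^1 norm is at most a constant times \<open>l2norm_sq\<close>, and the trace
  condition permits summing. The Wigner function uses the factors -1/2 and 1/2, the characteristic
  function 1 and 1.\<close>

lemma
  fixes \<psi> :: "'i \<Rightarrow> real^'n \<Rightarrow> complex"
  assumes fam: "l2_family I \<psi>" and c: "c \<noteq> 0" "c' \<noteq> 0"
    and e: "e \<in> borel_measurable borel" "\<And>s. cmod (e s) \<le> 1"
  shows integrable_kernel_affine: "integrable lborel (\<lambda>s. e s * kernel I \<psi> (t + c *\<^sub>R s, t' + c' *\<^sub>R s))"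
    and integral_kernel_affine: "(\<integral>s. e s * kernel I \<psi> (t + c *\<^sub>R s, t' + c' *\<^sub>R s) \<partial>lborel) =
      (\<Sum>\<^sub>\<infinity>i\<in>I. \<integral>s. e s * (\<psi> i (t + c *\<^sub>R s) * cnj (\<psi> i (t' + c' *\<^sub>R s))) \<partial>lborel)"
proof -
  have [measurable]: "e \<in> borel_measurable borel" by fact
  define f where "f i s = e s * (\<psi> i (t + c *\<^sub>R s) * cnj (\<psi> i (t' + c' *\<^sub>R s)))" for i s
  have eq: "e s * kernel I \<psi> (t + c *\<^sub>R s, t' + c' *\<^sub>R s) = (\<Sum>\<^sub>\<infinity>i\<in>I. f i s)" for s
    unfolding kernel_def f_def fst_conv snd_conv by (rule infsum_cmult_right'[symmetric])
  \<comment> \<open>Each affine copy divides the squared norm by a power of its factor;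
    Cauchy-Schwarz takes the root of the product.\<close>
  define K where "K = sqrt (1 / (\<bar>c\<bar> ^ CARD('n) * \<bar>c'\<bar> ^ CARD('n)))"
  have K: "K \<ge> 0" unfolding K_def by simp
  have main: "integrable lborel (f i) \<and> (\<integral>s. cmod (f i s) \<partial>lborel) \<le> K * l2norm_sq (\<psi> i)" if i: "i \<in> I" for i
  proof -
    have psi: "sq_integrable (\<psi> i)" by (rule l2_familyD(2)[OF fam i])
    let ?a = "\<lambda>s. \<psi> i (t + c *\<^sub>R s)" and ?b = "\<lambda>s. \<psi> i (t' + c' *\<^sub>R s)"
    have a: "sq_integrable ?a" and b: "sq_integrable ?b" by (intro sq_integrable_affine psi c)+
    have [measurable]: "?a \<in> borel_measurable borel" "?b \<in> borel_measurable borel"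
      by (intro sq_integrable_measurable a b)+
    have ab: "integrable lborel (\<lambda>s. cmod (?a s) * cmod (?b s))" by (rule l2ip_cmod_integrable[OF a b])
    have le: "cmod (f i s) \<le> cmod (?a s) * cmod (?b s)" for s
      using mult_right_mono[OF e(2), of "cmod (?a s) * cmod (?b s)" s] by (simp add: f_def norm_mult)
    have int: "integrable lborel (f i)"
    proof (rule Bochner_Integration.integrable_bound[OF ab])
      show "f i \<in> borel_measurable lborel" unfolding f_def[abs_def] by measurable
      show "AE s in lborel. cmod (f i s) \<le> norm (cmod (?a s) * cmod (?b s))"
        using le by (intro AE_I2) simp
    qed
    have "(\<integral>s. cmod (f i s) \<partial>lborel) \<le> (\<integral>s. cmod (?a s) * cmod (?b s) \<partial>lborel)"
      by (intro integral_mono integrable_norm int ab le)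
    also have "\<dots> \<le> K * l2norm_sq (\<psi> i)"
    proof (rule power2_le_imp_le)
      have "(\<integral>s. cmod (?a s) * cmod (?b s) \<partial>lborel)\<^sup>2 \<le> l2norm_sq ?a * l2norm_sq ?b"
        by (rule integral_cmod_mult_le[OF a b])
      also have "\<dots> = (K * l2norm_sq (\<psi> i))\<^sup>2"
        unfolding l2norm_sq_affine[OF psi c(1)] l2norm_sq_affine[OF psi c(2)] K_def power_mult_distrib
        by (subst real_sqrt_pow2) (simp_all add: power2_eq_square)
      finally show "(\<integral>s. cmod (?a s) * cmod (?b s) \<partial>lborel)\<^sup>2 \<le> (K * l2norm_sq (\<psi> i))\<^sup>2" .
      show "0 \<le> K * l2norm_sq (\<psi> i)" by (intro mult_nonneg_nonneg K l2norm_sq_nonneg)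
    qed
    finally show ?thesis using int by blast
  qed
  have sum: "(\<lambda>i. \<integral>s. cmod (f i s) \<partial>lborel) summable_on I"
  proof (rule summable_on_comparison_test)
    show "(\<lambda>i. K * l2norm_sq (\<psi> i)) summable_on I" by (rule summable_on_cmult_right[OF l2_familyD(3)[OF fam]])
  qed (use main in \<open>auto intro!: integral_nonneg_AE\<close>)
  note * = sigma_finite_lborel l2_familyD(1)[OF fam] main[THEN conjunct1] sum
  show "integrable lborel (\<lambda>s. e s * kernel I \<psi> (t + c *\<^sub>R s, t' + c' *\<^sub>R s))"
    unfolding eq by (rule integrable_infsum[OF *])
  show "(\<integral>s. e s * kernel I \<psi> (t + c *\<^sub>R s, t' + c' *\<^sub>R s) \<partial>lborel) =
      (\<Sum>\<^sub>\<infinity>i\<in>I. \<integral>s. e s * (\<psi> i (t + c *\<^sub>R s) * cnj (\<psi> i (t' + c' *\<^sub>R s))) \<partial>lborel)"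
    unfolding eq f_def[symmetric] by (rule integral_infsum[OF *])
qed

text \<open>Each term is a tensor product whose L^1 norm is again at most a constant times
  \<open>l2norm_sq\<close>, so sum and integral may be exchanged. This turns M and Q into integrals
  of the kernel against displaced copies of chi.\<close>

lemma
  fixes \<psi> :: "'i \<Rightarrow> real^'n \<Rightarrow> complex"
  assumes fam: "l2_family I \<psi>" and g: "sq_integrable g" "sq_integrable g'"
  shows integrable_kernel_form: "integrable lborel (\<lambda>z. cnj (g (fst z)) * g' (snd z) * kernel I \<psi> z)"
    and kernel_form: "(\<Sum>\<^sub>\<infinity>i\<in>I. l2ip g (\<psi> i) * l2ip (\<psi> i) g') = (\<integral>z. cnj (g (fst z)) * g' (snd z) * kernel I \<psi> z \<partial>lborel)"
proof -
  define f where "f i z = (cnj (g (fst z)) * \<psi> i (fst z)) * (cnj (\<psi> i (snd z)) * g' (snd z))" for i z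
  have eq: "cnj (g (fst z)) * g' (snd z) * kernel I \<psi> z = (\<Sum>\<^sub>\<infinity>i\<in>I. f i z)" for z
  proof -
    have "f i z = (cnj (g (fst z)) * g' (snd z)) * (\<psi> i (fst z) * cnj (\<psi> i (snd z)))" for i
      by (simp add: f_def mult_ac)
    then show ?thesis unfolding kernel_def by (simp only: infsum_cmult_right')
  qed
  have int: "integrable lborel (f i)" if i: "i \<in> I" for i
    unfolding f_def[abs_def] by (intro integrable_tensor l2ip_integrable g l2_familyD(2)[OF fam i])
  have val: "l2ip g (\<psi> i) * l2ip (\<psi> i) g' = (\<integral>z. f i z \<partial>lborel)" if i: "i \<in> I" for i
    unfolding lborel_integral_fst[OF int[OF i], symmetric] by (simp add: f_def l2ip_def)
  have nrm: "(\<integral>z. cmod (f i z) \<partial>lborel) \<le> sqrt (l2norm_sq g * l2norm_sq g') * l2norm_sq (\<psi> i)" if i: "i \<in> I" for i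
  proof -
    have psi: "sq_integrable (\<psi> i)" by (rule l2_familyD(2)[OF fam i])
    note i1 = l2ip_cmod_integrable[OF g(1) psi] and i2 = l2ip_cmod_integrable[OF psi g(2)]
    define A where "A = (\<integral>x. cmod (g x) * cmod (\<psi> i x) \<partial>lborel)"
    define B where "B = (\<integral>x. cmod (\<psi> i x) * cmod (g' x) \<partial>lborel)"
    have "complex_of_real (\<integral>z. cmod (f i z) \<partial>lborel) = (\<integral>z. of_real (cmod (g (fst z)) * cmod (\<psi> i (fst z))) * of_real (cmod (\<psi> i (snd z)) * cmod (g' (snd z))) \<partial>lborel)"
      by (subst integral_complex_of_real[symmetric]) (simp add: f_def norm_mult)
    also have "\<dots> = (\<integral>x. (\<integral>y. complex_of_real (cmod (g x) * cmod (\<psi> i x)) * of_real (cmod (\<psi> i y) * cmod (g' y)) \<partial>lborel) \<partial>lborel)"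
      by (subst lborel_integral_fst[symmetric])
        (use integrable_tensor[OF integrable_of_real[OF i1] integrable_of_real[OF i2], where 'c = complex] in auto)
    also have "\<dots> = complex_of_real A * complex_of_real B"
      unfolding A_def B_def integral_mult_right_zero integral_mult_left_zero integral_complex_of_real ..
    also have "\<dots> = complex_of_real (A * B)" by simp
    finally have AB: "(\<integral>z. cmod (f i z) \<partial>lborel) = A * B" by (simp only: of_real_eq_iff)
    have "(A * B)\<^sup>2 \<le> (l2norm_sq g * l2norm_sq (\<psi> i)) * (l2norm_sq (\<psi> i) * l2norm_sq g')"
      unfolding power_mult_distrib A_def B_def
      by (intro mult_mono integral_cmod_mult_le g psi mult_nonneg_nonneg l2norm_sq_nonneg) auto
    also have "\<dots> = (sqrt (l2norm_sq g * l2norm_sq g') * l2norm_sq (\<psi> i))\<^sup>2"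
      unfolding power_mult_distrib by (subst real_sqrt_pow2) (auto simp: l2norm_sq_nonneg power2_eq_square)
    finally have "A * B \<le> sqrt (l2norm_sq g * l2norm_sq g') * l2norm_sq (\<psi> i)"
      by (rule power2_le_imp_le) (auto simp: l2norm_sq_nonneg)
    then show ?thesis unfolding AB .
  qed
  have sum: "(\<lambda>i. \<integral>z. cmod (f i z) \<partial>lborel) summable_on I"
  proof (rule summable_on_comparison_test)
    show "(\<lambda>i. sqrt (l2norm_sq g * l2norm_sq g') * l2norm_sq (\<psi> i)) summable_on I"
      by (rule summable_on_cmult_right[OF l2_familyD(3)[OF fam]])
  qed (use nrm in \<open>auto intro!: integral_nonneg_AE\<close>)
  note * = sigma_finite_lborel l2_familyD(1)[OF fam] int sum
  show "integrable lborel (\<lambda>z. cnj (g (fst z)) * g' (snd z) * kernel I \<psi> z)"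
    unfolding eq by (rule integrable_infsum[OF *])
  have "(\<Sum>\<^sub>\<infinity>i\<in>I. l2ip g (\<psi> i) * l2ip (\<psi> i) g') = (\<Sum>\<^sub>\<infinity>i\<in>I. \<integral>z. f i z \<partial>lborel)"
    by (rule infsum_cong) (rule val)
  also have "\<dots> = (\<integral>z. (\<Sum>\<^sub>\<infinity>i\<in>I. f i z) \<partial>lborel)"
    by (rule integral_infsum[OF *, symmetric])
  finally show "(\<Sum>\<^sub>\<infinity>i\<in>I. l2ip g (\<psi> i) * l2ip (\<psi> i) g') = (\<integral>z. cnj (g (fst z)) * g' (snd z) * kernel I \<psi> z \<partial>lborel)"
    unfolding eq .
qed

lemma borel_measurable_iexp_inner: "(\<lambda>s::'a::euclidean_space. iexp (p \<bullet> s)) \<in> borel_measurable borel"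
  by (intro borel_measurable_continuous_onI continuous_intros)

lemma wigner_eq_pft:
  "wigner I \<psi> = (\<lambda>\<alpha>. of_real ((1 / (2 * pi)) ^ CARD('n)) *
     pft (\<lambda>z. kernel I (\<psi> :: 'i \<Rightarrow> real^'n \<Rightarrow> complex) (fst z - (1/2) *\<^sub>R snd z, fst z + (1/2) *\<^sub>R snd z)) \<alpha>)"
  by (simp add: fun_eq_iff wigner_def pft_def)

text \<open>Dual to the Wigner function: in midpoint and difference coordinates of the same kernel,
  the Wigner function transforms the difference, the characteristic function the midpoint.\<close>

lemma qchar_eq_pft:
  fixes \<psi> :: "'i \<Rightarrow> real^'n \<Rightarrow> complex"
  assumes fam: "l2_family I \<psi>"
  shows "qchar I \<psi> = pft (\<lambda>z. kernel I \<psi> (snd z - (1/2) *\<^sub>R fst z, snd z + (1/2) *\<^sub>R fst z))"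
proof
  fix \<xi> :: "'n phase"
  have "l2ip (\<psi> i) (disp \<xi> (\<psi> i)) = (\<integral>u. iexp (snd \<xi> \<bullet> u) *
      (\<psi> i (- ((1/2) *\<^sub>R fst \<xi>) + 1 *\<^sub>R u) * cnj (\<psi> i ((1/2) *\<^sub>R fst \<xi> + 1 *\<^sub>R u))) \<partial>lborel)" if i: "i \<in> I" for i
  proof -
    have [measurable]: "\<psi> i \<in> borel_measurable borel" by (rule sq_integrable_measurable[OF l2_familyD(2)[OF fam i]])
    have "l2ip (\<psi> i) (disp \<xi> (\<psi> i)) = cnj (pft (stft_kernel (\<psi> i) (\<psi> i)) (fst \<xi>, - snd \<xi>))"
      by (subst l2ip_cnj, subst l2ip_disp_eq_pft) simp_all
    also have "\<dots> = (\<integral>u. cnj (iexp (- (snd \<xi> \<bullet> u)) * stft_kernel (\<psi> i) (\<psi> i) (fst \<xi>, u)) \<partial>lborel)"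
      unfolding pft_def Bochner_Integration.integral_cnj by simp
    also have "\<dots> = (\<integral>u. iexp (snd \<xi> \<bullet> u) *
      (\<psi> i (- ((1/2) *\<^sub>R fst \<xi>) + 1 *\<^sub>R u) * cnj (\<psi> i ((1/2) *\<^sub>R fst \<xi> + 1 *\<^sub>R u))) \<partial>lborel)"
      by (intro Bochner_Integration.integral_cong refl) (simp add: stft_kernel_def exp_cnj add.commute)
    finally show ?thesis .
  qed
  then have "qchar I \<psi> \<xi> = (\<Sum>\<^sub>\<infinity>i\<in>I. \<integral>u. iexp (snd \<xi> \<bullet> u) *
      (\<psi> i (- ((1/2) *\<^sub>R fst \<xi>) + 1 *\<^sub>R u) * cnj (\<psi> i ((1/2) *\<^sub>R fst \<xi> + 1 *\<^sub>R u))) \<partial>lborel)"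
    unfolding qchar_def by (rule infsum_cong)
  also have "\<dots> = (\<integral>u. iexp (snd \<xi> \<bullet> u) * kernel I \<psi> (- ((1/2) *\<^sub>R fst \<xi>) + 1 *\<^sub>R u, (1/2) *\<^sub>R fst \<xi> + 1 *\<^sub>R u) \<partial>lborel)"
    by (rule integral_kernel_affine[OF fam, symmetric]) (simp_all add: borel_measurable_iexp_inner)
  finally show "qchar I \<psi> \<xi> = pft (\<lambda>z. kernel I \<psi> (snd z - (1/2) *\<^sub>R fst z, snd z + (1/2) *\<^sub>R fst z)) \<xi>"
    by (simp add: pft_def add.commute)
qed

lemma schwartz_swap: "schwartz G \<Longrightarrow> schwartz (\<lambda>z. G (snd z, fst z))"
  by (rule schwartz_linear[of G "\<lambda>z. (snd z, fst z)" "\<lambda>z. (snd z, fst z)"]) (auto intro!: linearI)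

section \<open>Almost everywhere equal representatives\<close>

lemma l2_family_cong_AE:
  assumes fam: "l2_family I \<psi>" and phi: "\<forall>i\<in>I. sq_integrable (\<phi> i)"
    and AE: "\<forall>i\<in>I. AE x in lborel. \<psi> i x = \<phi> i x"
  shows "l2_family I \<phi>"
proof -
  have "l2norm_sq (\<psi> i) = l2norm_sq (\<phi> i)" if "i \<in> I" for i
    by (rule l2norm_sq_cong_AE[OF AE[rule_format, OF that] l2_familyD(2)[OF fam that] phi[rule_format, OF that]])
  then have "(\<lambda>i. l2norm_sq (\<phi> i)) summable_on I"
    using l2_familyD(3)[OF fam] by (subst summable_on_cong[of I _ "\<lambda>i. l2norm_sq (\<psi> i)"]) auto
  then show ?thesis using l2_familyD(1)[OF fam] phi unfolding l2_family_def by blast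
qed

text \<open>Countability of \<open>I\<close> merges the exceptional null sets of the members into
  one.\<close>

lemma AE_all_eq:
  assumes "countable I" "\<forall>i\<in>I. AE x in M. \<psi> i x = \<phi> i x"
  shows "AE x in M. \<forall>i\<in>I. \<psi> i x = \<phi> i x"
  using assms by (subst AE_ball_countable) auto

lemma kernel_cong: "(\<And>i. i \<in> I \<Longrightarrow> \<psi> i (fst z) = \<phi> i (fst z)) \<Longrightarrow> (\<And>i. i \<in> I \<Longrightarrow> \<psi> i (snd z) = \<phi> i (snd z)) \<Longrightarrow>
   kernel I \<psi> z = kernel I \<phi> z"
  unfolding kernel_def by (rule infsum_cong) simp

lemma AE_kernel_eq:
  assumes "countable I" and AE: "\<forall>i\<in>I. AE x in lborel. \<psi> i x = \<phi> i x"
  shows "AE z in lborel. kernel I \<psi> z = kernel I \<phi> z"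
  using AE_lborel_fst[OF AE_all_eq[OF assms(1) AE]] AE_lborel_snd[OF AE_all_eq[OF assms(1) AE]]
  by eventually_elim (intro kernel_cong, auto)

text \<open>Equality of two kernels almost everywhere on the product space says nothing about a
  single line. Here the exceptional set depends on each coordinate separately, and null sets pull
  back to null sets because both factors are nonzero. So the Wigner and characteristic functions of
  the two families agree at every point.\<close>

lemma integral_kernel_affine_cong:
  fixes \<psi> \<phi> :: "'i \<Rightarrow> real^'n \<Rightarrow> complex"
  assumes fam: "l2_family I \<psi>" "l2_family I \<phi>" and AE: "\<forall>i\<in>I. AE x in lborel. \<psi> i x = \<phi> i x"
    and c: "c \<noteq> 0" "c' \<noteq> 0"
  shows "(\<integral>s. iexp (p \<bullet> s) * kernel I \<psi> (t + c *\<^sub>R s, t' + c' *\<^sub>R s) \<partial>lborel) =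
    (\<integral>s. iexp (p \<bullet> s) * kernel I \<phi> (t + c *\<^sub>R s, t' + c' *\<^sub>R s) \<partial>lborel)"
proof (rule integral_cong_AE)
  note ae = AE_all_eq[OF l2_familyD(1)[OF fam(1)] AE]
  show "AE s in lborel. iexp (p \<bullet> s) * kernel I \<psi> (t + c *\<^sub>R s, t' + c' *\<^sub>R s) = iexp (p \<bullet> s) * kernel I \<phi> (t + c *\<^sub>R s, t' + c' *\<^sub>R s)"
    using AE_lborel_affine[OF ae c(1), of t] AE_lborel_affine[OF ae c(2), of t']
  proof eventually_elim
    case (elim s)
    have "kernel I \<psi> (t + c *\<^sub>R s, t' + c' *\<^sub>R s) = kernel I \<phi> (t + c *\<^sub>R s, t' + c' *\<^sub>R s)"
      by (rule kernel_cong) (use elim in auto)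
    then show ?case by simp
  qed
qed (use integrable_kernel_affine[OF fam(1) c borel_measurable_iexp_inner] integrable_kernel_affine[OF fam(2) c borel_measurable_iexp_inner]
     in \<open>auto intro!: borel_measurable_integrable\<close>)

lemma pft_kernel_cong:
  fixes \<psi> \<phi> :: "'i \<Rightarrow> real^'n \<Rightarrow> complex"
  assumes fam: "l2_family I \<psi>" "l2_family I \<phi>" and AE: "\<forall>i\<in>I. AE x in lborel. \<psi> i x = \<phi> i x"
  shows "pft (\<lambda>z. kernel I \<psi> (fst z - (1/2) *\<^sub>R snd z, fst z + (1/2) *\<^sub>R snd z)) = pft (\<lambda>z. kernel I \<phi> (fst z - (1/2) *\<^sub>R snd z, fst z + (1/2) *\<^sub>R snd z))"
    and "pft (\<lambda>z. kernel I \<psi> (snd z - (1/2) *\<^sub>R fst z, snd z + (1/2) *\<^sub>R fst z)) = pft (\<lambda>z. kernel I \<phi> (snd z - (1/2) *\<^sub>R fst z, snd z + (1/2) *\<^sub>R fst z))"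
proof -
  show "pft (\<lambda>z. kernel I \<psi> (fst z - (1/2) *\<^sub>R snd z, fst z + (1/2) *\<^sub>R snd z)) = pft (\<lambda>z. kernel I \<phi> (fst z - (1/2) *\<^sub>R snd z, fst z + (1/2) *\<^sub>R snd z))"
    using integral_kernel_affine_cong[OF fam AE, of "-(1/2)" "1/2"] by (simp add: pft_def fun_eq_iff)
  show "pft (\<lambda>z. kernel I \<psi> (snd z - (1/2) *\<^sub>R fst z, snd z + (1/2) *\<^sub>R fst z)) = pft (\<lambda>z. kernel I \<phi> (snd z - (1/2) *\<^sub>R fst z, snd z + (1/2) *\<^sub>R fst z))"
  proof
    fix z :: "'n phase"
    show "pft (\<lambda>z. kernel I \<psi> (snd z - (1/2) *\<^sub>R fst z, snd z + (1/2) *\<^sub>R fst z)) z = pft (\<lambda>z. kernel I \<phi> (snd z - (1/2) *\<^sub>R fst z, snd z + (1/2) *\<^sub>R fst z)) z"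
      using integral_kernel_affine_cong[OF fam AE, of 1 1 "snd z" "- ((1/2) *\<^sub>R fst z)" "(1/2) *\<^sub>R fst z"]
      by (simp add: pft_def add.commute)
  qed
qed

context
  fixes I :: "'i set" and \<psi> \<phi> :: "'i \<Rightarrow> real^'n \<Rightarrow> complex"
  assumes fam: "l2_family I \<psi>" and sjs: "sjs I \<phi>" and AE: "\<forall>i\<in>I. AE x in lborel. \<psi> i x = \<phi> i x"
begin

lemma sjs_kernel_schwartz: "schwartz (kernel I \<phi>)"
  using schwartz_sum_kernel[OF sjs sjs_cnj[OF sjs]] by (simp add: kernel_def[abs_def])

lemma sjs_l2_family: "l2_family I \<phi>"
  by (rule l2_family_cong_AE[OF fam _ AE]) (auto intro: schwartz_sq_integrable sjs_imp_schwartz[OF sjs])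

lemma sjs_imp_kernel_schwartz: "\<exists>K. schwartz K \<and> (AE z in lborel. kernel I \<psi> z = K z)"
  using sjs_kernel_schwartz AE_kernel_eq[OF l2_familyD(1)[OF fam] AE] by blast

lemma sjs_imp_qchar_schwartz: "schwartz (qchar I \<psi>)"
  unfolding qchar_eq_pft[OF fam] pft_kernel_cong(2)[OF fam sjs_l2_family AE]
  by (intro schwartz_pft schwartz_midpoint sjs_kernel_schwartz)

lemma sjs_imp_wigner_schwartz: "schwartz (wigner I \<psi>)"
  unfolding wigner_eq_pft pft_kernel_cong(1)[OF fam sjs_l2_family AE]
  using schwartz_swap[OF schwartz_midpoint[OF sjs_kernel_schwartz]]
  by (intro schwartz_cmult schwartz_pft) simp

end

text \<open>Translating the integration variable by half of the two position shifts turns the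
  sesquilinear form into one partial Fourier transform over the doubled configuration space, of
  \<open>cnj chi\<close>, chi and K multiplied together on the midpoint shear.\<close>

lemma kernel_schwartz_imp_matel_schwartz:
  fixes chi :: "real^'n \<Rightarrow> complex"
  assumes fam: "l2_family I \<psi>" and chi: "schwartz chi" and K: "schwartz K" and AE: "AE z in lborel. kernel I \<psi> z = K z"
  shows "schwartz (matel chi I \<psi>)"
proof -
  define G where "G w = (cnj (chi (fst (fst w))) * chi (snd (fst w))) * K (snd w)" for w
  define H where "H z = G (snd z - (1/2) *\<^sub>R fst z, snd z + (1/2) *\<^sub>R fst z)" for z
  have G: "schwartz G" unfolding G_def[abs_def]
    by (intro schwartz_tensor[of "\<lambda>w. cnj (chi (fst w)) * chi (snd w)"] schwartz_tensor[of "\<lambda>x. cnj (chi x)"] schwartz_cnj chi K)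
  have H: "schwartz H" unfolding H_def[abs_def] by (rule schwartz_midpoint[OF G])
  \<comment> \<open>The two positions become the parameter and the two momenta the frequency; the
    momentum on the left is negated because its displaced function is conjugated.\<close>
  define T where "T z = ((fst (fst z), fst (snd z)), (- snd (fst z), snd (snd z)))" for z :: "'n phase \<times> 'n phase"
  have [measurable]: "chi \<in> borel_measurable borel" "K \<in> borel_measurable borel"
    by (intro schwartz_measurable chi K)+
  have "matel chi I \<psi> z = pft H (T z)" for z
  proof -
    define a where "a = (fst (fst z), fst (snd z))"
    let ?f = "\<lambda>w. cnj (disp (fst z) chi (fst w)) * disp (snd z) chi (snd w) * K w"
    have gm: "schwartz (disp (fst z) chi)" "schwartz (disp (snd z) chi)" by (intro schwartz_disp chi)+
    have fm: "schwartz ?f"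
      using schwartz_mult[OF schwartz_tensor[OF schwartz_cnj[OF gm(1)] gm(2)] K] .
    have "matel chi I \<psi> z = (\<integral>w. cnj (disp (fst z) chi (fst w)) * disp (snd z) chi (snd w) * kernel I \<psi> w \<partial>lborel)"
      unfolding matel_def by (rule kernel_form[OF fam gm[THEN schwartz_sq_integrable]])
    also have "\<dots> = (\<integral>w. ?f w \<partial>lborel)"
    proof (rule integral_cong_AE)
      show "AE w in lborel. cnj (disp (fst z) chi (fst w)) * disp (snd z) chi (snd w) * kernel I \<psi> w = ?f w"
        using AE by eventually_elim simp
    qed (use integrable_kernel_form[OF fam gm[THEN schwartz_sq_integrable]] schwartz_measurable[OF fm] in auto)
    also have "\<dots> = (\<integral>w. ?f (w + (1/2) *\<^sub>R a) \<partial>lborel)"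
      by (rule integral_translate[symmetric, of ?f, OF schwartz_measurable[OF fm]])
    also have "\<dots> = pft H (T z)"
      unfolding pft_def
    proof (rule Bochner_Integration.integral_cong[OF refl])
      fix w :: "'n phase"
      have e: "x + (1/2) *\<^sub>R y - y = x - (1/2) *\<^sub>R y" for x y :: "real^'n"
        using midpoint_shift(1)[of x "(1/2) *\<^sub>R y"] by (simp only: half_plus_half)
      have "?f (w + (1/2) *\<^sub>R a) = (cnj (iexp (fst w \<bullet> snd (fst z))) * iexp (snd w \<bullet> snd (snd z))) * H (a, w)"
        unfolding disp_def H_def G_def by (simp add: a_def e)
      also have "cnj (iexp (fst w \<bullet> snd (fst z))) * iexp (snd w \<bullet> snd (snd z)) = iexp (snd (T z) \<bullet> w)"
      proof -
        have "snd (T z) \<bullet> w = - (fst w \<bullet> snd (fst z)) + snd w \<bullet> snd (snd z)"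
          by (simp add: T_def inner_prod_def inner_commute)
        then show ?thesis by (simp only: of_real_add distrib_left exp_add exp_cnj) (simp add: exp_cnj)
      qed
      finally show "?f (w + (1/2) *\<^sub>R a) = iexp (snd (T z) \<bullet> w) * H (fst (T z), w)" by (simp add: T_def a_def)
    qed
    finally show ?thesis .
  qed
  then have eq: "matel chi I \<psi> = (\<lambda>z. pft H (T z))" by (rule ext)
  show ?thesis unfolding eq
    by (rule schwartz_linear[OF schwartz_pft[OF H], of T "\<lambda>w. ((fst (fst w), - fst (snd w)), (snd (fst w), snd (snd w)))"])
      (auto intro!: linearI simp: T_def)
qed

section \<open>From M, W and the characteristic function to the Husimi function\<close>

lemma matel_rapid_decay_imp_husimi:
  assumes "rapid_decay (matel chi I \<psi>)" shows "rapid_decay (husimi chi I \<psi>)"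
proof (rule rapid_decayI_wt)
  fix N
  obtain C where C: "\<And>z. wt z ^ N * cmod (matel chi I \<psi> z) \<le> C" using rapid_decay_wt_bound[OF assms] by meson
  have "wt \<alpha> ^ N * cmod (husimi chi I \<psi> \<alpha>) \<le> C" for \<alpha>
  proof -
    have "wt \<alpha> ^ N * cmod (husimi chi I \<psi> \<alpha>) \<le> wt (\<alpha>, \<alpha>) ^ N * cmod (matel chi I \<psi> (\<alpha>, \<alpha>))"
      unfolding husimi_def by (intro mult_right_mono power_mono) (auto simp: wt_Pair wt_le_mult)
    also have "\<dots> \<le> C" by (rule C)
    finally show ?thesis .
  qed
  then show "\<exists>C. \<forall>x. wt x ^ N * cmod (husimi chi I \<psi> x) \<le> C" by blast
qed

lemma matel_schwartz_imp_husimi: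
  assumes "schwartz (matel chi I \<psi>)" shows "schwartz (husimi chi I \<psi>)"
  unfolding husimi_def[abs_def]
  by (rule schwartz_linear[OF assms, of "\<lambda>\<alpha>. (\<alpha>, \<alpha>)" fst]) (auto intro!: linearI)

text \<open>The functions \<open>wigner_kernel g\<close> and \<open>wigner_kernel g\<close> with swapped arguments
  are the partial inverse Fourier transforms of the Wigner and the characteristic function of \<open>g\<close>.\<close>

definition wigner_kernel :: "(real^'n \<Rightarrow> complex) \<Rightarrow> (real^'n) \<times> (real^'n) \<Rightarrow> complex" where
  "wigner_kernel g z = g (fst z - (1/2) *\<^sub>R snd z) * cnj (g (fst z + (1/2) *\<^sub>R snd z))"

lemma schwartz_wigner_kernel:
  assumes "schwartz g" shows "schwartz (wigner_kernel g)"
  using schwartz_swap[OF schwartz_midpoint[OF schwartz_tensor[OF assms schwartz_cnj[OF assms]]]]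
  by (simp add: wigner_kernel_def[abs_def])

lemma iexp_mult_cnj: "iexp a * cnj (iexp b) = iexp (a - b)"
  by (simp add: exp_cnj right_diff_distrib exp_diff exp_minus divide_inverse)

text \<open>Covariance of the Wigner function before the transform: a displacement translates the
  midpoint variable and modulates the difference variable, so that after the transform it is a
  translation in phase space.\<close>

lemma wigner_kernel_disp:
  "wigner_kernel (disp \<alpha> chi) (u, s) = iexp (- (snd \<alpha> \<bullet> s)) * wigner_kernel chi (u - fst \<alpha>, s)"
proof -
  have e: "u - (1/2) *\<^sub>R s - fst \<alpha> = u - fst \<alpha> - (1/2) *\<^sub>R s" "u + (1/2) *\<^sub>R s - fst \<alpha> = u - fst \<alpha> + (1/2) *\<^sub>R s"
    by simp_all
  have "(u - (1/2) *\<^sub>R s - (1/2) *\<^sub>R fst \<alpha>) \<bullet> snd \<alpha> - (u + (1/2) *\<^sub>R s - (1/2) *\<^sub>R fst \<alpha>) \<bullet> snd \<alpha> = - (snd \<alpha> \<bullet> s)"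
  proof -
    have "(u - (1/2) *\<^sub>R s - (1/2) *\<^sub>R fst \<alpha>) \<bullet> snd \<alpha> - (u + (1/2) *\<^sub>R s - (1/2) *\<^sub>R fst \<alpha>) \<bullet> snd \<alpha> = - (((1/2) *\<^sub>R s + (1/2) *\<^sub>R s) \<bullet> snd \<alpha>)"
      by (simp add: inner_diff_left inner_add_left)
    then show ?thesis unfolding half_plus_half by (simp add: inner_commute)
  qed
  then have ie: "iexp ((u - (1/2) *\<^sub>R s - (1/2) *\<^sub>R fst \<alpha>) \<bullet> snd \<alpha>) * cnj (iexp ((u + (1/2) *\<^sub>R s - (1/2) *\<^sub>R fst \<alpha>) \<bullet> snd \<alpha>)) = iexp (- (snd \<alpha> \<bullet> s))"
    unfolding iexp_mult_cnj by (rule arg_cong)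
  show ?thesis unfolding wigner_kernel_def disp_def fst_conv snd_conv e complex_cnj_mult ie[symmetric]
    by (simp only: mult_ac)
qed

lemma husimi_eq_wigner_integral:
  fixes chi :: "real^'n \<Rightarrow> complex"
  assumes fam: "l2_family I \<psi>" and chi: "schwartz chi"
  shows "husimi chi I \<psi> \<alpha> = (\<integral>z. kernel I \<psi> (fst z - (1/2) *\<^sub>R snd z, fst z + (1/2) *\<^sub>R snd z) * cnj (wigner_kernel (disp \<alpha> chi) z) \<partial>lborel)"
    and "integrable lborel (\<lambda>z. kernel I \<psi> (fst z - (1/2) *\<^sub>R snd z, fst z + (1/2) *\<^sub>R snd z) * cnj (wigner_kernel (disp \<alpha> chi) z))"
proof -
  note g = schwartz_sq_integrable[OF schwartz_disp[OF chi, of \<alpha>]]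
  define F where "F z = cnj (disp \<alpha> chi (fst z)) * disp \<alpha> chi (snd z) * kernel I \<psi> z" for z
  have F: "integrable lborel F" unfolding F_def[abs_def] by (rule integrable_kernel_form[OF fam g g])
  have eq: "kernel I \<psi> (fst z - (1/2) *\<^sub>R snd z, fst z + (1/2) *\<^sub>R snd z) * cnj (wigner_kernel (disp \<alpha> chi) z) = F (fst z - (1/2) *\<^sub>R snd z, fst z + (1/2) *\<^sub>R snd z)" for z
    by (simp add: F_def wigner_kernel_def mult_ac)
  show "integrable lborel (\<lambda>z. kernel I \<psi> (fst z - (1/2) *\<^sub>R snd z, fst z + (1/2) *\<^sub>R snd z) * cnj (wigner_kernel (disp \<alpha> chi) z))"
    unfolding eq by (rule integrable_midpoint[OF F])
  have "husimi chi I \<psi> \<alpha> = (\<integral>z. F z \<partial>lborel)"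
    unfolding husimi_def matel_def fst_conv snd_conv F_def by (rule kernel_form[OF fam g g])
  then show "husimi chi I \<psi> \<alpha> = (\<integral>z. kernel I \<psi> (fst z - (1/2) *\<^sub>R snd z, fst z + (1/2) *\<^sub>R snd z) * cnj (wigner_kernel (disp \<alpha> chi) z) \<partial>lborel)"
    unfolding eq integral_midpoint[OF F] .
qed

lemma kernel_slices_integrable:
  fixes \<psi> :: "'i \<Rightarrow> real^'n \<Rightarrow> complex"
  assumes fam: "l2_family I \<psi>"
  shows "integrable lborel (\<lambda>s. kernel I \<psi> (u - (1/2) *\<^sub>R s, u + (1/2) *\<^sub>R s))"
    and "integrable lborel (\<lambda>u. kernel I \<psi> (u - (1/2) *\<^sub>R s, u + (1/2) *\<^sub>R s))"
  using integrable_kernel_affine[OF fam, of "-(1/2)" "1/2" "\<lambda>_. 1" u u]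
    integrable_kernel_affine[OF fam, of 1 1 "\<lambda>_. 1" "- ((1/2) *\<^sub>R s)" "(1/2) *\<^sub>R s"]
  by (simp_all add: add.commute)

text \<open>With \<Gamma> the Wigner function of chi up to a factor, Peetre's inequality turns the
  decay of \<Gamma> in \<open>z - \<alpha>\<close> into decay in \<alpha>, at the cost of growth in
  z that W absorbs. One extra power of the weight on W keeps the z-integral finite. Parseval is
  applied on each slice of fixed midpoint u.\<close>

lemma wigner_rapid_decay_imp_husimi:
  fixes chi :: "real^'n \<Rightarrow> complex"
  assumes fam: "l2_family I \<psi>" and chi: "schwartz chi" and W: "rapid_decay (wigner I \<psi>)"
  shows "rapid_decay (husimi chi I \<psi>)"
proof (rule rapid_decayI_wt)
  fix N
  define \<Gamma> where "\<Gamma> = pft (wigner_kernel chi)"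
  have S: "schwartz \<Gamma>" unfolding \<Gamma>_def by (intro schwartz_pft schwartz_wigner_kernel chi)
  obtain C1 where C1: "C1 \<ge> 0" "\<And>z. cmod (\<Gamma> z) \<le> C1 / wt z ^ N" using schwartz_bound[OF S] by meson
  obtain C2 where C2: "\<And>z. wt z ^ Suc N * cmod (wigner I \<psi> z) \<le> C2" using rapid_decay_wt_bound[OF W] by meson
  have C20: "0 \<le> C2" using C2[of 0] by (rule order_trans[rotated]) simp
  define k where "k z = kernel I \<psi> (fst z - (1/2) *\<^sub>R snd z, fst z + (1/2) *\<^sub>R snd z)" for z
  have pk: "of_real ((1 / (2 * pi)) ^ CARD('n)) * pft k z = wigner I \<psi> z" for z
    unfolding wigner_eq_pft k_def ..
  have pk': "wigner I \<psi> (u, p) = of_real ((1 / (2 * pi)) ^ CARD('n)) * (\<integral>s. iexp (p \<bullet> s) * k (u, s) \<partial>lborel)" for u p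
    unfolding pk[symmetric] pft_def fst_conv snd_conv ..
  have pG: "pft (wigner_kernel (disp \<alpha> chi)) (u, p) = \<Gamma> (u - fst \<alpha>, p - snd \<alpha>)" for \<alpha> u p
    unfolding \<Gamma>_def pft_def fst_conv snd_conv wigner_kernel_disp
  proof (rule Bochner_Integration.integral_cong[OF refl])
    fix y
    have "iexp (p \<bullet> y) * iexp (- (snd \<alpha> \<bullet> y)) = iexp ((p - snd \<alpha>) \<bullet> y)"
      by (simp add: inner_diff_left right_diff_distrib flip: exp_add)
    then show "iexp (p \<bullet> y) * (iexp (- (snd \<alpha> \<bullet> y)) * wigner_kernel chi (u - fst \<alpha>, y)) = iexp ((p - snd \<alpha>) \<bullet> y) * wigner_kernel chi (u - fst \<alpha>, y)"
      by (simp only: mult.assoc[symmetric])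
  qed
  \<comment> \<open>\<open>D\<close> is the constant of Peetre's inequality on phase space.
    \<open>J\<close> enters twice below, once for each of the variables u and p into which the
    weight splits.\<close>
  define D where "D = (2::real) ^ DIM('n phase)"
  define J where "J = (\<integral>x. 1 / wt x \<partial>(lborel::(real^'n) measure))"
  have bound: "cmod (wigner I \<psi> (u, p)) * cmod (\<Gamma> (u - fst \<alpha>, p - snd \<alpha>)) \<le> (C1 * C2 * D ^ N / wt \<alpha> ^ N) * (1 / wt u) * (1 / wt p)" for \<alpha> u p
  proof -
    let ?z = "(u, p)"
    have "1 / wt (- \<alpha> + ?z) \<le> D * wt ?z / wt (- \<alpha>)" unfolding D_def by (rule inverse_wt_shift)
    then have "(1 / wt (?z - \<alpha>)) ^ N \<le> (D * wt ?z / wt \<alpha>) ^ N" by (intro power_mono) auto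
    then have "C1 * (1 / wt (?z - \<alpha>)) ^ N \<le> C1 * (D * wt ?z / wt \<alpha>) ^ N" by (intro mult_left_mono C1(1))
    moreover have "cmod (\<Gamma> (?z - \<alpha>)) \<le> C1 * (1 / wt (?z - \<alpha>)) ^ N" using C1(2)[of "?z - \<alpha>"] by (simp add: power_divide)
    ultimately have g: "cmod (\<Gamma> (?z - \<alpha>)) \<le> C1 * (D * wt ?z / wt \<alpha>) ^ N" by linarith
    have w: "cmod (wigner I \<psi> ?z) \<le> C2 / wt ?z ^ Suc N"
      using C2[of ?z] by (subst pos_le_divide_eq) (auto simp: mult.commute)
    have "cmod (wigner I \<psi> ?z) * cmod (\<Gamma> (?z - \<alpha>)) \<le> (C2 / wt ?z ^ Suc N) * (C1 * (D * wt ?z / wt \<alpha>) ^ N)"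
      using C20 by (intro mult_mono w g) auto
    also have "\<dots> = (C1 * C2 * D ^ N / wt \<alpha> ^ N) * (1 / wt ?z)"
      by (simp add: power_mult_distrib power_divide mult_ac)
    finally show ?thesis by (cases \<alpha>) (simp add: wt_Pair)
  qed
  have "cmod (husimi chi I \<psi> \<alpha>) \<le> (C1 * C2 * D ^ N * J * J) / wt \<alpha> ^ N" for \<alpha>
  proof -
    let ?K = "C1 * C2 * D ^ N / wt \<alpha> ^ N"
    have iw: "integrable lborel (\<lambda>x::real^'n. a * (1 / wt x))" for a
      by (rule integrable_mult_right[OF integrable_inverse_wt])
    have "husimi chi I \<psi> \<alpha> = (\<integral>u. (\<integral>s. k (u, s) * cnj (wigner_kernel (disp \<alpha> chi) (u, s)) \<partial>lborel) \<partial>lborel)"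
      unfolding husimi_eq_wigner_integral(1)[OF fam chi] k_def lborel_integral_fst[OF husimi_eq_wigner_integral(2)[OF fam chi]] ..
    also have "cmod \<dots> \<le> (\<integral>u. ?K * J * (1 / wt u) \<partial>(lborel::(real^'n) measure))"
    proof (rule norm_integral_le)
      show "integrable lborel (\<lambda>u::real^'n. ?K * J * (1 / wt u))" by (rule iw)
      fix u :: "real^'n"
      have ki: "integrable lborel (\<lambda>s. k (u, s))" unfolding k_def fst_conv snd_conv by (rule kernel_slices_integrable(1)[OF fam])
      have "(\<integral>s. k (u, s) * cnj (wigner_kernel (disp \<alpha> chi) (u, s)) \<partial>lborel) =
        of_real ((1 / (2 * pi)) ^ CARD('n)) * (\<integral>p. (\<integral>s. iexp (p \<bullet> s) * k (u, s) \<partial>lborel) * cnj (pft (wigner_kernel (disp \<alpha> chi)) (u, p)) \<partial>lborel)"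
        using parseval_slice[OF schwartz_wigner_kernel[OF schwartz_disp[OF chi, of \<alpha>]] ki, of u] by simp
      also have "\<dots> = (\<integral>p. wigner I \<psi> (u, p) * cnj (\<Gamma> (u - fst \<alpha>, p - snd \<alpha>)) \<partial>lborel)"
        unfolding pG pk' mult.assoc by (rule integral_mult_right_zero[symmetric])
      also have "cmod \<dots> \<le> (\<integral>p. ?K * (1 / wt u) * (1 / wt p) \<partial>(lborel::(real^'n) measure))"
        by (rule norm_integral_le[OF iw]) (use bound in \<open>simp add: norm_mult\<close>)
      also have "\<dots> = ?K * J * (1 / wt u)" unfolding J_def integral_mult_right_zero by simp
      finally show "cmod (\<integral>s. k (u, s) * cnj (wigner_kernel (disp \<alpha> chi) (u, s)) \<partial>lborel) \<le> ?K * J * (1 / wt u)" .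
    qed
    also have "\<dots> = (C1 * C2 * D ^ N * J * J) / wt \<alpha> ^ N" unfolding J_def integral_mult_right_zero by simp
    finally show ?thesis .
  qed
  then have "wt \<alpha> ^ N * cmod (husimi chi I \<psi> \<alpha>) \<le> C1 * C2 * D ^ N * J * J" for \<alpha>
    by (subst mult.commute, subst pos_le_divide_eq[symmetric]) simp_all
  then show "\<exists>C. \<forall>x. wt x ^ N * cmod (husimi chi I \<psi> x) \<le> C" by blast
qed

text \<open>Displacing chi multiplies its characteristic function by a phase given by the symplectic
  form, so \<alpha> enters only through a Fourier phase. Hence Q is a symplectic Fourier transform
  of the Schwartz function \<open>R\<close>, and is itself Schwartz.\<close>

lemma qchar_schwartz_imp_husimi:
  fixes chi :: "real^'n \<Rightarrow> complex"
  assumes fam: "l2_family I \<psi>" and chi: "schwartz chi" and Q: "schwartz (qchar I \<psi>)"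
  shows "schwartz (husimi chi I \<psi>)"
proof -
  define \<Gamma> where "\<Gamma> \<alpha> z = wigner_kernel (disp \<alpha> chi) (snd z, fst z)" for \<alpha> z
  have G: "schwartz (\<Gamma> \<alpha>)" for \<alpha>
    unfolding \<Gamma>_def by (intro schwartz_swap schwartz_wigner_kernel schwartz_disp chi)
  have disp0: "disp 0 chi = chi" by (simp add: disp_def fun_eq_iff)
  \<comment> \<open>The phase is \<alpha> wedge (s, p): its first half comes from translating the
    midpoint, its second half from modulating the difference.\<close>
  have pG: "pft (\<Gamma> \<alpha>) (s, p) = iexp (p \<bullet> fst \<alpha> - snd \<alpha> \<bullet> s) * pft (\<Gamma> 0) (s, p)" for \<alpha> s p
  proof -
    have m: "(\<lambda>u. iexp (p \<bullet> (u + fst \<alpha>)) * \<Gamma> 0 (s, u)) \<in> borel_measurable borel"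
    proof -
      have "(\<lambda>u. iexp (p \<bullet> (u + fst \<alpha>))) \<in> borel_measurable borel"
        by (intro borel_measurable_continuous_onI continuous_intros)
      then show ?thesis using schwartz_measurable[OF schwartz_slice[OF G[of 0], of s]] by (rule borel_measurable_times)
    qed
    have "pft (\<Gamma> \<alpha>) (s, p) = (\<integral>u. iexp (- (snd \<alpha> \<bullet> s)) * (iexp (p \<bullet> ((u + - fst \<alpha>) + fst \<alpha>)) * \<Gamma> 0 (s, u + - fst \<alpha>)) \<partial>lborel)"
      unfolding pft_def fst_conv snd_conv \<Gamma>_def wigner_kernel_disp[of \<alpha>] disp0
      by (intro Bochner_Integration.integral_cong refl) (simp add: mult_ac)
    also have "\<dots> = iexp (- (snd \<alpha> \<bullet> s)) * (\<integral>u. iexp (p \<bullet> (u + fst \<alpha>)) * \<Gamma> 0 (s, u) \<partial>lborel)"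
      unfolding integral_mult_right_zero integral_translate[OF m, of "- fst \<alpha>"] ..
    also have "(\<integral>u. iexp (p \<bullet> (u + fst \<alpha>)) * \<Gamma> 0 (s, u) \<partial>lborel) = iexp (p \<bullet> fst \<alpha>) * pft (\<Gamma> 0) (s, p)"
      unfolding pft_def integral_mult_right_zero[symmetric]
      by (intro Bochner_Integration.integral_cong refl) (simp add: inner_add_right distrib_left exp_add mult_ac)
    also have "iexp (- (snd \<alpha> \<bullet> s)) * (iexp (p \<bullet> fst \<alpha>) * pft (\<Gamma> 0) (s, p)) = iexp (p \<bullet> fst \<alpha> - snd \<alpha> \<bullet> s) * pft (\<Gamma> 0) (s, p)"
    proof -
      have "iexp (p \<bullet> fst \<alpha> - snd \<alpha> \<bullet> s) = iexp (- (snd \<alpha> \<bullet> s)) * iexp (p \<bullet> fst \<alpha>)"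
        by (simp add: right_diff_distrib flip: exp_add)
      then show ?thesis by (simp only: mult.assoc)
    qed
    finally show ?thesis .
  qed
  define R where "R z = qchar I \<psi> z * cnj (pft (\<Gamma> 0) z)" for z
  have R: "schwartz R" unfolding R_def[abs_def] by (intro schwartz_mult schwartz_cnj schwartz_pft G Q)
  \<comment> \<open>The full Fourier transform is two partial ones; swapping the arguments brings
    the variable still to be transformed into second place.\<close>
  define R2 where "R2 z = pft R (snd z, fst z)" for z
  have R2: "schwartz R2" unfolding R2_def[abs_def] by (intro schwartz_swap schwartz_pft R)
  define k where "k z = kernel I \<psi> (snd z - (1/2) *\<^sub>R fst z, snd z + (1/2) *\<^sub>R fst z)" for z
  have "husimi chi I \<psi> \<alpha> = of_real ((1 / (2 * pi)) ^ CARD('n)) * pft R2 (- fst \<alpha>, snd \<alpha>)" for \<alpha>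
  proof -
    have "husimi chi I \<psi> \<alpha> = (\<integral>s. (\<integral>u. k (s, u) * cnj (\<Gamma> \<alpha> (s, u)) \<partial>lborel) \<partial>lborel)"
      unfolding husimi_eq_wigner_integral(1)[OF fam chi] lborel_integral_snd[OF husimi_eq_wigner_integral(2)[OF fam chi], symmetric]
      by (simp add: k_def \<Gamma>_def)
    also have "\<dots> = (\<integral>s. of_real ((1 / (2 * pi)) ^ CARD('n)) * (iexp (snd \<alpha> \<bullet> s) * R2 (- fst \<alpha>, s)) \<partial>lborel)"
    proof (rule Bochner_Integration.integral_cong[OF refl])
      fix s
      have ki: "integrable lborel (\<lambda>u. k (s, u))" unfolding k_def fst_conv snd_conv by (rule kernel_slices_integrable(2)[OF fam])
      have "(\<integral>u. k (s, u) * cnj (\<Gamma> \<alpha> (s, u)) \<partial>lborel) =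
        of_real ((1 / (2 * pi)) ^ CARD('n)) * (\<integral>p. (\<integral>u. iexp (p \<bullet> u) * k (s, u) \<partial>lborel) * cnj (pft (\<Gamma> \<alpha>) (s, p)) \<partial>lborel)"
        using parseval_slice[OF G[of \<alpha>] ki, of s] by simp
      also have "(\<integral>p. (\<integral>u. iexp (p \<bullet> u) * k (s, u) \<partial>lborel) * cnj (pft (\<Gamma> \<alpha>) (s, p)) \<partial>lborel) =
         (\<integral>p. iexp (snd \<alpha> \<bullet> s) * (iexp (- fst \<alpha> \<bullet> p) * R (s, p)) \<partial>lborel)"
      proof (rule Bochner_Integration.integral_cong[OF refl])
        fix p
        have q: "qchar I \<psi> (s, p) = (\<integral>u. iexp (p \<bullet> u) * k (s, u) \<partial>lborel)"
          unfolding qchar_eq_pft[OF fam] k_def pft_def by simp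
        have cc: "cnj (iexp (p \<bullet> fst \<alpha> - snd \<alpha> \<bullet> s)) = iexp (snd \<alpha> \<bullet> s) * iexp (- fst \<alpha> \<bullet> p)"
          by (simp add: exp_cnj inner_commute right_diff_distrib flip: exp_add)
        show "(\<integral>u. iexp (p \<bullet> u) * k (s, u) \<partial>lborel) * cnj (pft (\<Gamma> \<alpha>) (s, p)) = iexp (snd \<alpha> \<bullet> s) * (iexp (- fst \<alpha> \<bullet> p) * R (s, p))"
          unfolding pG[of \<alpha>] R_def q complex_cnj_mult cc by (simp only: mult_ac)
      qed
      also have "\<dots> = iexp (snd \<alpha> \<bullet> s) * R2 (- fst \<alpha>, s)"
        unfolding integral_mult_right_zero R2_def pft_def[of R] by simp
      finally show "(\<integral>u. k (s, u) * cnj (\<Gamma> \<alpha> (s, u)) \<partial>lborel) = of_real ((1 / (2 * pi)) ^ CARD('n)) * (iexp (snd \<alpha> \<bullet> s) * R2 (- fst \<alpha>, s))" .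
    qed
    also have "\<dots> = of_real ((1 / (2 * pi)) ^ CARD('n)) * pft R2 (- fst \<alpha>, snd \<alpha>)"
      unfolding integral_mult_right_zero pft_def by simp
    finally show ?thesis .
  qed
  then have eq: "husimi chi I \<psi> = (\<lambda>\<alpha>. of_real ((1 / (2 * pi)) ^ CARD('n)) * pft R2 (- fst \<alpha>, snd \<alpha>))" by (rule ext)
  have "schwartz (\<lambda>\<alpha>. pft R2 (- fst \<alpha>, snd \<alpha>))"
    by (rule schwartz_linear[OF schwartz_pft[OF R2], of "\<lambda>z. (- fst z, snd z)" "\<lambda>z. (- fst z, snd z)"]) (auto intro!: linearI)
  then show ?thesis unfolding eq by (rule schwartz_cmult)
qed

section \<open>Schwartz operators\<close>

text \<open>Finite partial sums are bounded, since an infinite sum that diverges would be 0 by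
  convention and satisfy any bound. The constant is uniform in the parameter, which will be the
  phase-space point.\<close>

definition sum_bounded :: "'i set \<Rightarrow> ('i \<Rightarrow> 'a \<Rightarrow> complex) \<Rightarrow> bool" where
  "sum_bounded I q \<longleftrightarrow> (\<exists>C. \<forall>x F. finite F \<longrightarrow> F \<subseteq> I \<longrightarrow> (\<Sum>i\<in>F. (cmod (q i x))\<^sup>2) \<le> C)"

lemma sum_bounded_diff:
  assumes "sum_bounded I q" "sum_bounded I r" shows "sum_bounded I (\<lambda>i x. q i x - r i x)"
proof -
  obtain C where C: "\<And>x F. finite F \<Longrightarrow> F \<subseteq> I \<Longrightarrow> (\<Sum>i\<in>F. (cmod (q i x))\<^sup>2) \<le> C"
    using assms(1) unfolding sum_bounded_def by blast
  obtain D where D: "\<And>x F. finite F \<Longrightarrow> F \<subseteq> I \<Longrightarrow> (\<Sum>i\<in>F. (cmod (r i x))\<^sup>2) \<le> D"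
    using assms(2) unfolding sum_bounded_def by blast
  have "(cmod (u - v))\<^sup>2 \<le> 2 * (cmod u)\<^sup>2 + 2 * (cmod v)\<^sup>2" for u v
  proof -
    have "(cmod (u - v))\<^sup>2 \<le> (cmod u + cmod v)\<^sup>2" by (intro power_mono norm_triangle_ineq4) auto
    also have "\<dots> \<le> 2 * (cmod u)\<^sup>2 + 2 * (cmod v)\<^sup>2"
      using zero_le_power2[of "cmod u - cmod v"] by (simp add: power2_sum power2_diff)
    finally show ?thesis .
  qed
  then have "(\<Sum>i\<in>F. (cmod (q i x - r i x))\<^sup>2) \<le> (\<Sum>i\<in>F. 2 * (cmod (q i x))\<^sup>2 + 2 * (cmod (r i x))\<^sup>2)" for x F
    by (intro sum_mono)
  also have "(\<Sum>i\<in>F. 2 * (cmod (q i x))\<^sup>2 + 2 * (cmod (r i x))\<^sup>2) \<le> 2 * C + 2 * D" if "finite F" "F \<subseteq> I" for x F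
    using C[OF that, of x] D[OF that, of x] by (simp add: sum.distrib sum_distrib_left[symmetric])
  finally show ?thesis unfolding sum_bounded_def by (intro exI[of _ "2 * C + 2 * D"]) blast
qed

lemma sum_bounded_cong:
  "(\<And>i x. i \<in> I \<Longrightarrow> q i x = r i x) \<Longrightarrow> sum_bounded I q \<Longrightarrow> sum_bounded I r"
proof -
  assume eq: "\<And>i x. i \<in> I \<Longrightarrow> q i x = r i x" and q: "sum_bounded I q"
  have "(\<Sum>i\<in>F. (cmod (r i x))\<^sup>2) = (\<Sum>i\<in>F. (cmod (q i x))\<^sup>2)" if "F \<subseteq> I" for x F
    using that by (intro sum.cong refl) (auto simp: eq)
  with q show "sum_bounded I r" unfolding sum_bounded_def by simp
qed

text \<open>If \<open>t\<^sub>\<alpha> D\<^sub>\<alpha> f = T D\<^sub>\<alpha> f - D\<^sub>\<alpha> T f\<close>, then powers of \<open>t\<^sub>\<alpha>\<close>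
  can be traded for powers of the operator \<open>T\<close>.\<close>

lemma sum_bounded_power:
  fixes \<psi> :: "'i \<Rightarrow> real^'n \<Rightarrow> complex" and t :: "'n phase \<Rightarrow> real"
  assumes fam: "l2_family I \<psi>"
    and Ts: "\<And>f. schwartz f \<Longrightarrow> schwartz (T f)"
    and Tsub: "\<And>f g. schwartz f \<Longrightarrow> schwartz g \<Longrightarrow> T (\<lambda>x. f x - g x) = (\<lambda>x. T f x - T g x)"
    and comm: "\<And>f \<alpha>. schwartz f \<Longrightarrow> (\<lambda>x. of_real (t \<alpha>) * disp \<alpha> f x) = (\<lambda>x. T (disp \<alpha> f) x - disp \<alpha> (T f) x)"
    and Tsc: "\<And>f (c::real). schwartz f \<Longrightarrow> T (\<lambda>x. of_real c * f x) = (\<lambda>x. of_real c * T f x)"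
    and base: "\<And>f k. schwartz f \<Longrightarrow> sum_bounded I (\<lambda>i \<alpha>. l2ip ((T ^^ k) (disp \<alpha> f)) (\<psi> i))"
    and f: "schwartz f"
  shows "sum_bounded I (\<lambda>i \<alpha>. of_real (t \<alpha> ^ N) * l2ip ((T ^^ k) (disp \<alpha> f)) (\<psi> i))"
  using f
\<comment> \<open>Trading one power of \<open>t\<close> either raises \<open>k\<close> by one or
  replaces \<open>f\<close> by \<open>T f\<close>, so both have to vary.\<close>
proof (induction N arbitrary: f k)
  case 0
  then show ?case using base by simp
next
  case (Suc N)
  have Tk: "schwartz ((T ^^ k) f)" if "schwartz f" for f k using that by (induction k) (auto intro: Ts)
  have Tksub: "(T ^^ k) (\<lambda>x. f x - g x) = (\<lambda>x. (T ^^ k) f x - (T ^^ k) g x)" if "schwartz f" "schwartz g" for f g k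
    using that by (induction k) (auto simp: Tsub Tk)
  have Tksc: "(T ^^ k) (\<lambda>x. of_real c * f x) = (\<lambda>x. of_real c * (T ^^ k) f x)" if "schwartz f" for f and c :: real and k
    using that by (induction k) (auto simp: Tsc Tk)
  have step: "of_real (t \<alpha>) * l2ip ((T ^^ k) (disp \<alpha> f)) (\<psi> i) =
     l2ip ((T ^^ Suc k) (disp \<alpha> f)) (\<psi> i) - l2ip ((T ^^ k) (disp \<alpha> (T f))) (\<psi> i)" if i: "i \<in> I" for i \<alpha>
  proof -
    note d = schwartz_disp[OF Suc.prems, of \<alpha>] and d' = schwartz_disp[OF Ts[OF Suc.prems], of \<alpha>]
    have "(\<lambda>x. of_real (t \<alpha>) * (T ^^ k) (disp \<alpha> f) x) = (T ^^ k) (\<lambda>x. of_real (t \<alpha>) * disp \<alpha> f x)"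
      by (rule Tksc[OF d, symmetric])
    also have "\<dots> = (\<lambda>x. (T ^^ k) (T (disp \<alpha> f)) x - (T ^^ k) (disp \<alpha> (T f)) x)"
      unfolding comm[OF Suc.prems] by (rule Tksub[OF Ts[OF d] d'])
    finally have eq: "(\<lambda>x. of_real (t \<alpha>) * (T ^^ k) (disp \<alpha> f) x) = (\<lambda>x. (T ^^ Suc k) (disp \<alpha> f) x + (- 1) * (T ^^ k) (disp \<alpha> (T f)) x)"
      by (simp add: funpow_swap1)
    have s1: "sq_integrable ((T ^^ Suc k) (disp \<alpha> f))" by (rule schwartz_sq_integrable[OF Tk[OF d]])
    have s2: "sq_integrable (\<lambda>x. (- 1) * (T ^^ k) (disp \<alpha> (T f)) x)" by (rule schwartz_sq_integrable[OF schwartz_cmult[OF Tk[OF d']]])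
    have "of_real (t \<alpha>) * l2ip ((T ^^ k) (disp \<alpha> f)) (\<psi> i) = l2ip (\<lambda>x. of_real (t \<alpha>) * (T ^^ k) (disp \<alpha> f) x) (\<psi> i)"
      unfolding l2ip_cmult_left by simp
    also have "\<dots> = l2ip ((T ^^ Suc k) (disp \<alpha> f)) (\<psi> i) + l2ip (\<lambda>x. (- 1) * (T ^^ k) (disp \<alpha> (T f)) x) (\<psi> i)"
      unfolding eq by (rule l2ip_add_left[OF s1 s2 l2_familyD(2)[OF fam i]])
    finally show ?thesis unfolding l2ip_cmult_left by simp
  qed
  have "sum_bounded I (\<lambda>i \<alpha>. of_real (t \<alpha> ^ N) * l2ip ((T ^^ Suc k) (disp \<alpha> f)) (\<psi> i) - of_real (t \<alpha> ^ N) * l2ip ((T ^^ k) (disp \<alpha> (T f))) (\<psi> i))"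
    by (intro sum_bounded_diff Suc.IH Suc.prems Ts)
  then show ?case
  proof (rule sum_bounded_cong[rotated])
    fix i \<alpha> assume i: "i \<in> I"
    have "of_real (t \<alpha> ^ Suc N) * l2ip ((T ^^ k) (disp \<alpha> f)) (\<psi> i) = of_real (t \<alpha> ^ N) * (of_real (t \<alpha>) * l2ip ((T ^^ k) (disp \<alpha> f)) (\<psi> i))"
      by (simp add: mult_ac)
    then show "of_real (t \<alpha> ^ N) * l2ip ((T ^^ Suc k) (disp \<alpha> f)) (\<psi> i) - of_real (t \<alpha> ^ N) * l2ip ((T ^^ k) (disp \<alpha> (T f))) (\<psi> i) =
      of_real (t \<alpha> ^ Suc N) * l2ip ((T ^^ k) (disp \<alpha> f)) (\<psi> i)"
      unfolding step[OF i] by (simp add: right_diff_distrib)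
  qed
qed

section \<open>From operator bounds to decay of the Husimi function\<close>

lemma dpart_cmult:
  assumes "schwartz f" "set bs \<subseteq> Basis"
  shows "dpart bs (\<lambda>x. c * f x) = (\<lambda>x. c * dpart bs f x)" and "schwartz (dpart bs f)"
proof -
  have "dpart bs (\<lambda>x. c * f x) = (\<lambda>x. c * dpart bs f x) \<and> schwartz (dpart bs f)"
    using assms(2)
  proof (induction bs)
    case (Cons b bs)
    then have IH: "dpart bs (\<lambda>x. c * f x) = (\<lambda>x. c * dpart bs f x)" "schwartz (dpart bs f)" by auto
    have "frechet_derivative (\<lambda>x. c * dpart bs f x) (at x) b = c * frechet_derivative (dpart bs f) (at x) b" for x
      using frechet_derivative_at[OF has_derivative_mult_right[OF schwartz_has_derivative[OF IH(2)], of c x]] by metis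
    then show ?case using IH schwartz_deriv[OF IH(2)] Cons.prems by simp
  qed (use assms in auto)
  then show "dpart bs (\<lambda>x. c * f x) = (\<lambda>x. c * dpart bs f x)" "schwartz (dpart bs f)" by auto
qed

lemma schwartz_monom_mult: "schwartz f \<Longrightarrow> schwartz (\<lambda>x. of_real (monom a x) * f x)"
proof (induction a rule: monom_induct)
  case (1 a)
  then have "monom a x = 1" for x by (simp add: monom_def)
  with 1 show ?case by simp
next
  case (2 a b)
  from schwartz_coord[OF 2(2)[OF 2(3)] 2(1)] show ?case
    by (simp add: mult_monom[OF 2(1), symmetric] mult.assoc del: fun_upd_apply)
qed

lemma schwartz_Pop: "schwartz f \<Longrightarrow> set bs \<subseteq> Basis \<Longrightarrow> schwartz (Pop bs f)"
  unfolding Pop_def[abs_def] by (intro schwartz_cmult dpart_cmult(2))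

lemma schwartz_Xop: "schwartz f \<Longrightarrow> schwartz (Xop a f)"
  unfolding Xop_def[abs_def] by (rule schwartz_monom_mult)

definition operator_bound :: "'i set \<Rightarrow> ('i \<Rightarrow> real^'n \<Rightarrow> complex) \<Rightarrow> ((real^'n \<Rightarrow> complex) \<Rightarrow> real^'n \<Rightarrow> complex) \<Rightarrow> real \<Rightarrow> bool" where
  "operator_bound I \<psi> S C \<longleftrightarrow> (\<forall>f F. schwartz f \<longrightarrow> l2norm_sq f = 1 \<longrightarrow> finite F \<longrightarrow> F \<subseteq> I \<longrightarrow> (\<Sum>i\<in>F. (cmod (l2ip (S f) (\<psi> i)))\<^sup>2) \<le> C)"

text \<open>With the same monomials on both sides and equal test functions each summand is a squared
  modulus, so the bound on the form becomes a bound on the sum of squares.\<close>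

lemma schwartz_operator_bound:
  assumes fam: "l2_family I \<psi>" and op: "schwartz_operator I \<psi>" and bs: "set bs \<subseteq> Basis"
  shows "\<exists>C. operator_bound I \<psi> (\<lambda>f. Pop bs (Xop a f)) C"
proof -
  let ?S = "\<lambda>f. Pop bs (Xop a f)"
  let ?A = "{(\<Sum>\<^sub>\<infinity>i\<in>I. l2ip (?S f) (\<psi> i) * l2ip (\<psi> i) (?S g)) | f g.
      schwartz f \<and> schwartz g \<and> l2norm_sq f = 1 \<and> l2norm_sq g = 1}"
  have "bounded ?A"
    using op bs unfolding schwartz_operator_def by blast
  then obtain C where C: "\<And>z. z \<in> ?A \<Longrightarrow> cmod z \<le> C" unfolding bounded_iff by blast
  have "(\<Sum>i\<in>F. (cmod (l2ip (?S f) (\<psi> i)))\<^sup>2) \<le> C" if f: "schwartz f" "l2norm_sq f = 1" and F: "finite F" "F \<subseteq> I" for f F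
  proof -
    have sq: "sq_integrable (?S f)" by (intro schwartz_sq_integrable schwartz_Pop schwartz_Xop f bs)
    have "l2ip (?S f) (\<psi> i) * l2ip (\<psi> i) (?S f) = of_real ((cmod (l2ip (?S f) (\<psi> i)))\<^sup>2)" for i
      by (subst (2) l2ip_cnj) (rule complex_norm_square[symmetric])
    then have "(\<Sum>\<^sub>\<infinity>i\<in>I. l2ip (?S f) (\<psi> i) * l2ip (\<psi> i) (?S f)) = of_real (\<Sum>\<^sub>\<infinity>i\<in>I. (cmod (l2ip (?S f) (\<psi> i)))\<^sup>2)"
      by (simp only: infsum_of_real_complex[OF summable_l2ip[OF fam sq]])
    moreover have "(\<Sum>\<^sub>\<infinity>i\<in>I. l2ip (?S f) (\<psi> i) * l2ip (\<psi> i) (?S f)) \<in> ?A" using f by blast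
    ultimately have "\<bar>\<Sum>\<^sub>\<infinity>i\<in>I. (cmod (l2ip (?S f) (\<psi> i)))\<^sup>2\<bar> \<le> C" using C by fastforce
    moreover have "(\<Sum>i\<in>F. (cmod (l2ip (?S f) (\<psi> i)))\<^sup>2) \<le> (\<Sum>\<^sub>\<infinity>i\<in>I. (cmod (l2ip (?S f) (\<psi> i)))\<^sup>2)"
      by (rule finite_sum_le_infsum[OF summable_l2ip[OF fam sq] F]) auto
    ultimately show ?thesis by linarith
  qed
  then show ?thesis unfolding operator_bound_def by blast
qed

lemma l2norm_sq_cmult: "l2norm_sq (\<lambda>x. c * f x) = (cmod c)\<^sup>2 * l2norm_sq f"
  unfolding l2norm_sq_def norm_mult power_mult_distrib by (rule integral_mult_right_zero)

text \<open>A function of norm 0 is split as \<open>(f + \<chi>) - \<chi>\<close> to reduce to normalised functions.\<close>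

lemma operator_bound_imp_sum_bounded:
  fixes \<psi> :: "'i \<Rightarrow> real^'n \<Rightarrow> complex" and chi f :: "real^'n \<Rightarrow> complex"
  assumes fam: "l2_family I \<psi>" and op: "operator_bound I \<psi> S C"
    and Ss: "\<And>f. schwartz f \<Longrightarrow> schwartz (S f)"
    and Ssub: "\<And>f g. schwartz f \<Longrightarrow> schwartz g \<Longrightarrow> S (\<lambda>x. f x - g x) = (\<lambda>x. S f x - S g x)"
    and Ssc: "\<And>f (c::real). schwartz f \<Longrightarrow> S (\<lambda>x. of_real c * f x) = (\<lambda>x. of_real c * S f x)"
    and chi: "schwartz chi" "l2norm_sq chi = 1" and f: "schwartz f"
  shows "sum_bounded I (\<lambda>i \<alpha>. l2ip (S (disp \<alpha> f)) (\<psi> i))"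
proof -
  have pos: "sum_bounded I (\<lambda>i \<alpha>. l2ip (S (disp \<alpha> f)) (\<psi> i))" if f: "schwartz f" and n: "l2norm_sq f \<noteq> 0" for f
    unfolding sum_bounded_def
  proof (intro exI allI impI)
    fix \<alpha> F assume F: "finite F" "F \<subseteq> I"
    \<comment> \<open>Displacements preserve the norm, so one normalising factor serves all \<alpha>
      and the resulting bound is uniform.\<close>
    define r where "r = sqrt (l2norm_sq f)"
    have r: "r > 0" "r\<^sup>2 = l2norm_sq f" using n l2norm_sq_nonneg[of f] by (auto simp: r_def)
    define g where "g x = of_real (1 / r) * disp \<alpha> f x" for x
    have g: "schwartz g" unfolding g_def[abs_def] by (intro schwartz_cmult schwartz_disp f)
    have "l2norm_sq g = 1"
      unfolding g_def[abs_def] l2norm_sq_cmult l2norm_sq_disp[OF schwartz_sq_integrable[OF f]] r(2)[symmetric]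
      using r(1) by (simp add: norm_divide power_divide)
    with op g F have le: "(\<Sum>i\<in>F. (cmod (l2ip (S g) (\<psi> i)))\<^sup>2) \<le> C" unfolding operator_bound_def by blast
    have dg: "disp \<alpha> f = (\<lambda>x. of_real r * g x)" using r(1) by (simp add: g_def fun_eq_iff)
    have "(cmod (l2ip (S (disp \<alpha> f)) (\<psi> i)))\<^sup>2 = r\<^sup>2 * (cmod (l2ip (S g) (\<psi> i)))\<^sup>2" for i
      unfolding dg Ssc[OF g] l2ip_cmult_left by (simp add: norm_mult power_mult_distrib)
    then have "(\<Sum>i\<in>F. (cmod (l2ip (S (disp \<alpha> f)) (\<psi> i)))\<^sup>2) = r\<^sup>2 * (\<Sum>i\<in>F. (cmod (l2ip (S g) (\<psi> i)))\<^sup>2)"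
      by (simp only: sum_distrib_left)
    also have "\<dots> \<le> r\<^sup>2 * C" by (rule mult_left_mono[OF le]) simp
    finally show "(\<Sum>i\<in>F. (cmod (l2ip (S (disp \<alpha> f)) (\<psi> i)))\<^sup>2) \<le> l2norm_sq f * C" unfolding r(2) .
  qed
  show ?thesis
  proof (cases "l2norm_sq f = 0")
    case True
    define g where "g x = f x + chi x" for x
    have g: "schwartz g" unfolding g_def[abs_def] by (rule schwartz_add[OF f chi(1)])
    have "AE x in lborel. (cmod (f x))\<^sup>2 = 0"
      using True schwartz_sq_integrable[OF f] unfolding l2norm_sq_def sq_integrable_def
      by (subst (asm) integral_nonneg_eq_0_iff_AE) auto
    then have "AE x in lborel. g x = chi x" by eventually_elim (simp add: g_def)
    then have "l2norm_sq g = 1"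
      using l2norm_sq_cong_AE[OF _ schwartz_sq_integrable[OF g] schwartz_sq_integrable[OF chi(1)]] chi(2) by simp
    then have "sum_bounded I (\<lambda>i \<alpha>. l2ip (S (disp \<alpha> g)) (\<psi> i) - l2ip (S (disp \<alpha> chi)) (\<psi> i))"
      using chi g by (intro sum_bounded_diff pos) auto
    then show ?thesis
    proof (rule sum_bounded_cong[rotated])
      fix i \<alpha> assume i: "i \<in> I"
      have "disp \<alpha> f = (\<lambda>x. disp \<alpha> g x - disp \<alpha> chi x)" by (simp add: disp_def g_def fun_eq_iff algebra_simps)
      then have eq: "S (disp \<alpha> f) = (\<lambda>x. S (disp \<alpha> g) x + (-1) * S (disp \<alpha> chi) x)"
        by (simp add: Ssub schwartz_disp g chi)
      have "l2ip (S (disp \<alpha> f)) (\<psi> i) = l2ip (S (disp \<alpha> g)) (\<psi> i) + l2ip (\<lambda>x. (-1) * S (disp \<alpha> chi) x) (\<psi> i)"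
        unfolding eq
        by (rule l2ip_add_left[OF _ _ l2_familyD(2)[OF fam i]])
          (intro schwartz_sq_integrable schwartz_cmult Ss schwartz_disp g chi)+
      then show "l2ip (S (disp \<alpha> g)) (\<psi> i) - l2ip (S (disp \<alpha> chi)) (\<psi> i) = l2ip (S (disp \<alpha> f)) (\<psi> i)"
        unfolding l2ip_cmult_left by simp
    qed
  qed (rule pos[OF f])
qed

text \<open>Q is the sum of the squared amplitudes, so a power N of \<open>t\<close> on each
  amplitude is a power 2N on Q.\<close>

lemma sum_bounded_husimi:
  fixes \<psi> :: "'i \<Rightarrow> real^'n \<Rightarrow> complex"
  assumes fam: "l2_family I \<psi>" and chi: "schwartz chi"
    and sb: "sum_bounded I (\<lambda>i \<alpha>. of_real (t \<alpha> ^ N) * l2ip (disp \<alpha> chi) (\<psi> i))"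
  shows "\<exists>C. \<forall>\<alpha>. t \<alpha> ^ (2 * N) * cmod (husimi chi I \<psi> \<alpha>) \<le> C"
proof -
  obtain C where C: "\<And>\<alpha> F. finite F \<Longrightarrow> F \<subseteq> I \<Longrightarrow> (\<Sum>i\<in>F. (cmod (of_real (t \<alpha> ^ N) * l2ip (disp \<alpha> chi) (\<psi> i)))\<^sup>2) \<le> C"
    using sb unfolding sum_bounded_def by blast
  note chi2 = schwartz_sq_integrable[OF chi]
  have "t \<alpha> ^ (2 * N) * cmod (husimi chi I \<psi> \<alpha>) \<le> C" for \<alpha>
  proof -
    note s = summable_l2ip[OF fam sq_integrable_disp[OF chi2], of \<alpha>]
    have h: "cmod (husimi chi I \<psi> \<alpha>) = (\<Sum>\<^sub>\<infinity>i\<in>I. (cmod (l2ip (disp \<alpha> chi) (\<psi> i)))\<^sup>2)"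
      unfolding husimi_eq[OF fam chi2] norm_of_real by (rule abs_of_nonneg, rule infsum_nonneg) simp
    have "t \<alpha> ^ (2 * N) * cmod (husimi chi I \<psi> \<alpha>) = (\<Sum>\<^sub>\<infinity>i\<in>I. t \<alpha> ^ (2 * N) * (cmod (l2ip (disp \<alpha> chi) (\<psi> i)))\<^sup>2)"
      unfolding h by (rule infsum_cmult_right'[symmetric])
    also have "\<dots> \<le> C"
    proof (rule infsum_le_finite_sums)
      show "(\<lambda>i. t \<alpha> ^ (2 * N) * (cmod (l2ip (disp \<alpha> chi) (\<psi> i)))\<^sup>2) summable_on I"
        by (rule summable_on_cmult_right[OF s])
      have "t \<alpha> ^ (2 * N) * (cmod (l2ip (disp \<alpha> chi) (\<psi> i)))\<^sup>2 = (cmod (of_real (t \<alpha> ^ N) * l2ip (disp \<alpha> chi) (\<psi> i)))\<^sup>2" for i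
        by (simp add: norm_mult power_mult_distrib norm_power power_mult[symmetric] mult.commute[of N] power_even_abs)
      then show "(\<Sum>i\<in>F. t \<alpha> ^ (2 * N) * (cmod (l2ip (disp \<alpha> chi) (\<psi> i)))\<^sup>2) \<le> C" if "finite F" "F \<subseteq> I" for F
        using C[OF that, of \<alpha>] by simp
    qed
    finally show ?thesis .
  qed
  then show ?thesis by blast
qed

definition Xmul :: "real^'n \<Rightarrow> (real^'n \<Rightarrow> complex) \<Rightarrow> real^'n \<Rightarrow> complex" where
  "Xmul b f x = of_real (x \<bullet> b) * f x"

definition Pder :: "real^'n \<Rightarrow> (real^'n \<Rightarrow> complex) \<Rightarrow> real^'n \<Rightarrow> complex" where
  "Pder b f x = - \<i> * frechet_derivative f (at x) b"

lemma schwartz_Xmul: "schwartz f \<Longrightarrow> b \<in> Basis \<Longrightarrow> schwartz (Xmul b f)"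
  unfolding Xmul_def[abs_def] by (rule schwartz_coord)

lemma schwartz_Pder: "schwartz f \<Longrightarrow> b \<in> Basis \<Longrightarrow> schwartz (Pder b f)"
  unfolding Pder_def[abs_def] by (intro schwartz_cmult schwartz_deriv)

lemma frechet_derivative_schwartz_diff:
  assumes "schwartz f" "schwartz g"
  shows "frechet_derivative (\<lambda>x. f x - g x) (at x) b = frechet_derivative f (at x) b - frechet_derivative g (at x) b"
  using frechet_derivative_at[OF has_derivative_diff[OF assms[THEN schwartz_has_derivative]]] by metis

lemma frechet_derivative_schwartz_cmult:
  assumes "schwartz f"
  shows "frechet_derivative (\<lambda>x. c * f x) (at x) b = c * frechet_derivative f (at x) b"
  using frechet_derivative_at[OF has_derivative_mult_right[OF schwartz_has_derivative[OF assms]]] by metis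

lemma Xmul_power: "b \<in> Basis \<Longrightarrow> (Xmul b ^^ k) f = Xop (\<lambda>c. if c = b then k else 0) f"
proof (induction k)
  case 0
  then show ?case by (simp add: Xop_def[abs_def] monom_def if_distrib cong: if_cong)
next
  case (Suc k)
  have m: "monom (\<lambda>c. if c = b then j else 0) x = (x \<bullet> b) ^ j" for j and x :: "real^'a"
    unfolding monom_def using Suc.prems by (subst prod.remove[of _ b]) auto
  show ?case using Suc by (simp add: Xmul_def Xop_def m fun_eq_iff)
qed

lemma Pder_power:
  assumes "schwartz f" "b \<in> Basis" shows "(Pder b ^^ k) f = Pop (replicate k b) f"
proof (induction k)
  case 0
  then show ?case by (simp add: Pop_def fun_eq_iff)
next
  case (Suc k)
  have "set (replicate k b) \<subseteq> Basis" using assms(2) by auto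
  from dpart_cmult(2)[OF assms(1) this] have s: "schwartz (dpart (replicate k b) f)" .
  have "(Pder b ^^ Suc k) f = Pder b (\<lambda>x. (- \<i>) ^ k * dpart (replicate k b) f x)"
    using Suc by (simp add: Pop_def[abs_def])
  also have "\<dots> = Pop (replicate (Suc k) b) f"
    unfolding Pder_def[abs_def] Pop_def[abs_def] frechet_derivative_schwartz_cmult[OF s] by (simp add: mult.assoc)
  finally show ?case .
qed

theorem schwartz_operator_imp_husimi:
  fixes chi :: "real^'n \<Rightarrow> complex"
  assumes fam: "l2_family I \<psi>" and chi: "schwartz chi" "l2norm_sq chi = 1" and op: "schwartz_operator I \<psi>"
  shows "rapid_decay (husimi chi I \<psi>)"
proof -
  \<comment> \<open>The argument shared by X and P: \<open>T\<close> is one of these operators and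
    \<open>t \<alpha>\<close> the scalar in its commutator with the displacement, a position or a
    momentum coordinate of \<alpha>.\<close>
  have power: "\<exists>C. \<forall>\<alpha>. t \<alpha> ^ (2 * N) * cmod (husimi chi I \<psi> \<alpha>) \<le> C"
    if Ts: "\<And>f. schwartz f \<Longrightarrow> schwartz (T f)"
    and Tsub: "\<And>f g. schwartz f \<Longrightarrow> schwartz g \<Longrightarrow> T (\<lambda>x. f x - g x) = (\<lambda>x. T f x - T g x)"
    and comm: "\<And>f \<alpha>. schwartz f \<Longrightarrow> (\<lambda>x. of_real (t \<alpha>) * disp \<alpha> f x) = (\<lambda>x. T (disp \<alpha> f) x - disp \<alpha> (T f) x)"
    and Tsc: "\<And>f (c::real). schwartz f \<Longrightarrow> T (\<lambda>x. of_real c * f x) = (\<lambda>x. of_real c * T f x)"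
    and bound: "\<And>k. \<exists>C. operator_bound I \<psi> (T ^^ k) C"
    for T and t :: "'n phase \<Rightarrow> real" and N
  proof -
    have Tk: "schwartz ((T ^^ k) f)" if "schwartz f" for f k using that by (induction k) (auto intro: Ts)
    have Tksub: "(T ^^ k) (\<lambda>x. f x - g x) = (\<lambda>x. (T ^^ k) f x - (T ^^ k) g x)" if "schwartz f" "schwartz g" for f g k
      using that by (induction k) (auto simp: Tsub Tk)
    have Tksc: "(T ^^ k) (\<lambda>x. of_real c * f x) = (\<lambda>x. of_real c * (T ^^ k) f x)" if "schwartz f" for f and c :: real and k
      using that by (induction k) (auto simp: Tsc Tk)
    have base: "sum_bounded I (\<lambda>i \<alpha>. l2ip ((T ^^ k) (disp \<alpha> f)) (\<psi> i))" if f: "schwartz f" for f k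
    proof -
      from bound[of k] obtain C where ob: "operator_bound I \<psi> (T ^^ k) C" ..
      show ?thesis
        by (rule operator_bound_imp_sum_bounded[OF fam ob _ _ _ chi f]) (fact Tk Tksub Tksc)+
    qed
    have "sum_bounded I (\<lambda>i \<alpha>. of_real (t \<alpha> ^ N) * l2ip ((T ^^ 0) (disp \<alpha> chi)) (\<psi> i))"
      by (rule sum_bounded_power[OF fam Ts Tsub comm Tsc base chi(1)])
    then have "sum_bounded I (\<lambda>i \<alpha>. of_real (t \<alpha> ^ N) * l2ip (disp \<alpha> chi) (\<psi> i))" by simp
    from sum_bounded_husimi[OF fam chi(1) this] show ?thesis .
  qed
  have X: "\<exists>C. \<forall>\<alpha>. (fst \<alpha> \<bullet> b) ^ (2 * N) * cmod (husimi chi I \<psi> \<alpha>) \<le> C" if b: "b \<in> Basis" for b N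
  proof (rule power[where T = "Xmul b" and t = "\<lambda>\<alpha>. fst \<alpha> \<bullet> b"])
    show "schwartz (Xmul b f)" if "schwartz f" for f by (rule schwartz_Xmul[OF that b])
    show "Xmul b (\<lambda>x. f x - g x) = (\<lambda>x. Xmul b f x - Xmul b g x)" for f g by (simp add: Xmul_def fun_eq_iff right_diff_distrib)
    show "(\<lambda>x. of_real (fst \<alpha> \<bullet> b) * disp \<alpha> f x) = (\<lambda>x. Xmul b (disp \<alpha> f) x - disp \<alpha> (Xmul b f) x)" for f \<alpha>
      using disp_coord[of _ b \<alpha> f] by (simp add: Xmul_def[abs_def] fun_eq_iff)
    show "Xmul b (\<lambda>x. of_real c * f x) = (\<lambda>x. of_real c * Xmul b f x)" for f and c :: real by (simp add: Xmul_def fun_eq_iff)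
    show "\<exists>C. operator_bound I \<psi> (Xmul b ^^ k) C" for k
    proof -
      have "Xmul b ^^ k = (\<lambda>f. Pop [] (Xop (\<lambda>c. if c = b then k else 0) f))"
        by (rule ext) (simp add: Xmul_power[OF b] Pop_def fun_eq_iff)
      then show ?thesis using schwartz_operator_bound[OF fam op, of "[]" "\<lambda>c. if c = b then k else 0"] by simp
    qed
  qed
  have P: "\<exists>C. \<forall>\<alpha>. (snd \<alpha> \<bullet> b) ^ (2 * N) * cmod (husimi chi I \<psi> \<alpha>) \<le> C" if b: "b \<in> Basis" for b N
  proof (rule power[where T = "Pder b" and t = "\<lambda>\<alpha>. snd \<alpha> \<bullet> b"])
    show "schwartz (Pder b f)" if "schwartz f" for f by (rule schwartz_Pder[OF that b])
    show "Pder b (\<lambda>x. f x - g x) = (\<lambda>x. Pder b f x - Pder b g x)" if "schwartz f" "schwartz g" for f g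
      unfolding Pder_def[abs_def] frechet_derivative_schwartz_diff[OF that] by (simp add: fun_eq_iff algebra_simps)
    show "(\<lambda>x. of_real (snd \<alpha> \<bullet> b) * disp \<alpha> f x) = (\<lambda>x. Pder b (disp \<alpha> f) x - disp \<alpha> (Pder b f) x)" if "schwartz f" for f \<alpha>
    proof
      fix x
      have "frechet_derivative (disp \<alpha> f) (at x) b = disp \<alpha> (\<lambda>y. frechet_derivative f (at y) b) x + \<i> * of_real (snd \<alpha> \<bullet> b) * disp \<alpha> f x"
        by (rule fun_cong[OF frechet_derivative_at[OF disp_has_derivative[OF that, of \<alpha> x]], symmetric])
      then show "of_real (snd \<alpha> \<bullet> b) * disp \<alpha> f x = Pder b (disp \<alpha> f) x - disp \<alpha> (Pder b f) x"
        unfolding Pder_def[abs_def] by (simp add: disp_def algebra_simps)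
    qed
    show "Pder b (\<lambda>x. of_real c * f x) = (\<lambda>x. of_real c * Pder b f x)" if "schwartz f" for f and c :: real
      unfolding Pder_def[abs_def] frechet_derivative_schwartz_cmult[OF that] by (simp add: fun_eq_iff algebra_simps)
    show "\<exists>C. operator_bound I \<psi> (Pder b ^^ k) C" for k
    proof -
      have "set (replicate k b) \<subseteq> Basis" using b by auto
      from schwartz_operator_bound[OF fam op this, of "\<lambda>_. 0"]
      obtain C where C: "operator_bound I \<psi> (\<lambda>f. Pop (replicate k b) (Xop (\<lambda>_. 0) f)) C" ..
      \<comment> \<open>The two operators are compared on Schwartz functions only;
        \<open>operator_bound\<close> tests no others.\<close>
      have "(Pder b ^^ k) f = Pop (replicate k b) (Xop (\<lambda>_. 0) f)" if "schwartz f" for f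
        unfolding Pder_power[OF that b] by (simp add: Xop_def[abs_def] monom_def)
      with C have "operator_bound I \<psi> (Pder b ^^ k) C"
        unfolding operator_bound_def by simp
      then show ?thesis ..
    qed
  qed
  show ?thesis
  proof (rule rapid_decayI_coord)
    have even: "\<exists>C. \<forall>\<alpha>. (\<alpha> \<bullet> b) ^ (2 * N) * cmod (husimi chi I \<psi> \<alpha>) \<le> C" if "b \<in> Basis" for b :: "'n phase" and N
    proof -
      from that consider b1 where "b1 \<in> Basis" "b = (b1, 0)" | b2 where "b2 \<in> Basis" "b = (0, b2)"
        unfolding Basis_prod_def by blast
      then show ?thesis
      proof cases
        case 1
        show ?thesis using X[OF 1(1), of N] by (simp add: 1(2) inner_prod_def)
      next
        case 2
        show ?thesis using P[OF 2(1), of N] by (simp add: 2(2) inner_prod_def)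
      qed
    qed
    obtain b0 :: "'n phase" where "b0 \<in> Basis" using nonempty_Basis by blast
    from even[OF this, of 0] show "\<exists>C. \<forall>x. cmod (husimi chi I \<psi> x) \<le> C" by simp
    then obtain C0 where C0: "\<And>x. cmod (husimi chi I \<psi> x) \<le> C0" by blast
    fix N and b :: "'n phase" assume b: "b \<in> Basis"
    obtain C where C: "\<And>\<alpha>. (\<alpha> \<bullet> b) ^ (2 * N) * cmod (husimi chi I \<psi> \<alpha>) \<le> C" using even[OF b] by blast
    have "\<bar>x \<bullet> b\<bar> ^ N * cmod (husimi chi I \<psi> x) \<le> C0 + C" for x
    proof -
      \<comment> \<open>Squared amplitudes produce even powers; this inequality recovers the odd
        ones.\<close>
      have "\<bar>x \<bullet> b\<bar> ^ N \<le> 1 + (x \<bullet> b) ^ (2 * N)"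
        using abs_le_one_add_square[of "(x \<bullet> b) ^ N"] by (simp add: power_abs power_mult[symmetric] mult.commute)
      then have "\<bar>x \<bullet> b\<bar> ^ N * cmod (husimi chi I \<psi> x) \<le> (1 + (x \<bullet> b) ^ (2 * N)) * cmod (husimi chi I \<psi> x)"
        by (rule mult_right_mono) simp
      also have "\<dots> \<le> C0 + C" unfolding distrib_right using C0[of x] C[of x] by simp
      finally show ?thesis .
    qed
    then show "\<exists>C. \<forall>x. \<bar>x \<bullet> b\<bar> ^ N * cmod (husimi chi I \<psi> x) \<le> C" by blast
  qed
qed

section \<open>Joint bounds on the eigenfunctions imply operator bounds\<close>

lemma integral_by_parts_list:
  assumes "schwartz f" "schwartz g" "set bs \<subseteq> Basis"
  shows "(\<integral>x. dpart bs f x * g x \<partial>lborel) = (-1) ^ length bs * (\<integral>x. f x * dpart (rev bs) g x \<partial>lborel)"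
  using assms(2,3)
proof (induction bs arbitrary: g)
  case (Cons b bs)
  have b: "b \<in> Basis" and bs: "set bs \<subseteq> Basis" using Cons.prems by auto
  have "(\<integral>x. dpart (b # bs) f x * g x \<partial>lborel) = - (\<integral>x. dpart bs f x * frechet_derivative g (at x) b \<partial>lborel)"
    using integral_by_parts[OF dpart_cmult(2)[OF assms(1) bs] Cons.prems(1) b] by simp
  also have "\<dots> = - ((-1) ^ length bs * (\<integral>x. f x * dpart (rev bs) (\<lambda>x. frechet_derivative g (at x) b) x \<partial>lborel))"
    by (simp only: Cons.IH[OF schwartz_deriv[OF Cons.prems(1) b] bs])
  \<comment> \<open>The head of the list is the outermost derivative and moves over first, so on g
    it becomes the innermost one; hence the reversal, without interchanging partial
    derivatives.\<close>
  also have "dpart (rev bs) (\<lambda>x. frechet_derivative g (at x) b) = dpart (rev (b # bs)) g"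
    by (simp add: dpart_append)
  finally show ?case by simp
qed simp

lemma jointly_schwartz_imp_schwartz:
  assumes "jointly_schwartz I \<phi>" "i \<in> I" shows "schwartz (\<phi> i)"
  unfolding schwartz_def
proof (intro conjI allI impI)
  show "smooth_fun (\<phi> i)" using assms unfolding jointly_schwartz_def by blast
  fix a :: "'b \<Rightarrow> nat" and bs assume "set bs \<subseteq> (Basis::'b set)"
  then obtain C where C: "\<And>x. (\<lambda>i. (cmod (of_real (monom a x) * dpart bs (\<phi> i) x))\<^sup>2) summable_on I"
    "\<And>x. (\<Sum>\<^sub>\<infinity>i\<in>I. (cmod (of_real (monom a x) * dpart bs (\<phi> i) x))\<^sup>2) \<le> C"
    using assms(1) unfolding jointly_schwartz_def by meson
  have "(cmod (of_real (monom a x) * dpart bs (\<phi> i) x))\<^sup>2 \<le> C" for x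
    using finite_sum_le_infsum[OF C(1)[of x], of "{i}"] C(2)[of x] assms(2) by simp
  then have "cmod (of_real (monom a x) * dpart bs (\<phi> i) x) \<le> sqrt C" for x by (rule real_le_rsqrt)
  then show "bounded (range (\<lambda>x. of_real (monom a x) * dpart bs (\<phi> i) x))"
    unfolding bounded_range_norm_iff by blast
qed

lemma sjs_imp_jointly_schwartz:
  assumes "sjs I \<phi>" shows "jointly_schwartz I \<phi>"
  unfolding jointly_schwartz_def
proof (intro conjI allI impI)
  show "\<forall>i\<in>I. smooth_fun (\<phi> i)" using assms unfolding sjs_def by blast
  fix a :: "'b \<Rightarrow> nat" and bs assume bs: "set bs \<subseteq> (Basis::'b set)"
  have "ssb I (\<lambda>i x. of_real (monom a x) * dpart bs (\<phi> i) x)" using assms bs unfolding sjs_def by blast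
  then obtain B where B: "B summable_on I" "\<And>i x. i \<in> I \<Longrightarrow> (cmod (of_real (monom a x) * dpart bs (\<phi> i) x))\<^sup>2 \<le> B i"
    unfolding ssb_def by blast
  have s: "(\<lambda>i. (cmod (of_real (monom a x) * dpart bs (\<phi> i) x))\<^sup>2) summable_on I" for x
    by (rule summable_on_comparison_test[OF B(1)]) (use B(2) in auto)
  moreover have "(\<Sum>\<^sub>\<infinity>i\<in>I. (cmod (of_real (monom a x) * dpart bs (\<phi> i) x))\<^sup>2) \<le> (\<Sum>\<^sub>\<infinity>i\<in>I. B i)" for x
    by (rule infsum_mono[OF s B(1) B(2)])
  ultimately show "\<exists>C. \<forall>x. (\<lambda>i. (cmod (of_real (monom a x) * dpart bs (\<phi> i) x))\<^sup>2) summable_on I \<and>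
        (\<Sum>\<^sub>\<infinity>i\<in>I. (cmod (of_real (monom a x) * dpart bs (\<phi> i) x))\<^sup>2) \<le> C" by blast
qed

text \<open>Passing from a supremum over x to an integral costs one power of the weight. It is
  gained by using the joint bounds also for exponents enlarged by the monomials whose squares add up
  to \<open>wt\<close>; the partial sums are then at most \<open>K / wt\<close>, an integrable
  majorant independent of \<open>F\<close>.\<close>

lemma jointly_schwartz_l2_bound:
  assumes j: "jointly_schwartz I \<phi>" and bs: "set bs \<subseteq> Basis"
  shows "\<exists>C. \<forall>F. finite F \<longrightarrow> F \<subseteq> I \<longrightarrow> (\<Sum>i\<in>F. \<integral>x. (cmod (of_real (monom a x) * dpart bs (\<phi> i) x))\<^sup>2 \<partial>lborel) \<le> C"
proof -
  define q where "q i x = (cmod (of_real (monom a x) * dpart bs (\<phi> i) x))\<^sup>2" for i x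
  \<comment> \<open>\<open>e A\<close> is the exponent 1 on \<open>A\<close> and 0 elsewhere; the
    squares of these monomials are the terms in the expansion of \<open>wt\<close>.\<close>
  define e where "e A b = (if b \<in> A then 1 else 0 :: nat)" for A and b :: 'b
  have "\<forall>A. \<exists>C. \<forall>x F. finite F \<longrightarrow> F \<subseteq> I \<longrightarrow> (\<Sum>i\<in>F. (monom (e A) x)\<^sup>2 * q i x) \<le> C"
  proof
    fix A
    obtain C where C: "\<And>x. (\<lambda>i. (cmod (of_real (monom (\<lambda>b. e A b + a b) x) * dpart bs (\<phi> i) x))\<^sup>2) summable_on I"
      "\<And>x. (\<Sum>\<^sub>\<infinity>i\<in>I. (cmod (of_real (monom (\<lambda>b. e A b + a b) x) * dpart bs (\<phi> i) x))\<^sup>2) \<le> C"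
      using j bs unfolding jointly_schwartz_def by meson
    have "(monom (e A) x)\<^sup>2 * q i x = (cmod (of_real (monom (\<lambda>b. e A b + a b) x) * dpart bs (\<phi> i) x))\<^sup>2" for i x
      by (simp add: q_def monom_add norm_mult power_mult_distrib)
    then have "(\<Sum>i\<in>F. (monom (e A) x)\<^sup>2 * q i x) \<le> C" if "finite F" "F \<subseteq> I" for x F
      using finite_sum_le_infsum[OF C(1)[of x] that] C(2)[of x] by simp
    then show "\<exists>C. \<forall>x F. finite F \<longrightarrow> F \<subseteq> I \<longrightarrow> (\<Sum>i\<in>F. (monom (e A) x)\<^sup>2 * q i x) \<le> C" by blast
  qed
  then obtain C where C: "\<And>A x F. finite F \<Longrightarrow> F \<subseteq> I \<Longrightarrow> (\<Sum>i\<in>F. (monom (e A) x)\<^sup>2 * q i x) \<le> C A" by metis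
  define K where "K = (\<Sum>A\<in>Pow Basis. C A)"
  have wt: "wt x = (\<Sum>A\<in>Pow Basis. (monom (e A) x)\<^sup>2)" for x
    unfolding wt_eq_sum_monom
  proof (intro sum.cong refl)
    fix A
    have "monom (\<lambda>b. if b \<in> A then 2 else 0) x = monom (\<lambda>b. e A b + e A b) x"
      unfolding monom_def by (intro prod.cong) (auto simp: e_def numeral_2_eq_2)
    then show "monom (\<lambda>b. if b \<in> A then 2 else 0) x = (monom (e A) x)\<^sup>2"
      by (simp add: monom_add power2_eq_square)
  qed
  have ptw: "(\<Sum>i\<in>F. q i x) \<le> K * (1 / wt x)" if F: "finite F" "F \<subseteq> I" for x F
  proof -
    have "wt x * (\<Sum>i\<in>F. q i x) = (\<Sum>A\<in>Pow Basis. \<Sum>i\<in>F. (monom (e A) x)\<^sup>2 * q i x)"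
      unfolding wt by (simp add: sum_distrib_left sum_distrib_right) (rule sum.swap)
    also have "\<dots> \<le> K" unfolding K_def by (intro sum_mono C F)
    finally show ?thesis by (simp add: pos_le_divide_eq mult.commute)
  qed
  have qi: "integrable lborel (q i)" if "i \<in> I" for i
  proof -
    have "schwartz (\<lambda>x. of_real (monom a x) * dpart bs (\<phi> i) x)"
      by (intro schwartz_monom_mult dpart_cmult(2) jointly_schwartz_imp_schwartz[OF j that] bs)
    from schwartz_square_bound[OF this, of 1] obtain B where B: "\<And>x. q i x \<le> B / wt x" unfolding q_def by auto
    have m: "(\<lambda>x. of_real (monom a x) * dpart bs (\<phi> i) x) \<in> borel_measurable borel"
      by (rule schwartz_measurable[OF \<open>schwartz (\<lambda>x. of_real (monom a x) * dpart bs (\<phi> i) x)\<close>])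
    show ?thesis
    proof (rule Bochner_Integration.integrable_bound)
      show "integrable lborel (\<lambda>x::'b. B * (1 / wt x))" by (rule integrable_mult_right[OF integrable_inverse_wt])
      show "q i \<in> borel_measurable lborel" unfolding q_def[abs_def] using m by measurable
      show "AE x in lborel. norm (q i x) \<le> norm (B * (1 / wt x))"
      proof (rule AE_I2)
        fix x
        have "norm (q i x) \<le> B * (1 / wt x)" using B[of x] by (simp add: q_def)
        also have "\<dots> \<le> norm (B * (1 / wt x))" unfolding real_norm_def by (rule abs_ge_self)
        finally show "norm (q i x) \<le> norm (B * (1 / wt x))" .
      qed
    qed
  qed
  have "(\<Sum>i\<in>F. \<integral>x. q i x \<partial>lborel) \<le> (\<integral>x. K * (1 / wt x) \<partial>(lborel::'b measure))" if F: "finite F" "F \<subseteq> I" for F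
  proof -
    have "(\<Sum>i\<in>F. \<integral>x. q i x \<partial>lborel) = (\<integral>x. (\<Sum>i\<in>F. q i x) \<partial>lborel)"
      using F qi by (subst Bochner_Integration.integral_sum) auto
    also have "\<dots> \<le> (\<integral>x. K * (1 / wt x) \<partial>(lborel::'b measure))"
      using F qi by (intro integral_mono ptw F Bochner_Integration.integrable_sum integrable_mult_right[OF integrable_inverse_wt]) auto
    finally show ?thesis .
  qed
  then show ?thesis unfolding q_def by blast
qed

lemma cmod_infsum_mult_le:
  fixes u v :: "'i \<Rightarrow> complex"
  assumes u: "\<And>F. finite F \<Longrightarrow> F \<subseteq> I \<Longrightarrow> (\<Sum>i\<in>F. (cmod (u i))\<^sup>2) \<le> C"
    and v: "\<And>F. finite F \<Longrightarrow> F \<subseteq> I \<Longrightarrow> (\<Sum>i\<in>F. (cmod (v i))\<^sup>2) \<le> D"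
  shows "cmod (\<Sum>\<^sub>\<infinity>i\<in>I. u i * v i) \<le> C + D"
proof -
  have fin: "(\<Sum>i\<in>F. cmod (u i * v i)) \<le> C + D" if F: "finite F" "F \<subseteq> I" for F
  proof -
    have "cmod (u i * v i) \<le> (cmod (u i))\<^sup>2 + (cmod (v i))\<^sup>2" for i
    proof -
      have "2 * (cmod (u i) * cmod (v i)) \<le> (cmod (u i))\<^sup>2 + (cmod (v i))\<^sup>2"
        using sum_squares_bound[of "cmod (u i)" "cmod (v i)"] by (simp add: mult.assoc)
      moreover have "0 \<le> cmod (u i) * cmod (v i)" by simp
      ultimately have "cmod (u i) * cmod (v i) \<le> (cmod (u i))\<^sup>2 + (cmod (v i))\<^sup>2" by linarith
      then show ?thesis by (simp add: norm_mult)
    qed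
    then have "(\<Sum>i\<in>F. cmod (u i * v i)) \<le> (\<Sum>i\<in>F. (cmod (u i))\<^sup>2 + (cmod (v i))\<^sup>2)" by (intro sum_mono)
    also have "\<dots> \<le> C + D" unfolding sum.distrib by (intro add_mono u v F)
    finally show ?thesis .
  qed
  have s: "(\<lambda>i. cmod (u i * v i)) summable_on I"
    by (rule nonneg_bdd_above_summable_on) (auto intro!: bdd_aboveI2[of _ _ "C + D"] fin)
  have "cmod (\<Sum>\<^sub>\<infinity>i\<in>I. u i * v i) \<le> (\<Sum>\<^sub>\<infinity>i\<in>I. cmod (u i * v i))"
    by (rule norm_infsum_bound[OF s])
  also have "\<dots> \<le> C + D" by (rule infsum_le_finite_sums[OF s fin])
  finally show ?thesis .
qed

text \<open>Once all derivatives and monomials are moved onto the representative, the test function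
  enters only through its norm, which is 1. This makes the bound uniform over test functions, and
  the two sides of the form can be estimated separately.\<close>

theorem jointly_schwartz_imp_schwartz_operator:
  fixes \<psi> \<phi> :: "'i \<Rightarrow> real^'n \<Rightarrow> complex"
  assumes fam: "l2_family I \<psi>" and j: "jointly_schwartz I \<phi>"
    and AE: "\<forall>i\<in>I. AE x in lborel. \<psi> i x = \<phi> i x"
  shows "schwartz_operator I \<psi>"
proof -
  have key: "\<exists>C. \<forall>f F. schwartz f \<longrightarrow> l2norm_sq f = 1 \<longrightarrow> finite F \<longrightarrow> F \<subseteq> I \<longrightarrow>
      (\<Sum>i\<in>F. (cmod (l2ip (Pop bs (Xop a f)) (\<psi> i)))\<^sup>2) \<le> C"
    if bs: "set bs \<subseteq> Basis" for a bs
  proof -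
    have rbs: "set (rev bs) \<subseteq> Basis" using bs by simp
    obtain C where C: "\<And>F. finite F \<Longrightarrow> F \<subseteq> I \<Longrightarrow>
        (\<Sum>i\<in>F. \<integral>x. (cmod (of_real (monom a x) * dpart (rev bs) (\<phi> i) x))\<^sup>2 \<partial>lborel) \<le> C"
      using jointly_schwartz_l2_bound[OF j rbs, of a] by blast
    have le: "(cmod (l2ip (Pop bs (Xop a f)) (\<psi> i)))\<^sup>2 \<le> (\<integral>x. (cmod (of_real (monom a x) * dpart (rev bs) (\<phi> i) x))\<^sup>2 \<partial>lborel)"
      if f: "schwartz f" "l2norm_sq f = 1" and i: "i \<in> I" for f i
    proof -
      have p: "schwartz (\<phi> i)" by (rule jointly_schwartz_imp_schwartz[OF j i])
      define h where "h x = of_real (monom a x) * dpart (rev bs) (\<phi> i) x" for x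
      have h: "schwartz h" unfolding h_def[abs_def] by (intro schwartz_monom_mult dpart_cmult(2) p rbs)
      note X = schwartz_Xop[OF f(1), of a]
      have cd: "cnj (dpart bs g x) = dpart bs (\<lambda>x. cnj (g x)) x" if g: "schwartz g" for g :: "real^'n \<Rightarrow> complex" and x
        using bs
      proof (induction bs arbitrary: x)
        case (Cons b bs)
        then have IH: "(\<lambda>x. cnj (dpart bs g x)) = dpart bs (\<lambda>x. cnj (g x))" by auto
        have "schwartz (dpart bs g)" using Cons.prems by (intro dpart_cmult(2) g) auto
        from frechet_derivative_at[OF has_derivative_cnj[OF schwartz_has_derivative[OF this, of x]]]
        have "frechet_derivative (\<lambda>x. cnj (dpart bs g x)) (at x) = (\<lambda>h. cnj (frechet_derivative (dpart bs g) (at x) h))" by simp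
        then show ?case by (simp add: IH[symmetric])
      qed simp
      note sP = schwartz_sq_integrable[OF schwartz_Pop[OF X bs]]
      have "l2ip (Pop bs (Xop a f)) (\<psi> i) = l2ip (Pop bs (Xop a f)) (\<phi> i)"
      proof (rule l2ip_cong_AE[OF _ _ sP sP l2_familyD(2)[OF fam i] schwartz_sq_integrable[OF p]])
        show "AE x in lborel. \<psi> i x = \<phi> i x" using AE i by blast
      qed simp
      also have "\<dots> = cnj ((- \<i>) ^ length bs) * (\<integral>x. dpart bs (\<lambda>x. cnj (Xop a f x)) x * \<phi> i x \<partial>lborel)"
        unfolding l2ip_def Pop_def complex_cnj_mult cd[OF X] mult.assoc by (rule integral_mult_right_zero)
      also have "(\<integral>x. dpart bs (\<lambda>x. cnj (Xop a f x)) x * \<phi> i x \<partial>lborel) = (-1) ^ length bs * (\<integral>x. cnj (Xop a f x) * dpart (rev bs) (\<phi> i) x \<partial>lborel)"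
        by (rule integral_by_parts_list[OF schwartz_cnj[OF X] p bs])
      also have "(\<integral>x. cnj (Xop a f x) * dpart (rev bs) (\<phi> i) x \<partial>lborel) = l2ip f h"
        unfolding l2ip_def by (intro Bochner_Integration.integral_cong refl) (simp add: Xop_def h_def mult_ac)
      finally have "cmod (l2ip (Pop bs (Xop a f)) (\<psi> i)) = cmod (l2ip f h)"
        by (simp add: norm_mult norm_power)
      then have "(cmod (l2ip (Pop bs (Xop a f)) (\<psi> i)))\<^sup>2 \<le> l2norm_sq f * l2norm_sq h"
        using l2ip_bound[OF schwartz_sq_integrable[OF f(1)] schwartz_sq_integrable[OF h]] by simp
      then show ?thesis using f(2) by (simp add: l2norm_sq_def h_def)
    qed
    have "(\<Sum>i\<in>F. (cmod (l2ip (Pop bs (Xop a f)) (\<psi> i)))\<^sup>2) \<le> C"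
      if f: "schwartz f" "l2norm_sq f = 1" and F: "finite F" "F \<subseteq> I" for f F
      using F by (intro order_trans[OF sum_mono C[OF F]] le f) auto
    then show ?thesis by blast
  qed
  show ?thesis unfolding schwartz_operator_def
  proof (intro allI impI)
    fix a bs cs d assume bs: "set bs \<subseteq> (Basis::(real^'n) set)" and cs: "set cs \<subseteq> (Basis::(real^'n) set)"
    obtain C where C: "\<And>f F. schwartz f \<Longrightarrow> l2norm_sq f = 1 \<Longrightarrow> finite F \<Longrightarrow> F \<subseteq> I \<Longrightarrow>
      (\<Sum>i\<in>F. (cmod (l2ip (Pop bs (Xop a f)) (\<psi> i)))\<^sup>2) \<le> C" using key[OF bs, of a] by blast
    obtain D where D: "\<And>f F. schwartz f \<Longrightarrow> l2norm_sq f = 1 \<Longrightarrow> finite F \<Longrightarrow> F \<subseteq> I \<Longrightarrow>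
      (\<Sum>i\<in>F. (cmod (l2ip (Pop cs (Xop d f)) (\<psi> i)))\<^sup>2) \<le> D" using key[OF cs, of d] by blast
    have "cmod (\<Sum>\<^sub>\<infinity>i\<in>I. l2ip (Pop bs (Xop a f)) (\<psi> i) * l2ip (\<psi> i) (Pop cs (Xop d g))) \<le> C + D"
      if f: "schwartz f" "l2norm_sq f = 1" and g: "schwartz g" "l2norm_sq g = 1" for f g
    proof (rule cmod_infsum_mult_le)
      fix F assume F: "finite F" "F \<subseteq> I"
      show "(\<Sum>i\<in>F. (cmod (l2ip (Pop bs (Xop a f)) (\<psi> i)))\<^sup>2) \<le> C" by (rule C[OF f F])
      have "cmod (l2ip (\<psi> i) (Pop cs (Xop d g))) = cmod (l2ip (Pop cs (Xop d g)) (\<psi> i))" for i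
        by (subst l2ip_cnj) simp
      then show "(\<Sum>i\<in>F. (cmod (l2ip (\<psi> i) (Pop cs (Xop d g))))\<^sup>2) \<le> D" using D[OF g F] by simp
    qed
    then show "bounded {(\<Sum>\<^sub>\<infinity>i\<in>I. l2ip (Pop bs (Xop a f)) (\<psi> i) * l2ip (\<psi> i) (Pop cs (Xop d g))) | f g.
                   schwartz f \<and> schwartz g \<and> l2norm_sq f = 1 \<and> l2norm_sq g = 1}"
      unfolding bounded_iff by (intro exI[of _ "C + D"]) auto
  qed
qed

text \<open>The kernel and the eigenvectors are determined up to null sets, so the conditions on
  them ask for Schwartz representatives. The functions W, Q, M and the characteristic function come
  from integrals that ignore null sets and are taken literally.\<close>

theorem theorem3:
  fixes chi :: "real^'n \<Rightarrow> complex"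
    and I :: "'i set"
    and \<psi> :: "'i \<Rightarrow> real^'n \<Rightarrow> complex"
  assumes chi_schwartz: "schwartz chi"
    and chi_norm: "l2norm_sq chi = 1"
    and state: "is_state I \<psi>"
  shows "(schwartz (wigner I \<psi>) \<longleftrightarrow> rapid_decay (wigner I \<psi>))
       \<and> (schwartz (wigner I \<psi>) \<longleftrightarrow> schwartz (husimi chi I \<psi>))
       \<and> (schwartz (wigner I \<psi>) \<longleftrightarrow> rapid_decay (husimi chi I \<psi>))
       \<and> (schwartz (wigner I \<psi>) \<longleftrightarrow> schwartz (matel chi I \<psi>))
       \<and> (schwartz (wigner I \<psi>) \<longleftrightarrow> rapid_decay (matel chi I \<psi>))
       \<and> (schwartz (wigner I \<psi>) \<longleftrightarrow> schwartz (qchar I \<psi>))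
       \<and> (schwartz (wigner I \<psi>) \<longleftrightarrow>
            (\<exists>K. schwartz K \<and> (AE z in lborel. kernel I \<psi> z = K z)))
       \<and> (schwartz (wigner I \<psi>) \<longleftrightarrow>
            (\<exists>\<phi>. (\<forall>i\<in>I. AE x in lborel. \<psi> i x = \<phi> i x) \<and> jointly_schwartz I \<phi>))
       \<and> (schwartz (wigner I \<psi>) \<longleftrightarrow> schwartz_operator I \<psi>)
       \<and> (finite I \<longrightarrow>
            (schwartz (wigner I \<psi>) \<longleftrightarrow>
              (\<forall>i\<in>I. \<exists>g. schwartz g \<and> (AE x in lborel. \<psi> i x = g x))))"
proof -
  note fam = is_state_l2_family[OF state]
  define Q where "Q = rapid_decay (husimi chi I \<psi>)"
  have rep: "\<exists>\<phi>. sjs I \<phi> \<and> (\<forall>i\<in>I. AE x in lborel. \<psi> i x = \<phi> i x)" if Q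
    using husimi_rapid_decay_imp_sjs[OF chi_schwartz chi_norm fam] that unfolding Q_def by blast
  have QW: "schwartz (wigner I \<psi>)" if Q
    using rep[OF that] sjs_imp_wigner_schwartz[OF fam] by blast
  have QF: "schwartz (qchar I \<psi>)" if Q
    using rep[OF that] sjs_imp_qchar_schwartz[OF fam] by blast
  have QK: "\<exists>K. schwartz K \<and> (AE z in lborel. kernel I \<psi> z = K z)" if Q
    using rep[OF that] sjs_imp_kernel_schwartz[OF fam] by blast
  have KM: "schwartz (matel chi I \<psi>)" if "\<exists>K. schwartz K \<and> (AE z in lborel. kernel I \<psi> z = K z)"
    using that kernel_schwartz_imp_matel_schwartz[OF fam chi_schwartz] by blast
  have MQ: Q if "rapid_decay (matel chi I \<psi>)"
    unfolding Q_def by (rule matel_rapid_decay_imp_husimi[OF that])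
  have WQ: Q if "rapid_decay (wigner I \<psi>)"
    unfolding Q_def by (rule wigner_rapid_decay_imp_husimi[OF fam chi_schwartz that])
  have FQ: Q if "schwartz (qchar I \<psi>)"
    unfolding Q_def by (rule schwartz_imp_rapid_decay[OF qchar_schwartz_imp_husimi[OF fam chi_schwartz that]])
  have QJ: "\<exists>\<phi>. (\<forall>i\<in>I. AE x in lborel. \<psi> i x = \<phi> i x) \<and> jointly_schwartz I \<phi>" if Q
    using rep[OF that] sjs_imp_jointly_schwartz by blast
  have JO: "schwartz_operator I \<psi>" if "\<exists>\<phi>. (\<forall>i\<in>I. AE x in lborel. \<psi> i x = \<phi> i x) \<and> jointly_schwartz I \<phi>"
    using that jointly_schwartz_imp_schwartz_operator[OF fam] by blast
  have OQ: Q if "schwartz_operator I \<psi>"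
    unfolding Q_def by (rule schwartz_operator_imp_husimi[OF fam chi_schwartz chi_norm that])
  \<comment> \<open>Representatives are chosen separately for each i; finiteness of \<open>I\<close>
    turns their individual bounds into joint ones.\<close>
  have finJ: "\<exists>\<phi>. (\<forall>i\<in>I. AE x in lborel. \<psi> i x = \<phi> i x) \<and> jointly_schwartz I \<phi>"
    if fin: "finite I" and g: "\<forall>i\<in>I. \<exists>g. schwartz g \<and> (AE x in lborel. \<psi> i x = g x)"
  proof -
    from bchoice[OF g] obtain \<phi> where \<phi>: "\<forall>i\<in>I. schwartz (\<phi> i) \<and> (AE x in lborel. \<psi> i x = \<phi> i x)" by blast
    then have "sjs I \<phi>" using finite_sjs_iff[OF fin, of \<phi>] by blast
    with \<phi> show ?thesis using sjs_imp_jointly_schwartz by blast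
  qed
  have Jfin: "\<forall>i\<in>I. \<exists>g. schwartz g \<and> (AE x in lborel. \<psi> i x = g x)"
    if "\<exists>\<phi>. (\<forall>i\<in>I. AE x in lborel. \<psi> i x = \<phi> i x) \<and> jointly_schwartz I \<phi>"
    using that jointly_schwartz_imp_schwartz by metis
  have "schwartz (wigner I \<psi>) \<longleftrightarrow> Q"
    using QW WQ schwartz_imp_rapid_decay by blast
  moreover have "rapid_decay (wigner I \<psi>) \<longleftrightarrow> Q"
    using QW WQ schwartz_imp_rapid_decay by blast
  moreover have "schwartz (matel chi I \<psi>) \<longleftrightarrow> Q"
    using QK KM MQ schwartz_imp_rapid_decay by blast
  moreover have "rapid_decay (matel chi I \<psi>) \<longleftrightarrow> Q"
    using QK KM MQ schwartz_imp_rapid_decay by blast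
  moreover have "schwartz (husimi chi I \<psi>) \<longleftrightarrow> Q"
    using QK KM matel_schwartz_imp_husimi schwartz_imp_rapid_decay unfolding Q_def by blast
  moreover have "schwartz (qchar I \<psi>) \<longleftrightarrow> Q" using QF FQ by blast
  moreover have "(\<exists>K. schwartz K \<and> (AE z in lborel. kernel I \<psi> z = K z)) \<longleftrightarrow> Q"
    using QK KM MQ schwartz_imp_rapid_decay by blast
  moreover have "(\<exists>\<phi>. (\<forall>i\<in>I. AE x in lborel. \<psi> i x = \<phi> i x) \<and> jointly_schwartz I \<phi>) \<longleftrightarrow> Q"
    using QJ JO OQ by blast
  moreover have "schwartz_operator I \<psi> \<longleftrightarrow> Q" using QJ JO OQ by blast
  moreover have "(\<forall>i\<in>I. \<exists>g. schwartz g \<and> (AE x in lborel. \<psi> i x = g x)) \<longleftrightarrow> Q" if "finite I"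
    using finJ[OF that] Jfin QJ JO OQ by blast
  ultimately show ?thesis unfolding Q_def[symmetric] by simp
qed

end
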